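(* Let $n\ge1$, let $V=\mathbb{C}^n$ be the permutation module of $S_n$, and let $\lambda$ be a strict partition of $n$. The graded multiplicity of $D^\lambda$ in the $\mathcal{H}_n$-module $\mathrm{ind}_{\mathbb{C}S_n}^{\mathcal{H}_n}(\wedge^*V)$, i.e. $\sum_{q=0}^n m_\lambda\big(\mathrm{ind}_{\mathbb{C}S_n}^{\mathcal{H}_n}(\wedge^qV)\big)s^q$, is $$2^{-\frac{\ell(\lambda)+\delta(\lambda)}{2}}Q_\lambda(1,s).$$ Moreover, $$Q_\lambda(1,s)=\begin{cases}\dfrac{2^{\ell(\lambda)}(1+s)(s^l-s^k)}{1-s}, & \text{if }\lambda=(k,l)\text{ with }k>l\ge0,\\[2mm] 0, & \text{otherwise.}\end{cases}$$
   Context: Ground field $\mathbb{C}$. All algebras and modules are $\mathbb{Z}_2$-graded (super); homomorphisms $f$ satisfy $f(av)=(-1)^{\bar f\bar a}af(v)$ and need not be even; $\Pi$ denotes parity shift. $S_n$-modules such as $\wedge^qV$ are regarded as purely even. For a strict partition $\lambda=(\lambda_1>\cdots>\lambda_\ell>0)$ of $n$, $\ell(\lambda)=\ell$ (so $(k,0)$ means the one-row partition $(k)$, of length $1$), and $\delta(\lambda)=0$ if $\ell(\lambda)$ is even and $1$ if odd. Algebras. $\mathcal{C}_n$ is the Clifford superalgebra generated by odd $c_1,\dots,c_n$ with $c_i^2=1$, $c_ic_j=-c_jc_i$ ($i\ne j$). $\mathcal{H}_n=\mathcal{C}_n\rtimes\mathbb{C}S_n$ (Hecke–Clifford algebra)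 is generated by $\mathcal{C}_n$ and $\mathbb{C}S_n$ (even, with simple transpositions $s_i$), with $s_ic_i=c_{i+1}s_i$ and $s_ic_j=c_js_i$ for $j\ne i,i+1$. Schur $Q$-functions. For $m\ge\ell=\ell(\lambda)$, $Q_\lambda(z_1,\dots,z_m)=2^{\ell}\sum_{w\in S_m/S_{m-\ell}}w\big(z_1^{\lambda_1}\cdots z_\ell^{\lambda_\ell}\prod_{1\le i\le\ell}\prod_{i<j\le m}\frac{z_i+z_j}{z_i-z_j}\big)$, where $S_{m-\ell}$ permutes $z_{\ell+1},\dots,z_m$; letting $m\to\infty$ gives the symmetric function $Q_\lambda(z_1,z_2,\ldots)$, and $Q_\lambda(1,s)$ denotes its value at $z_1=1$, $z_2=s$, $z_i=0$ for $i\ge3$. Define $q_r$ by $\sum_{r\ge0}q_r(z)u^r=\prod_i\frac{1+z_iu}{1-z_iu}$, $q_\nu=q_{\nu_1}q_{\nu_2}\cdots$, and $\Gamma_{\mathbb{C}}=\mathbb{C}[q_1,q_2,\dots]$. Irreducibles. The irreducible $\mathcal{H}_n$-modules, up to (not necessarily even) isomorphism, are $D^\lambda$, $\lambda$ a strict partition of $n$. Their labelling is characterized as follows: the characteristic map $\mathrm{ch}:\bigoplus_n K(\mathcal{H}_n\text{-smod})\to\Gamma_{\mathbb{C}}$ (complexified Grothendieck groups of finite-dimensional modules, with $[\Pi M]=[M]$) is the linear isomorphism with $\mathrm{ch}(\mathrm{ind}_{\mathbb{C}S_\nu}^{\mathcal{H}_n}\mathbf 1)=q_\nu$ for all compositions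 $\nu$ of $n$ ($S_\nu$ the Young subgroup, $\mathbf 1$ the trivial module), and $\mathrm{ch}(D^\lambda)=2^{-\frac{\ell(\lambda)-\delta(\lambda)}{2}}Q_\lambda$. $m_\lambda(N)$ denotes the multiplicity of $D^\lambda$ in a finite-dimensional $\mathcal{H}_n$-module $N$, counting $D^\lambda$ and $\Pi D^\lambda$ together. *)

theory Defs
  imports
    "HOL-Library.Poly_Mapping"
    "HOL-Combinatorics.Permutations"
    "HOL-Computational_Algebra.Polynomial"
    "HOL-Computational_Algebra.Formal_Power_Series"
    "HOL-Computational_Algebra.Fraction_Field"
    "HOL-Computational_Algebra.Normalized_Fraction"
    "HOL-Algebra.AbelCoset"
    "HOL-Algebra.Module"
begin

text \<open>Indices start at 0: what is usually indexed by 1, ..., n is indexed by 0, ..., n - 1 here.\<close>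

section \<open>Free complex vector spaces and their quotients\<close>

text \<open>The free vector space on a set \<open>B\<close> consists of the finitely supported functions with support
  in \<open>B\<close>; the basis vector of \<open>b\<close> is \<open>fbasis b\<close>.\<close>

abbreviation fbasis :: "'b \<Rightarrow> 'b \<Rightarrow>\<^sub>0 complex" where
  "fbasis b \<equiv> Poly_Mapping.single b 1"

definition fscale :: "complex \<Rightarrow> ('b \<Rightarrow>\<^sub>0 complex) \<Rightarrow> ('b \<Rightarrow>\<^sub>0 complex)" where
  "fscale c x = Poly_Mapping.map (\<lambda>y. c * y) x"

definition free_space :: "'b set \<Rightarrow> ('b \<Rightarrow>\<^sub>0 complex) set" where
  "free_space B = {x. Poly_Mapping.keys x \<subseteq> B}"

definition flinear :: "('b \<Rightarrow> 'c \<Rightarrow>\<^sub>0 complex) \<Rightarrow> ('b \<Rightarrow>\<^sub>0 complex) \<Rightarrow> ('c \<Rightarrow>\<^sub>0 complex)" where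
  "flinear f x = (\<Sum>b\<in>Poly_Mapping.keys x. fscale (Poly_Mapping.lookup x b) (f b))"

abbreviation fspan :: "('b \<Rightarrow>\<^sub>0 complex) set \<Rightarrow> ('b \<Rightarrow>\<^sub>0 complex) set" where
  "fspan \<equiv> module.span fscale"

definition fcoset :: "('b \<Rightarrow>\<^sub>0 complex) set \<Rightarrow> ('b \<Rightarrow>\<^sub>0 complex) \<Rightarrow> ('b \<Rightarrow>\<^sub>0 complex) set" where
  "fcoset R x = {y. y - x \<in> R}"

definition qadd :: "('b \<Rightarrow>\<^sub>0 complex) set \<Rightarrow> ('b \<Rightarrow>\<^sub>0 complex) set \<Rightarrow> ('b \<Rightarrow>\<^sub>0 complex) set" where
  "qadd X Y = {x + y | x y. x \<in> X \<and> y \<in> Y}"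

text \<open>The map induced on cosets of \<open>R\<close> by a linear map \<open>f\<close> that preserves \<open>R\<close>.\<close>

definition qmap :: "('b \<Rightarrow>\<^sub>0 complex) set \<Rightarrow> (('b \<Rightarrow>\<^sub>0 complex) \<Rightarrow> ('b \<Rightarrow>\<^sub>0 complex))
    \<Rightarrow> ('b \<Rightarrow>\<^sub>0 complex) set \<Rightarrow> ('b \<Rightarrow>\<^sub>0 complex) set" where
  "qmap R f X = (\<Union>x\<in>X. fcoset R (f x))"

lemma vector_space_fscale: "vector_space fscale"
proof -
  have lk: "Poly_Mapping.lookup (fscale c x) b = c * Poly_Mapping.lookup x b" for c b and x :: "'b \<Rightarrow>\<^sub>0 complex"
    by (simp add: fscale_def map.rep_eq when_def)
  show ?thesis
    by unfold_locales (auto intro!: poly_mapping_eqI simp: lk lookup_add algebra_simps)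
qed

section \<open>The Hecke--Clifford superalgebra\<close>

text \<open>As a vector space, the semidirect product of the Clifford algebra and the group algebra of the
  symmetric group is their tensor product. Its basis vector \<open>c\<^sub>I w\<close> is encoded as the pair
  \<open>(I, w)\<close>, where \<open>c\<^sub>I\<close> is the product of the \<open>c\<^sub>i\<close>, \<open>i \<in> I\<close>, in increasing order. The parity \<open>True\<close>
  means odd.\<close>

type_synonym hc = "(nat set \<times> (nat \<Rightarrow> nat)) \<Rightarrow>\<^sub>0 complex"

text \<open>\<open>c\<^sub>I c\<^sub>J = clifford_sign I J \<cdot> c\<^bsub>I \<triangle> J\<^esub>\<close>, by \<open>c\<^sub>i c\<^sub>j = - c\<^sub>j c\<^sub>i\<close> for distinct \<open>i\<close>, \<open>j\<close> and
  \<open>c\<^sub>i\<^sup>2 = 1\<close>.\<close>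

definition clifford_sign :: "nat set \<Rightarrow> nat set \<Rightarrow> complex" where
  "clifford_sign I J = (-1) ^ card {(i, j). i \<in> I \<and> j \<in> J \<and> j < i}"

text \<open>\<open>w c\<^sub>J w\<^sup>-\<^sup>1 = perm_sign w J \<cdot> c\<^bsub>w J\<^esub>\<close>, by \<open>w c\<^sub>j w\<^sup>-\<^sup>1 = c\<^bsub>w j\<^esub>\<close>; the sign comes from sorting the
  factors.\<close>

definition perm_sign :: "(nat \<Rightarrow> nat) \<Rightarrow> nat set \<Rightarrow> complex" where
  "perm_sign w J = (-1) ^ card {(i, j). i \<in> J \<and> j \<in> J \<and> i < j \<and> w j < w i}"

text \<open>\<open>(c\<^sub>I w) (c\<^sub>J v) = c\<^sub>I (w c\<^sub>J w\<^sup>-\<^sup>1) (w v)\<close>\<close>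

fun hc_mult_basis :: "nat set \<times> (nat \<Rightarrow> nat) \<Rightarrow> nat set \<times> (nat \<Rightarrow> nat) \<Rightarrow> hc" where
  "hc_mult_basis (I, w) (J, v) =
     Poly_Mapping.single ((I - w ` J) \<union> (w ` J - I), w \<circ> v) (perm_sign w J * clifford_sign I (w ` J))"

definition hc_mult :: "hc \<Rightarrow> hc \<Rightarrow> hc" (infixl "\<star>" 70) where
  "x \<star> y = flinear (\<lambda>a. flinear (\<lambda>b. hc_mult_basis a b) y) x"

definition hc_scalar :: "complex \<Rightarrow> hc" where
  "hc_scalar c = Poly_Mapping.single ({}, id) c"

definition hc_part :: "bool \<Rightarrow> hc set" where
  "hc_part p = free_space {(I, w). odd (card I) = p}"

text \<open>The automorphism \<open>a \<mapsto> (-1)\<^sup>|\<^sup>a\<^sup>| a\<close> (for homogeneous \<open>a\<close>).\<close>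

definition hc_grading :: "hc \<Rightarrow> hc" where
  "hc_grading = flinear (\<lambda>(I, w). Poly_Mapping.single (I, w) ((-1) ^ card I))"

definition hecke_clifford :: "nat \<Rightarrow> hc set" where
  "hecke_clifford n = free_space (Pow {..<n} \<times> {w. w permutes {..<n}})"

definition group_algebra :: "(nat \<Rightarrow> nat) set \<Rightarrow> hc set" where
  "group_algebra G = free_space ({{}} \<times> G)"

abbreviation sym_group :: "nat \<Rightarrow> (nat \<Rightarrow> nat) set" where
  "sym_group n \<equiv> {w. w permutes {..<n}}"

text \<open>Checks of the structure constants against the defining relations.\<close>

definition hc_c :: "nat \<Rightarrow> hc" where "hc_c i = fbasis ({i}, id)"

definition hc_w :: "(nat \<Rightarrow> nat) \<Rightarrow> hc" where "hc_w w = fbasis ({}, w)"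

lemma hc_mult_fbasis: "fbasis a \<star> fbasis b = hc_mult_basis a b"
proof -
  interpret vector_space fscale by (rule vector_space_fscale)
  show ?thesis by (simp add: hc_mult_def flinear_def)
qed

lemma perm_sign_id: "perm_sign id J = 1"
proof -
  have "{(i, j). i \<in> J \<and> j \<in> J \<and> i < j \<and> id j < id i} = {}" by auto
  then show ?thesis unfolding perm_sign_def by (simp only: card.empty power_0)
qed

lemma perm_sign_singleton: "perm_sign w {j} = 1"
proof -
  have "{(a, b). a \<in> {j} \<and> b \<in> {j} \<and> a < b \<and> w b < w a} = {}" by auto
  then show ?thesis unfolding perm_sign_def by (simp only: card.empty power_0)
qed

lemma clifford_sign_singletons: "clifford_sign {i} {j} = (if j < i then -1 else 1)"
proof -
  have "{(a, b). a \<in> {i} \<and> b \<in> {j} \<and> b < a} = (if j < i then {(i, j)} else {})" by auto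
  then show ?thesis unfolding clifford_sign_def by simp
qed

lemma clifford_sign_empty: "clifford_sign {} J = 1" "clifford_sign I {} = 1"
  by (simp_all add: clifford_sign_def)

lemma hc_c_square: "hc_c i \<star> hc_c i = hc_scalar 1"
  by (simp add: hc_c_def hc_mult_fbasis hc_scalar_def perm_sign_id clifford_sign_singletons)

lemma hc_c_anticommute: "i \<noteq> j \<Longrightarrow> hc_c i \<star> hc_c j = - (hc_c j \<star> hc_c i)"
  by (cases i j rule: linorder_cases)
    (simp_all add: hc_c_def hc_mult_fbasis perm_sign_id clifford_sign_singletons single_uminus
      insert_commute Un_commute)

lemma hc_w_mult: "hc_w w \<star> hc_w v = hc_w (w \<circ> v)"
  by (simp add: hc_w_def hc_mult_fbasis perm_sign_def clifford_sign_empty)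

lemma hc_w_c: "hc_w w \<star> hc_c j = hc_c (w j) \<star> hc_w w"
  by (simp add: hc_w_def hc_c_def hc_mult_fbasis perm_sign_singleton clifford_sign_empty perm_sign_id)

lemma hc_c_product:
  assumes "\<And>j. j \<in> I \<Longrightarrow> i < j"
  shows "hc_c i \<star> fbasis (I, w) = fbasis (insert i I, w)"
proof -
  have "{(a, b). a \<in> {i} \<and> b \<in> I \<and> b < a} = {}" using assms by (auto dest: less_asym)
  then have "clifford_sign {i} I = 1" unfolding clifford_sign_def by (simp only: card.empty power_0)
  moreover have "{i} - I \<union> (I - {i}) = insert i I" using assms by auto
  ultimately show ?thesis by (simp add: hc_c_def hc_mult_fbasis perm_sign_id)
qed

section \<open>Supermodules\<close>

text \<open>The fields \<open>mult\<close> and \<open>one\<close>, inherited from ring records, are not used. The complex vector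
  space structure of a module is given by the action of \<open>hc_scalar\<close>.\<close>

record ('a, 'v) smod = "('a, 'v) module" +
  part :: "bool \<Rightarrow> 'v set"

locale supermodule = abelian_group M for A :: "hc set" and M :: "(hc, 'v) smod" (structure) +
  assumes act_closed: "\<lbrakk>a \<in> A; v \<in> carrier M\<rbrakk> \<Longrightarrow> a \<odot> v \<in> carrier M"
    and act_add_left: "\<lbrakk>a \<in> A; b \<in> A; v \<in> carrier M\<rbrakk> \<Longrightarrow> (a + b) \<odot> v = a \<odot> v \<oplus> b \<odot> v"
    and act_add_right: "\<lbrakk>a \<in> A; v \<in> carrier M; u \<in> carrier M\<rbrakk> \<Longrightarrow> a \<odot> (v \<oplus> u) = a \<odot> v \<oplus> a \<odot> u"
    and act_mult: "\<lbrakk>a \<in> A; b \<in> A; v \<in> carrier M\<rbrakk> \<Longrightarrow> (a \<star> b) \<odot> v = a \<odot> (b \<odot> v)"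
    and act_one: "v \<in> carrier M \<Longrightarrow> hc_scalar 1 \<odot> v = v"
    and part_subgroup: "additive_subgroup (part M p) M"
    and part_sum: "carrier M = part M False <+> part M True"
    and part_inter: "part M False \<inter> part M True = {\<zero>}"
    and part_act: "\<lbrakk>a \<in> A \<inter> hc_part p; v \<in> part M r\<rbrakk> \<Longrightarrow> a \<odot> v \<in> part M (p \<noteq> r)"

definition fin_dim :: "(hc, 'v) smod \<Rightarrow> bool" where
  "fin_dim M \<longleftrightarrow> (\<exists>S. finite S \<and> S \<subseteq> carrier M \<and>
     (\<forall>v\<in>carrier M. \<exists>f. v = (\<Oplus>\<^bsub>M\<^esub>s\<in>S. hc_scalar (f s) \<odot>\<^bsub>M\<^esub> s)))"

text \<open>Homomorphisms of parity \<open>p\<close>: \<open>f (a v) = (-1)\<^sup>p\<^sup>|\<^sup>a\<^sup>| a (f v)\<close>.\<close>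

definition shom_part ::
  "hc set \<Rightarrow> bool \<Rightarrow> (hc, 'v) smod \<Rightarrow> (hc, 'w) smod \<Rightarrow> ('v \<Rightarrow> 'w) \<Rightarrow> bool" where
  "shom_part A p M N f \<longleftrightarrow>
     f ` carrier M \<subseteq> carrier N \<and>
     (\<forall>v\<in>carrier M. \<forall>u\<in>carrier M. f (v \<oplus>\<^bsub>M\<^esub> u) = f v \<oplus>\<^bsub>N\<^esub> f u) \<and>
     (\<forall>r. f ` part M r \<subseteq> part N (p \<noteq> r)) \<and>
     (\<forall>r. \<forall>a\<in>A \<inter> hc_part r. \<forall>v\<in>carrier M.
        f (a \<odot>\<^bsub>M\<^esub> v) = (if p \<and> r then \<ominus>\<^bsub>N\<^esub> (a \<odot>\<^bsub>N\<^esub> f v) else a \<odot>\<^bsub>N\<^esub> f v))"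

definition shom :: "hc set \<Rightarrow> (hc, 'v) smod \<Rightarrow> (hc, 'w) smod \<Rightarrow> ('v \<Rightarrow> 'w) \<Rightarrow> bool" where
  "shom A M N f \<longleftrightarrow> (\<exists>f0 f1. shom_part A False M N f0 \<and> shom_part A True M N f1 \<and>
     (\<forall>v\<in>carrier M. f v = f0 v \<oplus>\<^bsub>N\<^esub> f1 v))"

definition smod_iso :: "hc set \<Rightarrow> (hc, 'v) smod \<Rightarrow> (hc, 'w) smod \<Rightarrow> bool" where
  "smod_iso A M N \<longleftrightarrow> (\<exists>f. shom A M N f \<and> bij_betw f (carrier M) (carrier N))"

definition smod_even_iso :: "hc set \<Rightarrow> (hc, 'v) smod \<Rightarrow> (hc, 'w) smod \<Rightarrow> bool" where
  "smod_even_iso A M N \<longleftrightarrow> (\<exists>f. shom_part A False M N f \<and> bij_betw f (carrier M) (carrier N))"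

definition parity_shift :: "(hc, 'v) smod \<Rightarrow> (hc, 'v) smod" where
  "parity_shift M = M\<lparr>part := (\<lambda>p. part M (\<not> p)), smult := (\<lambda>a v. hc_grading a \<odot>\<^bsub>M\<^esub> v)\<rparr>"

definition subsupermodule :: "hc set \<Rightarrow> (hc, 'v) smod \<Rightarrow> 'v set \<Rightarrow> bool" where
  "subsupermodule A M W \<longleftrightarrow>
     additive_subgroup W M \<and>
     (\<forall>a\<in>A. \<forall>v\<in>W. a \<odot>\<^bsub>M\<^esub> v \<in> W) \<and>
     W = (W \<inter> part M False) <+>\<^bsub>M\<^esub> (W \<inter> part M True)"

definition restrict_smod :: "(hc, 'v) smod \<Rightarrow> 'v set \<Rightarrow> (hc, 'v) smod" where
  "restrict_smod M W = M\<lparr>carrier := W, part := (\<lambda>p. W \<inter> part M p)\<rparr>"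

definition quotient_smod :: "(hc, 'v) smod \<Rightarrow> 'v set \<Rightarrow> (hc, 'v set) smod" where
  "quotient_smod M W =
     \<lparr>carrier = a_rcosets\<^bsub>M\<^esub> W, mult = undefined, one = undefined, zero = W,
      add = set_add M, smult = (\<lambda>a X. \<Union>v\<in>X. W +>\<^bsub>M\<^esub> (a \<odot>\<^bsub>M\<^esub> v)),
      part = (\<lambda>p. (\<lambda>v. W +>\<^bsub>M\<^esub> v) ` part M p)\<rparr>"

definition irreducible_smod :: "hc set \<Rightarrow> (hc, 'v) smod \<Rightarrow> bool" where
  "irreducible_smod A M \<longleftrightarrow> supermodule A M \<and> carrier M \<noteq> {\<zero>\<^bsub>M\<^esub>} \<and>
     (\<forall>W. subsupermodule A M W \<longrightarrow> W = {\<zero>\<^bsub>M\<^esub>} \<or> W = carrier M)"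

definition composition_factor :: "(hc, 'v) smod \<Rightarrow> 'v set list \<Rightarrow> nat \<Rightarrow> (hc, 'v set) smod" where
  "composition_factor N Ws i = quotient_smod (restrict_smod N (Ws ! Suc i)) (Ws ! i)"

definition composition_series :: "hc set \<Rightarrow> (hc, 'v) smod \<Rightarrow> 'v set list \<Rightarrow> bool" where
  "composition_series A N Ws \<longleftrightarrow>
     Ws \<noteq> [] \<and> hd Ws = {\<zero>\<^bsub>N\<^esub>} \<and> last Ws = carrier N \<and>
     (\<forall>W\<in>set Ws. subsupermodule A N W) \<and>
     (\<forall>i. Suc i < length Ws \<longrightarrow> Ws ! i \<subseteq> Ws ! Suc i \<and> irreducible_smod A (composition_factor N Ws i))"

text \<open>Multiplicity of \<open>D\<close> as a composition factor, counting \<open>D\<close> and its parity shift together; it does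
  not depend on the composition series (Jordan--Hoelder).\<close>

definition smod_multiplicity :: "hc set \<Rightarrow> (hc, 'd) smod \<Rightarrow> (hc, 'v) smod \<Rightarrow> nat" where
  "smod_multiplicity A D N = (THE k. \<exists>Ws. composition_series A N Ws \<and>
     k = card {i. Suc i < length Ws \<and>
       (smod_even_iso A (composition_factor N Ws i) D \<or>
        smod_even_iso A (composition_factor N Ws i) (parity_shift D))})"

section \<open>Induction, exterior powers\<close>

text \<open>The induced module is the tensor product of \<open>A\<close> and \<open>M\<close> over \<open>B\<close>: the free vector space on the
  symbols \<open>(a, v)\<close> modulo the following relations.\<close>

definition tensor_relations :: "hc set \<Rightarrow> hc set \<Rightarrow> (hc, 'v) smod \<Rightarrow> (hc \<times> 'v \<Rightarrow>\<^sub>0 complex) set" where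
  "tensor_relations A B M = fspan (
     {fbasis (a + a', v) - fbasis (a, v) - fbasis (a', v) | a a' v. a \<in> A \<and> a' \<in> A \<and> v \<in> carrier M} \<union>
     {fbasis (a, v \<oplus>\<^bsub>M\<^esub> v') - fbasis (a, v) - fbasis (a, v') | a v v'. a \<in> A \<and> v \<in> carrier M \<and> v' \<in> carrier M} \<union>
     {fbasis (fscale c a, v) - fscale c (fbasis (a, v)) | c a v. a \<in> A \<and> v \<in> carrier M} \<union>
     {fbasis (a \<star> b, v) - fbasis (a, b \<odot>\<^bsub>M\<^esub> v) | a b v. a \<in> A \<and> b \<in> B \<and> v \<in> carrier M})"

definition induced_module ::
  "hc set \<Rightarrow> hc set \<Rightarrow> (hc, 'v) smod \<Rightarrow> (hc, (hc \<times> 'v \<Rightarrow>\<^sub>0 complex) set) smod" where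
  "induced_module A B M = (let R = tensor_relations A B M in
     \<lparr>carrier = fcoset R ` free_space (A \<times> carrier M), mult = undefined, one = undefined,
      zero = fcoset R 0, add = qadd,
      smult = (\<lambda>a. qmap R (flinear (\<lambda>(b, v). fbasis (a \<star> b, v)))),
      part = (\<lambda>p. fcoset R ` free_space
        {(a, v). \<exists>r t. a \<in> A \<inter> hc_part r \<and> v \<in> part M t \<and> p = (r \<noteq> t)})\<rparr>)"

text \<open>Modules over group algebras are regarded as purely even.\<close>

definition trivial_module :: "(hc, complex) smod" where
  "trivial_module =
     \<lparr>carrier = UNIV, mult = undefined, one = undefined, zero = 0, add = (+),
      smult = (\<lambda>x v. (\<Sum>g\<in>Poly_Mapping.keys x. Poly_Mapping.lookup x g) * v),
      part = (\<lambda>p. if p then {0} else UNIV)\<rparr>"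

text \<open>The permutation action is \<open>w e\<^sub>i = e\<^bsub>w i\<^esub>\<close>, that is, \<open>(w v)\<^sub>i = v\<^bsub>w\<^sup>-\<^sup>1 i\<^esub>\<close>.\<close>

definition permutation_module :: "nat \<Rightarrow> (hc, nat \<Rightarrow> complex) smod" where
  "permutation_module n = (let V = {v. \<forall>i\<ge>n. v i = 0} in
     \<lparr>carrier = V, mult = undefined, one = undefined,
      zero = (\<lambda>i. 0), add = (\<lambda>v u i. v i + u i),
      smult = (\<lambda>x v i. \<Sum>(I, w)\<in>Poly_Mapping.keys x. Poly_Mapping.lookup x (I, w) * v (inv_into UNIV w i)),
      part = (\<lambda>p. if p then {\<lambda>i. 0} else V)\<rparr>)"

text \<open>The \<open>q\<close>-th exterior power of a module over a group algebra: the free vector space on the symbols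
  \<open>[v\<^sub>1, \<dots>, v\<^sub>q]\<close> (for \<open>v\<^sub>1 \<and> \<dots> \<and> v\<^sub>q\<close>) modulo multilinearity and alternation, with the diagonal
  action of the group elements.\<close>

definition exterior_relations :: "nat \<Rightarrow> (hc, 'v) smod \<Rightarrow> ('v list \<Rightarrow>\<^sub>0 complex) set" where
  "exterior_relations q M = fspan (
     {fbasis (us @ [v \<oplus>\<^bsub>M\<^esub> v'] @ us') - fbasis (us @ [v] @ us') - fbasis (us @ [v'] @ us') | us us' v v'.
        Suc (length us + length us') = q \<and> set us \<union> set us' \<union> {v, v'} \<subseteq> carrier M} \<union>
     {fbasis (us @ [hc_scalar c \<odot>\<^bsub>M\<^esub> v] @ us') - fscale c (fbasis (us @ [v] @ us')) | c us us' v.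
        Suc (length us + length us') = q \<and> set us \<union> set us' \<union> {v} \<subseteq> carrier M} \<union>
     {fbasis vs | vs. length vs = q \<and> set vs \<subseteq> carrier M \<and> \<not> distinct vs})"

definition exterior_power :: "nat \<Rightarrow> (hc, 'v) smod \<Rightarrow> (hc, ('v list \<Rightarrow>\<^sub>0 complex) set) smod" where
  "exterior_power q M =
     (let R = exterior_relations q M;
          E = fcoset R ` free_space {vs. length vs = q \<and> set vs \<subseteq> carrier M} in
     \<lparr>carrier = E, mult = undefined, one = undefined,
      zero = fcoset R 0, add = qadd,
      smult = (\<lambda>x. qmap R (flinear (\<lambda>vs.
        flinear (\<lambda>g. fbasis (map (\<lambda>v. fbasis g \<odot>\<^bsub>M\<^esub> v) vs)) x))),
      part = (\<lambda>p. if p then {fcoset R 0} else E)\<rparr>)"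

section \<open>Schur Q-functions\<close>

type_synonym mpoly = "(nat \<Rightarrow>\<^sub>0 nat) \<Rightarrow>\<^sub>0 complex"

definition zvar :: "nat \<Rightarrow> mpoly" where
  "zvar i = Poly_Mapping.single (Poly_Mapping.single i 1) 1"

definition mconst :: "complex \<Rightarrow> mpoly" where
  "mconst c = Poly_Mapping.single 0 c"

text \<open>Value of a polynomial at \<open>z\<^sub>i = z i\<close> in the algebra with structure map \<open>e\<close>.\<close>

definition mpoly_eval :: "(complex \<Rightarrow> 'r :: comm_semiring_1) \<Rightarrow> (nat \<Rightarrow> 'r) \<Rightarrow> mpoly \<Rightarrow> 'r" where
  "mpoly_eval e z f = (\<Sum>\<alpha>\<in>Poly_Mapping.keys f. e (Poly_Mapping.lookup f \<alpha>) *
     (\<Prod>i\<in>Poly_Mapping.keys \<alpha>. z i ^ Poly_Mapping.lookup \<alpha> i))"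

text \<open>A symmetric function \<open>f\<close> is represented by the sequence of the polynomials
  \<open>f m = f(z\<^sub>0, \<dots>, z\<^bsub>m - 1\<^esub>, 0, 0, \<dots>)\<close>.\<close>

type_synonym symfun = "nat \<Rightarrow> mpoly"

definition strict_partition :: "nat list \<Rightarrow> nat \<Rightarrow> bool" where
  "strict_partition lam n \<longleftrightarrow> sorted_wrt (>) lam \<and> (\<forall>x\<in>set lam. 0 < x) \<and> sum_list lam = n"

definition pdelta :: "nat list \<Rightarrow> nat" where
  "pdelta lam = (if even (length lam) then 0 else 1)"

definition left_cosets :: "('a \<Rightarrow> 'a) set \<Rightarrow> ('a \<Rightarrow> 'a) set \<Rightarrow> ('a \<Rightarrow> 'a) set set" where
  "left_cosets G H = (\<lambda>w. (\<lambda>v. w \<circ> v) ` H) ` G"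

definition Q_summand :: "nat list \<Rightarrow> nat \<Rightarrow> (nat \<Rightarrow> nat) \<Rightarrow> mpoly fract" where
  "Q_summand lam m w =
     (\<Prod>i<length lam. Fract (zvar (w i)) 1 ^ (lam ! i)) *
     (\<Prod>i<length lam. \<Prod>j\<in>{i<..<m}. Fract (zvar (w i) + zvar (w j)) (zvar (w i) - zvar (w j)))"

text \<open>\<open>Q\<^bsub>lam\<^esub>(z\<^sub>0, \<dots>, z\<^bsub>m - 1\<^esub>)\<close> for \<open>m \<ge> \<ell>(lam)\<close>: the polynomial that equals the rational function
  given by the symmetrization. The summand depends only on the coset \<open>X\<close>, not on its representative.\<close>

definition Q_poly :: "nat list \<Rightarrow> nat \<Rightarrow> mpoly" where
  "Q_poly lam m = (THE f. Fract f 1 =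
     2 ^ length lam * (\<Sum>X\<in>left_cosets {w. w permutes {..<m}} {v. v permutes {length lam..<m}}.
       Q_summand lam m (SOME w. w \<in> X)))"

text \<open>For \<open>m < \<ell>(lam)\<close> the remaining variables of \<open>Q\<^bsub>lam\<^esub>(z\<^sub>0, \<dots>, z\<^bsub>\<ell> - 1\<^esub>)\<close> are set to 0.\<close>

definition Q_fun :: "nat list \<Rightarrow> symfun" where
  "Q_fun lam m = mpoly_eval mconst (\<lambda>i. if i < m then zvar i else 0) (Q_poly lam (max m (length lam)))"

text \<open>\<open>Q\<^bsub>lam\<^esub>(1, s) = Q\<^bsub>lam\<^esub>(1, s, 0, 0, \<dots>)\<close> as a polynomial in the indeterminate \<open>s\<close>.\<close>

definition Q_one_s :: "nat list \<Rightarrow> complex poly" where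
  "Q_one_s lam = mpoly_eval (\<lambda>c. [:c:]) (\<lambda>i. if i = 0 then 1 else [:0, 1:]) (Q_fun lam 2)"

text \<open>The factor \<open>Abs_fps (\<lambda>k. z\<^sub>i\<^sup>k)\<close> is the power series \<open>1 / (1 - z\<^sub>i u)\<close>.\<close>

definition q_fun :: "nat \<Rightarrow> symfun" where
  "q_fun r m = fps_nth (\<Prod>i<m. (1 + fps_const (zvar i) * fps_X) * Abs_fps (\<lambda>k. zvar i ^ k)) r"

definition q_comp :: "nat list \<Rightarrow> symfun" where
  "q_comp \<nu> m = (\<Prod>r\<leftarrow>\<nu>. q_fun r m)"

text \<open>The subalgebra of the algebra of symmetric functions generated by the \<open>q\<^sub>r\<close>.\<close>

inductive_set Gamma :: "symfun set" where
  const: "(\<lambda>m. mconst c) \<in> Gamma"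
| gen: "q_fun r \<in> Gamma"
| add: "\<lbrakk>f \<in> Gamma; g \<in> Gamma\<rbrakk> \<Longrightarrow> (\<lambda>m. f m + g m) \<in> Gamma"
| mult: "\<lbrakk>f \<in> Gamma; g \<in> Gamma\<rbrakk> \<Longrightarrow> (\<lambda>m. f m * g m) \<in> Gamma"

section \<open>Grothendieck group and characteristic map\<close>

text \<open>Up to even isomorphism, every finite-dimensional module can be realized inside
  \<open>nat \<Rightarrow> complex\<close>, so modules with underlying set in this type suffice for the Grothendieck
  group. A module \<open>M\<close> over \<open>hecke_clifford n\<close> is represented by the symbol \<open>(n, M)\<close>.\<close>

type_synonym cmod = "(hc, nat \<Rightarrow> complex) smod"

definition hc_module :: "nat \<Rightarrow> (hc, 'v) smod \<Rightarrow> bool" where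
  "hc_module n M \<longleftrightarrow> supermodule (hecke_clifford n) M \<and> fin_dim M"

definition short_exact :: "hc set \<Rightarrow> (hc, 'u) smod \<Rightarrow> (hc, 'v) smod \<Rightarrow> (hc, 'w) smod \<Rightarrow> bool" where
  "short_exact A M' M M'' \<longleftrightarrow> (\<exists>f g.
     shom_part A False M' M f \<and> shom_part A False M M'' g \<and>
     inj_on f (carrier M') \<and> g ` carrier M = carrier M'' \<and>
     f ` carrier M' = {v \<in> carrier M. g v = \<zero>\<^bsub>M''\<^esub>})"

definition K_relations :: "(nat \<times> cmod \<Rightarrow>\<^sub>0 complex) set" where
  "K_relations = fspan (
     {fbasis (n, M) - fbasis (n, M') - fbasis (n, M'') | n M M' M''.
        hc_module n M \<and> hc_module n M' \<and> hc_module n M'' \<and>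
        short_exact (hecke_clifford n) M' M M''} \<union>
     {fbasis (n, parity_shift M) - fbasis (n, M) | n M. hc_module n M})"

text \<open>The direct sum over all \<open>n\<close> of the complexified Grothendieck groups, with \<open>[\<Pi> M] = [M]\<close>.\<close>

definition K_space :: "(nat \<times> cmod \<Rightarrow>\<^sub>0 complex) set set" where
  "K_space = fcoset K_relations ` free_space {(n, M). hc_module n M}"

text \<open>The class of a finite-dimensional module over \<open>hecke_clifford n\<close> with any underlying type.\<close>

definition K_class :: "nat \<Rightarrow> (hc, 'v) smod \<Rightarrow> (nat \<times> cmod \<Rightarrow>\<^sub>0 complex) set" where
  "K_class n N = fcoset K_relations (fbasis (n,
     SOME M :: cmod. hc_module n M \<and> smod_even_iso (hecke_clifford n) M N))"

definition young_subgroup :: "nat list \<Rightarrow> (nat \<Rightarrow> nat) set" where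
  "young_subgroup \<nu> = {w. w permutes {..<sum_list \<nu>} \<and> (\<forall>k<length \<nu>.
     w ` {sum_list (take k \<nu>)..<sum_list (take (Suc k) \<nu>)} = {sum_list (take k \<nu>)..<sum_list (take (Suc k) \<nu>)})}"

definition characteristic_map :: "((nat \<times> cmod \<Rightarrow>\<^sub>0 complex) set \<Rightarrow> symfun) \<Rightarrow> bool" where
  "characteristic_map ch \<longleftrightarrow>
     bij_betw ch K_space Gamma \<and>
     (\<forall>X\<in>K_space. \<forall>Y\<in>K_space. ch (qadd X Y) = (\<lambda>m. ch X m + ch Y m)) \<and>
     (\<forall>c. \<forall>X\<in>K_space. ch (qmap K_relations (fscale c) X) = (\<lambda>m. mconst c * ch X m)) \<and>
     (\<forall>n \<nu>. sum_list \<nu> = n \<and> (\<forall>r\<in>set \<nu>. 0 < r) \<longrightarrow>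
        ch (K_class n (induced_module (hecke_clifford n) (group_algebra (young_subgroup \<nu>)) trivial_module))
          = q_comp \<nu>)"

text \<open>A complete irredundant list of irreducible modules over the algebras \<open>hecke_clifford n\<close> that is
  labelled by strict partitions as prescribed by the characteristic map. The number
  \<open>length lam - pdelta lam\<close> is even.\<close>

definition irreducible_labelling ::
  "((nat \<times> cmod \<Rightarrow>\<^sub>0 complex) set \<Rightarrow> symfun) \<Rightarrow> (nat list \<Rightarrow> cmod) \<Rightarrow> bool" where
  "irreducible_labelling ch D \<longleftrightarrow>
     (\<forall>n lam. strict_partition lam n \<longrightarrow>
        hc_module n (D lam) \<and> irreducible_smod (hecke_clifford n) (D lam) \<and>
        ch (K_class n (D lam)) = (\<lambda>m. mconst (1 / 2 ^ ((length lam - pdelta lam) div 2)) * Q_fun lam m)) \<and>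
     (\<forall>n lam \<mu>. strict_partition lam n \<and> strict_partition \<mu> n \<and>
        smod_iso (hecke_clifford n) (D lam) (D \<mu>) \<longrightarrow> lam = \<mu>) \<and>
     (\<forall>n (M :: cmod). hc_module n M \<and> irreducible_smod (hecke_clifford n) M \<longrightarrow>
        (\<exists>lam. strict_partition lam n \<and> smod_iso (hecke_clifford n) M (D lam)))"

end

theory Submission
  imports Defs "HOL-Computational_Algebra.Polynomial_Factorial" "HOL-Computational_Algebra.Polynomial_FPS"
begin

text \<open>
  A finite-dimensional module over the Hecke--Clifford superalgebra is determined in the Grothendieck
  group by its characteristic. The characteristic of a module is the sum, over its composition factors
  \<open>D\<^sup>\<lambda>\<close>, of multiples of \<open>Q\<^sub>\<lambda>\<close>, and the \<open>Q\<^sub>\<lambda>\<close> are linearly independent; so the multiplicities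
  can be read off from the expansion of the characteristic in Schur \<open>Q\<close>-functions
  (\<open>chi_multiplicity\<close>).

  For the module induced from the \<open>q\<close>-th exterior power of the permutation module, the key point is
  that exterior powers become tame after induction: in \<open>c\<^sub>I \<otimes> e\<^sub>J\<close> the Clifford algebra supplies, by left
  multiplication, an element \<open>c\<^sub>J\<close> on which a permutation acts with exactly the same sign as on \<open>e\<^sub>J\<close>. The
  vectors \<open>c\<^sub>J \<otimes> e\<^sub>J\<close> are therefore permuted without signs, and each is fixed by a Young subgroup of type
  \<open>(q, n - q)\<close>. Both the module induced from the exterior power
  (\<open>induced_exterior_power_model\<close>) and, up to parity, the module induced from the trivial module of
  this subgroup (\<open>induced_trivial_model\<close>) are isomorphic to one explicit module, \<open>model n q\<close>. Hence the
  characteristic is the product of the generators \<open>q\<^sub>q\<close> and \<open>q\<^bsub>n - q\<^esub>\<close>.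

  It remains to expand this product. Evaluated at a point with distinct positive coordinates, a partial
  fraction expansion turns \<open>q\<^sub>k q\<^sub>l\<close> into a combination of \<open>Q\<close>-functions with at most two rows, with
  coefficients 0, 1 and 2 (\<open>Q_product_coefficients\<close>). The same coefficients appear in \<open>Q\<^sub>\<lambda>(1, s)\<close>
  (\<open>Q_one_s_eq\<close>), which is computed from the symmetrization formula: with two variables the sum has two
  terms, and for three or more rows every term contains the product of at least three variables, one of
  which is set to zero.
\<close>

section \<open>Evaluation of polynomials\<close>

lemma sum_monomials: "(\<Sum>a\<in>Poly_Mapping.keys f. Poly_Mapping.single a (Poly_Mapping.lookup f a)) = f"
proof (rule poly_mapping_eqI)
  fix k
  have "(\<Sum>a\<in>Poly_Mapping.keys f. Poly_Mapping.lookup (Poly_Mapping.single a (Poly_Mapping.lookup f a)) k)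
      = (\<Sum>a\<in>Poly_Mapping.keys f. if k = a then Poly_Mapping.lookup f a else 0)"
    by (intro sum.cong) (auto simp: lookup_single when_def)
  also have "\<dots> = Poly_Mapping.lookup f k"
    by (simp add: sum.delta in_keys_iff)
  finally show "Poly_Mapping.lookup (\<Sum>a\<in>Poly_Mapping.keys f. Poly_Mapping.single a (Poly_Mapping.lookup f a)) k
      = Poly_Mapping.lookup f k"
    by (simp add: lookup_sum)
qed

definition monomial_value :: "(nat \<Rightarrow> 'r :: comm_semiring_1) \<Rightarrow> (nat \<Rightarrow>\<^sub>0 nat) \<Rightarrow> 'r" where
  "monomial_value z \<alpha> = (\<Prod>i\<in>Poly_Mapping.keys \<alpha>. z i ^ Poly_Mapping.lookup \<alpha> i)"

lemma monomial_value_superset: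
  assumes "finite S" "Poly_Mapping.keys \<alpha> \<subseteq> S"
  shows "monomial_value z \<alpha> = (\<Prod>i\<in>S. z i ^ Poly_Mapping.lookup \<alpha> i)"
  unfolding monomial_value_def using assms
  by (intro prod.mono_neutral_left) (auto simp: in_keys_iff)

lemma monomial_value_add:
  "monomial_value z (\<alpha> + \<beta>) = monomial_value z \<alpha> * monomial_value z \<beta>"
proof -
  let ?S = "Poly_Mapping.keys \<alpha> \<union> Poly_Mapping.keys \<beta>"
  have "monomial_value z \<gamma> = (\<Prod>i\<in>?S. z i ^ Poly_Mapping.lookup \<gamma> i)"
    if "Poly_Mapping.keys \<gamma> \<subseteq> ?S" for \<gamma>
    using that by (intro monomial_value_superset) auto
  from this[of \<alpha>] this[of \<beta>] this[of "\<alpha> + \<beta>"] show ?thesis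
    using Poly_Mapping.keys_add[of \<alpha> \<beta>]
    by (simp add: lookup_add power_add prod.distrib)
qed

locale coefficient_map =
  fixes e :: "complex \<Rightarrow> 'r :: comm_ring_1"
  assumes map_zero: "e 0 = 0" and map_one: "e 1 = 1"
    and map_add: "e (a + b) = e a + e b" and map_mult: "e (a * b) = e a * e b"
begin

lemma eval_superset:
  assumes "finite S" "Poly_Mapping.keys f \<subseteq> S"
  shows "mpoly_eval e z f = (\<Sum>\<alpha>\<in>S. e (Poly_Mapping.lookup f \<alpha>) * monomial_value z \<alpha>)"
  unfolding mpoly_eval_def monomial_value_def using assms
  by (intro sum.mono_neutral_left) (auto simp: in_keys_iff map_zero)

lemma eval_add: "mpoly_eval e z (f + g) = mpoly_eval e z f + mpoly_eval e z g"
proof -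
  let ?S = "Poly_Mapping.keys f \<union> Poly_Mapping.keys g"
  have "mpoly_eval e z h = (\<Sum>\<alpha>\<in>?S. e (Poly_Mapping.lookup h \<alpha>) * monomial_value z \<alpha>)"
    if "Poly_Mapping.keys h \<subseteq> ?S" for h
    using that by (intro eval_superset) auto
  from this[of f] this[of g] this[of "f + g"] show ?thesis
    using Poly_Mapping.keys_add[of f g]
    by (simp add: lookup_add map_add distrib_right sum.distrib)
qed

lemma eval_zero [simp]: "mpoly_eval e z 0 = 0"
  by (simp add: mpoly_eval_def)

lemma eval_single: "mpoly_eval e z (Poly_Mapping.single \<alpha> c) = e c * monomial_value z \<alpha>"
  by (subst eval_superset[of "{\<alpha>}"]) auto

lemma eval_sum: "mpoly_eval e z (sum f S) = (\<Sum>x\<in>S. mpoly_eval e z (f x))"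
  by (induction S rule: infinite_finite_induct) (auto simp: eval_add)

lemma eval_mult: "mpoly_eval e z (f * g) = mpoly_eval e z f * mpoly_eval e z g"
proof -
  let ?m = "\<lambda>f \<alpha>. Poly_Mapping.single \<alpha> (Poly_Mapping.lookup f \<alpha>)"
  have "f * g = (\<Sum>\<alpha>\<in>Poly_Mapping.keys f. \<Sum>\<beta>\<in>Poly_Mapping.keys g. ?m f \<alpha> * ?m g \<beta>)"
    unfolding sum_product[symmetric] sum_monomials ..
  also have "mpoly_eval e z \<dots> = (\<Sum>\<alpha>\<in>Poly_Mapping.keys f. \<Sum>\<beta>\<in>Poly_Mapping.keys g.
      mpoly_eval e z (?m f \<alpha>) * mpoly_eval e z (?m g \<beta>))"
    by (simp add: eval_sum mult_single eval_single map_mult monomial_value_add mult_ac)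
  also have "\<dots> = mpoly_eval e z (\<Sum>\<alpha>\<in>Poly_Mapping.keys f. ?m f \<alpha>) *
      mpoly_eval e z (\<Sum>\<alpha>\<in>Poly_Mapping.keys g. ?m g \<alpha>)"
    by (simp only: eval_sum sum_product)
  finally show ?thesis by (simp only: sum_monomials)
qed

lemma eval_mconst [simp]: "mpoly_eval e z (mconst c) = e c"
  by (simp add: mconst_def eval_single monomial_value_def)

lemma eval_zvar [simp]: "mpoly_eval e z (zvar i) = z i"
  by (simp add: zvar_def eval_single monomial_value_def map_one)

lemma eval_one [simp]: "mpoly_eval e z 1 = 1"
  using eval_mconst[of z 1] by (simp add: mconst_def map_one)

lemma eval_uminus: "mpoly_eval e z (- f) = - mpoly_eval e z f"
  using eval_add[of z f "- f"] by (simp add: eq_neg_iff_add_eq_0 add.commute)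

lemma eval_diff: "mpoly_eval e z (f - g) = mpoly_eval e z f - mpoly_eval e z g"
  using eval_add[of z f "- g"] by (simp add: eval_uminus)

lemma eval_prod: "mpoly_eval e z (prod f S) = (\<Prod>x\<in>S. mpoly_eval e z (f x))"
  by (induction S rule: infinite_finite_induct) (auto simp: eval_mult)

lemma eval_power: "mpoly_eval e z (f ^ k) = mpoly_eval e z f ^ k"
  by (induction k) (auto simp: eval_mult)

lemma eval_of_nat [simp]: "mpoly_eval e z (of_nat k) = of_nat k"
  by (induction k) (auto simp: eval_add)

lemma eval_numeral [simp]: "mpoly_eval e z (numeral k) = numeral k"
  using eval_of_nat[of z "numeral k"] by (simp only: of_nat_numeral)

end

interpretation coeff_mconst: coefficient_map mconst
  by unfold_locales (auto simp: mconst_def single_add mult_single)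

interpretation coeff_pCons: coefficient_map "\<lambda>c. [:c:]"
  by unfold_locales (auto simp: one_pCons)

interpretation coeff_complex: coefficient_map "\<lambda>c. c"
  by unfold_locales auto

lemma eval_zvar_self: "mpoly_eval mconst zvar f = f"
proof -
  have "monomial_value zvar \<alpha> = Poly_Mapping.single \<alpha> 1" for \<alpha>
  proof -
    have pow: "zvar i ^ k = Poly_Mapping.single (Poly_Mapping.single i k) 1" for i k
      by (induction k) (auto simp: zvar_def mult_single single_add[symmetric])
    have "(\<Prod>i\<in>S. Poly_Mapping.single (h i) (1::complex)) = Poly_Mapping.single (\<Sum>i\<in>S. h i) 1"
      if "finite S" for S and h :: "nat \<Rightarrow> nat \<Rightarrow>\<^sub>0 nat"
      using that by (induction S) (auto simp: mult_single)
    then show ?thesis unfolding monomial_value_def pow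
      by (simp add: sum_monomials)
  qed
  then show ?thesis
    unfolding mpoly_eval_def monomial_value_def[symmetric]
    by (simp add: mconst_def mult_single sum_monomials)
qed

section \<open>Divisibility by differences of variables\<close>

lemma dvd_power_diff: "d dvd (x::'a::comm_ring_1) - y \<Longrightarrow> d dvd x ^ k - y ^ k"
  using dvd_trans[OF _ dvdI[OF power_diff_sumr2]] by blast

lemma dvd_prod_diff:
  fixes f g :: "'b \<Rightarrow> 'a :: comm_ring_1"
  assumes "\<And>i. i \<in> S \<Longrightarrow> d dvd f i - g i"
  shows "d dvd prod f S - prod g S"
  using assms
proof (induction S rule: infinite_finite_induct)
  case (insert x F)
  have "prod f (insert x F) - prod g (insert x F)
      = (f x - g x) * prod f F + g x * (prod f F - prod g F)"
    using insert by (simp add: algebra_simps)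
  then show ?case using insert by (metis dvd_add dvd_mult dvd_mult2 insertCI)
qed auto

lemma dvd_eval_diff:
  assumes "\<And>i. d dvd z i - z' i"
  shows "d dvd mpoly_eval e z f - mpoly_eval e (z' :: nat \<Rightarrow> 'r :: comm_ring_1) f"
  unfolding mpoly_eval_def sum_subtractf[symmetric] right_diff_distrib[symmetric]
  by (intro dvd_sum dvd_mult dvd_prod_diff dvd_power_diff assms)

text \<open>Putting \<open>z\<^sub>a = z\<^sub>b\<close> has kernel generated by \<open>z\<^sub>a - z\<^sub>b\<close> and an integral domain as its image, so
  \<open>z\<^sub>a - z\<^sub>b\<close> is prime.\<close>

abbreviation merge_vars :: "nat \<Rightarrow> nat \<Rightarrow> mpoly \<Rightarrow> mpoly" where
  "merge_vars a b \<equiv> mpoly_eval mconst (zvar(a := zvar b))"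

lemma merge_vars_zero_imp_dvd:
  assumes "merge_vars a b f = 0" shows "zvar a - zvar b dvd f"
proof -
  have "zvar a - zvar b dvd mpoly_eval mconst zvar f - merge_vars a b f"
    by (rule dvd_eval_diff) auto
  then show ?thesis using assms by (simp add: eval_zvar_self)
qed

lemma zvar_inject [simp]: "zvar i = zvar j \<longleftrightarrow> i = j"
proof
  assume "zvar i = zvar j"
  then have "Poly_Mapping.single i (1::nat) = Poly_Mapping.single j 1"
    unfolding zvar_def by (metis keys_single singleton_inject zero_neq_one)
  then show "i = j" by (metis keys_single singleton_inject zero_neq_one)
qed auto

text \<open>The linear forms \<open>z\<^sub>i - z\<^sub>j\<close>, \<open>i < j\<close>, are pairwise coprime primes, so their product divides
  whatever each of them divides.\<close>

lemma prod_differences_dvd: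
  assumes "finite P" "\<And>i j. (i, j) \<in> P \<Longrightarrow> i < j"
    and "\<And>i j. (i, j) \<in> P \<Longrightarrow> merge_vars i j f = 0"
  shows "(\<Prod>(i, j)\<in>P. zvar i - zvar j) dvd f"
  using assms
proof (induction P)
  case (insert p P)
  obtain a b where p: "p = (a, b)" by (cases p)
  have ab: "a < b" and fab: "merge_vars a b f = 0"
    using insert.prems(1)[of a b] insert.prems(2)[of a b] unfolding p by blast+
  have "(\<Prod>(i, j)\<in>P. zvar i - zvar j) dvd f" using insert by auto
  then obtain g where g: "f = (\<Prod>(i, j)\<in>P. zvar i - zvar j) * g" ..
  have "merge_vars a b (\<Prod>(i, j)\<in>P. zvar i - zvar j) * merge_vars a b g = 0"
    using fab unfolding g coeff_mconst.eval_mult by simp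
  moreover have "merge_vars a b (\<Prod>(i, j)\<in>P. zvar i - zvar j) \<noteq> 0"
  proof -
    have "merge_vars a b (zvar i - zvar j) \<noteq> 0" if "(i, j) \<in> P" for i j
    proof -
      have "i < j" "(i, j) \<noteq> (a, b)" using that insert p by auto
      then show ?thesis using ab by (auto simp: coeff_mconst.eval_diff)
    qed
    then show ?thesis using insert.hyps
      by (auto simp: coeff_mconst.eval_prod prod_zero_iff)
  qed
  ultimately have "merge_vars a b g = 0" by simp
  then have "zvar a - zvar b dvd g" by (rule merge_vars_zero_imp_dvd)
  then show ?case using insert.hyps unfolding g p
    by (auto simp: mult.commute intro: mult_dvd_mono)
qed auto

section \<open>The Vandermonde product\<close>

definition pairs_below :: "nat \<Rightarrow> (nat \<times> nat) set" where
  "pairs_below m = {(i, j). i < j \<and> j < m}"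

definition vandermonde :: "nat \<Rightarrow> (nat \<Rightarrow> 'a :: comm_ring_1) \<Rightarrow> 'a" where
  "vandermonde m f = (\<Prod>(i, j)\<in>pairs_below m. f i - f j)"

lemma finite_pairs_below [simp]: "finite (pairs_below m)"
  by (rule finite_subset[of _ "{..<m} \<times> {..<m}"]) (auto simp: pairs_below_def)

lemma prod_pairs_Suc:
  "(\<Prod>(i, j)\<in>pairs_below (Suc m). g i j) = (\<Prod>(i, j)\<in>pairs_below m. g i j) * (\<Prod>i<m. g i m)"
proof -
  have split: "pairs_below (Suc m) = pairs_below m \<union> (\<lambda>i. (i, m)) ` {..<m}"
    by (auto simp: pairs_below_def less_Suc_eq)
  have "inj_on (\<lambda>i. (i, m)) {..<m}" by (auto simp: inj_on_def)
  then show ?thesis unfolding split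
    by (subst prod.union_disjoint) (simp_all add: prod.reindex, auto simp: pairs_below_def)
qed

lemma prod_pairs_nested:
  "(\<Prod>(i, j)\<in>pairs_below m. g i j) = (\<Prod>i<m. \<Prod>j\<in>{i<..<m}. g i j)"
proof -
  have "pairs_below m = Sigma {..<m} (\<lambda>i. {i<..<m})" by (auto simp: pairs_below_def)
  then show ?thesis by (simp add: prod.Sigma)
qed

lemma vandermonde_Suc: "vandermonde (Suc m) f = vandermonde m f * (\<Prod>i<m. f i - f m)"
  unfolding vandermonde_def by (rule prod_pairs_Suc)

lemma vandermonde_cong: "(\<And>i. i < m \<Longrightarrow> f i = g i) \<Longrightarrow> vandermonde m f = vandermonde m g"
  unfolding vandermonde_def by (intro prod.cong) (auto simp: pairs_below_def)

text \<open>By induction on the number of variables: a transposition that fixes the last index only rearranges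
  the factors that involve it; the exchange of the last two indices is checked directly, and the
  remaining transpositions are conjugate to it.\<close>

lemma vandermonde_transpose:
  assumes "a < b" "b < m"
  shows "vandermonde m (f \<circ> transpose a b) = - vandermonde m f"
  using assms
proof (induction m arbitrary: f a b)
  case (Suc m)
  have inner: "vandermonde (Suc m) (f \<circ> transpose a b) = - vandermonde (Suc m) f"
    if "a < b" "b < m" for a b and f :: "nat \<Rightarrow> 'a"
  proof -
    have "(\<Prod>i<m. f (transpose a b i) - f m) = (\<Prod>i<m. f i - f m)"
      using prod.permute[OF permutes_swap_id[of a "{..<m}" b], of "\<lambda>i. f i - f m"] that
      by (simp add: o_def)
    then show ?thesis
      using Suc.IH[OF that, of f] that by (simp add: vandermonde_Suc o_def)
  qed
  have last: "vandermonde (Suc m) (f \<circ> transpose k m) = - vandermonde (Suc m) f"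
    if "m = Suc k" for k and f :: "nat \<Rightarrow> 'a"
  proof -
    have "vandermonde k (f \<circ> transpose k m) = vandermonde k f"
      using that by (intro vandermonde_cong) auto
    moreover have "(\<Prod>i<k. f (transpose k m i) - c) = (\<Prod>i<k. f i - c)" for c
      using that by (intro prod.cong) auto
    ultimately show ?thesis using that
      by (simp add: vandermonde_Suc algebra_simps)
  qed
  show ?case
  proof (cases "b < m")
    case True
    then show ?thesis using Suc.prems by (intro inner)
  next
    case False
    then have b: "b = m" using Suc.prems by simp
    show ?thesis
    proof (cases "m = Suc a")
      case True
      then show ?thesis unfolding b by (rule last)
    next
      case neq: False
      then obtain k where k: "m = Suc k" "a < k" using Suc.prems b by (cases m) auto
      \<comment> \<open>conjugate the adjacent transposition \<open>(k m)\<close> by \<open>(a k)\<close>\<close>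
      have "transpose a m = transpose a k \<circ> transpose k m \<circ> transpose a k"
        using k by (auto simp: fun_eq_iff transpose_def)
      then have "f \<circ> transpose a b = ((f \<circ> transpose a k) \<circ> transpose k m) \<circ> transpose a k"
        using b by (simp add: o_assoc)
      moreover have "vandermonde (Suc m) (g \<circ> transpose a k) = - vandermonde (Suc m) g" for g :: "nat \<Rightarrow> 'a"
        using k by (intro inner) auto
      ultimately show ?thesis using last[OF k(1)] by (simp only: minus_minus)
    qed
  qed
qed simp

lemma vandermonde_permute:
  assumes "w permutes {..<m}"
  shows "vandermonde m (f \<circ> w) = of_int (sign w) * vandermonde m f"
  using assms finite_lessThan[of m]
proof (induction arbitrary: f rule: permutes_induct)
  case (swap a b p)
  have perm: "permutation p" using swap by (metis finite_lessThan permutes_imp_permutation)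
  have "vandermonde m (f \<circ> transpose a b) = - vandermonde m f"
    using swap.hyps vandermonde_transpose[of a b m f] vandermonde_transpose[of b a m f]
    by (cases "a < b") (auto simp: transpose_commute)
  moreover have "vandermonde m (f \<circ> (transpose a b \<circ> p)) = of_int (sign p) * vandermonde m (f \<circ> transpose a b)"
    using swap.IH[of "f \<circ> transpose a b"] by (simp only: o_assoc)
  moreover have "sign (transpose a b \<circ> p) = - sign p"
    using swap.hyps perm by (simp only: sign_compose permutation_swap_id sign_swap_id) simp
  ultimately show ?case by (simp only:) simp
qed auto

section \<open>Existence of the Schur Q-polynomials\<close>

text \<open>Over the common denominator \<open>vandermonde m\<close>, the \<open>w\<close>-summand of \<open>Q_poly lam m\<close> has the numerator
  \<open>sign w \<cdot> Q_numerator lam m (zvar \<circ> w)\<close>.\<close>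

definition Q_numerator :: "nat list \<Rightarrow> nat \<Rightarrow> (nat \<Rightarrow> 'a :: comm_ring_1) \<Rightarrow> 'a" where
  "Q_numerator lam m z = (\<Prod>i<length lam. z i ^ (lam ! i)) *
     (\<Prod>(i, j)\<in>pairs_below m. if i < length lam then z i + z j else z i - z j)"

definition Q_alternant :: "nat list \<Rightarrow> nat \<Rightarrow> (nat \<Rightarrow> 'a :: comm_ring_1) \<Rightarrow> 'a" where
  "Q_alternant lam m z = (\<Sum>w\<in>sym_group m. of_int (sign w) * Q_numerator lam m (z \<circ> w))"

text \<open>Composition with the transposition of \<open>a\<close> and \<open>b\<close> pairs the
  summands off, with opposite signs.\<close>

lemma Q_alternant_swap:
  fixes z :: "nat \<Rightarrow> mpoly"
  assumes "a < b" "b < m" "z a = z b"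
  shows "Q_alternant lam m z = 0"
proof -
  let ?t = "transpose a b"
  have t: "?t permutes {..<m}" using assms by (intro permutes_swap_id) auto
  have zt: "z \<circ> ?t = z" using assms by (auto simp: fun_eq_iff transpose_def)
  have "Q_alternant lam m z = (\<Sum>w\<in>sym_group m. of_int (sign (?t \<circ> w)) * Q_numerator lam m (z \<circ> (?t \<circ> w)))"
    unfolding Q_alternant_def
    by (rule sum.reindex_bij_witness[of _ "\<lambda>w. ?t \<circ> w" "\<lambda>w. ?t \<circ> w"])
      (use t in \<open>auto simp: o_assoc intro: permutes_compose\<close>)
  also have "\<dots> = (\<Sum>w\<in>sym_group m. - (of_int (sign w) * Q_numerator lam m (z \<circ> w)))"
  proof (rule sum.cong)
    fix w assume "w \<in> sym_group m"
    then have "permutation w" by (metis finite_lessThan mem_Collect_eq permutes_imp_permutation)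
    then have "sign (?t \<circ> w) = - sign w"
      using assms by (simp add: sign_compose permutation_swap_id sign_swap_id)
    moreover have "z \<circ> (?t \<circ> w) = z \<circ> w" by (metis zt o_assoc)
    ultimately show "of_int (sign (?t \<circ> w)) * Q_numerator lam m (z \<circ> (?t \<circ> w))
        = - (of_int (sign w) * Q_numerator lam m (z \<circ> w))" by simp
  qed simp
  also have "\<dots> = - Q_alternant lam m z"
    unfolding Q_alternant_def by (rule sum_negf)
  finally have "(2 :: mpoly) * Q_alternant lam m z = 0" by simp
  then show ?thesis by simp
qed

context coefficient_map
begin

lemma eval_of_int [simp]: "mpoly_eval e z (of_int k) = of_int k"
  by (cases k rule: int_cases2) (auto simp: eval_uminus)

lemma eval_vandermonde: "mpoly_eval e z (vandermonde m f) = vandermonde m (\<lambda>i. mpoly_eval e z (f i))"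
  by (simp add: vandermonde_def eval_prod eval_diff case_prod_unfold)

lemma eval_Q_numerator:
  "mpoly_eval e z (Q_numerator lam m f) = Q_numerator lam m (\<lambda>i. mpoly_eval e z (f i))"
  by (auto simp: Q_numerator_def eval_mult eval_prod eval_power eval_add eval_diff case_prod_unfold intro!: prod.cong arg_cong2[of _ _ _ _ "(*)"])

lemma eval_Q_alternant:
  "mpoly_eval e z (Q_alternant lam m f) = Q_alternant lam m (\<lambda>i. mpoly_eval e z (f i))"
  by (simp add: Q_alternant_def eval_sum eval_mult eval_Q_numerator o_def)

end

text \<open>The alternant vanishes as soon as two variables coincide.\<close>

lemma vandermonde_dvd_Q_alternant: "vandermonde m zvar dvd Q_alternant lam m zvar"
  unfolding vandermonde_def
proof (rule prod_differences_dvd)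
  fix i j assume "(i, j) \<in> pairs_below m"
  then have "i < j" "j < m" by (auto simp: pairs_below_def)
  then show "merge_vars i j (Q_alternant lam m zvar) = 0"
    unfolding coeff_mconst.eval_Q_alternant by (intro Q_alternant_swap[of i j]) auto
next
  fix i j assume "(i, j) \<in> pairs_below m"
  then show "i < j" by (simp add: pairs_below_def)
qed simp

lemma vandermonde_zvar_nonzero: "vandermonde m zvar \<noteq> 0"
  unfolding vandermonde_def by (subst prod_zero_iff) (simp, auto simp: pairs_below_def)

lemma to_fract_prod: "to_fract (prod f S) = (\<Prod>x\<in>S. to_fract (f x))"
  by (induction S rule: infinite_finite_induct) auto

lemma to_fract_sum: "to_fract (sum f S) = (\<Sum>x\<in>S. to_fract (f x))"
  by (induction S rule: infinite_finite_induct) auto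

lemma to_fract_power: "to_fract (x ^ k) = to_fract x ^ k"
  by (induction k) auto

lemma to_fract_of_nat: "to_fract (of_nat k) = of_nat k"
  by (induction k) auto

definition Q_term :: "nat list \<Rightarrow> nat \<Rightarrow> (nat \<Rightarrow> 'a :: field) \<Rightarrow> 'a" where
  "Q_term lam m z = (\<Prod>i<length lam. z i ^ (lam ! i)) *
     (\<Prod>i<length lam. \<Prod>j\<in>{i<..<m}. (z i + z j) / (z i - z j))"

lemma Q_term_eq:
  assumes inj: "inj_on z {..<m}" and len: "length lam \<le> m"
  shows "Q_term lam m z = Q_numerator lam m z / vandermonde m z"
proof -
  let ?l = "length lam"
  let ?g = "\<lambda>i j. if i < ?l then (z i + z j) / (z i - z j) else 1"
  have "(\<Prod>i<?l. \<Prod>j\<in>{i<..<m}. (z i + z j) / (z i - z j)) = (\<Prod>i<m. \<Prod>j\<in>{i<..<m}. ?g i j)"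
    using len by (intro prod.mono_neutral_cong_left) auto
  also have "\<dots> = (\<Prod>(i, j)\<in>pairs_below m. ?g i j)" by (simp only: prod_pairs_nested)
  also have "\<dots> = (\<Prod>(i, j)\<in>pairs_below m. (if i < ?l then z i + z j else z i - z j) / (z i - z j))"
    by (intro prod.cong) (auto simp: pairs_below_def inj_on_eq_iff[OF inj])
  also have "\<dots> = (\<Prod>(i, j)\<in>pairs_below m. if i < ?l then z i + z j else z i - z j) / vandermonde m z"
    unfolding vandermonde_def by (simp add: prod_dividef case_prod_unfold)
  finally show ?thesis unfolding Q_term_def Q_numerator_def by simp
qed

lemma Q_term_permuted:
  assumes w: "w permutes {..<m}" and inj: "inj_on z {..<m}" and len: "length lam \<le> m"
  shows "Q_term lam m (z \<circ> w) = of_int (sign w) * Q_numerator lam m (z \<circ> w) / vandermonde m z"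
proof -
  have "inj_on (z \<circ> w) {..<m}"
    using permutes_inj_on[OF w] permutes_image[OF w] inj by (intro comp_inj_on) auto
  from Q_term_eq[OF this len] show ?thesis
    using vandermonde_permute[OF w, of z] by (cases w rule: sign_cases) simp_all
qed

lemma Q_summand_eq:
  assumes w: "w permutes {..<m}" and len: "length lam \<le> m"
  shows "Q_summand lam m w =
    to_fract (of_int (sign w) * Q_numerator lam m (zvar \<circ> w)) / to_fract (vandermonde m zvar)"
proof -
  have numer: "to_fract (Q_numerator lam m (zvar \<circ> w)) = Q_numerator lam m ((\<lambda>i. to_fract (zvar i)) \<circ> w)"
    unfolding Q_numerator_def
    by (auto simp: to_fract_prod to_fract_power intro!: arg_cong2[of _ _ _ _ "(*)"] prod.cong)
  have vand: "to_fract (vandermonde m zvar) = vandermonde m (\<lambda>i. to_fract (zvar i))"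
    unfolding vandermonde_def by (auto simp: to_fract_prod intro!: prod.cong)
  have "Q_summand lam m w = Q_term lam m ((\<lambda>i. to_fract (zvar i)) \<circ> w)"
    unfolding Q_summand_def Q_term_def by (simp add: Fract_conv_to_fract)
  also have "\<dots> = of_int (sign w) * Q_numerator lam m ((\<lambda>i. to_fract (zvar i)) \<circ> w)
      / vandermonde m (\<lambda>i. to_fract (zvar i))"
    by (rule Q_term_permuted[OF w _ len]) (auto simp: inj_on_def)
  finally show ?thesis unfolding vand numer[symmetric]
    by (cases w rule: sign_cases) simp_all
qed

text \<open>A permutation of the indices from \<open>\<ell>\<close> on only rearranges the factors of
  the inner products.\<close>

lemma Q_summand_coset:
  assumes v: "v permutes {length lam..<m}"
  shows "Q_summand lam m (w \<circ> v) = Q_summand lam m w"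
proof -
  have fix_v: "v i = i" if "i < length lam" for i
    using that v by (auto intro: permutes_not_in)
  have "(\<Prod>j\<in>{i<..<m}. Fract (zvar (w i) + zvar (w (v j))) (zvar (w i) - zvar (w (v j))))
      = (\<Prod>j\<in>{i<..<m}. Fract (zvar (w i) + zvar (w j)) (zvar (w i) - zvar (w j)))"
    if "i < length lam" for i
  proof -
    have "v permutes {i<..<m}" using v by (rule permutes_subset) (use that in auto)
    from prod.permute[OF this, of "\<lambda>j. Fract (zvar (w i) + zvar (w j)) (zvar (w i) - zvar (w j))"]
    show ?thesis by (simp add: o_def)
  qed
  then show ?thesis unfolding Q_summand_def by (simp add: fix_v)
qed

lemma sum_over_left_cosets:
  fixes g :: "(nat \<Rightarrow> nat) \<Rightarrow> 'a :: comm_ring_1"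
  assumes len: "l \<le> m"
    and g: "\<And>w v. v permutes {l..<m} \<Longrightarrow> g (w \<circ> v) = g w"
  shows "(\<Sum>w\<in>sym_group m. g w) =
    of_nat (fact (m - l)) * (\<Sum>X\<in>left_cosets (sym_group m) {v. v permutes {l..<m}}. g (SOME w. w \<in> X))"
proof -
  let ?H = "{v. v permutes {l..<m}}" and ?c = "\<lambda>w. (\<lambda>v. w \<circ> v) ` {v. v permutes {l..<m}}"
  have HS: "v permutes {..<m}" if "v \<in> ?H" for v
    using that by (auto intro: permutes_subset)
  have mem: "w \<in> ?c w" for w by (auto intro!: image_eqI[of _ _ id] permutes_id)
  have shift: "?c (w \<circ> v) = ?c w" if "v \<in> ?H" for w v
  proof -
    have vv: "v permutes {l..<m}" using that by simp
    have "?H = (\<lambda>u. v \<circ> u) ` ?H"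
      using image_compose_permutations_left[OF vv] unfolding image_def by blast
    then have "?c w = (\<lambda>u. w \<circ> u) ` ((\<lambda>u. v \<circ> u) ` ?H)" by simp
    also have "\<dots> = ?c (w \<circ> v)" by (simp add: image_image o_assoc)
    finally show ?thesis by simp
  qed
  have "(\<Sum>w\<in>sym_group m. g w) = (\<Sum>X\<in>?c ` sym_group m. \<Sum>w\<in>{w \<in> sym_group m. ?c w = X}. g w)"
    by (rule sum.image_gen) (simp add: finite_permutations)
  also have "\<dots> = (\<Sum>X\<in>?c ` sym_group m. of_nat (fact (m - l)) * g (SOME w. w \<in> X))"
  proof (rule sum.cong)
    fix X assume "X \<in> ?c ` sym_group m"
    then obtain u where u: "u permutes {..<m}" and X: "X = ?c u" by auto
    have fib: "{w \<in> sym_group m. ?c w = X} = X"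
    proof (intro equalityI subsetI)
      fix w assume "w \<in> {w \<in> sym_group m. ?c w = X}"
      then show "w \<in> X" using mem[of w] by auto
    next
      fix w assume "w \<in> X"
      then obtain v where v: "v \<in> ?H" "w = u \<circ> v" using X by auto
      then show "w \<in> {w \<in> sym_group m. ?c w = X}"
        using HS[OF v(1)] u shift[OF v(1), of u] X by (auto intro: permutes_compose)
    qed
    have const: "g w = g u" if "w \<in> X" for w using that g X by auto
    have "(SOME w. w \<in> X) \<in> X" using mem[of u] X by (metis someI)
    then have rep: "g (SOME w. w \<in> X) = g u" by (rule const)
    have "inj_on (\<lambda>v. u \<circ> v) ?H"
      using permutes_inj[OF u] by (auto simp: inj_on_def fun_eq_iff inj_def)
    then have "card X = card ?H" unfolding X by (rule card_image)
    also have "\<dots> = fact (m - l)" by (rule card_permutations) auto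
    finally have "(\<Sum>w\<in>X. g w) = of_nat (fact (m - l)) * g u"
      using const by simp
    then show "(\<Sum>w\<in>{w \<in> sym_group m. ?c w = X}. g w) = of_nat (fact (m - l)) * g (SOME w. w \<in> X)"
      unfolding fib rep .
  qed simp
  finally show ?thesis unfolding left_cosets_def by (simp add: sum_distrib_left)
qed

text \<open>The defining property of \<open>Q_poly\<close> with denominators cleared and the sum taken over the whole
  symmetric group, in which every coset is counted \<open>(m - \<ell>)!\<close> times.\<close>

lemma Q_poly_times_vandermonde:
  assumes len: "length lam \<le> m"
  shows "of_nat (fact (m - length lam)) * Q_poly lam m * vandermonde m zvar
    = 2 ^ length lam * Q_alternant lam m zvar"
proof -
  let ?V = "vandermonde m zvar" and ?k = "of_nat (fact (m - length lam)) :: mpoly"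
  let ?S = "\<Sum>X\<in>left_cosets {w. w permutes {..<m}} {v. v permutes {length lam..<m}}.
    Q_summand lam m (SOME w. w \<in> X)"
  obtain g where g: "Q_alternant lam m zvar = ?V * g"
    using vandermonde_dvd_Q_alternant by blast
  have V: "to_fract ?V \<noteq> 0" by (metis to_fract_eq_0_iff vandermonde_zvar_nonzero)
  have "to_fract ?k * ?S = (\<Sum>w\<in>sym_group m. Q_summand lam m w)"
    by (subst sum_over_left_cosets[OF len]) (auto simp: Q_summand_coset to_fract_of_nat simp del: of_nat_fact)
  also have "\<dots> = to_fract (Q_alternant lam m zvar) / to_fract ?V"
    unfolding Q_alternant_def to_fract_sum sum_divide_distrib
    by (intro sum.cong) (auto simp: Q_summand_eq[OF _ len])
  also have "\<dots> = to_fract g" using V by (simp add: g)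
  finally have S: "to_fract ?k * ?S = to_fract g" .
  have two: "to_fract (2 :: mpoly) = 2" by (metis to_fract_of_nat of_nat_numeral)
  have k: "mconst (1 / of_nat (fact (m - length lam))) * ?k = 1"
  proof -
    have eq: "?k = mconst (of_nat (fact (m - length lam)))"
      unfolding mconst_def by (simp only: single_of_nat)
    show ?thesis by (subst eq) (simp add: mconst_def mult_single del: of_nat_fact single_of_nat)
  qed
  let ?f = "2 ^ length lam * mconst (1 / of_nat (fact (m - length lam))) * g"
  have F: "to_fract ?f = 2 ^ length lam * ?S"
  proof -
    have "to_fract ?f = to_fract (2 ^ length lam * mconst (1 / of_nat (fact (m - length lam)))) * (to_fract ?k * ?S)"
      unfolding S by simp
    also have "\<dots> = to_fract (2 ^ length lam * (mconst (1 / of_nat (fact (m - length lam))) * ?k)) * ?S"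
      by (simp add: mult_ac)
    also have "\<dots> = 2 ^ length lam * ?S"
      unfolding k using two by (simp add: to_fract_power)
    finally show ?thesis .
  qed
  have "Q_poly lam m = ?f"
    unfolding Q_poly_def to_fract_def[symmetric] F[symmetric] to_fract_eq_iff by simp
  then have "?k * Q_poly lam m = 2 ^ length lam * g * (mconst (1 / of_nat (fact (m - length lam))) * ?k)"
    by (simp only: mult_ac)
  then show ?thesis unfolding k g by (simp add: mult_ac)
qed

section \<open>Values of Schur Q-functions\<close>

lemma Q_alternant_cong:
  assumes "\<And>i. i < m \<Longrightarrow> z i = z' i" "length lam \<le> m"
  shows "Q_alternant lam m z = Q_alternant lam m z'"
  unfolding Q_alternant_def
proof (rule sum.cong)
  fix w assume "w \<in> sym_group m"
  then have "(z \<circ> w) i = (z' \<circ> w) i" if "i < m" for i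
    using that assms permutes_in_image[of w "{..<m}" i] by simp
  then have "Q_numerator lam m (z \<circ> w) = Q_numerator lam m (z' \<circ> w)"
    unfolding Q_numerator_def using assms(2)
    by (intro arg_cong2[of _ _ _ _ "(*)"] prod.cong) (auto simp: pairs_below_def)
  then show "of_int (sign w) * Q_numerator lam m (z \<circ> w) = of_int (sign w) * Q_numerator lam m (z' \<circ> w)"
    by simp
qed simp

lemma Q_fun_times_vandermonde:
  assumes len: "length lam \<le> m"
  shows "of_nat (fact (m - length lam)) * Q_fun lam m * vandermonde m zvar
    = 2 ^ length lam * Q_alternant lam m zvar"
proof -
  let ?y = "\<lambda>i. if i < m then zvar i else 0"
  have "mpoly_eval mconst ?y (of_nat (fact (m - length lam)) * Q_poly lam m * vandermonde m zvar)
    = mpoly_eval mconst ?y (2 ^ length lam * Q_alternant lam m zvar)"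
    by (simp only: Q_poly_times_vandermonde[OF len])
  moreover have "vandermonde m ?y = vandermonde m zvar" by (rule vandermonde_cong) simp
  moreover have "Q_alternant lam m ?y = Q_alternant lam m zvar" by (rule Q_alternant_cong) (use len in auto)
  ultimately show ?thesis using len
    by (simp add: Q_fun_def coeff_mconst.eval_mult coeff_mconst.eval_power coeff_mconst.eval_vandermonde
        coeff_mconst.eval_Q_alternant max_absorb1 del: of_nat_fact)
qed

lemma (in coefficient_map) eval_Q_fun:
  assumes len: "length lam \<le> m"
  shows "of_nat (fact (m - length lam)) * mpoly_eval e z (Q_fun lam m) * vandermonde m z
    = 2 ^ length lam * Q_alternant lam m z"
proof -
  have "mpoly_eval e z (of_nat (fact (m - length lam)) * Q_fun lam m * vandermonde m zvar)
    = mpoly_eval e z (2 ^ length lam * Q_alternant lam m zvar)"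
    by (simp only: Q_fun_times_vandermonde[OF len])
  then show ?thesis
    by (simp add: eval_mult eval_power eval_vandermonde eval_Q_alternant del: of_nat_fact)
qed

lemma Q_alternant_2:
  "Q_alternant lam 2 z = Q_numerator lam 2 z - Q_numerator lam 2 (z \<circ> transpose 0 1)"
proof -
  have "{..<2::nat} = {0, 1}" by auto
  then have "sym_group 2 = {id, transpose 0 1}" by (auto simp: permutes_doubleton_iff)
  moreover have "transpose 0 (1::nat) \<noteq> id" by (metis id_apply zero_neq_one transpose_apply_first)
  ultimately show ?thesis unfolding Q_alternant_def by (simp add: sign_swap_id)
qed

lemma pairs_below_2: "pairs_below 2 = {(0, 1)}"
  by (auto simp: pairs_below_def)

text \<open>At \<open>(1, s)\<close> there are only two summands, and the denominator is \<open>1 - s\<close>.\<close>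

lemma Q_one_s_two_parts:
  "Q_one_s [k, l] * (1 - [:0, 1:]) = 4 * (1 + [:0, 1:]) * ([:0, 1:] ^ l - [:0, 1:] ^ k)"
proof -
  let ?z = "\<lambda>i::nat. if i = 0 then 1 else [:0, 1:] :: complex poly"
  have "Q_one_s [k, l] * vandermonde 2 ?z = 4 * Q_alternant [k, l] 2 ?z"
    using coeff_pCons.eval_Q_fun[of "[k, l]" 2 ?z] by (simp add: Q_one_s_def)
  moreover have "{..<2::nat} = {0, 1}" by auto
  ultimately show ?thesis
    by (simp add: vandermonde_def Q_alternant_2 Q_numerator_def pairs_below_2 ring_distribs ac_simps)
qed

lemma Q_one_s_one_part:
  "Q_one_s [k] * (1 - [:0, 1:]) = 2 * (1 + [:0, 1:]) * (1 - [:0, 1:] ^ k)"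
proof -
  let ?z = "\<lambda>i::nat. if i = 0 then 1 else [:0, 1:] :: complex poly"
  have "Q_one_s [k] * vandermonde 2 ?z = 2 * Q_alternant [k] 2 ?z"
    using coeff_pCons.eval_Q_fun[of "[k]" 2 ?z] by (simp add: Q_one_s_def)
  moreover have "{..<1::nat} = {0}" by auto
  ultimately show ?thesis
    by (simp add: vandermonde_def Q_alternant_2 Q_numerator_def pairs_below_2 ring_distribs ac_simps)
qed

text \<open>In \<open>\<ell>(lam)\<close> variables, the factor \<open>z\<^sub>0 \<cdots> z\<^bsub>\<ell> - 1\<^esub>\<close> can be pulled out of \<open>Q_poly lam\<close>, since all parts
  are positive; it vanishes at \<open>(1, s, 0, \<dots>)\<close> as soon as there are three parts.\<close>

lemma Q_one_s_many_parts:
  assumes pos: "\<forall>x\<in>set lam. 0 < x" and len: "length lam \<ge> 3"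
  shows "Q_one_s lam = 0"
proof -
  let ?l = "length lam" and ?P = "\<Prod>i<length lam. zvar i"
  let ?mu = "map (\<lambda>x. x - 1) lam"
  have "Q_numerator lam ?l (zvar \<circ> w) = ?P * Q_numerator ?mu ?l (zvar \<circ> w)" if "w \<in> sym_group ?l" for w
  proof -
    have w: "w permutes {..<?l}" using that by simp
    have "zvar (w i) ^ (lam ! i) = zvar (w i) * zvar (w i) ^ (lam ! i - 1)" if "i < ?l" for i
    proof -
      have "0 < lam ! i" using pos that by simp
      then show ?thesis by (metis power_minus_mult mult.commute)
    qed
    then have "(\<Prod>i<?l. zvar (w i) ^ (lam ! i)) = (\<Prod>i<?l. zvar (w i)) * (\<Prod>i<?l. zvar (w i) ^ (lam ! i - 1))"
      by (simp add: prod.distrib[symmetric])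
    moreover have "(\<Prod>i<?l. zvar (w i)) = ?P"
      using prod.permute[OF w, of zvar] by (simp add: o_def)
    ultimately show ?thesis by (simp add: Q_numerator_def mult.assoc)
  qed
  then have "Q_alternant lam ?l zvar = ?P * Q_alternant ?mu ?l zvar"
    unfolding Q_alternant_def sum_distrib_left by (intro sum.cong) (simp_all add: mult.left_commute)
  moreover obtain g where "Q_alternant ?mu ?l zvar = vandermonde ?l zvar * g"
    using vandermonde_dvd_Q_alternant by blast
  ultimately have "Q_poly lam ?l * vandermonde ?l zvar = (2 ^ ?l * ?P * g) * vandermonde ?l zvar"
    using Q_poly_times_vandermonde[of lam ?l] by (simp add: mult_ac)
  then have Q: "Q_poly lam ?l = 2 ^ ?l * ?P * g"
    using vandermonde_zvar_nonzero by (metis mult_right_cancel)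
  have "(\<Prod>i<?l. (if i < 2 then zvar i else 0)) = 0"
    using len by (intro prod_zero) (auto intro!: bexI[of _ 2])
  then have "Q_fun lam 2 = 0"
    using len by (simp add: Q_fun_def max_absorb2 Q coeff_mconst.eval_mult coeff_mconst.eval_prod)
  then show ?thesis by (simp add: Q_one_s_def)
qed

definition complex_value :: "(nat \<Rightarrow> complex) \<Rightarrow> mpoly \<Rightarrow> complex" where
  "complex_value z = mpoly_eval (\<lambda>c. c) z"

text \<open>At points with distinct coordinates, the denominators of the symmetrization formula do not
  vanish.\<close>

lemma complex_value_Q_fun:
  assumes inj: "inj_on z {..<m}" and len: "length lam \<le> m"
  shows "fact (m - length lam) * complex_value z (Q_fun lam m)
    = 2 ^ length lam * (\<Sum>w\<in>sym_group m. Q_term lam m (z \<circ> w))"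
proof -
  have V: "vandermonde m z \<noteq> 0"
    using inj unfolding vandermonde_def by (subst prod_zero_iff) (simp, auto simp: pairs_below_def inj_on_def)
  have "Q_alternant lam m z = (\<Sum>w\<in>sym_group m. Q_term lam m (z \<circ> w)) * vandermonde m z"
    unfolding Q_alternant_def sum_distrib_right
    using V by (intro sum.cong) (simp_all add: Q_term_permuted[OF _ inj len])
  then show ?thesis
    using coeff_complex.eval_Q_fun[OF len, of z] V by (simp add: complex_value_def)
qed

section \<open>Linear independence\<close>

definition part_at :: "nat list \<Rightarrow> nat \<Rightarrow> nat" where
  "part_at lam i = (if i < length lam then lam ! i else 0)"

text \<open>Read as a number in base \<open>b\<close>, an exponent vector with entries below
  \<open>b\<close> is compared lexicographically.\<close>

definition lex_weight :: "nat \<Rightarrow> nat \<Rightarrow> (nat \<Rightarrow> nat) \<Rightarrow> nat" where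
  "lex_weight b m e = (\<Sum>i<m. e i * b ^ (m - i))"

lemma lex_weight_Suc: "lex_weight b (Suc m) e = b * (lex_weight b m e + e m)"
proof -
  have "(\<Sum>i<m. e i * b ^ (Suc m - i)) = b * (\<Sum>i<m. e i * b ^ (m - i))"
    unfolding sum_distrib_left by (intro sum.cong) (auto simp: Suc_diff_le)
  then show ?thesis by (simp add: lex_weight_def algebra_simps)
qed

lemma lex_weight_less:
  assumes "\<And>i. e i < b" "j < m" "\<And>i. i < j \<Longrightarrow> e i = d i" "e j < d j"
  shows "lex_weight b m e + b \<le> lex_weight b m d"
  using assms(2)
proof (induction m)
  case (Suc m)
  have eq: "lex_weight b m e = lex_weight b m d" if "j = m"
    unfolding lex_weight_def using that assms(3) by simp
  have "lex_weight b m e + e m + 1 \<le> lex_weight b m d + d m"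
  proof (cases "j = m")
    case True
    then show ?thesis using eq assms(4) by simp
  next
    case False
    then show ?thesis using Suc assms(1)[of m] by simp
  qed
  then have "b * (lex_weight b m e + e m + 1) \<le> b * (lex_weight b m d + d m)" by (rule mult_le_mono2)
  then show ?case by (simp add: lex_weight_Suc algebra_simps)
qed simp

lemma strict_partition_bounds:
  assumes "strict_partition lam n"
  shows "length lam \<le> n" "\<And>i. part_at lam i \<le> n"
    "\<And>i j. \<lbrakk>j < length lam; j < i\<rbrakk> \<Longrightarrow> part_at lam i < part_at lam j"
proof -
  have pos: "0 < lam ! i" if "i < length lam" for i
    using assms that by (auto simp: strict_partition_def)
  have "length lam = (\<Sum>x\<leftarrow>lam. 1)" by (simp add: sum_list_triv)
  also have "\<dots> \<le> sum_list lam"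
    using assms sum_list_mono[of lam "\<lambda>x. 1" "\<lambda>x. x"] by (auto simp: strict_partition_def Suc_le_eq)
  finally show "length lam \<le> n" using assms by (simp add: strict_partition_def)
  show "part_at lam i \<le> n" for i
    using assms member_le_sum_list[of "lam ! i" lam]
    by (auto simp: part_at_def strict_partition_def)
  show "part_at lam i < part_at lam j" if "j < length lam" "j < i" for i j
    using assms that pos by (auto simp: part_at_def strict_partition_def sorted_wrt_iff_nth_less)
qed

lemma finite_strict_partitions: "finite {lam. strict_partition lam n}"
proof (rule finite_subset)
  show "{lam. strict_partition lam n} \<subseteq> {xs. set xs \<subseteq> {..n} \<and> length xs \<le> n}"
    using strict_partition_bounds(1) member_le_sum_list by (fastforce simp: strict_partition_def)
qed (simp add: finite_lists_length_le)

lemma strict_partition_eqI: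
  assumes "strict_partition lam n" "strict_partition mu n" "part_at lam = part_at mu"
  shows "lam = mu"
proof -
  have pos: "part_at nu i > 0 \<longleftrightarrow> i < length nu" if "strict_partition nu n" for nu i
    using that by (auto simp: part_at_def strict_partition_def)
  have len: "length lam = length mu"
    using pos[OF assms(1)] pos[OF assms(2)] assms(3) by (metis linorder_neqE_nat less_irrefl)
  show ?thesis
  proof (rule nth_equalityI[OF len])
    fix i assume "i < length lam"
    then show "lam ! i = mu ! i" using fun_cong[OF assms(3), of i] len by (simp add: part_at_def)
  qed
qed

lemma lex_weight_inject:
  assumes "strict_partition lam n" "strict_partition mu n" "n < b" "n \<le> m"
    and "lex_weight b m (part_at lam) = lex_weight b m (part_at mu)"
  shows "lam = mu"
proof (rule ccontr)
  assume "lam \<noteq> mu"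
  then have "\<exists>i. part_at lam i \<noteq> part_at mu i" using strict_partition_eqI[OF assms(1,2)] by blast
  then obtain j where j: "part_at lam j \<noteq> part_at mu j" "\<And>i. i < j \<Longrightarrow> part_at lam i = part_at mu i"
    using exists_least_iff[of "\<lambda>i. part_at lam i \<noteq> part_at mu i"] by auto
  have "j < m"
    using j(1) strict_partition_bounds(1)[OF assms(1)] strict_partition_bounds(1)[OF assms(2)] assms(4)
    by (auto simp: part_at_def split: if_splits)
  have lt: "part_at lam i < b" "part_at mu i < b" for i
    using strict_partition_bounds(2)[OF assms(1), of i] strict_partition_bounds(2)[OF assms(2), of i] assms(3)
    by simp_all
  show False
  proof (cases "part_at lam j < part_at mu j")
    case True
    then have "lex_weight b m (part_at lam) + b \<le> lex_weight b m (part_at mu)"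
      using lt j \<open>j < m\<close> by (intro lex_weight_less[of _ _ j]) auto
    then show False using assms(3,5) by simp
  next
    case False
    then have "part_at mu j < part_at lam j" using j(1) by simp
    then have "lex_weight b m (part_at mu) + b \<le> lex_weight b m (part_at lam)"
      using lt j \<open>j < m\<close> by (intro lex_weight_less[of _ _ j]) auto
    then show False using assms(3,5) by simp
  qed
qed

text \<open>Among all rearrangements of the exponents, the decreasing one is lexicographically largest.\<close>

lemma lex_weight_rearrange:
  assumes lam: "strict_partition lam n" and w: "w permutes {..<m}" and "n < b" "n \<le> m"
    and moved: "\<exists>i<length lam. w i \<noteq> i"
  shows "(\<Sum>i<length lam. lam ! i * b ^ (m - w i)) < lex_weight b m (part_at lam)"
proof -
  let ?u = "inv_into UNIV w"
  have u: "?u permutes {..<m}" by (rule permutes_inv[OF w])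
  have len: "length lam \<le> m" using strict_partition_bounds(1)[OF lam] assms by simp
  have "\<exists>j. ?u j \<noteq> j \<and> j < length lam"
    using moved permutes_inverses[OF w] by metis
  then obtain j where j: "?u j \<noteq> j" "j < length lam" "\<And>i. i < j \<Longrightarrow> ?u i = i"
    using exists_least_iff[of "\<lambda>j. ?u j \<noteq> j \<and> j < length lam"] by (metis order.strict_trans)
  have "\<not> ?u j < j" using j permutes_inj[OF u] by (metis injD)
  then have "j < ?u j" using j by simp
  then have "part_at lam (?u j) < part_at lam j"
    using strict_partition_bounds(3)[OF lam j(2)] by blast
  moreover have "part_at lam i < b" for i
    using strict_partition_bounds(2)[OF lam, of i] assms by simp
  ultimately have "lex_weight b m (part_at lam \<circ> ?u) + b \<le> lex_weight b m (part_at lam)"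
    using j len by (intro lex_weight_less[of _ _ j]) auto
  moreover have "lex_weight b m (part_at lam \<circ> ?u) = (\<Sum>i<length lam. lam ! i * b ^ (m - w i))"
  proof -
    have "lex_weight b m (part_at lam \<circ> ?u) = (\<Sum>i<m. part_at lam (?u (w i)) * b ^ (m - w i))"
      unfolding lex_weight_def using sum.permute[OF w, of "\<lambda>i. part_at lam (?u i) * b ^ (m - i)"]
      by (simp add: o_def)
    also have "\<dots> = (\<Sum>i<m. part_at lam i * b ^ (m - w i))"
      using permutes_inverses[OF w] by simp
    also have "\<dots> = (\<Sum>i<length lam. lam ! i * b ^ (m - w i))"
      using len by (intro sum.mono_neutral_cong_right) (auto simp: part_at_def)
    finally show ?thesis .
  qed
  ultimately show ?thesis using assms by simp
qed

lemma tendsto_power_quotient: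
  assumes "a < b" shows "((\<lambda>x::real. x ^ a / x ^ b) \<longlongrightarrow> 0) at_top"
proof -
  have "((\<lambda>x::real. inverse x ^ (b - a)) \<longlongrightarrow> 0 ^ (b - a)) at_top"
    by (intro tendsto_power tendsto_inverse_0_at_top filterlim_ident)
  then have "((\<lambda>x::real. inverse x ^ (b - a)) \<longlongrightarrow> 0) at_top"
    using assms by (simp add: zero_power)
  moreover have "eventually (\<lambda>x::real. inverse x ^ (b - a) = x ^ a / x ^ b) at_top"
    using eventually_gt_at_top[of 0]
    by eventually_elim (use assms in \<open>simp add: power_diff field_simps\<close>)
  ultimately show ?thesis by (rule Lim_transform_eventually)
qed

lemma tendsto_sum_over_difference:
  assumes "a \<noteq> b"
  shows "((\<lambda>x::real. (x ^ a + x ^ b) / (x ^ a - x ^ b)) \<longlongrightarrow> (if b < a then 1 else -1)) at_top"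
proof -
  have greater: "((\<lambda>x::real. (x ^ a + x ^ b) / (x ^ a - x ^ b)) \<longlongrightarrow> 1) at_top" if "b < a" for a b
  proof -
    have "((\<lambda>x::real. (1 + x ^ b / x ^ a) / (1 - x ^ b / x ^ a)) \<longlongrightarrow> (1 + 0) / (1 - 0)) at_top"
      using that by (intro tendsto_intros tendsto_power_quotient) auto
    moreover have "eventually (\<lambda>x::real. (1 + x ^ b / x ^ a) / (1 - x ^ b / x ^ a)
        = (x ^ a + x ^ b) / (x ^ a - x ^ b)) at_top"
      using eventually_gt_at_top[of 0]
    proof eventually_elim
      case (elim x)
      have "(1 + x ^ b / x ^ a) / (1 - x ^ b / x ^ a)
          = (x ^ a * (1 + x ^ b / x ^ a)) / (x ^ a * (1 - x ^ b / x ^ a))"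
        using elim by simp
      then show ?case using elim by (simp add: distrib_left right_diff_distrib)
    qed
    ultimately show ?thesis by (simp add: tendsto_cong)
  qed
  show ?thesis
  proof (cases "b < a")
    case True
    then show ?thesis using greater by simp
  next
    case False
    have "(x ^ a + x ^ b) / (x ^ a - x ^ b) = - ((x ^ b + x ^ a) / (x ^ b - x ^ a))" for x :: real
      by (metis add.commute minus_diff_eq minus_divide_right)
    then show ?thesis using tendsto_minus[OF greater[of a b]] False assms by simp
  qed
qed

definition spread_point :: "nat \<Rightarrow> nat \<Rightarrow> real \<Rightarrow> nat \<Rightarrow> real" where
  "spread_point b m x i = x ^ (b ^ (m - i))"

text \<open>Along \<open>z\<^sub>i = x\<^bsup>b^(m - i)\<^esup>\<close>, \<open>x \<rightarrow> \<infinity>\<close>, the quotients of linear forms tend to \<open>\<plusminus>1\<close> and the dominant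
  monomial of \<open>Q\<^bsub>lam\<^esub>\<close> is \<open>z\<^bsup>lam\<^esup>\<close>.\<close>

lemma Q_term_limit:
  assumes lam: "strict_partition lam n" and w: "w permutes {..<m}" and b: "n < b" "1 < b" and "n \<le> m"
  shows "((\<lambda>x. Q_term lam m (spread_point b m x \<circ> w) / x ^ lex_weight b m (part_at lam)) \<longlongrightarrow>
    (if \<forall>i<length lam. w i = i then 1 else 0)) at_top"
proof -
  let ?l = "length lam" and ?W = "\<lambda>i. b ^ (m - w i)"
  let ?E = "\<Sum>i<?l. lam ! i * ?W i" and ?T = "lex_weight b m (part_at lam)"
  have len: "?l \<le> m" using strict_partition_bounds(1)[OF lam] assms by simp
  have wlt: "w i < m" if "i < m" for i using permutes_in_image[OF w, of i] that by simp
  have W: "?W j < ?W i \<longleftrightarrow> w i < w j" "?W j = ?W i \<longleftrightarrow> i = j" if "i < m" "j < m" for i j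
    using wlt[OF that(1)] wlt[OF that(2)] b permutes_inj[OF w]
    by (auto simp: power_strict_increasing_iff inj_def eq_diff_iff)
  have mono: "(\<Prod>i<?l. (spread_point b m x \<circ> w) i ^ (lam ! i)) = x ^ ?E" for x
    by (simp add: spread_point_def power_sum power_mult[symmetric] mult.commute)
  let ?R = "\<lambda>x. \<Prod>i<?l. \<Prod>j\<in>{i<..<m}. (x ^ ?W i + x ^ ?W j) / (x ^ ?W i - x ^ ?W j) :: real"
  let ?L = "\<Prod>i<?l. \<Prod>j\<in>{i<..<m}. (if ?W j < ?W i then 1 else -1) :: real"
  have R: "(?R \<longlongrightarrow> ?L) at_top"
    using len W(2) by (intro tendsto_prod tendsto_sum_over_difference) auto
  have eq: "Q_term lam m (spread_point b m x \<circ> w) / x ^ ?T = x ^ ?E / x ^ ?T * ?R x" for x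
    unfolding Q_term_def mono by (simp add: spread_point_def)
  show ?thesis
  proof (cases "\<forall>i<?l. w i = i")
    case True
    then have "?E = ?T" using len
      unfolding lex_weight_def by (intro sum.mono_neutral_cong_left) (auto simp: part_at_def)
    have "w i < w j" if "i < ?l" "i < j" "j < m" for i j
    proof (rule ccontr)
      assume "\<not> w i < w j"
      then have "w j < i" using that True permutes_inj[OF w]
        by (metis injD less_irrefl linorder_neqE_nat)
      then have "w (w j) = w j" using that True by auto
      then show False using permutes_inj[OF w] \<open>w j < i\<close> that by (metis injD less_asym)
    qed
    then have "?L = 1" using len W(1) by (intro prod.neutral ballI) auto
    have "eventually (\<lambda>x::real. x ^ ?E / x ^ ?T * ?R x = ?R x) at_top"
      using eventually_gt_at_top[of 0] by eventually_elim (simp add: \<open>?E = ?T\<close>)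
    then show ?thesis using R True unfolding eq \<open>?L = 1\<close> by (simp add: tendsto_cong)
  next
    case False
    then have "?E < ?T" using lex_weight_rearrange[OF lam w] assms by auto
    from tendsto_mult[OF tendsto_power_quotient[OF this] R] show ?thesis
      unfolding eq if_not_P[OF False] by simp
  qed
qed

lemma spread_point_inj:
  assumes "1 < b" "1 < x" shows "inj_on (spread_point b m x) {..<m}"
  using assms by (auto simp: inj_on_def spread_point_def eq_diff_iff power_inject_exp)

lemma Q_term_of_real: "Q_term lam m (\<lambda>i. complex_of_real (y i)) = complex_of_real (Q_term lam m y)"
  by (simp add: Q_term_def)

lemma Q_fun_limit:
  assumes lam: "strict_partition lam n" and b: "n < b" "1 < b" and "n \<le> m"
  obtains L where "L \<noteq> 0"
    "((\<lambda>x. complex_value (\<lambda>i. complex_of_real (spread_point b m x i)) (Q_fun lam m)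
        / complex_of_real (x ^ lex_weight b m (part_at lam))) \<longlongrightarrow> L) at_top"
proof -
  let ?F = "{w \<in> sym_group m. \<forall>i<length lam. w i = i}" and ?T = "lex_weight b m (part_at lam)"
  let ?c = "2 ^ length lam / fact (m - length lam) :: complex"
  let ?S = "\<lambda>x. \<Sum>w\<in>sym_group m. Q_term lam m (spread_point b m x \<circ> w) / x ^ ?T"
  have len: "length lam \<le> m" using strict_partition_bounds(1)[OF lam] assms by simp
  have "(?S \<longlongrightarrow> (\<Sum>w\<in>sym_group m. if \<forall>i<length lam. w i = i then 1 else 0)) at_top"
    using assms by (intro tendsto_sum Q_term_limit) auto
  also have "(\<Sum>w\<in>sym_group m. if \<forall>i<length lam. w i = i then 1 else 0) = real (card ?F)"
    by (simp add: sum.If_cases finite_permutations Int_def)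
  finally have lim: "((\<lambda>x. ?c * complex_of_real (?S x)) \<longlongrightarrow> ?c * complex_of_real (real (card ?F))) at_top"
    by (intro tendsto_intros)
  have "eventually (\<lambda>x. ?c * complex_of_real (?S x)
      = complex_value (\<lambda>i. complex_of_real (spread_point b m x i)) (Q_fun lam m) / complex_of_real (x ^ ?T)) at_top"
    using eventually_gt_at_top[of 1]
  proof eventually_elim
    case (elim x)
    let ?z = "\<lambda>i. complex_of_real (spread_point b m x i)"
    have "inj_on ?z {..<m}" using spread_point_inj[OF b(2) elim] by (auto simp: inj_on_def)
    from complex_value_Q_fun[OF this len]
    have "complex_value ?z (Q_fun lam m) = ?c * (\<Sum>w\<in>sym_group m. Q_term lam m (?z \<circ> w))"
      by (simp add: field_simps)
    moreover have "Q_term lam m (?z \<circ> w) = complex_of_real (Q_term lam m (spread_point b m x \<circ> w))" for w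
      using Q_term_of_real[of lam m "spread_point b m x \<circ> w"] by (simp add: o_def)
    ultimately show ?case by (simp add: sum_divide_distrib[symmetric])
  qed
  then have "((\<lambda>x. complex_value (\<lambda>i. complex_of_real (spread_point b m x i)) (Q_fun lam m) / complex_of_real (x ^ ?T))
      \<longlongrightarrow> ?c * complex_of_real (real (card ?F))) at_top"
    using lim by (rule Lim_transform_eventually[rotated])
  moreover have "id \<in> ?F" "finite ?F" by (simp_all add: permutes_id finite_permutations)
  then have "card ?F \<noteq> 0" by (metis (no_types, lifting) card_0_eq empty_iff)
  then have "?c * complex_of_real (real (card ?F)) \<noteq> 0" by simp
  ultimately show thesis using that by blast
qed

text \<open>Among the \<open>lam\<close> with \<open>c lam \<noteq> 0\<close>, the lexicographically
  largest one dominates along the curve \<open>spread_point\<close>: divided by its leading power of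
  \<open>x\<close>, the relation tends to a nonzero multiple of its coefficient.\<close>

theorem Q_fun_independent:
  fixes c :: "nat list \<Rightarrow> complex"
  assumes zero: "\<And>y. \<lbrakk>\<And>i. 0 < y i; inj_on y {..<m}\<rbrakk> \<Longrightarrow>
      (\<Sum>lam | strict_partition lam n. c lam * complex_value (\<lambda>i. complex_of_real (y i)) (Q_fun lam m)) = 0"
    and "n \<le> m" and lam: "strict_partition lam n"
  shows "c lam = 0"
proof (rule ccontr)
  assume "c lam \<noteq> 0"
  let ?b = "n + 2" and ?P = "{lam. strict_partition lam n}"
  let ?T = "\<lambda>lam. lex_weight (n + 2) m (part_at lam)"
  let ?f = "\<lambda>lam x. complex_value (\<lambda>i. complex_of_real (spread_point ?b m x i)) (Q_fun lam m)"
  let ?N = "{lam \<in> ?P. c lam \<noteq> 0}"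
  have fin: "finite ?N" using finite_strict_partitions by simp
  have "?N \<noteq> {}" using lam \<open>c lam \<noteq> 0\<close> by auto
  then have "Max (?T ` ?N) \<in> ?T ` ?N" using fin by (intro Max_in) auto
  then obtain mu where mu: "mu \<in> ?N" "?T mu = Max (?T ` ?N)" by auto
  have less: "?T nu < ?T mu" if "nu \<in> ?N" "nu \<noteq> mu" for nu
  proof -
    have "?T nu \<le> ?T mu" using mu fin that by simp
    moreover have "?T nu \<noteq> ?T mu" using that mu lex_weight_inject[of nu n mu ?b m] assms by auto
    ultimately show ?thesis by simp
  qed
  obtain L where L: "L \<noteq> 0" "((\<lambda>x. ?f mu x / complex_of_real (x ^ ?T mu)) \<longlongrightarrow> L) at_top"
    using Q_fun_limit[of mu n ?b m] mu assms by auto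
  have small: "((\<lambda>x. c nu * (?f nu x / complex_of_real (x ^ ?T mu))) \<longlongrightarrow> 0) at_top"
    if nu: "nu \<in> ?P" "nu \<noteq> mu" for nu
  proof (cases "c nu = 0")
    case False
    then have lt: "?T nu < ?T mu" using less nu by auto
    obtain K where K: "((\<lambda>x. ?f nu x / complex_of_real (x ^ ?T nu)) \<longlongrightarrow> K) at_top"
      using Q_fun_limit[of nu n ?b m] nu assms by auto
    have "((\<lambda>x. complex_of_real (x ^ ?T nu / x ^ ?T mu)) \<longlongrightarrow> complex_of_real 0) at_top"
      by (intro tendsto_of_real tendsto_power_quotient lt)
    from tendsto_mult[OF tendsto_const[of "c nu"] tendsto_mult[OF K this]]
    have "((\<lambda>x. c nu * (?f nu x / complex_of_real (x ^ ?T nu) * complex_of_real (x ^ ?T nu / x ^ ?T mu))) \<longlongrightarrow> 0) at_top"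
      by simp
    moreover have "eventually (\<lambda>x. c nu * (?f nu x / complex_of_real (x ^ ?T nu) * complex_of_real (x ^ ?T nu / x ^ ?T mu))
        = c nu * (?f nu x / complex_of_real (x ^ ?T mu))) at_top"
      using eventually_gt_at_top[of 0] by eventually_elim simp
    ultimately show ?thesis by (rule Lim_transform_eventually)
  qed simp
  have "((\<lambda>x. \<Sum>nu\<in>?P. c nu * (?f nu x / complex_of_real (x ^ ?T mu)))
      \<longlongrightarrow> (\<Sum>nu\<in>?P. if nu = mu then c mu * L else 0)) at_top"
  proof (rule tendsto_sum)
    fix nu assume nu: "nu \<in> ?P"
    show "((\<lambda>x. c nu * (?f nu x / complex_of_real (x ^ ?T mu))) \<longlongrightarrow> (if nu = mu then c mu * L else 0)) at_top"
    proof (cases "nu = mu")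
      case True
      then show ?thesis using tendsto_mult[OF tendsto_const[of "c mu"] L(2)] by (simp only: if_True simp_thms)
    next
      case False
      show ?thesis using small[OF nu False] by (simp only: False if_False)
    qed
  qed
  moreover have "(\<Sum>nu\<in>?P. if nu = mu then c mu * L else 0) = c mu * L"
    using mu finite_strict_partitions by simp
  moreover have "eventually (\<lambda>x. (\<Sum>nu\<in>?P. c nu * (?f nu x / complex_of_real (x ^ ?T mu))) = 0) at_top"
    using eventually_gt_at_top[of 1]
  proof eventually_elim
    case (elim x)
    have "(\<Sum>nu\<in>?P. c nu * ?f nu x) = 0"
    proof (rule zero)
      show "0 < spread_point ?b m x i" for i using elim by (simp add: spread_point_def)
      show "inj_on (spread_point ?b m x) {..<m}" using elim by (intro spread_point_inj) auto
    qed
    then have "(\<Sum>nu\<in>?P. c nu * ?f nu x) / complex_of_real (x ^ ?T mu) = 0" by simp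
    then show ?case by (simp add: sum_divide_distrib)
  qed
  ultimately have "((\<lambda>x::real. 0) \<longlongrightarrow> c mu * L) at_top"
    using Lim_transform_eventually by fastforce
  then have "c mu * L = 0" by (metis tendsto_const tendsto_unique trivial_limit_at_top_linorder)
  then show False using mu L by simp
qed

section \<open>Products of two generating functions\<close>

lemma split_by_sum:
  assumes "y + x \<noteq> (0 :: 'a :: field)"
  shows "c * y - c * x = c * y * (y - x) / (y + x) + c * x * (y - x) / (y + x)"
    and "c * y - c * y * (y - x) / (y + x) = c * x * (2 * y / (x + y))"
proof -
  have "c * y * (y - x) / (y + x) + c * x * (y - x) / (y + x) = (c * y - c * x) * (y + x) / (y + x)"
    unfolding add_divide_distrib[symmetric] by (simp add: algebra_simps)
  then show *: "c * y - c * x = c * y * (y - x) / (y + x) + c * x * (y - x) / (y + x)"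
    using assms by simp
  have "c * y - c * y * (y - x) / (y + x) = (c * y * (y + x) - c * y * (y - x)) / (y + x)"
    using assms by (simp add: diff_divide_distrib)
  also have "\<dots> = c * x * (2 * y) / (x + y)" by (simp add: algebra_simps)
  finally show "c * y - c * y * (y - x) / (y + x) = c * x * (2 * y / (x + y))" by simp
qed

text \<open>Throughout, \<open>z\<close> consists of positive real numbers, so no \<open>z\<^sub>i + z\<^sub>j\<close> vanishes.\<close>

locale positive_point =
  fixes m :: nat and y :: "nat \<Rightarrow> real" and z :: "nat \<Rightarrow> complex"
  defines "z \<equiv> \<lambda>i. complex_of_real (y i)"
  assumes pos: "\<And>i. 0 < y i" and inj: "inj_on y {..<m}"
begin

lemma z_nonzero [simp]: "z i \<noteq> 0" "z i + z j \<noteq> 0"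
  using pos[of i] pos[of j] by (auto simp: z_def simp flip: of_real_add)

lemma z_eq_iff: "i < m \<Longrightarrow> j < m \<Longrightarrow> z i = z j \<longleftrightarrow> i = j"
  using inj by (auto simp: z_def inj_on_def)

lemma z_inj: "inj_on z {..<m}"
  by (auto simp: inj_on_def z_eq_iff)

text \<open>Up to an elementary factor, the residue of \<open>\<Prod>\<^sub>p (1 + z\<^sub>p u) / (1 -
  z\<^sub>p u)\<close> at \<open>u = 1 / z\<^sub>i\<close>.\<close>

definition A :: "nat \<Rightarrow> complex" where
  "A i = (\<Prod>p\<in>{..<m} - {i}. (z i + z p) / (z i - z p))"

text \<open>Lagrange interpolation at \<open>u = 0\<close> and \<open>u = 1 / z\<^sub>i\<close>.\<close>

lemma partial_fractions_poly:
  "(\<Prod>i<m. [:1, z i:]) = (\<Prod>i<m. [:1, - z i:])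
    + (\<Sum>i<m. [:0, 2 * z i * A i:] * (\<Prod>p\<in>{..<m} - {i}. [:1, - z p:]))"
proof -
  let ?lin = "\<lambda>a. [:1, a:] :: complex poly"
  let ?L = "\<Prod>i<m. ?lin (z i)"
  let ?R = "(\<Prod>i<m. ?lin (- z i)) + (\<Sum>i<m. [:0, 2 * z i * A i:] * (\<Prod>p\<in>{..<m} - {i}. ?lin (- z p)))"
  have deg: "degree (\<Prod>i\<in>S. ?lin (f i)) \<le> card S" for S and f :: "nat \<Rightarrow> complex"
  proof -
    have "degree (\<Prod>i\<in>S. ?lin (f i)) \<le> (\<Sum>i\<in>S. degree (?lin (f i)))"
      by (cases "finite S") (simp_all only: degree_prod_sum_le[unfolded o_def], simp)
    also have "\<dots> \<le> (\<Sum>i\<in>S. 1)" by (intro sum_mono) simp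
    finally show ?thesis by simp
  qed
  have degL: "degree ?L \<le> m" using deg[of z "{..<m}"] by simp
  have degR: "degree ?R \<le> m"
  proof (intro degree_add_le degree_sum_le)
    show "degree (\<Prod>i<m. ?lin (- z i)) \<le> m" using deg[of "\<lambda>i. - z i" "{..<m}"] by simp
    fix i assume "i \<in> {..<m}"
    then have "degree ([:0, 2 * z i * A i:] * (\<Prod>p\<in>{..<m} - {i}. ?lin (- z p))) \<le> 1 + card ({..<m} - {i})"
      by (intro order_trans[OF degree_mult_le] add_mono deg) simp
    then show "degree ([:0, 2 * z i * A i:] * (\<Prod>p\<in>{..<m} - {i}. ?lin (- z p))) \<le> m"
      using \<open>i \<in> {..<m}\<close> by simp
  qed simp
  let ?X = "insert 0 ((\<lambda>i. 1 / z i) ` {..<m})"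
  have "inj_on (\<lambda>i. 1 / z i) {..<m}" by (auto simp: inj_on_def z_eq_iff)
  then have "card ?X = Suc m" by (subst card_insert_disjoint) (auto simp: card_image)
  moreover have "poly ?L x = poly ?R x" if x: "x \<in> ?X" for x
  proof (cases "x = 0")
    case False
    then obtain k where k: "k < m" "x = 1 / z k" using x by auto
    have vanish: "(\<Prod>i\<in>S. 1 - z i * x) = 0" if "finite S" "k \<in> S" for S
      using that k by (intro prod_zero) auto
    have "(\<Sum>i<m. 2 * z i * A i * x * (\<Prod>p\<in>{..<m} - {i}. 1 - z p * x))
        = (\<Sum>i\<in>{k}. 2 * z i * A i * x * (\<Prod>p\<in>{..<m} - {i}. 1 - z p * x))"
      using k(1) by (intro sum.mono_neutral_right) (auto simp: vanish)
    also have "\<dots> = 2 * (A k * (\<Prod>p\<in>{..<m} - {k}. 1 - z p * x))" using k by simp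
    also have "A k * (\<Prod>p\<in>{..<m} - {k}. 1 - z p * x) = (\<Prod>p\<in>{..<m} - {k}. 1 + z p * x)"
      unfolding A_def prod.distrib[symmetric]
    proof (rule prod.cong)
      fix p assume "p \<in> {..<m} - {k}"
      then have "z k - z p \<noteq> 0" using k z_eq_iff[of k p] by auto
      then show "(z k + z p) / (z k - z p) * (1 - z p * x) = 1 + z p * x"
        using k by (simp add: field_simps)
    qed simp
    also have "2 * \<dots> = (\<Prod>i<m. 1 + z i * x)"
      using k by (subst prod.remove[of "{..<m}" k]) auto
    finally have "(\<Prod>i<m. 1 + z i * x) = (\<Prod>i<m. 1 - z i * x)
        + (\<Sum>i<m. 2 * z i * A i * x * (\<Prod>p\<in>{..<m} - {i}. 1 - z p * x))"
      using k(1) vanish[of "{..<m}"] by simp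
    then show ?thesis by (simp add: poly_prod poly_sum mult_ac)
  qed (simp add: poly_prod poly_sum)
  ultimately show "?L = ?R"
    using degL degR by (intro poly_eqI_degree[of ?X]) auto
qed

lemma partial_fractions:
  "(\<Prod>i<m. 1 + z i * u) = (\<Prod>i<m. 1 - z i * u)
    + (\<Sum>i<m. 2 * z i * A i * u * (\<Prod>p\<in>{..<m} - {i}. 1 - z p * u))"
  using arg_cong[OF partial_fractions_poly, of "\<lambda>p. poly p u"]
  by (simp add: poly_prod poly_sum mult_ac)

text \<open>The partial fraction expansion at \<open>u = - 1 / z\<^sub>i\<close>, where the product on
  the left vanishes.\<close>

lemma sum_A: 
  assumes "i < m" shows "(\<Sum>j<m. 2 * z j * A j / (z i + z j)) = 1"
proof -
  let ?u = "- 1 / z i" and ?P = "\<Prod>p<m. (1 + z p / z i)"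
  have P: "?P \<noteq> 0"
  proof -
    have "1 + z p / z i = (z i + z p) / z i" for p by (simp add: add_divide_distrib)
    then show ?thesis by (simp add: prod_zero_iff)
  qed
  have zero: "(\<Prod>k<m. 1 + z k * ?u) = 0" using assms by (intro prod_zero) auto
  have lin: "1 - z p * ?u = 1 + z p / z i" for p by simp
  have "0 = ?P + (\<Sum>j<m. 2 * z j * A j * ?u * (\<Prod>p\<in>{..<m} - {j}. 1 + z p / z i))"
    using partial_fractions[of ?u] unfolding zero lin .
  also have "(\<Sum>j<m. 2 * z j * A j * ?u * (\<Prod>p\<in>{..<m} - {j}. 1 + z p / z i))
      = (\<Sum>j<m. - (2 * z j * A j / (z i + z j) * ?P))"
  proof (rule sum.cong)
    fix j assume j: "j \<in> {..<m}"
    have "?P = (1 + z j / z i) * (\<Prod>p\<in>{..<m} - {j}. 1 + z p / z i)"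
      using j by (intro prod.remove) auto
    moreover have "2 * z j * A j * ?u = - (2 * z j * A j / (z i + z j) * (1 + z j / z i))"
    proof -
      have "1 + z j / z i = (z i + z j) / z i" by (simp add: add_divide_distrib)
      then show ?thesis by simp
    qed
    ultimately show "2 * z j * A j * ?u * (\<Prod>p\<in>{..<m} - {j}. 1 + z p / z i)
        = - (2 * z j * A j / (z i + z j) * ?P)" by simp
  qed simp
  also have "\<dots> = - ((\<Sum>j<m. 2 * z j * A j / (z i + z j)) * ?P)"
    by (simp add: sum_negf sum_distrib_right)
  finally have "?P * (1 - (\<Sum>j<m. 2 * z j * A j / (z i + z j))) = 0" by (simp add: algebra_simps)
  then show ?thesis using P by simp
qed

definition q :: "nat \<Rightarrow> complex" where
  "q r = complex_value z (q_fun r m)"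

text \<open>The partial fraction expansion, with each simple fraction expanded into a geometric
  series.\<close>

lemma q_eq: "q r = (if r = 0 then 1 else 2 * (\<Sum>i<m. A i * z i ^ r))"
proof -
  let ?lin = "\<lambda>a. 1 + fps_const a * fps_X :: complex fps" and ?geo = "\<lambda>a. Abs_fps (\<lambda>k. a ^ k) :: complex fps"
  have ev: "complex_value z (fps_nth F r) = fps_nth G r"
    if "F = (\<Prod>i<k. (1 + fps_const (zvar i) * fps_X) * Abs_fps (\<lambda>k. zvar i ^ k))"
      "G = (\<Prod>i<k. ?lin (z i) * ?geo (z i))" for F G k r
    using that
  proof (induction k arbitrary: F G r)
    case 0
    then show ?case by (simp add: complex_value_def)
  next
    case (Suc k)
    let ?F = "\<Prod>i<k. (1 + fps_const (zvar i) * fps_X) * Abs_fps (\<lambda>k. zvar i ^ k)"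
    have mult: "complex_value z (fps_nth (a * b) r) = fps_nth (a' * b') r"
      if "\<And>r. complex_value z (fps_nth a r) = fps_nth a' r" "\<And>r. complex_value z (fps_nth b r) = fps_nth b' r"
      for a b a' b' r
      using that by (simp add: fps_mult_nth complex_value_def coeff_complex.eval_sum coeff_complex.eval_mult)
    show ?case unfolding Suc.prems prod.lessThan_Suc
    proof (intro mult)
      show "complex_value z (fps_nth ?F r) = fps_nth (\<Prod>i<k. ?lin (z i) * ?geo (z i)) r" for r
        by (rule Suc.IH) auto
      show "complex_value z (fps_nth (1 + fps_const (zvar k) * fps_X) r) = fps_nth (?lin (z k)) r" for r
        by (cases r) (auto simp: complex_value_def fps_X_nth)
      show "complex_value z (fps_nth (Abs_fps (\<lambda>j. zvar k ^ j)) r) = fps_nth (?geo (z k)) r" for r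
        by (simp add: complex_value_def coeff_complex.eval_power)
    qed
  qed
  have geo: "(1 - fps_const a * fps_X) * ?geo a = 1" for a
  proof (rule fps_ext)
    fix k show "fps_nth ((1 - fps_const a * fps_X) * ?geo a) k = fps_nth 1 k"
      by (cases k) (auto simp: left_diff_distrib mult.assoc fps_X_mult_nth)
  qed
  let ?G = "\<Prod>i<m. ?geo (z i)"
  have series: "(\<Prod>i<m. ?lin (z i)) = (\<Prod>i<m. 1 - fps_const (z i) * fps_X)
    + (\<Sum>i<m. fps_const (2 * z i * A i) * fps_X * (\<Prod>p\<in>{..<m} - {i}. 1 - fps_const (z p) * fps_X))"
  proof -
    have lin: "fps_of_poly [:1, a:] = ?lin a" "fps_of_poly [:0, a:] = fps_const a * fps_X" for a
      by (simp_all add: fps_of_poly_pCons mult.commute)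
    have minus: "1 - fps_const a * fps_X = ?lin (- a)" for a
      by (simp flip: fps_const_neg)
    show ?thesis unfolding minus
      using arg_cong[OF partial_fractions_poly, of fps_of_poly]
      by (simp only: fps_of_poly_add fps_of_poly_mult fps_of_poly_prod fps_of_poly_sum lin)
  qed
  have "(\<Prod>i<m. ?lin (z i) * ?geo (z i)) = (\<Prod>i<m. ?lin (z i)) * ?G"
    by (simp add: prod.distrib)
  also have "\<dots> = (\<Prod>i<m. (1 - fps_const (z i) * fps_X) * ?geo (z i))
      + (\<Sum>i<m. fps_const (2 * z i * A i) * fps_X * ((\<Prod>p\<in>{..<m} - {i}. 1 - fps_const (z p) * fps_X) * ?G))"
    unfolding series by (simp add: distrib_right sum_distrib_right prod.distrib mult.assoc)
  also have "\<dots> = 1 + (\<Sum>i<m. fps_const (2 * z i * A i) * (fps_X * ?geo (z i)))"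
  proof -
    have "(\<Prod>p\<in>{..<m} - {i}. 1 - fps_const (z p) * fps_X) * ?G = ?geo (z i)" if "i < m" for i
    proof -
      have "?G = ?geo (z i) * (\<Prod>p\<in>{..<m} - {i}. ?geo (z p))"
        using that by (intro prod.remove) auto
      then have "(\<Prod>p\<in>{..<m} - {i}. 1 - fps_const (z p) * fps_X) * ?G
          = ?geo (z i) * (\<Prod>p\<in>{..<m} - {i}. (1 - fps_const (z p) * fps_X) * ?geo (z p))"
        by (simp add: prod.distrib mult_ac)
      then show ?thesis by (simp add: geo)
    qed
    then show ?thesis by (simp add: geo mult.assoc)
  qed
  finally have "q r = fps_nth (1 + (\<Sum>i<m. fps_const (2 * z i * A i) * (fps_X * ?geo (z i)))) r"
    unfolding q_def q_fun_def using ev[OF refl refl, of m r] by simp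
  then show ?thesis
    by (cases r) (simp_all add: fps_sum_nth sum_distrib_left mult_ac)
qed

text \<open>The value of \<open>Q\<^bsub>(k, l)\<^esub>\<close>; as a formula it also makes sense for \<open>k \<le> l\<close>.\<close>

definition two_row :: "nat \<Rightarrow> nat \<Rightarrow> complex" where
  "two_row k l = 4 * (\<Sum>i<m. \<Sum>j<m. z i ^ k * z j ^ l * A i * A j * (z j - z i) / (z j + z i))"

text \<open>The summand is antisymmetric in \<open>i\<close> and \<open>j\<close>.\<close>

lemma two_row_same: "two_row k k = 0"
proof -
  let ?g = "\<lambda>i j. z i ^ k * z j ^ k * A i * A j * (z j - z i) / (z j + z i)"
  have "(\<Sum>i<m. \<Sum>j<m. ?g i j) = (\<Sum>j<m. \<Sum>i<m. ?g i j)" by (rule sum.swap)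
  also have "\<dots> = (\<Sum>j<m. \<Sum>i<m. - ?g j i)"
  proof (intro sum.cong refl)
    fix i j
    have "z i ^ k * z j ^ k * A i * A j * (z j - z i) = - (z j ^ k * z i ^ k * A j * A i * (z i - z j))"
      by (simp add: algebra_simps)
    then show "?g i j = - ?g j i"
      by (simp only: add.commute[of "z j" "z i"] minus_divide_left)
  qed
  also have "\<dots> = - (\<Sum>i<m. \<Sum>j<m. ?g i j)" by (simp add: sum_negf)
  finally have "2 * (\<Sum>i<m. \<Sum>j<m. ?g i j) = 0" by simp
  then show ?thesis by (simp add: two_row_def)
qed

lemma q_mult:
  assumes "k \<noteq> 0" "l \<noteq> 0"
  shows "q k * q l = 4 * (\<Sum>i<m. \<Sum>j<m. z i ^ k * z j ^ l * A i * A j)"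
proof -
  have "q k * q l = 4 * ((\<Sum>i<m. A i * z i ^ k) * (\<Sum>j<m. A j * z j ^ l))"
    using assms by (simp add: q_eq)
  also have "(\<Sum>i<m. A i * z i ^ k) * (\<Sum>j<m. A j * z j ^ l) = (\<Sum>i<m. \<Sum>j<m. z i ^ k * z j ^ l * A i * A j)"
    by (simp add: sum_product mult_ac)
  finally show ?thesis .
qed

text \<open>On the left the summand contains \<open>z\<^sub>j - z\<^sub>i\<close>, which is
  \<open>(z\<^sub>j - z\<^sub>i) / (z\<^sub>j + z\<^sub>i)\<close> times \<open>z\<^sub>j +
  z\<^sub>i\<close>.\<close>

lemma q_step:
  assumes "k \<noteq> 0" "l \<noteq> 0"
  shows "q k * q (Suc l) - q (Suc k) * q l = two_row k (Suc l) + two_row (Suc k) l"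
proof -
  have "z i ^ k * z j ^ Suc l * a * b - z i ^ Suc k * z j ^ l * a * b
      = z i ^ k * z j ^ Suc l * a * b * (z j - z i) / (z j + z i)
      + z i ^ Suc k * z j ^ l * a * b * (z j - z i) / (z j + z i)" for i j a b
    using split_by_sum[of "z j" "z i" "z i ^ k * z j ^ l * a * b"] by (simp add: mult_ac)
  then show ?thesis using assms
    by (simp add: q_mult two_row_def sum_subtractf[symmetric] sum.distrib[symmetric] ring_distribs(4)[symmetric]
        distrib_left[symmetric] right_diff_distrib[symmetric] del: power_Suc)
qed

text \<open>The summands of \<open>q k * q 1\<close> and of \<open>two_row k 1\<close> differ by a
  multiple of \<open>2 z\<^sub>j A\<^sub>j / (z\<^sub>i + z\<^sub>j)\<close>, and the sum of these over
  \<open>j\<close> is given by \<open>sum_A\<close>.\<close>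

lemma q_base:
  assumes "k \<noteq> 0"
  shows "q k * q 1 = two_row k 1 + 2 * q (Suc k)"
proof -
  have "z i ^ k * z j ^ 1 * a * b - z i ^ k * z j ^ 1 * a * b * (z j - z i) / (z j + z i)
      = z i ^ Suc k * a * (2 * z j * b / (z i + z j))" for i j a b
    using split_by_sum[of "z j" "z i" "z i ^ k * a * b"]
    by (simp add: mult_ac)
  then have "q k * q 1 - two_row k 1 = 4 * (\<Sum>i<m. \<Sum>j<m. z i ^ Suc k * A i * (2 * z j * A j / (z i + z j)))"
    using assms by (simp only: q_mult two_row_def sum_subtractf[symmetric] right_diff_distrib[symmetric] one_neq_zero simp_thms)
  also have "\<dots> = 4 * (\<Sum>i<m. z i ^ Suc k * A i * (\<Sum>j<m. 2 * z j * A j / (z i + z j)))"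
    by (simp only: sum_distrib_left)
  also have "\<dots> = 4 * (\<Sum>i<m. z i ^ Suc k * A i)"
    by (intro arg_cong[of _ _ "\<lambda>t. 4 * t"] sum.cong) (simp_all only: sum_A lessThan_iff mult_1_right)
  also have "\<dots> = 2 * q (Suc k)" by (simp add: q_eq mult.commute)
  finally show ?thesis by (simp add: diff_eq_eq add.commute)
qed

text \<open>Repeated use of \<open>q_step\<close> lowers \<open>l\<close> to 1, where
  \<open>q_base\<close> applies; every intermediate two-row term is produced by two consecutive steps,
  which explains the coefficient 2.\<close>

lemma q_product_expansion:
  assumes "0 < l" "l \<le> k"
  shows "q k * q l = two_row k l + 2 * (\<Sum>i\<in>{1..<l}. two_row (k + l - i) i) + 2 * q (k + l)"
  using assms
proof (induction l arbitrary: k rule: nat_induct_non_zero)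
  case 1
  then show ?case using q_base[of k] by simp
next
  case (Suc l)
  have "q k * q (Suc l) = two_row k (Suc l) + two_row (Suc k) l + q (Suc k) * q l"
    using q_step[of k l] Suc by (simp add: algebra_simps)
  also have "\<dots> = two_row k (Suc l) + 2 * (two_row (Suc k) l + (\<Sum>i\<in>{1..<l}. two_row (Suc k + l - i) i)) + 2 * q (Suc k + l)"
    using Suc.IH[of "Suc k"] Suc.prems by simp
  also have "two_row (Suc k) l + (\<Sum>i\<in>{1..<l}. two_row (Suc k + l - i) i) = (\<Sum>i\<in>{1..<Suc l}. two_row (k + Suc l - i) i)"
    using Suc.hyps by simp
  finally show ?case by simp
qed

end

text \<open>The permutations with prescribed values on \<open>{..<l}\<close> form a coset of the stabilizer.\<close>

lemma card_permutations_agreeing: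
  assumes u: "u permutes {..<m}" and l: "l \<le> m"
  shows "card {w \<in> sym_group m. \<forall>i<l. w i = u i} = fact (m - l)"
proof -
  let ?H = "{v. v permutes {l..<m}}"
  have "{w \<in> sym_group m. \<forall>i<l. w i = u i} = (\<lambda>v. u \<circ> v) ` ?H"
  proof (intro equalityI subsetI)
    fix w assume "w \<in> {w \<in> sym_group m. \<forall>i<l. w i = u i}"
    then have w: "w permutes {..<m}" "\<And>i. i < l \<Longrightarrow> w i = u i" by auto
    let ?v = "inv_into UNIV u \<circ> w"
    have "?v permutes {..<m}" using w(1) permutes_inv[OF u] by (rule permutes_compose)
    moreover have "?v i = i" if "i \<in> {..<m} - {l..<m}" for i
    proof -
      have "w i = u i" using that by (intro w(2)) auto
      then show ?thesis using permutes_inverses[OF u] by simp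
    qed
    ultimately have "?v permutes {l..<m}" by (rule permutes_superset)
    moreover have "w = u \<circ> ?v" using permutes_inverses[OF u] by (simp add: fun_eq_iff)
    ultimately show "w \<in> (\<lambda>v. u \<circ> v) ` ?H" by blast
  next
    fix w assume "w \<in> (\<lambda>v. u \<circ> v) ` ?H"
    then obtain v where v: "v permutes {l..<m}" "w = u \<circ> v" by auto
    have "v permutes {..<m}" using v(1) by (rule permutes_subset) auto
    moreover have "v i = i" if "i < l" for i using v(1) that by (auto intro: permutes_not_in)
    ultimately show "w \<in> {w \<in> sym_group m. \<forall>i<l. w i = u i}"
      using u v(2) by (auto intro: permutes_compose)
  qed
  moreover have "inj_on (\<lambda>v. u \<circ> v) ?H"
    using permutes_inj[OF u] by (auto simp: inj_on_def fun_eq_iff inj_def)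
  ultimately have "card {w \<in> sym_group m. \<forall>i<l. w i = u i} = card ?H" by (simp add: card_image)
  also have "\<dots> = fact (m - l)" by (rule card_permutations) auto
  finally show ?thesis .
qed

lemma sum_permutations_first_two:
  fixes g :: "nat \<Rightarrow> nat \<Rightarrow> 'a :: field_char_0"
  assumes m: "2 \<le> m" and diag: "\<And>i. g i i = 0"
  shows "(\<Sum>w\<in>sym_group m. g (w 0) (w 1)) = fact (m - 2) * (\<Sum>i<m. \<Sum>j<m. g i j)"
proof -
  let ?f = "\<lambda>w. (w 0, w (1::nat))"
  have sub: "?f ` sym_group m \<subseteq> {..<m} \<times> {..<m}"
    using m by (auto dest: permutes_in_image[of _ "{..<m}" 0] permutes_in_image[of _ "{..<m}" "1"])
  have diag': "g (fst p) (snd p) = 0" if p: "p \<in> {..<m} \<times> {..<m} - ?f ` sym_group m" for p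
  proof (rule ccontr)
    assume "g (fst p) (snd p) \<noteq> 0"
    then have ne: "fst p \<noteq> snd p" using diag by metis
    let ?t = "transpose 0 (fst p)" let ?u = "transpose (?t 1) (snd p) \<circ> ?t"
    have "?t 1 \<noteq> fst p" by (simp add: transpose_def)
    then have "?u 0 = fst p" "?u 1 = snd p" using ne by (auto simp: transpose_def)
    moreover have "?t permutes {..<m}" "?t 1 < m" using p m
      by (auto intro!: permutes_swap_id simp: transpose_def)
    then have "?u permutes {..<m}" using p by (intro permutes_compose permutes_swap_id) auto
    ultimately have "p \<in> ?f ` sym_group m" by (intro image_eqI[of _ _ ?u]) auto
    then show False using p by blast
  qed
  have "(\<Sum>w\<in>sym_group m. g (w 0) (w 1))
      = (\<Sum>p\<in>?f ` sym_group m. \<Sum>w\<in>{w \<in> sym_group m. ?f w = p}. g (w 0) (w 1))"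
    by (rule sum.image_gen) (simp add: finite_permutations)
  also have "\<dots> = (\<Sum>p\<in>?f ` sym_group m. fact (m - 2) * g (fst p) (snd p))"
  proof (rule sum.cong)
    fix p assume "p \<in> ?f ` sym_group m"
    then obtain u where u: "u permutes {..<m}" "p = ?f u" by auto
    have "{w \<in> sym_group m. ?f w = p} = {w \<in> sym_group m. \<forall>i<2. w i = u i}"
      using u(2) by (auto simp: less_2_cases_iff)
    then have "card {w \<in> sym_group m. ?f w = p} = fact (m - 2)"
      using card_permutations_agreeing[OF u(1) m] by simp
    moreover have "(\<Sum>w\<in>{w \<in> sym_group m. ?f w = p}. g (w 0) (w 1))
        = (\<Sum>w\<in>{w \<in> sym_group m. ?f w = p}. g (fst p) (snd p))"
      by (rule sum.cong) auto
    ultimately show "(\<Sum>w\<in>{w \<in> sym_group m. ?f w = p}. g (w 0) (w 1)) = fact (m - 2) * g (fst p) (snd p)"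
      by (simp only: sum_constant of_nat_fact)
  qed simp
  also have "\<dots> = (\<Sum>p\<in>{..<m} \<times> {..<m}. fact (m - 2) * g (fst p) (snd p))"
    using sub diag' by (intro sum.mono_neutral_left) auto
  finally show ?thesis by (simp add: sum.cartesian_product sum_distrib_left case_prod_unfold)
qed

lemma sum_permutations_first:
  fixes g :: "nat \<Rightarrow> 'a :: field_char_0"
  assumes m: "1 \<le> m"
  shows "(\<Sum>w\<in>sym_group m. g (w 0)) = fact (m - 1) * (\<Sum>i<m. g i)"
proof -
  have "(\<lambda>w. w (0::nat)) ` sym_group m = {..<m}"
  proof (intro equalityI subsetI)
    fix i assume "i \<in> {..<m}"
    then show "i \<in> (\<lambda>w. w 0) ` sym_group m"
      using m by (intro image_eqI[of _ _ "transpose 0 i"]) (auto intro!: permutes_swap_id)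
  qed (use m permutes_in_image in fastforce)
  then have "(\<Sum>w\<in>sym_group m. g (w 0)) = (\<Sum>i<m. \<Sum>w\<in>{w \<in> sym_group m. w 0 = i}. g (w 0))"
    using sum.image_gen[of "sym_group m" "\<lambda>w. g (w 0)" "\<lambda>w. w 0"] by (simp add: finite_permutations)
  also have "\<dots> = (\<Sum>i<m. fact (m - 1) * g i)"
  proof (rule sum.cong)
    fix i assume "i \<in> {..<m}"
    then have "transpose 0 i permutes {..<m}" using m by (intro permutes_swap_id) auto
    from card_permutations_agreeing[OF this m] have "card {w \<in> sym_group m. w 0 = i} = fact (m - 1)" by simp
    then show "(\<Sum>w\<in>{w \<in> sym_group m. w 0 = i}. g (w 0)) = fact (m - 1) * g i" by simp
  qed simp
  finally show ?thesis by (simp add: sum_distrib_left)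
qed

context positive_point
begin

text \<open>The summand of a permutation \<open>w\<close> depends only on \<open>w 0\<close> and
  \<open>w 1\<close>. The inner product for the second row lacks the factor of \<open>A\<close> that
  pairs \<open>w 1\<close> with \<open>w 0\<close>; dividing by it gives the quotient in
  \<open>two_row\<close>.\<close>

lemma Q_fun_two_rows:
  assumes m: "2 \<le> m" shows "complex_value z (Q_fun [k, l] m) = two_row k l"
proof -
  let ?F = "\<lambda>i j. (z i + z j) / (z i - z j)"
  let ?g = "\<lambda>i j. z i ^ k * z j ^ l * A i * A j * (z j - z i) / (z j + z i)"
  have "Q_term [k, l] m (z \<circ> w) = ?g (w 0) (w 1)" if "w \<in> sym_group m" for w
  proof -
    have w: "w permutes {..<m}" using that by simp
    have bij: "bij_betw w S (w ` S)" for S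
      using permutes_inj_on[OF w] by (rule inj_on_imp_bij_betw)
    have img: "w ` {..<m} = {..<m}" using w by (rule permutes_image)
    have inj': "inj_on w {..<m}" using permutes_inj_on[OF w] .
    have lt: "w 0 < m" "w 1 < m" using m permutes_in_image[OF w] by auto
    have ne: "w 1 \<noteq> w 0" using permutes_inj[OF w] by (auto dest: injD)
    have s0: "{0<..<m} = {..<m} - {0}" and s1: "{1<..<m} = {..<m} - {0, 1}" using m by auto
    have "w ` {0<..<m} = {..<m} - {w 0}" unfolding s0
      using inj' m by (subst inj_on_image_set_diff[of w "{..<m}"]) (auto simp: img)
    then have P0: "(\<Prod>j\<in>{0<..<m}. ?F (w 0) (w j)) = A (w 0)"
      unfolding A_def using prod.reindex_bij_betw[OF bij, of "\<lambda>p. ?F (w 0) p"] by metis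
    have "w ` {1<..<m} = {..<m} - {w 1} - {w 0}" unfolding s1
      using inj' m by (subst inj_on_image_set_diff[of w "{..<m}"]) (auto simp: img)
    then have P1: "(\<Prod>j\<in>{1<..<m}. ?F (w 1) (w j)) = (\<Prod>p\<in>{..<m} - {w 1} - {w 0}. ?F (w 1) p)"
      using prod.reindex_bij_betw[OF bij, of "\<lambda>p. ?F (w 1) p"] by metis
    have "A (w 1) = ?F (w 1) (w 0) * (\<Prod>p\<in>{..<m} - {w 1} - {w 0}. ?F (w 1) p)"
      unfolding A_def using lt ne by (intro prod.remove) auto
    moreover have "z (w 1) - z (w 0) \<noteq> 0" using lt ne by (simp add: z_eq_iff)
    ultimately have "(\<Prod>j\<in>{1<..<m}. ?F (w 1) (w j)) = A (w 1) * (z (w 1) - z (w 0)) / (z (w 1) + z (w 0))"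
      unfolding P1 by simp
    moreover have "{..<2::nat} = {0, 1}" by auto
    ultimately show ?thesis unfolding Q_term_def using P0
      by (simp add: numeral_2_eq_2[symmetric])
  qed
  then have "fact (m - 2) * complex_value z (Q_fun [k, l] m) = 4 * (\<Sum>w\<in>sym_group m. ?g (w 0) (w 1))"
    using complex_value_Q_fun[OF z_inj, of "[k, l]"] m by (simp add: numeral_2_eq_2)
  also have "\<dots> = fact (m - 2) * two_row k l"
    unfolding two_row_def by (subst sum_permutations_first_two[OF m]) auto
  finally show ?thesis by simp
qed

lemma Q_fun_one_row:
  assumes m: "1 \<le> m" and k: "k \<noteq> 0" shows "complex_value z (Q_fun [k] m) = q k"
proof -
  have "Q_term [k] m (z \<circ> w) = z (w 0) ^ k * A (w 0)" if "w \<in> sym_group m" for w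
  proof -
    have w: "w permutes {..<m}" using that by simp
    have s0: "{0<..<m} = {..<m} - {0}" by auto
    have "w ` {0<..<m} = {..<m} - {w 0}" unfolding s0
      using permutes_inj_on[OF w] m
      by (subst inj_on_image_set_diff[of w "{..<m}"]) (auto simp: permutes_image[OF w])
    then have "(\<Prod>j\<in>{0<..<m}. (z (w 0) + z (w j)) / (z (w 0) - z (w j))) = A (w 0)"
      unfolding A_def using prod.reindex_bij_betw[OF inj_on_imp_bij_betw[OF permutes_inj_on[OF w]],
        of "\<lambda>p. (z (w 0) + z p) / (z (w 0) - z p)"] by metis
    moreover have "{..<1::nat} = {0}" by auto
    ultimately show ?thesis unfolding Q_term_def by simp
  qed
  then have "fact (m - 1) * complex_value z (Q_fun [k] m) = 2 * (\<Sum>w\<in>sym_group m. z (w 0) ^ k * A (w 0))"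
    using complex_value_Q_fun[OF z_inj, of "[k]"] m by simp
  also have "\<dots> = fact (m - 1) * q k"
    unfolding q_eq using k by (subst sum_permutations_first[OF m]) (simp add: mult_ac)
  finally show ?thesis by simp
qed

end

text \<open>The coefficient of \<open>s\<^sup>q\<close> in \<open>Q\<^bsub>lam\<^esub>(1, s) /
  2\<^sup>\<ell>\<close>, that is, for a partition with at most two rows \<open>k > l\<close>, in
  \<open>(1 + s) (s\<^sup>l + \<dots> + s\<^bsup>k - 1\<^esup>)\<close>.\<close>

definition Q_coeff :: "nat list \<Rightarrow> nat \<Rightarrow> nat" where
  "Q_coeff lam q = (if 2 < length lam then 0
     else if part_at lam 1 < q \<and> q < part_at lam 0 then 2
     else if q = part_at lam 1 \<or> q = part_at lam 0 then 1 else 0)"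

lemma strict_partition_two_rows:
  assumes "strict_partition lam n" "length lam \<le> 2" "1 \<le> n"
  obtains "lam = [n]" | i where "lam = [n - i, i]" "1 \<le> i" "i < n - i"
proof (cases lam)
  case Nil
  then show ?thesis using assms by (simp add: strict_partition_def)
next
  case (Cons k mu)
  show ?thesis
  proof (cases mu)
    case Nil
    then show ?thesis using assms Cons that(1) by (simp add: strict_partition_def)
  next
    case (Cons l nu)
    then have "lam = [k, l]" using assms(2) \<open>lam = k # mu\<close> by simp
    then show ?thesis using assms(1) that(2)[of l] by (auto simp: strict_partition_def)
  qed
qed

text \<open>Comparison of the coefficients of \<open>s\<^sup>i\<close> in \<open>(1 + s) (s\<^sup>l -
  s\<^sup>k) = (1 - s) (s\<^sup>l + 2 s\<^bsup>l + 1\<^esup> + \<dots> + 2 s\<^bsup>k - 1\<^esup> +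
  s\<^sup>k)\<close>.\<close>

lemma two_row_profile_difference:
  fixes i k l :: nat
  assumes "l < k"
  shows "((if i = l then 1 else 0) - (if i = k then 1 else 0))
      + (if i = 0 then 0 else (if i - 1 = l then 1 else 0) - (if i - 1 = k then 1 else 0))
    = (if l < i \<and> i < k then 2 else if i = l \<or> i = k then 1 else 0)
      - (if i = 0 then 0 else if l < i - 1 \<and> i - 1 < k then 2 else if i - 1 = l \<or> i - 1 = k then 1 else (0::complex))"
proof (cases i)
  case (Suc j)
  consider "j < l" | "j = l" | "l < j" "Suc j < k" | "l < j" "Suc j = k" | "j = k" | "k < j"
    using assms by linarith
  then show ?thesis using Suc assms by cases auto
qed (use assms in auto)

lemma Q_one_s_eq:
  assumes lam: "strict_partition lam n" and n: "1 \<le> n"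
  shows "Q_one_s lam = 2 ^ length lam * (\<Sum>q=0..n. monom (of_nat (Q_coeff lam q)) q)"
proof (cases "2 < length lam")
  case True
  then show ?thesis using lam Q_one_s_many_parts[of lam] by (simp add: Q_coeff_def strict_partition_def)
next
  case False
  let ?k = "part_at lam 0" and ?l = "part_at lam 1" and ?s = "[:0, 1:] :: complex poly"
  have len: "length lam \<le> 2" using False by simp
  have "?l < ?k \<and> ?k + ?l = n \<and> Q_one_s lam * (1 - ?s) = 2 ^ length lam * ((1 + ?s) * (?s ^ ?l - ?s ^ ?k))"
  proof (rule strict_partition_two_rows[OF lam len n])
    assume "lam = [n]"
    then show ?thesis using n by (simp add: part_at_def Q_one_s_one_part mult.assoc)
  next
    fix i assume "lam = [n - i, i]" "1 \<le> i" "i < n - i"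
    then show ?thesis by (simp add: part_at_def Q_one_s_two_parts mult.assoc)
  qed
  then have kl: "?l < ?k" "?k + ?l = n"
    and Q: "Q_one_s lam * (1 - ?s) = 2 ^ length lam * ((1 + ?s) * (?s ^ ?l - ?s ^ ?k))"
    by blast+
  let ?S = "\<Sum>q=0..n. monom (of_nat (Q_coeff lam q) :: complex) q"
  have "?S * (1 - ?s) = (1 + ?s) * (?s ^ ?l - ?s ^ ?k)"
  proof (rule poly_eqI)
    fix i
    have S: "coeff ?S i = (if i \<le> n then of_nat (Q_coeff lam i) else 0)" for i
      by (simp add: coeff_sum)
    have shift: "coeff (p * ?s) i = (if i = 0 then 0 else coeff p (i - 1))" for p :: "complex poly"
      by (cases i) auto
    have L: "coeff (?S * (1 - ?s)) i = coeff ?S i - (if i = 0 then 0 else coeff ?S (i - 1))"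
      by (simp only: right_diff_distrib coeff_diff mult_1_right shift)
    have pw: "coeff (?s ^ k) i = (if i = k then 1 else 0)" for k i
    proof -
      have "?s ^ k = monom 1 k" by (simp add: monom_altdef)
      then show ?thesis by simp
    qed
    have "coeff ((?s ^ ?l - ?s ^ ?k) * (1 + ?s)) i
        = (coeff (?s ^ ?l) i - coeff (?s ^ ?k) i)
          + (if i = 0 then 0 else coeff (?s ^ ?l) (i - 1) - coeff (?s ^ ?k) (i - 1))"
      by (simp only: distrib_left coeff_add mult_1_right shift coeff_diff)
    also have "\<dots> = coeff (?S * (1 - ?s)) i"
    proof -
      have "coeff ?S j = (if ?l < j \<and> j < ?k then 2 else if j = ?l \<or> j = ?k then 1 else 0)" for j
        unfolding S using kl False by (simp add: Q_coeff_def)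
      then show ?thesis unfolding L pw by (simp only: two_row_profile_difference[OF kl(1)])
    qed
    finally show "coeff (?S * (1 - ?s)) i = coeff ((1 + ?s) * (?s ^ ?l - ?s ^ ?k)) i"
      by (simp only: mult.commute)
  qed
  then have "Q_one_s lam * (1 - ?s) = (2 ^ length lam * ?S) * (1 - ?s)"
    unfolding Q by (simp only: mult.assoc)
  moreover have nz: "(1 - ?s) \<noteq> 0" by (simp add: one_pCons)
  ultimately show ?thesis by (simp only: mult_right_cancel[OF nz])
qed

text \<open>The coefficients in \<open>q\<^sub>a q\<^sub>b = \<Sum>\<^sub>l Q_coeff (a + b - l, l) \<cdot> Q\<^bsub>(a + b - l, l)\<^esub>\<close> are those of
  \<open>Q\<^bsub>lam\<^esub>(1, s) / 2\<^sup>\<ell>\<close>.\<close>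

lemma (in positive_point) q_product_Q_fun:
  assumes n: "1 \<le> n" "n \<le> m" and r: "r \<le> n"
  shows "(\<Sum>lam | strict_partition lam n. of_nat (Q_coeff lam r) * complex_value z (Q_fun lam m))
    = q r * q (n - r)"
proof -
  let ?t = "\<lambda>lam. of_nat (Q_coeff lam r) * complex_value z (Q_fun lam m)"
  let ?two = "\<lambda>i. [n - i, i]" and ?I = "{i. 1 \<le> i \<and> i < n - i}"
  define b where "b = min r (n - r)"
  have fin: "finite ?I" by (rule finite_subset[of _ "{..n}"]) auto
  have "(\<Sum>lam | strict_partition lam n. ?t lam) = (\<Sum>lam\<in>insert [n] (?two ` ?I). ?t lam)"
  proof (rule sum.mono_neutral_right)
    show "insert [n] (?two ` ?I) \<subseteq> {lam. strict_partition lam n}"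
      using n by (auto simp: strict_partition_def)
    show "\<forall>lam\<in>{lam. strict_partition lam n} - insert [n] (?two ` ?I). ?t lam = 0"
    proof
      fix lam assume lam: "lam \<in> {lam. strict_partition lam n} - insert [n] (?two ` ?I)"
      have "\<not> length lam \<le> 2"
      proof
        assume "length lam \<le> 2"
        from lam have "strict_partition lam n" by simp
        from this \<open>length lam \<le> 2\<close> n(1) show False
          by (rule strict_partition_two_rows) (use lam in auto)
      qed
      then show "?t lam = 0" by (simp add: Q_coeff_def)
    qed
  qed (rule finite_strict_partitions)
  also have "\<dots> = ?t [n] + (\<Sum>i\<in>?I. ?t (?two i))"
    using fin by (subst sum.insert) (auto simp: sum.reindex inj_on_def)
  also have "?t [n] = (if b = 0 then 1 else 2) * q n"
    using n r Q_fun_one_row[of n] by (auto simp: Q_coeff_def part_at_def b_def min_def)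
  also have "(\<Sum>i\<in>?I. ?t (?two i)) = (\<Sum>i\<in>?I. (if i < b then 2 else if i = b then 1 else 0) * two_row (n - i) i)"
  proof (rule sum.cong)
    fix i assume i: "i \<in> ?I"
    then have "Q_coeff (?two i) r = (if i < b then 2 else if i = b then 1 else 0)"
      using r by (auto simp: Q_coeff_def part_at_def b_def min_def)
    moreover have "2 \<le> m" using i n by auto
    ultimately show "?t (?two i) = (if i < b then 2 else if i = b then 1 else 0) * two_row (n - i) i"
      by (simp add: Q_fun_two_rows)
  qed simp
  finally have *: "(\<Sum>lam | strict_partition lam n. ?t lam) = (if b = 0 then 1 else 2) * q n
    + (\<Sum>i\<in>?I. (if i < b then 2 else if i = b then 1 else 0) * two_row (n - i) i)" .
  have qb: "q r * q (n - r) = q (n - b) * q b"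
    using r by (auto simp: b_def min_def mult.commute)
  show ?thesis
  proof (cases "b = 0")
    case True
    then have "(\<Sum>i\<in>?I. (if i < b then 2 else if i = b then 1 else 0) * two_row (n - i) i) = 0"
      by (intro sum.neutral) auto
    then show ?thesis unfolding * qb using True by (simp add: q_eq)
  next
    case False
    have "q (n - b) * q b = two_row (n - b) b + 2 * (\<Sum>i\<in>{1..<b}. two_row (n - b + b - i) i) + 2 * q (n - b + b)"
      using False r by (intro q_product_expansion) (auto simp: b_def min_def)
    moreover have "n - b + b = n" using r by (auto simp: b_def)
    moreover have "(\<Sum>i\<in>?I. (if i < b then 2 else if i = b then 1 else 0) * two_row (n - i) i)
        = (\<Sum>i\<in>{1..<b} \<union> {b}. (if i < b then 2 else if i = b then 1 else 0) * two_row (n - i) i)"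
    proof (rule sum.mono_neutral_cong)
      fix i assume "i \<in> {1..<b} \<union> {b} - ?I"
      then have "i = b" "n - b = b" using False r by (auto simp: b_def min_def split: if_splits)
      then show "(if i < b then 2 else if i = b then 1 else 0) * two_row (n - i) i = 0"
        by (simp add: two_row_same)
    qed (use fin in auto)
    moreover have "\<dots> = 2 * (\<Sum>i\<in>{1..<b}. two_row (n - i) i) + two_row (n - b) b"
      by (simp add: sum_distrib_left)
    ultimately show ?thesis unfolding * qb using False by simp
  qed
qed

text \<open>Both expansions of the product have the same values at all points with distinct positive
  coordinates, so independence applies to the difference of the coefficients.\<close>

theorem Q_product_coefficients:
  fixes c :: "nat list \<Rightarrow> complex"
  assumes n: "1 \<le> n" and r: "r \<le> n"
    and expansion: "(\<Sum>lam | strict_partition lam n. mconst (c lam) * Q_fun lam n) = q_fun r n * q_fun (n - r) n"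
    and lam: "strict_partition lam n"
  shows "c lam = of_nat (Q_coeff lam r)"
proof -
  have "c lam - of_nat (Q_coeff lam r) = 0"
  proof (rule Q_fun_independent[OF _ order_refl lam, of "\<lambda>lam. c lam - of_nat (Q_coeff lam r)"])
    fix y :: "nat \<Rightarrow> real" assume y: "\<And>i. 0 < y i" "inj_on y {..<n}"
    let ?z = "\<lambda>i. complex_of_real (y i)"
    interpret positive_point n y ?z by unfold_locales (use y in auto)
    have "complex_value ?z (\<Sum>lam | strict_partition lam n. mconst (c lam) * Q_fun lam n)
      = (\<Sum>lam | strict_partition lam n. c lam * complex_value ?z (Q_fun lam n))"
      by (simp add: complex_value_def coeff_complex.eval_sum coeff_complex.eval_mult)
    moreover have "complex_value ?z (q_fun r n * q_fun (n - r) n) = q r * q (n - r)"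
      by (simp add: complex_value_def coeff_complex.eval_mult q_def)
    ultimately show "(\<Sum>lam | strict_partition lam n.
        (c lam - of_nat (Q_coeff lam r)) * complex_value ?z (Q_fun lam n)) = 0"
      using expansion q_product_Q_fun[OF n order_refl r]
      by (simp add: left_diff_distrib sum_subtractf)
  qed
  then show ?thesis by simp
qed

lemma Q_independent:
  assumes "(\<Sum>lam | strict_partition lam n. mconst (c lam) * Q_fun lam n) = 0" "strict_partition lam n"
  shows "c lam = 0"
proof (rule Q_fun_independent[OF _ order_refl assms(2)])
  fix y :: "nat \<Rightarrow> real"
  show "(\<Sum>lam | strict_partition lam n. c lam * complex_value (\<lambda>i. complex_of_real (y i)) (Q_fun lam n)) = 0"
    using arg_cong[OF assms(1), of "complex_value (\<lambda>i. complex_of_real (y i))"]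
    by (simp add: complex_value_def coeff_complex.eval_sum coeff_complex.eval_mult)
qed

section \<open>Free spaces and linear extension\<close>

interpretation fs: vector_space fscale by (rule vector_space_fscale)

lemma lookup_fscale [simp]: "Poly_Mapping.lookup (fscale c x) b = c * Poly_Mapping.lookup x b"
  by (simp add: fscale_def map.rep_eq when_def)

lemma fscale_single [simp]: "fscale c (Poly_Mapping.single b d) = Poly_Mapping.single b (c * d)"
  by (rule poly_mapping_eqI) (simp add: lookup_single when_def)

lemma flinear_superset:
  assumes "finite S" "Poly_Mapping.keys x \<subseteq> S"
  shows "flinear f x = (\<Sum>b\<in>S. fscale (Poly_Mapping.lookup x b) (f b))"
  unfolding flinear_def using assms
  by (intro sum.mono_neutral_left) (auto simp: in_keys_iff)

lemma flinear_add: "flinear f (x + y) = flinear f x + flinear f y"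
proof -
  let ?S = "Poly_Mapping.keys x \<union> Poly_Mapping.keys y"
  have "flinear f t = (\<Sum>b\<in>?S. fscale (Poly_Mapping.lookup t b) (f b))"
    if "Poly_Mapping.keys t \<subseteq> ?S" for t
    using that by (intro flinear_superset) auto
  from this[of x] this[of y] this[of "x + y"] show ?thesis
    using Poly_Mapping.keys_add[of x y]
    by (simp add: lookup_add fs.scale_left_distrib sum.distrib)
qed

lemma keys_fscale: "Poly_Mapping.keys (fscale c x) \<subseteq> Poly_Mapping.keys x"
  by (auto simp: in_keys_iff)

lemma flinear_fscale: "flinear f (fscale c x) = fscale c (flinear f x)"
  by (subst flinear_superset[OF _ keys_fscale]) (auto simp: flinear_def fs.scale_sum_right)

lemma flinear_single [simp]: "flinear f (Poly_Mapping.single b c) = fscale c (f b)"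
  by (subst flinear_superset[of "{b}"]) auto

lemma flinear_zero [simp]: "flinear f 0 = 0"
  by (simp add: flinear_def)

lemma flinear_diff: "flinear f (x - y) = flinear f x - flinear f y"
proof -
  have "x - y = x + fscale (- 1) y" by (simp add: fs.scale_minus_left)
  then show ?thesis by (simp only: flinear_add flinear_fscale) (simp add: fs.scale_minus_left)
qed

lemma flinear_sum: "flinear f (\<Sum>i\<in>S. g i) = (\<Sum>i\<in>S. flinear f (g i))"
  by (induction S rule: infinite_finite_induct) (auto simp: flinear_add)

lemma free_space_zero: "0 \<in> free_space B"
  by (simp add: free_space_def)

lemma free_space_single: "b \<in> B \<Longrightarrow> Poly_Mapping.single b c \<in> free_space B"
  by (auto simp: free_space_def)

lemma free_space_add: "x \<in> free_space B \<Longrightarrow> y \<in> free_space B \<Longrightarrow> x + y \<in> free_space B"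
  using Poly_Mapping.keys_add[of x y] by (auto simp: free_space_def)

lemma free_space_fscale: "x \<in> free_space B \<Longrightarrow> fscale c x \<in> free_space B"
  using keys_fscale[of c x] by (auto simp: free_space_def)

lemma free_space_sum: "(\<And>i. i \<in> S \<Longrightarrow> g i \<in> free_space B) \<Longrightarrow> (\<Sum>i\<in>S. g i) \<in> free_space B"
  by (induction S rule: infinite_finite_induct) (auto simp: free_space_zero free_space_add)

lemma subspace_free_space: "fs.subspace (free_space B)"
  by (simp add: fs.subspace_def free_space_zero free_space_add free_space_fscale)

lemma free_space_diff: "x \<in> free_space B \<Longrightarrow> y \<in> free_space B \<Longrightarrow> x - y \<in> free_space B"
  by (rule fs.subspace_diff[OF subspace_free_space])

lemma free_space_uminus: "x \<in> free_space B \<Longrightarrow> - x \<in> free_space B"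
  by (rule fs.subspace_neg[OF subspace_free_space])

lemma flinear_closed:
  assumes "x \<in> free_space B" "\<And>b. b \<in> B \<Longrightarrow> f b \<in> free_space C"
  shows "flinear f x \<in> free_space C"
  unfolding flinear_def using assms
  by (intro free_space_sum free_space_fscale) (auto simp: free_space_def)

lemma flinear_cong:
  assumes "x \<in> free_space B" "\<And>b. b \<in> B \<Longrightarrow> f b = g b"
  shows "flinear f x = flinear g x"
  unfolding flinear_def using assms by (intro sum.cong) (auto simp: free_space_def)

lemma free_space_induct [consumes 1, case_names zero basis add scale]:
  assumes "x \<in> free_space B" and "P 0" and "\<And>b. b \<in> B \<Longrightarrow> P (fbasis b)"
    and add: "\<And>x y. x \<in> free_space B \<Longrightarrow> y \<in> free_space B \<Longrightarrow> P x \<Longrightarrow> P y \<Longrightarrow> P (x + y)"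
    and scale: "\<And>c x. x \<in> free_space B \<Longrightarrow> P x \<Longrightarrow> P (fscale c x)"
  shows "P x"
proof -
  have "P x \<and> x \<in> free_space B" if "finite S" "S \<subseteq> B" "x = (\<Sum>b\<in>S. fscale (c b) (fbasis b))" for S c x
    using that
  proof (induction S arbitrary: x)
    case empty
    then show ?case using assms(2) by (simp add: free_space_zero)
  next
    case (insert b S)
    have IH: "P (\<Sum>b\<in>S. fscale (c b) (fbasis b)) \<and> (\<Sum>b\<in>S. fscale (c b) (fbasis b)) \<in> free_space B"
      by (rule insert.IH) (use insert in auto)
    have b: "b \<in> B" using insert by auto
    have "P (fscale (c b) (fbasis b))"
      by (rule scale[OF free_space_single[OF b] assms(3)[OF b]])
    moreover have "fscale (c b) (fbasis b) \<in> free_space B"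
      by (rule free_space_fscale[OF free_space_single[OF b]])
    moreover have "x = fscale (c b) (fbasis b) + (\<Sum>b\<in>S. fscale (c b) (fbasis b))"
      using insert.prems insert.hyps by simp
    ultimately show ?case using IH add free_space_add by blast
  qed
  moreover have "x = (\<Sum>b\<in>Poly_Mapping.keys x. fscale (Poly_Mapping.lookup x b) (fbasis b))"
    by (rule poly_mapping_eqI)
      (auto simp: lookup_sum lookup_single when_def sum.delta in_keys_iff)
  ultimately show ?thesis using assms(1) finite_keys unfolding free_space_def by blast
qed

lemma free_space_UNIV [simp]: "x \<in> free_space UNIV"
  by (simp add: free_space_def)

lemma flinear_fbasis [simp]: "flinear fbasis x = x"
  by (rule free_space_induct[of x UNIV]) (auto simp: flinear_add flinear_fscale)

lemma flinear_flinear: "flinear f (flinear g x) = flinear (\<lambda>b. flinear f (g b)) x"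
  by (rule free_space_induct[of x UNIV]) (auto simp: flinear_add flinear_fscale)

lemma flinear_sum_fun: "flinear (\<lambda>b. f b + g b) x = flinear f x + flinear g x"
  by (simp add: flinear_def fs.scale_right_distrib sum.distrib)

lemma flinear_fscale_fun: "flinear (\<lambda>b. fscale c (f b)) x = fscale c (flinear f x)"
  by (simp add: flinear_def fs.scale_sum_right mult.commute)

lemma fs_span_induct_linear:
  assumes "x \<in> fspan G" "\<And>g. g \<in> G \<Longrightarrow> flinear f g \<in> R" "fs.subspace R"
  shows "flinear f x \<in> R"
  using assms(1)
  by (induction rule: fs.span_induct_alt)
    (auto simp: flinear_add flinear_fscale assms fs.subspace_0 fs.subspace_add fs.subspace_scale)

section \<open>Cosets of a subspace\<close>

lemma fcoset_eq_iff:
  assumes "fs.subspace R" shows "fcoset R x = fcoset R y \<longleftrightarrow> x - y \<in> R"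
proof
  assume "fcoset R x = fcoset R y"
  moreover have "x \<in> fcoset R x" using fs.subspace_0[OF assms] by (simp add: fcoset_def)
  ultimately show "x - y \<in> R" by (simp add: fcoset_def)
next
  assume xy: "x - y \<in> R"
  have "t - x \<in> R \<longleftrightarrow> t - y \<in> R" for t
    using fs.subspace_add[OF assms _ xy, of "t - x"] fs.subspace_diff[OF assms _ xy, of "t - y"]
    by auto
  then show "fcoset R x = fcoset R y" by (simp add: fcoset_def)
qed

lemma fcoset_self: "fs.subspace R \<Longrightarrow> x \<in> fcoset R x"
  by (simp add: fcoset_def fs.subspace_0)

lemma qadd_fcoset:
  assumes "fs.subspace R" shows "qadd (fcoset R x) (fcoset R y) = fcoset R (x + y)"
proof (intro equalityI subsetI)
  fix t assume "t \<in> qadd (fcoset R x) (fcoset R y)"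
  then obtain a b where "t = a + b" "a - x \<in> R" "b - y \<in> R" by (auto simp: qadd_def fcoset_def)
  then show "t \<in> fcoset R (x + y)"
    using fs.subspace_add[OF assms, of "a - x" "b - y"] by (simp add: fcoset_def algebra_simps)
next
  fix t assume "t \<in> fcoset R (x + y)"
  then have "t - y \<in> fcoset R x" by (simp add: fcoset_def algebra_simps)
  moreover have "t = (t - y) + y" by simp
  ultimately show "t \<in> qadd (fcoset R x) (fcoset R y)"
    unfolding qadd_def using fcoset_self[OF assms, of y] by blast
qed

lemma qmap_fcoset:
  assumes "fs.subspace R" "\<And>y. y \<in> fcoset R x \<Longrightarrow> f y - f x \<in> R"
  shows "qmap R f (fcoset R x) = fcoset R (f x)"
proof -
  have "fcoset R (f y) = fcoset R (f x)" if "y \<in> fcoset R x" for y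
    using that assms by (simp add: fcoset_eq_iff)
  then show ?thesis unfolding qmap_def using fcoset_self[OF assms(1), of x] by blast
qed

section \<open>The Hecke--Clifford superalgebra\<close>

lemma hc_mult_add_left: "(a + b) \<star> c = a \<star> c + b \<star> c"
  by (simp add: hc_mult_def flinear_add)

lemma hc_mult_add_right: "a \<star> (b + c) = a \<star> b + a \<star> c"
  by (simp add: hc_mult_def flinear_add flinear_sum_fun)

lemma hc_mult_scale_left: "fscale c a \<star> b = fscale c (a \<star> b)"
  by (simp add: hc_mult_def flinear_fscale)

lemma hc_mult_scale_right: "a \<star> fscale c b = fscale c (a \<star> b)"
  by (simp add: hc_mult_def flinear_fscale flinear_fscale_fun)

lemma hc_mult_zero [simp]: "0 \<star> b = 0" "a \<star> 0 = 0"
  by (simp_all add: hc_mult_def flinear_def)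

lemma hc_scalar_eq: "hc_scalar c = fscale c (hc_scalar 1)"
  by (simp add: hc_scalar_def)

lemma hc_scalar_mult [simp]: "hc_scalar c \<star> a = fscale c a"
proof -
  have "fbasis ({}, id) \<star> a = a"
    by (rule free_space_induct[of a UNIV])
      (auto simp: hc_mult_fbasis hc_mult_add_right hc_mult_scale_right perm_sign_id[unfolded id_def] perm_sign_id clifford_sign_empty o_def)
  then show ?thesis
    by (subst hc_scalar_eq) (simp only: hc_mult_scale_left, simp add: hc_scalar_def)
qed

lemma hc_scalar_add: "hc_scalar (c + d) = hc_scalar c + hc_scalar d"
  by (simp add: hc_scalar_def single_add)

lemma hc_scalar_zero [simp]: "hc_scalar 0 = 0"
  by (simp add: hc_scalar_def)

abbreviation hc_basis :: "nat \<Rightarrow> (nat set \<times> (nat \<Rightarrow> nat)) set" where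
  "hc_basis n \<equiv> Pow {..<n} \<times> sym_group n"

lemma hc_scalar_closed [simp]: "hc_scalar c \<in> hecke_clifford n"
  by (auto simp: hc_scalar_def hecke_clifford_def permutes_id intro: free_space_single)

lemma hc_zero_closed [simp]: "0 \<in> hecke_clifford n"
  by (simp add: hecke_clifford_def free_space_zero)

lemma hc_add_closed: "a \<in> hecke_clifford n \<Longrightarrow> b \<in> hecke_clifford n \<Longrightarrow> a + b \<in> hecke_clifford n"
  by (simp add: hecke_clifford_def free_space_add)

lemma hc_scale_closed: "a \<in> hecke_clifford n \<Longrightarrow> fscale c a \<in> hecke_clifford n"
  by (simp add: hecke_clifford_def free_space_fscale)

lemma hc_basis_closed: "(I, w) \<in> hc_basis n \<Longrightarrow> Poly_Mapping.single (I, w) c \<in> hecke_clifford n"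
  by (simp add: hecke_clifford_def free_space_single)

lemma permutes_image_subset: "w permutes {..<n::nat} \<Longrightarrow> J \<subseteq> {..<n} \<Longrightarrow> w ` J \<subseteq> {..<n}"
  using permutes_image by blast

lemma hc_mult_closed:
  assumes "a \<in> hecke_clifford n" "b \<in> hecke_clifford n" shows "a \<star> b \<in> hecke_clifford n"
  using assms(1) unfolding hecke_clifford_def
proof (induction rule: free_space_induct)
  case (basis p)
  show ?case using assms(2) unfolding hecke_clifford_def
  proof (induction rule: free_space_induct)
    case (basis q)
    obtain I w J v where pq: "p = (I, w)" "q = (J, v)" by fastforce
    have "w permutes {..<n}" "v permutes {..<n}" "I \<subseteq> {..<n}" "J \<subseteq> {..<n}"
      using basis \<open>p \<in> hc_basis n\<close> pq by auto
    then have "((I - w ` J) \<union> (w ` J - I), w \<circ> v) \<in> hc_basis n"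
      using permutes_image_subset[of w n J] by (auto intro: permutes_compose)
    then show ?case unfolding pq hc_mult_fbasis hc_mult_basis.simps by (rule free_space_single)
  qed (auto simp: hc_mult_add_right hc_mult_scale_right free_space_zero free_space_add free_space_fscale)
qed (auto simp: hc_mult_add_left hc_mult_scale_left free_space_zero free_space_add free_space_fscale)

lemma hc_grading_add: "hc_grading (a + b) = hc_grading a + hc_grading b"
  by (simp add: hc_grading_def flinear_add)

lemma hc_grading_scale: "hc_grading (fscale c a) = fscale c (hc_grading a)"
  by (simp add: hc_grading_def flinear_fscale)

lemma hc_grading_zero [simp]: "hc_grading 0 = 0"
  by (simp add: hc_grading_def)

lemma hc_grading_single: "hc_grading (Poly_Mapping.single (I, w) c) = Poly_Mapping.single (I, w) (c * (-1) ^ card I)"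
  by (simp add: hc_grading_def)

lemma hc_grading_part:
  assumes "a \<in> hc_part r" shows "hc_grading a = (if r then - a else a)"
  using assms unfolding hc_part_def
proof (induction rule: free_space_induct)
  case (basis b)
  then show ?case by (cases b) (auto simp: hc_grading_single single_uminus)
qed (auto simp: hc_grading_add hc_grading_scale fs.scale_minus_right)

lemma hc_grading_scalar [simp]: "hc_grading (hc_scalar c) = hc_scalar c"
  by (simp add: hc_scalar_def hc_grading_single)

lemma hc_grading_closed: "a \<in> hecke_clifford n \<Longrightarrow> hc_grading a \<in> hecke_clifford n"
  unfolding hc_grading_def hecke_clifford_def
  by (rule flinear_closed, assumption) (auto intro: free_space_single)

lemma hc_grading_part_closed: "a \<in> hc_part r \<Longrightarrow> hc_grading a \<in> hc_part r"
  unfolding hc_grading_def hc_part_def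
  by (rule flinear_closed, assumption) (auto intro: free_space_single)

lemma card_symmetric_difference_parity:
  assumes "finite X" "finite Y" shows "(-1) ^ card ((X - Y) \<union> (Y - X)) = (-1) ^ card X * (- 1 :: 'a :: ring_1) ^ card Y"
proof -
  have "card ((X - Y) \<union> (Y - X)) = card (X - Y) + card (Y - X)"
    using assms by (intro card_Un_disjoint) auto
  moreover have "card X = card (X - Y) + card (X \<inter> Y)" "card Y = card (Y - X) + card (X \<inter> Y)"
    using assms card_Diff_subset_Int[of X Y] card_Diff_subset_Int[of Y X]
      card_mono[of X "X \<inter> Y"] card_mono[of Y "X \<inter> Y"] by (auto simp: Int_commute)
  ultimately show ?thesis by (simp add: power_add[symmetric] minus_one_power_iff)
qed

lemma hc_grading_mult:
  assumes "a \<in> hecke_clifford n" "b \<in> hecke_clifford n"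
  shows "hc_grading (a \<star> b) = hc_grading a \<star> hc_grading b"
  using assms(1) unfolding hecke_clifford_def
proof (induction rule: free_space_induct)
  case (basis p)
  show ?case using assms(2) unfolding hecke_clifford_def
  proof (induction rule: free_space_induct)
    case (basis q)
    obtain I w J v where pq: "p = (I, w)" "q = (J, v)" by fastforce
    have w: "w permutes {..<n}" "finite I" "finite J"
      using basis \<open>p \<in> hc_basis n\<close> pq finite_subset[of _ "{..<n}"] by auto
    then have "card (w ` J) = card J"
      using permutes_inj_on[OF w(1)] by (intro card_image) auto
    then have sign: "(-1) ^ card ((I - w ` J) \<union> (w ` J - I)) = (-1) ^ card I * (-1 :: complex) ^ card J"
      using w card_symmetric_difference_parity[of I "w ` J"] by simp
    have g: "hc_grading (fbasis (K, u)) = fscale ((-1) ^ card K) (fbasis (K, u))" for K u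
      by (simp add: hc_grading_single)
    show ?case
      unfolding pq g hc_mult_scale_left hc_mult_scale_right
      by (simp add: hc_mult_fbasis hc_grading_single sign mult_ac)
  qed (auto simp: hc_mult_add_right hc_mult_scale_right hc_grading_add hc_grading_scale)
qed (auto simp: hc_mult_add_left hc_mult_scale_left hc_grading_add hc_grading_scale)

lemma hc_parity_decomposition:
  assumes "a \<in> hecke_clifford n"
  obtains a0 a1 where "a = a0 + a1" "a0 \<in> hecke_clifford n \<inter> hc_part False" "a1 \<in> hecke_clifford n \<inter> hc_part True"
proof -
  have sp: "fs.subspace (hecke_clifford n \<inter> hc_part r)" for r
    unfolding hecke_clifford_def hc_part_def by (intro fs.subspace_inter subspace_free_space)
  have "\<exists>a0 a1. a = a0 + a1 \<and> a0 \<in> hecke_clifford n \<inter> hc_part False \<and> a1 \<in> hecke_clifford n \<inter> hc_part True"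
    using assms unfolding hecke_clifford_def
  proof (induction rule: free_space_induct)
    case zero
    then show ?case using fs.subspace_0[OF sp] unfolding hecke_clifford_def by force
  next
    case (basis b)
    obtain I w where b: "b = (I, w)" by fastforce
    have mem: "fbasis b \<in> hecke_clifford n \<inter> hc_part (odd (card I))"
      using basis b by (auto simp: hecke_clifford_def hc_part_def intro: free_space_single)
    show ?case
    proof (cases "odd (card I)")
      case True
      then show ?thesis using mem fs.subspace_0[OF sp, of False] unfolding hecke_clifford_def
        by (intro exI[of _ 0] exI[of _ "fbasis b"]) auto
    next
      case False
      then show ?thesis using mem fs.subspace_0[OF sp, of True] unfolding hecke_clifford_def
        by (intro exI[of _ "fbasis b"] exI[of _ 0]) auto
    qed
  next
    case (add x y)
    then obtain x0 x1 y0 y1 where "x = x0 + x1" "y = y0 + y1"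
      "x0 \<in> hecke_clifford n \<inter> hc_part False" "y0 \<in> hecke_clifford n \<inter> hc_part False"
      "x1 \<in> hecke_clifford n \<inter> hc_part True" "y1 \<in> hecke_clifford n \<inter> hc_part True"
      unfolding hecke_clifford_def by blast
    moreover from this have "x + y = (x0 + y0) + (x1 + y1)" by simp
    ultimately show ?case using fs.subspace_add[OF sp] unfolding hecke_clifford_def by blast
  next
    case (scale c x)
    then obtain x0 x1 where "x = x0 + x1"
      "x0 \<in> hecke_clifford n \<inter> hc_part False" "x1 \<in> hecke_clifford n \<inter> hc_part True"
      unfolding hecke_clifford_def by blast
    moreover from this have "fscale c x = fscale c x0 + fscale c x1" by (simp add: fs.scale_right_distrib)
    ultimately show ?case using fs.subspace_scale[OF sp] unfolding hecke_clifford_def by blast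
  qed
  then show ?thesis using that by blast
qed

section \<open>Supermodules\<close>

context supermodule
begin

lemma part_carrier: "v \<in> part M p \<Longrightarrow> v \<in> carrier M"
  using part_subgroup[of p] by (rule additive_subgroup.a_Hcarr)

lemma zero_part [simp]: "\<zero> \<in> part M p"
  using part_subgroup[of p] by (rule additive_subgroup.zero_closed)

lemma part_add: "u \<in> part M p \<Longrightarrow> v \<in> part M p \<Longrightarrow> u \<oplus> v \<in> part M p"
  using part_subgroup[of p] by (rule additive_subgroup.a_closed)

lemma part_minus: "u \<in> part M p \<Longrightarrow> \<ominus> u \<in> part M p"
  using part_subgroup[of p] by (rule additive_subgroup.a_inv_closed)

lemma decompose:
  assumes "v \<in> carrier M"
  obtains v0 v1 where "v0 \<in> part M False" "v1 \<in> part M True" "v = v0 \<oplus> v1"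
  using assms part_sum unfolding set_add_def' by blast

lemma part_sum_zero:
  assumes "a \<in> part M False" "b \<in> part M True" "a \<oplus> b = \<zero>"
  shows "a = \<zero>" "b = \<zero>"
proof -
  have ca: "a \<in> carrier M" "b \<in> carrier M" using assms part_carrier by auto
  have "a = \<ominus> b" using assms(3) ca by (metis a_comm minus_equality)
  then have "a \<in> part M True" using assms(2) part_minus by simp
  then show "a = \<zero>" using assms(1) part_inter by blast
  then show "b = \<zero>" using assms(3) ca by simp
qed

lemma part_unique:
  assumes "a \<in> part M p" "b \<in> part M (\<not> p)" "a \<oplus> b \<in> part M p"
  shows "b = \<zero>"
proof -
  have ca: "a \<in> carrier M" "b \<in> carrier M" using assms part_carrier by auto
  have "b = \<ominus> a \<oplus> (a \<oplus> b)" using ca by (simp add: r_neg1)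
  then have "b \<in> part M p" using assms part_add part_minus by metis
  then show ?thesis using assms(2) part_inter by (cases p) auto
qed

lemma act_zero_right: "a \<in> A \<Longrightarrow> a \<odot> \<zero> = \<zero>"
  using act_add_right[of a \<zero> \<zero>] act_closed[of a \<zero>]
  by (metis a_closed add.r_cancel_one' l_zero zero_closed)

lemma act_zero_left: "0 \<in> A \<Longrightarrow> v \<in> carrier M \<Longrightarrow> 0 \<odot> v = \<zero>"
  using act_add_left[of 0 0 v] act_closed[of 0 v]
  by (metis add_0 add.r_cancel_one' )

lemma act_minus_left:
  assumes "0 \<in> A" "a \<in> A" "- a \<in> A" "v \<in> carrier M" shows "(- a) \<odot> v = \<ominus> (a \<odot> v)"
proof -
  have "(- a) \<odot> v \<oplus> a \<odot> v = \<zero>"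
    using assms act_add_left[of "- a" a v] act_zero_left by simp
  then show ?thesis using assms act_closed by (metis minus_equality)
qed

end

lemma hc_minus_closed: "a \<in> hecke_clifford n \<Longrightarrow> - a \<in> hecke_clifford n"
  by (simp add: hecke_clifford_def free_space_uminus)

lemma (in abelian_group) additive_subgroup_of_closed:
  assumes "P \<subseteq> carrier G" "\<zero> \<in> P" "\<And>x y. x \<in> P \<Longrightarrow> y \<in> P \<Longrightarrow> x \<oplus> y \<in> P" "\<And>x. x \<in> P \<Longrightarrow> \<ominus> x \<in> P"
  shows "additive_subgroup P G"
  by (rule additive_subgroupI, rule add.subgroupI) (use assms in \<open>auto simp: a_inv_def\<close>)

text \<open>All module structures below are images of known ones: quotients, copies inside
  \<open>nat \<Rightarrow> complex\<close>, and induced modules, which are the images of explicit models.\<close>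

lemma supermodule_image:
  assumes "supermodule (hecke_clifford n) M"
    and car: "carrier N = f ` carrier M"
    and add: "\<And>u v. u \<in> carrier M \<Longrightarrow> v \<in> carrier M \<Longrightarrow> f (u \<oplus>\<^bsub>M\<^esub> v) = f u \<oplus>\<^bsub>N\<^esub> f v"
    and zero: "\<zero>\<^bsub>N\<^esub> = f \<zero>\<^bsub>M\<^esub>"
    and act: "\<And>a v. a \<in> hecke_clifford n \<Longrightarrow> v \<in> carrier M \<Longrightarrow> f (a \<odot>\<^bsub>M\<^esub> v) = a \<odot>\<^bsub>N\<^esub> f v"
    and part: "\<And>p. part N p = f ` part M p"
    and ker: "\<And>u v. u \<in> part M False \<Longrightarrow> v \<in> part M True \<Longrightarrow> f u = f v \<Longrightarrow> f u = \<zero>\<^bsub>N\<^esub>"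
  shows "supermodule (hecke_clifford n) N"
proof -
  interpret M: supermodule "hecke_clifford n" M by fact
  have ag: "abelian_group N"
  proof (rule abelian_groupI)
    fix x y assume "x \<in> carrier N" "y \<in> carrier N"
    then obtain u v where "u \<in> carrier M" "v \<in> carrier M" "x = f u" "y = f v" using car by auto
    then show "x \<oplus>\<^bsub>N\<^esub> y \<in> carrier N" "x \<oplus>\<^bsub>N\<^esub> y = y \<oplus>\<^bsub>N\<^esub> x"
      using car by (simp_all add: add[symmetric] M.a_comm)
  next
    show "\<zero>\<^bsub>N\<^esub> \<in> carrier N" using car zero by simp
  next
    fix x y z assume "x \<in> carrier N" "y \<in> carrier N" "z \<in> carrier N"
    then obtain u v w where "u \<in> carrier M" "v \<in> carrier M" "w \<in> carrier M" "x = f u" "y = f v" "z = f w"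
      using car by auto
    then show "x \<oplus>\<^bsub>N\<^esub> y \<oplus>\<^bsub>N\<^esub> z = x \<oplus>\<^bsub>N\<^esub> (y \<oplus>\<^bsub>N\<^esub> z)"
      by (simp add: add[symmetric] M.a_assoc)
  next
    fix x assume "x \<in> carrier N"
    then obtain u where u: "u \<in> carrier M" "x = f u" using car by auto
    then show "\<zero>\<^bsub>N\<^esub> \<oplus>\<^bsub>N\<^esub> x = x" by (simp add: zero add[symmetric])
    show "\<exists>y\<in>carrier N. y \<oplus>\<^bsub>N\<^esub> x = \<zero>\<^bsub>N\<^esub>"
      using u car by (intro bexI[of _ "f (\<ominus>\<^bsub>M\<^esub> u)"]) (simp_all add: zero add[symmetric] M.l_neg)
  qed
  then interpret N: abelian_group N .
  have f_minus: "f (\<ominus>\<^bsub>M\<^esub> u) = \<ominus>\<^bsub>N\<^esub> f u" if "u \<in> carrier M" for u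
    using that car by (intro N.minus_equality[symmetric]) (auto simp: zero add[symmetric] M.l_neg)
  show ?thesis
  proof (intro supermodule.intro ag supermodule_axioms.intro)
    fix a v assume "a \<in> hecke_clifford n" "v \<in> carrier N"
    then show "a \<odot>\<^bsub>N\<^esub> v \<in> carrier N" using car by (auto simp: act[symmetric] M.act_closed)
  next
    fix a b v assume *: "a \<in> hecke_clifford n" "b \<in> hecke_clifford n" "v \<in> carrier N"
    then obtain u where u: "u \<in> carrier M" "v = f u" using car by auto
    show "(a + b) \<odot>\<^bsub>N\<^esub> v = a \<odot>\<^bsub>N\<^esub> v \<oplus>\<^bsub>N\<^esub> b \<odot>\<^bsub>N\<^esub> v"
      using * u hc_add_closed[of a n b] by (simp add: act[symmetric] add[symmetric] M.act_closed M.act_add_left)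
    show "(a \<star> b) \<odot>\<^bsub>N\<^esub> v = a \<odot>\<^bsub>N\<^esub> (b \<odot>\<^bsub>N\<^esub> v)"
      using * u hc_mult_closed[of a n b] by (simp add: act[symmetric] M.act_closed M.act_mult)
  next
    fix a u v assume *: "a \<in> hecke_clifford n" "u \<in> carrier N" "v \<in> carrier N"
    then obtain x y where "x \<in> carrier M" "u = f x" "y \<in> carrier M" "v = f y" using car by auto
    then show "a \<odot>\<^bsub>N\<^esub> (u \<oplus>\<^bsub>N\<^esub> v) = a \<odot>\<^bsub>N\<^esub> u \<oplus>\<^bsub>N\<^esub> a \<odot>\<^bsub>N\<^esub> v"
      using * by (simp add: act[symmetric] add[symmetric] M.act_closed M.act_add_right)
  next
    fix v assume "v \<in> carrier N"
    then show "hc_scalar 1 \<odot>\<^bsub>N\<^esub> v = v" using car by (auto simp: act[symmetric] M.act_one)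
  next
    fix p
    show "additive_subgroup (part N p) N"
    proof (rule N.additive_subgroup_of_closed)
      show "part N p \<subseteq> carrier N" using car part M.part_carrier by auto
      show "\<zero>\<^bsub>N\<^esub> \<in> part N p" unfolding part zero by simp
      show "x \<oplus>\<^bsub>N\<^esub> y \<in> part N p" if "x \<in> part N p" "y \<in> part N p" for x y
        using that M.part_add M.part_carrier unfolding part by (auto simp: add[symmetric])
      show "\<ominus>\<^bsub>N\<^esub> x \<in> part N p" if "x \<in> part N p" for x
        using that M.part_minus M.part_carrier unfolding part by (auto simp: f_minus[symmetric])
    qed
  next
    show "carrier N = part N False <+>\<^bsub>N\<^esub> part N True"
    proof (intro equalityI subsetI)
      fix x assume "x \<in> carrier N"
      then obtain u where u: "u \<in> carrier M" "x = f u" using car by auto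
      obtain u0 u1 where u01: "u0 \<in> part M False" "u1 \<in> part M True" "u = u0 \<oplus>\<^bsub>M\<^esub> u1"
        using M.decompose[OF u(1)] by blast
      then have "x = f u0 \<oplus>\<^bsub>N\<^esub> f u1" using u(2) by (simp add: add M.part_carrier)
      then show "x \<in> part N False <+>\<^bsub>N\<^esub> part N True"
        using u01 unfolding part set_add_def' by blast
    next
      fix x assume "x \<in> part N False <+>\<^bsub>N\<^esub> part N True"
      then show "x \<in> carrier N"
        unfolding part set_add_def' using M.part_carrier by (auto simp: car add[symmetric])
    qed
  next
    show "part N False \<inter> part N True = {\<zero>\<^bsub>N\<^esub>}"
      using ker M.zero_part[of False] M.zero_part[of True] unfolding part zero by blast
  next
    fix a p v r assume "a \<in> hecke_clifford n \<inter> hc_part p" "v \<in> part N r"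
    then show "a \<odot>\<^bsub>N\<^esub> v \<in> part N (p \<noteq> r)"
      using M.part_act M.part_carrier unfolding part by (auto simp: act[symmetric])
  qed
qed

section \<open>Finite-dimensional modules\<close>

text \<open>Linear combinations built up one term at a time: unlike finite sums in a module, they can be
  followed through linear maps and pulled back by a plain induction.\<close>

inductive_set lin_span :: "(hc, 'v) smod \<Rightarrow> 'v set \<Rightarrow> 'v set" for M S where
  zero: "\<zero>\<^bsub>M\<^esub> \<in> lin_span M S"
| step: "\<lbrakk>x \<in> lin_span M S; s \<in> S\<rbrakk> \<Longrightarrow> x \<oplus>\<^bsub>M\<^esub> hc_scalar c \<odot>\<^bsub>M\<^esub> s \<in> lin_span M S"

lemma fin_dim_iff:
  assumes "supermodule (hecke_clifford n) M"
  shows "fin_dim M \<longleftrightarrow> (\<exists>S. finite S \<and> S \<subseteq> carrier M \<and> carrier M \<subseteq> lin_span M S)"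
proof -
  interpret M: supermodule "hecke_clifford n" M by fact
  have to_span: "(\<Oplus>\<^bsub>M\<^esub>s\<in>T. hc_scalar (f s) \<odot>\<^bsub>M\<^esub> s) \<in> lin_span M S"
    if "finite T" "T \<subseteq> S" "S \<subseteq> carrier M" for S T f
    using that
  proof (induction T)
    case empty
    then show ?case by (simp add: lin_span.zero)
  next
    case (insert t T)
    have "(\<Oplus>\<^bsub>M\<^esub>s\<in>insert t T. hc_scalar (f s) \<odot>\<^bsub>M\<^esub> s)
      = (\<Oplus>\<^bsub>M\<^esub>s\<in>T. hc_scalar (f s) \<odot>\<^bsub>M\<^esub> s) \<oplus>\<^bsub>M\<^esub> hc_scalar (f t) \<odot>\<^bsub>M\<^esub> t"
      using insert by (subst M.finsum_insert) (auto intro!: M.a_comm M.finsum_closed M.act_closed)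
    then show ?case using insert by (auto intro: lin_span.step)
  qed
  have from_span: "\<exists>f. v = (\<Oplus>\<^bsub>M\<^esub>s\<in>S. hc_scalar (f s) \<odot>\<^bsub>M\<^esub> s)"
    if "finite S" "S \<subseteq> carrier M" "v \<in> lin_span M S" for S v
    using that(3)
  proof induction
    case zero
    have "(\<Oplus>\<^bsub>M\<^esub>s\<in>S. hc_scalar 0 \<odot>\<^bsub>M\<^esub> s) = \<zero>\<^bsub>M\<^esub>"
      using that by (intro M.add.finprod_one_eqI) (auto simp: M.act_zero_left)
    then show ?case by (intro exI[of _ "\<lambda>_. 0"]) (rule sym)
  next
    case (step x t c)
    then obtain f where f: "x = (\<Oplus>\<^bsub>M\<^esub>s\<in>S. hc_scalar (f s) \<odot>\<^bsub>M\<^esub> s)" by auto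
    let ?g = "f(t := f t + c)" and ?T = "S - {t}"
    have S: "S = insert t ?T" using step by auto
    have cl: "hc_scalar d \<odot>\<^bsub>M\<^esub> s \<in> carrier M" if "s \<in> S" for d s
      using that \<open>S \<subseteq> carrier M\<close> by (auto intro: M.act_closed)
    have sum: "(\<Oplus>\<^bsub>M\<^esub>s\<in>S. hc_scalar (h s) \<odot>\<^bsub>M\<^esub> s)
        = hc_scalar (h t) \<odot>\<^bsub>M\<^esub> t \<oplus>\<^bsub>M\<^esub> (\<Oplus>\<^bsub>M\<^esub>s\<in>?T. hc_scalar (h s) \<odot>\<^bsub>M\<^esub> s)" for h
      by (subst S, subst M.finsum_insert) (use that cl step in auto)
    have same: "(\<Oplus>\<^bsub>M\<^esub>s\<in>?T. hc_scalar (?g s) \<odot>\<^bsub>M\<^esub> s) = (\<Oplus>\<^bsub>M\<^esub>s\<in>?T. hc_scalar (f s) \<odot>\<^bsub>M\<^esub> s)"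
      by (intro M.finsum_cong') (use cl in auto)
    have clT: "(\<Oplus>\<^bsub>M\<^esub>s\<in>?T. hc_scalar (f s) \<odot>\<^bsub>M\<^esub> s) \<in> carrier M"
      by (intro M.finsum_closed) (use cl in auto)
    have t: "t \<in> carrier M" using step that by auto
    have "x \<oplus>\<^bsub>M\<^esub> hc_scalar c \<odot>\<^bsub>M\<^esub> t = (\<Oplus>\<^bsub>M\<^esub>s\<in>S. hc_scalar (?g s) \<odot>\<^bsub>M\<^esub> s)"
      unfolding f sum same using t clT
      by (simp add: hc_scalar_add M.act_add_left M.act_closed M.a_ac)
    then show ?case by blast
  qed
  show ?thesis unfolding fin_dim_def
  proof (intro iffI; elim exE conjE)
    fix S assume S: "finite S" "S \<subseteq> carrier M"
      and sp: "\<forall>v\<in>carrier M. \<exists>f. v = (\<Oplus>\<^bsub>M\<^esub>s\<in>S. hc_scalar (f s) \<odot>\<^bsub>M\<^esub> s)"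
    have "carrier M \<subseteq> lin_span M S"
    proof
      fix v assume "v \<in> carrier M"
      then obtain f where "v = (\<Oplus>\<^bsub>M\<^esub>s\<in>S. hc_scalar (f s) \<odot>\<^bsub>M\<^esub> s)" using sp by blast
      then show "v \<in> lin_span M S" using to_span[OF S(1) subset_refl S(2), of f] by simp
    qed
    then show "\<exists>S. finite S \<and> S \<subseteq> carrier M \<and> carrier M \<subseteq> lin_span M S" using S by blast
  next
    fix S assume S: "finite S" "S \<subseteq> carrier M" "carrier M \<subseteq> lin_span M S"
    show "\<exists>S. finite S \<and> S \<subseteq> carrier M \<and>
      (\<forall>v\<in>carrier M. \<exists>f. v = (\<Oplus>\<^bsub>M\<^esub>s\<in>S. hc_scalar (f s) \<odot>\<^bsub>M\<^esub> s))"
      by (intro exI[of _ S] conjI ballI S(1,2) from_span[OF S(1,2)] subsetD[OF S(3)])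
  qed
qed

lemma fin_dim_image:
  assumes M: "supermodule (hecke_clifford n) M" and N: "supermodule (hecke_clifford n) N" and "fin_dim M"
    and car: "carrier N = f ` carrier M"
    and add: "\<And>u v. u \<in> carrier M \<Longrightarrow> v \<in> carrier M \<Longrightarrow> f (u \<oplus>\<^bsub>M\<^esub> v) = f u \<oplus>\<^bsub>N\<^esub> f v"
    and zero: "\<zero>\<^bsub>N\<^esub> = f \<zero>\<^bsub>M\<^esub>"
    and act: "\<And>a v. a \<in> hecke_clifford n \<Longrightarrow> v \<in> carrier M \<Longrightarrow> f (a \<odot>\<^bsub>M\<^esub> v) = a \<odot>\<^bsub>N\<^esub> f v"
  shows "fin_dim N"
proof -
  interpret M: supermodule "hecke_clifford n" M by fact
  obtain S where S: "finite S" "S \<subseteq> carrier M" "carrier M \<subseteq> lin_span M S"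
    using fin_dim_iff[OF M] \<open>fin_dim M\<close> by auto
  have "f v \<in> lin_span N (f ` S) \<and> v \<in> carrier M" if "v \<in> lin_span M S" for v
    using that
  proof induction
    case zero
    then show ?case by (simp add: lin_span.zero assms(6)[symmetric])
  next
    case (step x s c)
    then have "s \<in> carrier M" using S by auto
    then have "f (x \<oplus>\<^bsub>M\<^esub> hc_scalar c \<odot>\<^bsub>M\<^esub> s) = f x \<oplus>\<^bsub>N\<^esub> hc_scalar c \<odot>\<^bsub>N\<^esub> f s"
      using step by (simp add: add act M.act_closed)
    moreover have "x \<oplus>\<^bsub>M\<^esub> hc_scalar c \<odot>\<^bsub>M\<^esub> s \<in> carrier M"
      using step \<open>s \<in> carrier M\<close> by (simp add: M.act_closed)
    ultimately show ?case using step by (auto intro: lin_span.step)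
  qed
  then have "carrier N \<subseteq> lin_span N (f ` S)" using S car by auto
  then show ?thesis using fin_dim_iff[OF N] S car by (intro iffD2[OF fin_dim_iff[OF N]] exI[of _ "f ` S"]) auto
qed

section \<open>Even homomorphisms\<close>

lemma even_homI:
  assumes "\<And>v. v \<in> carrier M \<Longrightarrow> f v \<in> carrier N"
    and "\<And>u v. u \<in> carrier M \<Longrightarrow> v \<in> carrier M \<Longrightarrow> f (u \<oplus>\<^bsub>M\<^esub> v) = f u \<oplus>\<^bsub>N\<^esub> f v"
    and "\<And>r v. v \<in> part M r \<Longrightarrow> f v \<in> part N r"
    and "\<And>a v. a \<in> A \<Longrightarrow> v \<in> carrier M \<Longrightarrow> f (a \<odot>\<^bsub>M\<^esub> v) = a \<odot>\<^bsub>N\<^esub> f v"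
  shows "shom_part A False M N f"
  unfolding shom_part_def using assms by auto

lemma even_homD:
  assumes "shom_part A False M N f"
  shows "v \<in> carrier M \<Longrightarrow> f v \<in> carrier N"
    and "u \<in> carrier M \<Longrightarrow> v \<in> carrier M \<Longrightarrow> f (u \<oplus>\<^bsub>M\<^esub> v) = f u \<oplus>\<^bsub>N\<^esub> f v"
    and "v \<in> part M r \<Longrightarrow> f v \<in> part N r"
  using assms unfolding shom_part_def by (auto simp: image_subset_iff)

lemma even_hom_act:
  assumes f: "shom_part (hecke_clifford n) False M N f"
    and M: "supermodule (hecke_clifford n) M" and N: "supermodule (hecke_clifford n) N"
    and a: "a \<in> hecke_clifford n" and v: "v \<in> carrier M"
  shows "f (a \<odot>\<^bsub>M\<^esub> v) = a \<odot>\<^bsub>N\<^esub> f v"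
proof -
  interpret M: supermodule "hecke_clifford n" M by fact
  interpret N: supermodule "hecke_clifford n" N by fact
  have hom: "f (b \<odot>\<^bsub>M\<^esub> v) = b \<odot>\<^bsub>N\<^esub> f v" if "b \<in> hecke_clifford n \<inter> hc_part r" for b r
    using f that v unfolding shom_part_def by auto
  obtain a0 a1 where dec: "a = a0 + a1" "a0 \<in> hecke_clifford n \<inter> hc_part False"
      "a1 \<in> hecke_clifford n \<inter> hc_part True"
    using hc_parity_decomposition[OF a] by blast
  then show ?thesis
    using hom[OF dec(2)] hom[OF dec(3)] v even_homD(1,2)[OF f]
    by (simp add: M.act_add_left N.act_add_left M.act_closed)
qed

lemma even_hom_zero:
  assumes f: "shom_part A False M N f" and M: "supermodule A M" and N: "supermodule A N"
  shows "f \<zero>\<^bsub>M\<^esub> = \<zero>\<^bsub>N\<^esub>"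
proof -
  interpret M: supermodule A M by fact
  interpret N: supermodule A N by fact
  have "f \<zero>\<^bsub>M\<^esub> \<oplus>\<^bsub>N\<^esub> f \<zero>\<^bsub>M\<^esub> = f \<zero>\<^bsub>M\<^esub>"
    using even_homD(2)[OF f, of "\<zero>\<^bsub>M\<^esub>" "\<zero>\<^bsub>M\<^esub>"] by simp
  then show ?thesis using even_homD(1)[OF f, of "\<zero>\<^bsub>M\<^esub>"] N.add.r_cancel_one' by auto
qed

lemma even_hom_minus:
  assumes f: "shom_part A False M N f" and M: "supermodule A M" and N: "supermodule A N"
    and v: "v \<in> carrier M"
  shows "f (\<ominus>\<^bsub>M\<^esub> v) = \<ominus>\<^bsub>N\<^esub> f v"
proof -
  interpret M: supermodule A M by fact
  interpret N: supermodule A N by fact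
  have "f (\<ominus>\<^bsub>M\<^esub> v) \<oplus>\<^bsub>N\<^esub> f v = \<zero>\<^bsub>N\<^esub>"
    using even_homD(2)[OF f, of "\<ominus>\<^bsub>M\<^esub> v" v] v even_hom_zero[OF f M N] by (simp add: M.l_neg)
  then show ?thesis using v even_homD(1)[OF f] by (intro N.minus_equality[symmetric]) auto
qed

lemma even_hom_compose:
  assumes f: "shom_part A False M N f" and g: "shom_part A False N P g"
  shows "shom_part A False M P (\<lambda>v. g (f v))"
  using assms unfolding shom_part_def by (auto simp: image_subset_iff)

lemma even_iso_part:
  assumes f: "shom_part A False M N f" and bij: "bij_betw f (carrier M) (carrier N)"
    and M: "supermodule A M" and N: "supermodule A N"
  shows "part N p = f ` part M p"
proof
  interpret M: supermodule A M by fact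
  interpret N: supermodule A N by fact
  show "f ` part M p \<subseteq> part N p" using even_homD(3)[OF f] by auto
  show "part N p \<subseteq> f ` part M p"
  proof
    fix y assume y: "y \<in> part N p"
    then obtain x where x: "x \<in> carrier M" "y = f x"
      using bij N.part_carrier unfolding bij_betw_def by blast
    obtain x0 x1 where x01: "x0 \<in> part M False" "x1 \<in> part M True" "x = x0 \<oplus>\<^bsub>M\<^esub> x1"
      using M.decompose[OF x(1)] by blast
    let ?a = "if p then x1 else x0" and ?b = "if p then x0 else x1"
    have ab: "?a \<in> part M p" "?b \<in> part M (\<not> p)" using x01 by auto
    have cab: "?a \<in> carrier M" "?b \<in> carrier M" using ab M.part_carrier by blast+
    have xab: "x = ?a \<oplus>\<^bsub>M\<^esub> ?b" using x01 M.part_carrier by (auto simp: M.a_comm)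
    have "f ?a \<oplus>\<^bsub>N\<^esub> f ?b \<in> part N p" using y x xab even_homD(2)[OF f cab] by simp
    then have "f ?b = \<zero>\<^bsub>N\<^esub>"
      using N.part_unique[OF even_homD(3)[OF f ab(1)] even_homD(3)[OF f ab(2)]] by simp
    then have "f x = f ?a" using x xab even_homD(2)[OF f cab] even_homD(1)[OF f cab(1)] by simp
    then show "y \<in> f ` part M p" using x(2) ab(1) by blast
  qed
qed

lemma even_iso_inverse:
  assumes "smod_even_iso (hecke_clifford n) M N"
    and M: "supermodule (hecke_clifford n) M" and N: "supermodule (hecke_clifford n) N"
  obtains f g where "shom_part (hecke_clifford n) False M N f" "shom_part (hecke_clifford n) False N M g"
    "\<And>v. v \<in> carrier M \<Longrightarrow> g (f v) = v" "\<And>v. v \<in> carrier N \<Longrightarrow> f (g v) = v"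
proof -
  interpret M: supermodule "hecke_clifford n" M by fact
  interpret N: supermodule "hecke_clifford n" N by fact
  obtain f where f: "shom_part (hecke_clifford n) False M N f" and bij: "bij_betw f (carrier M) (carrier N)"
    using assms(1) unfolding smod_even_iso_def by auto
  let ?g = "the_inv_into (carrier M) f"
  have inj: "inj_on f (carrier M)" using bij by (simp add: bij_betw_def)
  have gf: "?g (f v) = v" if "v \<in> carrier M" for v using the_inv_into_f_f[OF inj that] .
  have ex: "\<exists>u\<in>carrier M. v = f u" if "v \<in> carrier N" for v using that bij by (auto simp: bij_betw_def)
  have "shom_part (hecke_clifford n) False N M ?g"
  proof (rule even_homI)
    fix v assume "v \<in> carrier N"
    then show "?g v \<in> carrier M" using ex gf by fastforce
  next
    fix u v assume "u \<in> carrier N" "v \<in> carrier N"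
    then obtain x y where "x \<in> carrier M" "u = f x" "y \<in> carrier M" "v = f y" using ex by blast
    then show "?g (u \<oplus>\<^bsub>N\<^esub> v) = ?g u \<oplus>\<^bsub>M\<^esub> ?g v"
      by (simp add: even_homD(2)[OF f, symmetric] gf)
  next
    fix r v assume "v \<in> part N r"
    then show "?g v \<in> part M r"
      using even_iso_part[OF f bij M N, of r] gf M.part_carrier by auto
  next
    fix a v assume a: "a \<in> hecke_clifford n" and "v \<in> carrier N"
    then obtain x where "x \<in> carrier M" "v = f x" using ex by blast
    then show "?g (a \<odot>\<^bsub>N\<^esub> v) = a \<odot>\<^bsub>M\<^esub> ?g v"
      using a by (simp add: even_hom_act[OF f M N, symmetric] gf M.act_closed)
  qed
  moreover have "f (?g v) = v" if "v \<in> carrier N" for v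
    using ex[OF that] gf by auto
  ultimately show ?thesis using that[OF f] gf by blast
qed

lemma even_iso_of_inverse:
  assumes "shom_part A False M N f" "shom_part A False N M g"
    and "\<And>v. v \<in> carrier M \<Longrightarrow> g (f v) = v" "\<And>v. v \<in> carrier N \<Longrightarrow> f (g v) = v"
  shows "smod_even_iso A M N"
  unfolding smod_even_iso_def
  using assms(1) bij_betw_byWitness[of "carrier M" g f "carrier N"] assms(3,4)
    even_homD(1)[OF assms(1)] even_homD(1)[OF assms(2)] by blast

lemma even_iso_sym:
  assumes "smod_even_iso (hecke_clifford n) M N"
    and M: "supermodule (hecke_clifford n) M" and N: "supermodule (hecke_clifford n) N"
  shows "smod_even_iso (hecke_clifford n) N M"
  using even_iso_inverse[OF assms] even_iso_of_inverse[of _ N M] by metis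

lemma even_iso_trans:
  assumes "smod_even_iso A M N" "smod_even_iso A N P"
  shows "smod_even_iso A M P"
proof -
  obtain f g where "shom_part A False M N f" "bij_betw f (carrier M) (carrier N)"
    "shom_part A False N P g" "bij_betw g (carrier N) (carrier P)"
    using assms unfolding smod_even_iso_def by auto
  then show ?thesis unfolding smod_even_iso_def
    using even_hom_compose bij_betw_trans[of f _ _ g] by (fastforce simp: o_def)
qed

lemma hc_module_transport:
  assumes hM: "hc_module n M"
    and bij: "bij_betw f (carrier M) (carrier N)"
    and add: "\<And>u v. u \<in> carrier M \<Longrightarrow> v \<in> carrier M \<Longrightarrow> f (u \<oplus>\<^bsub>M\<^esub> v) = f u \<oplus>\<^bsub>N\<^esub> f v"
    and zero: "\<zero>\<^bsub>N\<^esub> = f \<zero>\<^bsub>M\<^esub>"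
    and act: "\<And>a v. a \<in> hecke_clifford n \<Longrightarrow> v \<in> carrier M \<Longrightarrow> f (a \<odot>\<^bsub>M\<^esub> v) = a \<odot>\<^bsub>N\<^esub> f v"
    and part: "\<And>p. part N p = f ` part M p"
  shows "hc_module n N" "smod_even_iso (hecke_clifford n) M N"
proof -
  have M: "supermodule (hecke_clifford n) M" and fd: "fin_dim M" using hM by (auto simp: hc_module_def)
  interpret M: supermodule "hecke_clifford n" M by fact
  have car: "carrier N = f ` carrier M" using bij by (simp add: bij_betw_def)
  have N: "supermodule (hecke_clifford n) N"
  proof (rule supermodule_image[OF M car add zero act part])
    fix u v assume uv: "u \<in> part M False" "v \<in> part M True" "f u = f v"
    then have "u = v" using bij M.part_carrier by (auto simp: bij_betw_def inj_on_def)
    then have "u = \<zero>\<^bsub>M\<^esub>" using uv M.part_inter by blast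
    then show "f u = \<zero>\<^bsub>N\<^esub>" using zero by simp
  qed
  have "fin_dim N" by (rule fin_dim_image[OF M N fd car add zero act])
  then show "hc_module n N" using N by (simp add: hc_module_def)
  have "shom_part (hecke_clifford n) False M N f"
    by (rule even_homI) (use car add act part in auto)
  then show "smod_even_iso (hecke_clifford n) M N" using bij unfolding smod_even_iso_def by blast
qed

text \<open>The coordinates with respect to a finite spanning set, chosen for every vector, give an
  injection into \<open>nat \<Rightarrow> complex\<close>, along which the structure is transported; the
  injection itself need not be linear.\<close>

lemma ex_cmod_model:
  assumes hN: "hc_module n N"
  shows "\<exists>M :: cmod. hc_module n M \<and> smod_even_iso (hecke_clifford n) N M"
proof -
  interpret N: supermodule "hecke_clifford n" N using hN by (simp add: hc_module_def)
  obtain S where S: "finite S" "S \<subseteq> carrier N"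
    "\<forall>v\<in>carrier N. \<exists>f. v = (\<Oplus>\<^bsub>N\<^esub>s\<in>S. hc_scalar (f s) \<odot>\<^bsub>N\<^esub> s)"
    using hN unfolding hc_module_def fin_dim_def by auto
  obtain co where "\<forall>v\<in>carrier N. v = (\<Oplus>\<^bsub>N\<^esub>s\<in>S. hc_scalar (co v s) \<odot>\<^bsub>N\<^esub> s)"
    using bchoice[OF S(3)] by blast
  then have co: "v = (\<Oplus>\<^bsub>N\<^esub>s\<in>S. hc_scalar (co v s) \<odot>\<^bsub>N\<^esub> s)" if "v \<in> carrier N" for v
    using that by blast
  obtain xs where xs: "set xs = S" using finite_list[OF S(1)] by blast
  let ?g = "\<lambda>v i. if i < length xs then co v (xs ! i) else 0"
  have "inj_on ?g (carrier N)"
  proof (rule inj_onI)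
    fix u v assume uv: "u \<in> carrier N" "v \<in> carrier N" "?g u = ?g v"
    have "co u s = co v s" if s: "s \<in> S" for s
    proof -
      obtain i where "i < length xs" "s = xs ! i" using s unfolding xs[symmetric] in_set_conv_nth by blast
      then show ?thesis using fun_cong[OF uv(3), of i] by simp
    qed
    then have "(\<Oplus>\<^bsub>N\<^esub>s\<in>S. hc_scalar (co u s) \<odot>\<^bsub>N\<^esub> s) = (\<Oplus>\<^bsub>N\<^esub>s\<in>S. hc_scalar (co v s) \<odot>\<^bsub>N\<^esub> s)"
      using S(2) by (intro N.finsum_cong') (auto intro!: N.act_closed)
    then show "u = v" using co uv by simp
  qed
  then obtain g :: "_ \<Rightarrow> nat \<Rightarrow> complex" where inj: "inj_on g (carrier N)" by blast
  let ?h = "the_inv_into (carrier N) g"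
  have hg: "?h (g v) = v" if "v \<in> carrier N" for v using the_inv_into_f_f[OF inj that] .
  let ?M = "\<lparr>carrier = g ` carrier N, mult = undefined, one = undefined, zero = g \<zero>\<^bsub>N\<^esub>,
    add = (\<lambda>x y. g (?h x \<oplus>\<^bsub>N\<^esub> ?h y)), smult = (\<lambda>a x. g (a \<odot>\<^bsub>N\<^esub> ?h x)), part = (\<lambda>p. g ` part N p)\<rparr> :: cmod"
  have "bij_betw g (carrier N) (carrier ?M)" using inj by (simp add: bij_betw_def)
  note tr = hc_module_transport[OF hN this]
  have "hc_module n ?M" by (rule tr(1)) (simp_all add: hg)
  moreover have "smod_even_iso (hecke_clifford n) N ?M" by (rule tr(2)) (simp_all add: hg)
  ultimately show ?thesis by blast
qed

section \<open>Parity shift\<close>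

lemma parity_shift_simps [simp]:
  "carrier (parity_shift M) = carrier M" "\<zero>\<^bsub>parity_shift M\<^esub> = \<zero>\<^bsub>M\<^esub>"
  "add (parity_shift M) = add M" "part (parity_shift M) p = part M (\<not> p)"
  "smult (parity_shift M) a v = hc_grading a \<odot>\<^bsub>M\<^esub> v"
  by (simp_all add: parity_shift_def)

lemma a_inv_cong: "carrier M = carrier N \<Longrightarrow> add M = add N \<Longrightarrow> \<zero>\<^bsub>M\<^esub> = \<zero>\<^bsub>N\<^esub> \<Longrightarrow> a_inv M = a_inv N"
  by (simp add: a_inv_def m_inv_def fun_eq_iff)

lemma parity_shift_supermodule:
  assumes "supermodule (hecke_clifford n) M"
  shows "supermodule (hecke_clifford n) (parity_shift M)"
proof -
  interpret M: supermodule "hecke_clifford n" M by fact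
  have ag: "abelian_group (parity_shift M)"
    by (rule abelian_groupI) (auto simp: M.a_ac intro: bexI[of _ "\<ominus>\<^bsub>M\<^esub> x" for x] M.l_neg)
  show ?thesis
  proof (intro supermodule.intro ag supermodule_axioms.intro; (simp only: parity_shift_simps)?)
    fix a b u v assume a: "a \<in> hecke_clifford n" and v: "v \<in> carrier M"
    note g = hc_grading_closed
    show "hc_grading a \<odot>\<^bsub>M\<^esub> v \<in> carrier M" using a v by (intro M.act_closed g)
    assume b: "b \<in> hecke_clifford n"
    show "hc_grading (a + b) \<odot>\<^bsub>M\<^esub> v = hc_grading a \<odot>\<^bsub>M\<^esub> v \<oplus>\<^bsub>M\<^esub> hc_grading b \<odot>\<^bsub>M\<^esub> v"
      using a b v by (simp add: hc_grading_add M.act_add_left g)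
    show "hc_grading (a \<star> b) \<odot>\<^bsub>M\<^esub> v = hc_grading a \<odot>\<^bsub>M\<^esub> (hc_grading b \<odot>\<^bsub>M\<^esub> v)"
      using a b v by (simp add: hc_grading_mult[OF a b] M.act_mult g)
  next
    fix a u v assume "a \<in> hecke_clifford n" "u \<in> carrier M" "v \<in> carrier M"
    then show "hc_grading a \<odot>\<^bsub>M\<^esub> (u \<oplus>\<^bsub>M\<^esub> v) = hc_grading a \<odot>\<^bsub>M\<^esub> u \<oplus>\<^bsub>M\<^esub> hc_grading a \<odot>\<^bsub>M\<^esub> v"
      by (intro M.act_add_right hc_grading_closed)
  next
    fix v assume "v \<in> carrier M"
    then show "hc_grading (hc_scalar 1) \<odot>\<^bsub>M\<^esub> v = v" by (simp add: M.act_one)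
  next
    fix p
    interpret P: abelian_group "parity_shift M" by (rule ag)
    have "a_inv (parity_shift M) = a_inv M" by (rule a_inv_cong) simp_all
    then show "additive_subgroup (part M (\<not> p)) (parity_shift M)"
      by (intro P.additive_subgroup_of_closed) (auto simp: M.part_carrier M.part_add M.part_minus)
  next
    have "part M p <+>\<^bsub>M\<^esub> part M q \<subseteq> part M q <+>\<^bsub>M\<^esub> part M p" for p q
    proof
      fix x assume "x \<in> part M p <+>\<^bsub>M\<^esub> part M q"
      then obtain h k where hk: "h \<in> part M p" "k \<in> part M q" "x = h \<oplus>\<^bsub>M\<^esub> k"
        unfolding set_add_def' by blast
      then have "x = k \<oplus>\<^bsub>M\<^esub> h" by (simp add: M.a_comm M.part_carrier)
      then show "x \<in> part M q <+>\<^bsub>M\<^esub> part M p" using hk unfolding set_add_def' by blast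
    qed
    then have "part M True <+>\<^bsub>M\<^esub> part M False = part M False <+>\<^bsub>M\<^esub> part M True" by blast
    then show "carrier M = part M (\<not> False) <+>\<^bsub>parity_shift M\<^esub> part M (\<not> True)"
      using M.part_sum by (simp add: set_add_def')
    show "part M (\<not> False) \<inter> part M (\<not> True) = {\<zero>\<^bsub>M\<^esub>}" using M.part_inter by auto
  next
    fix a p v r assume a: "a \<in> hecke_clifford n \<inter> hc_part p" and v: "v \<in> part M (\<not> r)"
    have "hc_grading a \<in> hecke_clifford n \<inter> hc_part p"
      using a hc_grading_closed hc_grading_part_closed by blast
    from M.part_act[OF this v] show "hc_grading a \<odot>\<^bsub>M\<^esub> v \<in> part M (\<not> (p \<noteq> r))"
      by (cases p; cases r) auto
  qed
qed

lemma parity_shift_hc_module: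
  assumes "hc_module n M" shows "hc_module n (parity_shift M)"
proof -
  have M: "supermodule (hecke_clifford n) M" and fd: "fin_dim M" using assms by (auto simp: hc_module_def)
  have P: "supermodule (hecke_clifford n) (parity_shift M)" by (rule parity_shift_supermodule[OF M])
  obtain S where S: "finite S" "S \<subseteq> carrier M" "carrier M \<subseteq> lin_span M S"
    using fin_dim_iff[OF M] fd by auto
  have "v \<in> lin_span (parity_shift M) S" if "v \<in> lin_span M S" for v
    using that
  proof induction
    case zero
    then show ?case using lin_span.zero[of "parity_shift M" S] by simp
  next
    case (step x s c)
    then show ?case using lin_span.step[of x "parity_shift M" S s c] by simp
  qed
  then have "fin_dim (parity_shift M)"
    using S by (intro iffD2[OF fin_dim_iff[OF P]] exI[of _ S]) auto
  then show ?thesis using P by (simp add: hc_module_def)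
qed

lemma odd_hom_parity_shift:
  assumes f: "shom_part (hecke_clifford n) True M N f" and N: "supermodule (hecke_clifford n) N"
  shows "shom_part (hecke_clifford n) False M (parity_shift N) f"
proof -
  interpret N: supermodule "hecke_clifford n" N by fact
  have cl: "f v \<in> carrier N" if "v \<in> carrier M" for v using f that unfolding shom_part_def by auto
  have "hc_grading a \<odot>\<^bsub>N\<^esub> f v = (if r then \<ominus>\<^bsub>N\<^esub> (a \<odot>\<^bsub>N\<^esub> f v) else a \<odot>\<^bsub>N\<^esub> f v)"
    if "a \<in> hecke_clifford n \<inter> hc_part r" "v \<in> carrier M" for a r v
    using that cl N.act_minus_left[of a "f v"] hc_minus_closed[of a n] by (auto simp: hc_grading_part)
  note key = this
  note F = f[unfolded shom_part_def]
  note f1 = F[THEN conjunct1] and f2 = F[THEN conjunct2, THEN conjunct1]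
    and f3 = F[THEN conjunct2, THEN conjunct2, THEN conjunct1]
    and f4 = F[THEN conjunct2, THEN conjunct2, THEN conjunct2]
  show ?thesis unfolding shom_part_def
  proof (intro conjI allI ballI)
    fix r a v assume av: "a \<in> hecke_clifford n \<inter> hc_part r" "v \<in> carrier M"
    have "f (a \<odot>\<^bsub>M\<^esub> v) = (if r then \<ominus>\<^bsub>N\<^esub> (a \<odot>\<^bsub>N\<^esub> f v) else a \<odot>\<^bsub>N\<^esub> f v)"
      using f4[THEN spec, THEN bspec, OF av(1), THEN bspec, OF av(2)] by simp
    then show "f (a \<odot>\<^bsub>M\<^esub> v) = (if False \<and> r then \<ominus>\<^bsub>parity_shift N\<^esub> (a \<odot>\<^bsub>parity_shift N\<^esub> f v)
        else a \<odot>\<^bsub>parity_shift N\<^esub> f v)"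
      using key[OF av] by simp
  next
    fix r
    show "f ` part M r \<subseteq> part (parity_shift N) (False \<noteq> r)"
      using f3[THEN spec, of r] by simp
  qed (use f1 f2 in simp_all)
qed

lemma parity_shift_even_iso:
  assumes "smod_even_iso (hecke_clifford n) M N"
    and M: "supermodule (hecke_clifford n) M" and N: "supermodule (hecke_clifford n) N"
  shows "smod_even_iso (hecke_clifford n) (parity_shift M) (parity_shift N)"
proof -
  obtain f where f: "shom_part (hecke_clifford n) False M N f" "bij_betw f (carrier M) (carrier N)"
    using assms(1) unfolding smod_even_iso_def by auto
  have "shom_part (hecke_clifford n) False (parity_shift M) (parity_shift N) f"
    by (rule even_homI) (auto simp: even_homD[OF f(1)] even_hom_act[OF f(1) M N] hc_grading_closed)
  then show ?thesis using f(2) unfolding smod_even_iso_def by auto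
qed

section \<open>The Grothendieck group\<close>

lemma subspace_K_relations: "fs.subspace K_relations"
  unfolding K_relations_def by (rule fs.subspace_span)

abbreviation module_class :: "nat \<Rightarrow> cmod \<Rightarrow> (nat \<times> cmod \<Rightarrow>\<^sub>0 complex) set" where
  "module_class n M \<equiv> fcoset K_relations (fbasis (n, M))"

lemma module_class_ses:
  assumes "hc_module n M" "hc_module n M'" "hc_module n M''" "short_exact (hecke_clifford n) M' M M''"
  shows "module_class n M = qadd (module_class n M') (module_class n M'')"
proof -
  have "fbasis (n, M) - fbasis (n, M') - fbasis (n, M'') \<in> K_relations"
    unfolding K_relations_def by (rule fs.span_base) (use assms in blast)
  then show ?thesis
    by (simp add: qadd_fcoset[OF subspace_K_relations] fcoset_eq_iff[OF subspace_K_relations] diff_diff_eq)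
qed

lemma module_class_parity_shift:
  assumes "hc_module n M" shows "module_class n (parity_shift M) = module_class n M"
proof -
  have "fbasis (n, parity_shift M) - fbasis (n, M) \<in> K_relations"
    unfolding K_relations_def by (rule fs.span_base) (use assms in blast)
  then show ?thesis by (simp add: fcoset_eq_iff[OF subspace_K_relations])
qed

lemma module_class_K_space: "hc_module n M \<Longrightarrow> module_class n M \<in> K_space"
  unfolding K_space_def by (intro imageI free_space_single) simp

definition zero_cmod :: cmod where
  "zero_cmod = \<lparr>carrier = {\<lambda>_. 0}, mult = undefined, one = undefined, zero = \<lambda>_. 0,
    add = \<lambda>_ _ _. 0, smult = \<lambda>_ _ _. 0, part = \<lambda>_. {\<lambda>_. 0}\<rparr>"

lemma hc_module_zero_cmod: "hc_module n zero_cmod"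
proof -
  have ag: "abelian_group zero_cmod"
    by (rule abelian_groupI) (auto simp: zero_cmod_def)
  interpret abelian_group zero_cmod by (rule ag)
  have inv: "\<ominus>\<^bsub>zero_cmod\<^esub> (\<lambda>_. 0) = (\<lambda>_. 0)"
    using a_inv_closed[of "\<lambda>_. 0"] by (simp add: zero_cmod_def)
  have "supermodule (hecke_clifford n) zero_cmod"
  proof (intro supermodule.intro ag supermodule_axioms.intro)
    show "additive_subgroup (part zero_cmod p) zero_cmod" for p
      by (rule additive_subgroup_of_closed) (use inv in \<open>auto simp: zero_cmod_def\<close>)
  qed (auto simp: zero_cmod_def set_add_def')
  moreover from this have "fin_dim zero_cmod"
    by (intro iffD2[OF fin_dim_iff] exI[of _ "{}"]) (auto simp: zero_cmod_def intro: lin_span.zero[of zero_cmod, unfolded zero_cmod_def, simplified])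
  ultimately show ?thesis by (simp add: hc_module_def)
qed

lemma short_exact_zero_left:
  assumes Z: "hc_module n Z" "carrier Z = {\<zero>\<^bsub>Z\<^esub>}" and M: "hc_module n M" and N: "hc_module n N"
    and iso: "smod_even_iso (hecke_clifford n) M N"
  shows "short_exact (hecke_clifford n) Z M N"
proof -
  have sM: "supermodule (hecke_clifford n) M" and sN: "supermodule (hecke_clifford n) N"
    and sZ: "supermodule (hecke_clifford n) Z" using assms by (auto simp: hc_module_def)
  interpret M: supermodule "hecke_clifford n" M by fact
  interpret Z: supermodule "hecke_clifford n" Z by fact
  obtain g where g: "shom_part (hecke_clifford n) False M N g" "bij_betw g (carrier M) (carrier N)"
    using iso unfolding smod_even_iso_def by auto
  have f: "shom_part (hecke_clifford n) False Z M (\<lambda>_. \<zero>\<^bsub>M\<^esub>)"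
    by (rule even_homI) (auto simp: M.act_zero_right)
  have inj: "inj_on g (carrier M)" and im: "g ` carrier M = carrier N" using g(2) by (auto simp: bij_betw_def)
  have g0: "g \<zero>\<^bsub>M\<^esub> = \<zero>\<^bsub>N\<^esub>" by (rule even_hom_zero[OF g(1) sM sN])
  have ker: "{v \<in> carrier M. g v = \<zero>\<^bsub>N\<^esub>} = {\<zero>\<^bsub>M\<^esub>}"
    unfolding g0[symmetric] using inj_on_eq_iff[OF inj] M.zero_closed by blast
  show ?thesis unfolding short_exact_def
  proof (intro exI conjI)
    show "inj_on (\<lambda>_. \<zero>\<^bsub>M\<^esub>) (carrier Z)" unfolding Z(2) by simp
    show "(\<lambda>_. \<zero>\<^bsub>M\<^esub>) ` carrier Z = {v \<in> carrier M. g v = \<zero>\<^bsub>N\<^esub>}" unfolding Z(2) ker by simp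
  qed (rule f, rule g(1), rule im)
qed

text \<open>For a zero module \<open>M\<close>, the sequence \<open>0 \<rightarrow> M \<rightarrow> M
  \<rightarrow> M \<rightarrow> 0\<close> is exact.\<close>

lemma module_class_zero:
  assumes "hc_module n M" "carrier M = {\<zero>\<^bsub>M\<^esub>}"
  shows "fbasis (n, M) \<in> K_relations"
proof -
  have "smod_even_iso (hecke_clifford n) M M"
    unfolding smod_even_iso_def by (intro exI[of _ "\<lambda>x. x"] conjI even_homI) (auto simp: bij_betw_def)
  then have "short_exact (hecke_clifford n) M M M"
    using assms by (intro short_exact_zero_left)
  then have "module_class n M = qadd (module_class n M) (module_class n M)"
    using assms by (intro module_class_ses)
  then have "fbasis (n, M) - (fbasis (n, M) + fbasis (n, M)) \<in> K_relations"
    by (simp add: qadd_fcoset[OF subspace_K_relations] fcoset_eq_iff[OF subspace_K_relations])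
  then show ?thesis using fs.subspace_neg[OF subspace_K_relations] by fastforce
qed

text \<open>An isomorphism is the second map of a short exact sequence that starts with a zero
  module.\<close>

lemma module_class_iso:
  assumes M: "hc_module n M" and N: "hc_module n N" and iso: "smod_even_iso (hecke_clifford n) M N"
  shows "module_class n M = module_class n N"
proof -
  have car: "carrier zero_cmod = {\<zero>\<^bsub>zero_cmod\<^esub>}" by (simp add: zero_cmod_def)
  have "short_exact (hecke_clifford n) zero_cmod M N"
    using assms hc_module_zero_cmod car by (intro short_exact_zero_left)
  then have "module_class n M = qadd (module_class n zero_cmod) (module_class n N)"
    using assms hc_module_zero_cmod by (intro module_class_ses)
  also have "\<dots> = module_class n N"
    using module_class_zero[OF hc_module_zero_cmod car]
    by (simp add: qadd_fcoset[OF subspace_K_relations] fcoset_eq_iff[OF subspace_K_relations])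
  finally show ?thesis .
qed

lemma K_class_eq:
  assumes N: "hc_module n N" and M: "hc_module n M" and iso: "smod_even_iso (hecke_clifford n) M N"
  shows "K_class n N = module_class n M"
proof -
  let ?P = "\<lambda>M :: cmod. hc_module n M \<and> smod_even_iso (hecke_clifford n) M N"
  have "?P (SOME M. ?P M)" by (rule someI[of ?P M]) (use M iso in blast)
  then have M0: "hc_module n (SOME M. ?P M)" "smod_even_iso (hecke_clifford n) (SOME M. ?P M) N" by blast+
  have "smod_even_iso (hecke_clifford n) N M"
    by (rule even_iso_sym[OF iso]) (use M N in \<open>auto simp: hc_module_def\<close>)
  then have "smod_even_iso (hecke_clifford n) (SOME M. ?P M) M" by (rule even_iso_trans[OF M0(2)])
  then show ?thesis unfolding K_class_def using M0(1) M by (intro module_class_iso)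
qed

lemma ex_model:
  assumes "hc_module n N"
  obtains M :: cmod where "hc_module n M" "smod_even_iso (hecke_clifford n) M N"
    "K_class n N = module_class n M"
proof -
  obtain M :: cmod where M: "hc_module n M" "smod_even_iso (hecke_clifford n) N M"
    using ex_cmod_model[OF assms] by blast
  then have "smod_even_iso (hecke_clifford n) M N"
    by (intro even_iso_sym[OF M(2)]) (use assms M(1) in \<open>auto simp: hc_module_def\<close>)
  then show ?thesis using that K_class_eq[OF assms] M by blast
qed

lemma short_exact_model:
  assumes ses: "short_exact (hecke_clifford n) N' N N''"
    and h: "hc_module n N'" "hc_module n N" "hc_module n N''" "hc_module n M'" "hc_module n M" "hc_module n M''"
    and iso: "smod_even_iso (hecke_clifford n) M' N'" "smod_even_iso (hecke_clifford n) M N" "smod_even_iso (hecke_clifford n) M'' N''"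
  shows "short_exact (hecke_clifford n) M' M M''"
proof -
  note sm = h[unfolded hc_module_def, THEN conjunct1]
  obtain a a' where a: "shom_part (hecke_clifford n) False M' N' a" "shom_part (hecke_clifford n) False N' M' a'"
    "\<And>v. v \<in> carrier M' \<Longrightarrow> a' (a v) = v" "\<And>v. v \<in> carrier N' \<Longrightarrow> a (a' v) = v"
    using even_iso_inverse[OF iso(1) sm(4) sm(1)] by blast
  obtain b b' where b: "shom_part (hecke_clifford n) False M N b" "shom_part (hecke_clifford n) False N M b'"
    "\<And>v. v \<in> carrier M \<Longrightarrow> b' (b v) = v" "\<And>v. v \<in> carrier N \<Longrightarrow> b (b' v) = v"
    using even_iso_inverse[OF iso(2) sm(5) sm(2)] by blast
  obtain c c' where c: "shom_part (hecke_clifford n) False M'' N'' c" "shom_part (hecke_clifford n) False N'' M'' c'"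
    "\<And>v. v \<in> carrier M'' \<Longrightarrow> c' (c v) = v" "\<And>v. v \<in> carrier N'' \<Longrightarrow> c (c' v) = v"
    using even_iso_inverse[OF iso(3) sm(6) sm(3)] by blast
  obtain f g where f: "shom_part (hecke_clifford n) False N' N f" "inj_on f (carrier N')"
    and g: "shom_part (hecke_clifford n) False N N'' g" "g ` carrier N = carrier N''"
    and ex: "f ` carrier N' = {v \<in> carrier N. g v = \<zero>\<^bsub>N''\<^esub>}"
    using ses unfolding short_exact_def by auto
  note cl = even_homD(1)[OF a(1)] even_homD(1)[OF a(2)] even_homD(1)[OF b(1)] even_homD(1)[OF b(2)]
    even_homD(1)[OF c(1)] even_homD(1)[OF c(2)] even_homD(1)[OF f(1)] even_homD(1)[OF g(1)]
  let ?f = "\<lambda>v. b' (f (a v))" and ?g = "\<lambda>v. c' (g (b v))"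
  have "inj_on ?f (carrier M')"
    by (rule inj_on_inverseI[of _ "\<lambda>v. a' (the_inv_into (carrier N') f (b v))"])
      (simp add: a b cl the_inv_into_f_f[OF f(2)])
  moreover have "?g ` carrier M = carrier M''"
  proof (intro equalityI subsetI)
    fix y assume y: "y \<in> carrier M''"
    then obtain x where "x \<in> carrier N" "c y = g x" using g(2) cl by blast
    then have "y = ?g (b' x)" using y by (metis b(4) c(3))
    then show "y \<in> ?g ` carrier M" using \<open>x \<in> carrier N\<close> cl by blast
  qed (use cl in auto)
  moreover have "?f ` carrier M' = {v \<in> carrier M. ?g v = \<zero>\<^bsub>M''\<^esub>}"
  proof (intro equalityI subsetI)
    fix y assume "y \<in> ?f ` carrier M'"
    then obtain x where x: "x \<in> carrier M'" "y = ?f x" by blast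
    have "f (a x) \<in> {v \<in> carrier N. g v = \<zero>\<^bsub>N''\<^esub>}" using x(1) cl ex by blast
    then show "y \<in> {v \<in> carrier M. ?g v = \<zero>\<^bsub>M''\<^esub>}"
      using x cl b(4) even_hom_zero[OF c(2) sm(3) sm(6)] by auto
  next
    fix y assume "y \<in> {v \<in> carrier M. ?g v = \<zero>\<^bsub>M''\<^esub>}"
    then have y: "y \<in> carrier M" "?g y = \<zero>\<^bsub>M''\<^esub>" by auto
    have "g (b y) = c (?g y)" using c(4) cl y(1) by simp
    then have "g (b y) = \<zero>\<^bsub>N''\<^esub>" using y(2) even_hom_zero[OF c(1) sm(6) sm(3)] by simp
    then have "b y \<in> f ` carrier N'" using even_homD(1)[OF b(1) y(1)] unfolding ex by simp
    then obtain x where "x \<in> carrier N'" "b y = f x" by blast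
    then have "y = ?f (a' x)" using a(4)[of x] b(3)[OF y(1)] by simp
    then show "y \<in> ?f ` carrier M'" using \<open>x \<in> carrier N'\<close> cl by blast
  qed
  ultimately show ?thesis unfolding short_exact_def
    using even_hom_compose[OF even_hom_compose[OF a(1) f(1)] b(2)]
      even_hom_compose[OF even_hom_compose[OF b(1) g(1)] c(2)] by blast
qed

locale char_map =
  fixes ch :: "(nat \<times> cmod \<Rightarrow>\<^sub>0 complex) set \<Rightarrow> symfun"
  assumes ch: "characteristic_map ch"
begin

definition chi :: "nat \<Rightarrow> (hc, 'v) smod \<Rightarrow> symfun" where
  "chi n N = ch (K_class n N)"

lemma chi_iso:
  assumes "hc_module n N" "hc_module n N'" "smod_even_iso (hecke_clifford n) N N'"
  shows "chi n N = chi n N'"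
proof -
  obtain M :: cmod where M: "hc_module n M" "smod_even_iso (hecke_clifford n) M N" "K_class n N = module_class n M"
    using ex_model[OF assms(1)] by blast
  have "K_class n N' = module_class n M"
    using assms(2) M(1) even_iso_trans[OF M(2) assms(3)] by (rule K_class_eq)
  then show ?thesis using M(3) by (simp add: chi_def)
qed

lemma chi_parity_shift:
  assumes "hc_module n N" shows "chi n (parity_shift N) = chi n N"
proof -
  obtain M :: cmod where M: "hc_module n M" "smod_even_iso (hecke_clifford n) M N" "K_class n N = module_class n M"
    using ex_model[OF assms] by blast
  have "smod_even_iso (hecke_clifford n) (parity_shift M) (parity_shift N)"
    using M assms by (intro parity_shift_even_iso) (auto simp: hc_module_def)
  then have "K_class n (parity_shift N) = module_class n (parity_shift M)"
    using M assms by (intro K_class_eq parity_shift_hc_module)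
  then show ?thesis using M by (simp add: chi_def module_class_parity_shift)
qed

lemma chi_ses:
  assumes h: "hc_module n N'" "hc_module n N" "hc_module n N''"
    and ses: "short_exact (hecke_clifford n) N' N N''"
  shows "chi n N = (\<lambda>m. chi n N' m + chi n N'' m)"
proof -
  obtain M' :: cmod where M': "hc_module n M'" "smod_even_iso (hecke_clifford n) M' N'" "K_class n N' = module_class n M'"
    using ex_model[OF h(1)] by blast
  obtain M :: cmod where M: "hc_module n M" "smod_even_iso (hecke_clifford n) M N" "K_class n N = module_class n M"
    using ex_model[OF h(2)] by blast
  obtain M'' :: cmod where M'': "hc_module n M''" "smod_even_iso (hecke_clifford n) M'' N''" "K_class n N'' = module_class n M''"
    using ex_model[OF h(3)] by blast
  have "short_exact (hecke_clifford n) M' M M''"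
    by (rule short_exact_model[OF ses h M'(1) M(1) M''(1) M'(2) M(2) M''(2)])
  then have "module_class n M = qadd (module_class n M') (module_class n M'')"
    by (rule module_class_ses[OF M(1) M'(1) M''(1)])
  moreover have "ch (qadd X Y) = (\<lambda>m. ch X m + ch Y m)" if "X \<in> K_space" "Y \<in> K_space" for X Y
    using ch that unfolding characteristic_map_def by blast
  ultimately show ?thesis using M M' M'' by (simp add: chi_def module_class_K_space)
qed

lemma chi_zero:
  assumes "hc_module n N" "carrier N = {\<zero>\<^bsub>N\<^esub>}" shows "chi n N = (\<lambda>m. 0)"
proof -
  have "smod_even_iso (hecke_clifford n) N N"
    unfolding smod_even_iso_def by (intro exI[of _ "\<lambda>x. x"] conjI even_homI) (auto simp: bij_betw_def)
  then have "short_exact (hecke_clifford n) N N N" using assms by (intro short_exact_zero_left)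
  then have "chi n N = (\<lambda>m. chi n N m + chi n N m)" using assms by (intro chi_ses)
  then show ?thesis by (simp add: fun_eq_iff)
qed

end

section \<open>Submodules and quotients\<close>

lemma (in supermodule) part_unique2:
  assumes "a \<in> part M False" "a' \<in> part M False" "b \<in> part M True" "b' \<in> part M True" "a \<oplus> b = a' \<oplus> b'"
  shows "a = a'" "b = b'"
proof -
  have c: "a \<in> carrier M" "a' \<in> carrier M" "b \<in> carrier M" "b' \<in> carrier M"
    using assms part_carrier by auto
  have "(a \<oplus> \<ominus> a') \<oplus> (b \<oplus> \<ominus> b') = (a \<oplus> b) \<oplus> \<ominus> (a' \<oplus> b')"
    using c by (simp add: minus_add a_ac)
  also have "\<dots> = \<zero>" unfolding assms(5) using c by (simp add: r_neg)
  finally have z: "(a \<oplus> \<ominus> a') \<oplus> (b \<oplus> \<ominus> b') = \<zero>" .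
  have "a \<oplus> \<ominus> a' \<in> part M False" "b \<oplus> \<ominus> b' \<in> part M True"
    using assms part_add part_minus by auto
  then have d: "a \<oplus> \<ominus> a' = \<zero>" "b \<oplus> \<ominus> b' = \<zero>" using part_sum_zero z by blast+
  show "a = a'" using minus_equality[OF d(1)] c by simp
  show "b = b'" using minus_equality[OF d(2)] c by simp
qed

lemma subsupermodule_iff:
  assumes N: "supermodule (hecke_clifford n) N"
  shows "subsupermodule (hecke_clifford n) N W \<longleftrightarrow>
    W \<subseteq> carrier N \<and> \<zero>\<^bsub>N\<^esub> \<in> W \<and> (\<forall>x\<in>W. \<forall>y\<in>W. x \<oplus>\<^bsub>N\<^esub> y \<in> W) \<and>
    (\<forall>a\<in>hecke_clifford n. \<forall>v\<in>W. a \<odot>\<^bsub>N\<^esub> v \<in> W) \<and>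
    (\<forall>v\<in>W. \<exists>v0\<in>W \<inter> part N False. \<exists>v1\<in>W \<inter> part N True. v = v0 \<oplus>\<^bsub>N\<^esub> v1)" (is "?L \<longleftrightarrow> ?R")
proof
  interpret N: supermodule "hecke_clifford n" N by fact
  assume L: ?L
  then interpret W: additive_subgroup W N by (simp add: subsupermodule_def)
  have W: "W = (W \<inter> part N False) <+>\<^bsub>N\<^esub> (W \<inter> part N True)" using L by (simp add: subsupermodule_def)
  have "\<exists>v0\<in>W \<inter> part N False. \<exists>v1\<in>W \<inter> part N True. v = v0 \<oplus>\<^bsub>N\<^esub> v1" if "v \<in> W" for v
  proof -
    have "v \<in> (W \<inter> part N False) <+>\<^bsub>N\<^esub> (W \<inter> part N True)" using that W by blast
    then show ?thesis unfolding set_add_def' by blast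
  qed
  then show ?R using L W.a_subset W.a_closed W.zero_closed by (simp add: subsupermodule_def)
next
  interpret N: supermodule "hecke_clifford n" N by fact
  assume R: ?R
  have "\<ominus>\<^bsub>N\<^esub> v \<in> W" if v: "v \<in> W" for v
  proof -
    have "v \<in> carrier N" using v R by blast
    then have "\<ominus>\<^bsub>N\<^esub> v = (- hc_scalar 1) \<odot>\<^bsub>N\<^esub> v"
      using N.act_minus_left[of "hc_scalar 1" v] hc_minus_closed[OF hc_scalar_closed] by (simp add: N.act_one)
    then show ?thesis using R v hc_minus_closed[OF hc_scalar_closed, of 1 n] by metis
  qed
  then have "additive_subgroup W N"
    using R by (intro N.additive_subgroup_of_closed) auto
  moreover have "W = (W \<inter> part N False) <+>\<^bsub>N\<^esub> (W \<inter> part N True)"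
  proof (intro equalityI subsetI)
    fix v assume "v \<in> W"
    then obtain v0 v1 where "v0 \<in> W \<inter> part N False" "v1 \<in> W \<inter> part N True" "v = v0 \<oplus>\<^bsub>N\<^esub> v1" using R by blast
    then show "v \<in> (W \<inter> part N False) <+>\<^bsub>N\<^esub> (W \<inter> part N True)" unfolding set_add_def' by blast
  next
    fix v assume "v \<in> (W \<inter> part N False) <+>\<^bsub>N\<^esub> (W \<inter> part N True)"
    then obtain v0 v1 where "v0 \<in> W" "v1 \<in> W" "v = v0 \<oplus>\<^bsub>N\<^esub> v1" unfolding set_add_def' by blast
    then show "v \<in> W" using R by blast
  qed
  ultimately show ?L using R by (simp add: subsupermodule_def)
qed

lemma restrict_smod_simps [simp]:
  "carrier (restrict_smod M W) = W" "\<zero>\<^bsub>restrict_smod M W\<^esub> = \<zero>\<^bsub>M\<^esub>"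
  "add (restrict_smod M W) = add M" "smult (restrict_smod M W) = smult M"
  "part (restrict_smod M W) p = W \<inter> part M p"
  by (simp_all add: restrict_smod_def)

lemma restrict_supermodule:
  assumes N: "supermodule (hecke_clifford n) N" and W: "subsupermodule (hecke_clifford n) N W"
  shows "supermodule (hecke_clifford n) (restrict_smod N W)"
proof -
  interpret N: supermodule "hecke_clifford n" N by fact
  let ?W = "restrict_smod N W"
  note R = W[unfolded subsupermodule_iff[OF N]]
  have sub: "W \<subseteq> carrier N" and z: "\<zero>\<^bsub>N\<^esub> \<in> W" using R by blast+
  have cl: "x \<oplus>\<^bsub>N\<^esub> y \<in> W" if "x \<in> W" "y \<in> W" for x y using R that by blast
  have act: "a \<odot>\<^bsub>N\<^esub> v \<in> W" if "a \<in> hecke_clifford n" "v \<in> W" for a v using R that by blast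
  have dec: "\<exists>v0\<in>W \<inter> part N False. \<exists>v1\<in>W \<inter> part N True. v = v0 \<oplus>\<^bsub>N\<^esub> v1" if "v \<in> W" for v
    using R that by blast
  have car: "x \<in> carrier N" if "x \<in> W" for x using that sub by blast
  have inv: "\<ominus>\<^bsub>N\<^esub> v \<in> W" if "v \<in> W" for v
    using W that by (auto simp: subsupermodule_def intro: additive_subgroup.a_inv_closed)
  have ex: "\<exists>y\<in>W. y \<oplus>\<^bsub>N\<^esub> x = \<zero>\<^bsub>N\<^esub>" if "x \<in> W" for x
    using that inv car by (intro bexI[of _ "\<ominus>\<^bsub>N\<^esub> x"]) (auto simp: N.l_neg)
  have ag: "abelian_group ?W"
    by (rule abelian_groupI; simp) (use z cl car ex in \<open>auto simp: N.a_ac\<close>)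
  interpret W: abelian_group ?W by (rule ag)
  have minus: "\<ominus>\<^bsub>?W\<^esub> v = \<ominus>\<^bsub>N\<^esub> v" if "v \<in> W" for v
    using that inv by (intro W.minus_equality) (auto simp: car N.l_neg)
  show ?thesis
  proof (intro supermodule.intro ag supermodule_axioms.intro; (simp only: restrict_smod_simps)?)
    fix p show "additive_subgroup (W \<inter> part N p) ?W"
      by (rule W.additive_subgroup_of_closed)
        (use z cl inv minus in \<open>auto simp: N.part_add N.part_minus\<close>)
  next
    show "W = (W \<inter> part N False) <+>\<^bsub>?W\<^esub> (W \<inter> part N True)"
      using W unfolding subsupermodule_def set_add_def' by simp
    show "W \<inter> part N False \<inter> (W \<inter> part N True) = {\<zero>\<^bsub>N\<^esub>}" using N.part_inter z by blast
  next
    fix a p v r assume "a \<in> hecke_clifford n \<inter> hc_part p" "v \<in> W \<inter> part N r"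
    then show "a \<odot>\<^bsub>N\<^esub> v \<in> W \<inter> part N (p \<noteq> r)" using act N.part_act[of a p v r] by blast
  qed (use act car in \<open>auto simp: N.act_add_left N.act_add_right N.act_mult N.act_one N.part_act\<close>)
qed

lemma restrict_subsupermodule:
  assumes N: "supermodule (hecke_clifford n) N"
    and W: "subsupermodule (hecke_clifford n) N W" and U: "subsupermodule (hecke_clifford n) N U" "U \<subseteq> W"
  shows "subsupermodule (hecke_clifford n) (restrict_smod N W) U"
  using U subsupermodule_iff[OF N, of U] subsupermodule_iff[OF restrict_supermodule[OF N W], of U]
  by (simp add: Int_assoc[symmetric] Int_absorb2)

lemma quotient_facts:
  assumes N: "supermodule (hecke_clifford n) N" and W: "subsupermodule (hecke_clifford n) N W"
  shows "supermodule (hecke_clifford n) (quotient_smod N W)"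
    and "shom_part (hecke_clifford n) False N (quotient_smod N W) (\<lambda>v. W +>\<^bsub>N\<^esub> v)"
    and "carrier (quotient_smod N W) = (\<lambda>v. W +>\<^bsub>N\<^esub> v) ` carrier N"
    and "u \<in> carrier N \<Longrightarrow> v \<in> carrier N \<Longrightarrow> W +>\<^bsub>N\<^esub> u = W +>\<^bsub>N\<^esub> v \<longleftrightarrow> u \<ominus>\<^bsub>N\<^esub> v \<in> W"
    and "\<zero>\<^bsub>quotient_smod N W\<^esub> = W"
    and "v \<in> carrier N \<Longrightarrow> W +>\<^bsub>N\<^esub> v = W \<longleftrightarrow> v \<in> W"
    and "fin_dim N \<Longrightarrow> fin_dim (quotient_smod N W)"
proof -
  interpret N: supermodule "hecke_clifford n" N by fact
  have "additive_subgroup W N" using W by (simp add: subsupermodule_def)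
  then interpret W: abelian_subgroup W N by (rule abelian_subgroupI3) (rule N.abelian_group_axioms)
  let ?Q = "quotient_smod N W" and ?c = "\<lambda>v. W +>\<^bsub>N\<^esub> v"
  note R = W[unfolded subsupermodule_iff[OF N]]
  have act: "a \<odot>\<^bsub>N\<^esub> v \<in> W" if "a \<in> hecke_clifford n" "v \<in> W" for a v using R that by blast
  show car: "carrier ?Q = ?c ` carrier N"
    by (auto simp: quotient_smod_def A_RCOSETS_def')
  show eq: "?c u = ?c v \<longleftrightarrow> u \<ominus>\<^bsub>N\<^esub> v \<in> W" if "u \<in> carrier N" "v \<in> carrier N" for u v
  proof -
    have "u \<in> ?c v \<longleftrightarrow> u \<ominus>\<^bsub>N\<^esub> v \<in> W" unfolding a_minus_def by (rule W.a_rcos_module[OF that(2,1)])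
    moreover have "u \<in> ?c v \<longleftrightarrow> ?c u = ?c v"
      using that W.a_rcos_self W.a_repr_independence' by blast
    ultimately show ?thesis by simp
  qed
  show zero: "\<zero>\<^bsub>?Q\<^esub> = W" by (simp add: quotient_smod_def)
  have c0: "?c \<zero>\<^bsub>N\<^esub> = W" using W.a_subset by simp
  show mem: "?c v = W \<longleftrightarrow> v \<in> W" if "v \<in> carrier N" for v
  proof -
    have "\<ominus>\<^bsub>N\<^esub> \<zero>\<^bsub>N\<^esub> = \<zero>\<^bsub>N\<^esub>" by (rule N.minus_equality) simp_all
    then have m: "v \<ominus>\<^bsub>N\<^esub> \<zero>\<^bsub>N\<^esub> = v" using that by (simp only: a_minus_def N.r_zero)
    show ?thesis using eq[OF that N.zero_closed] unfolding c0 m .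
  qed
  have add: "?c (u \<oplus>\<^bsub>N\<^esub> v) = ?c u \<oplus>\<^bsub>?Q\<^esub> ?c v" if "u \<in> carrier N" "v \<in> carrier N" for u v
    using W.a_rcos_sum[OF that] by (simp add: quotient_smod_def)
  have smult: "?c (a \<odot>\<^bsub>N\<^esub> v) = a \<odot>\<^bsub>?Q\<^esub> ?c v" if a: "a \<in> hecke_clifford n" and v: "v \<in> carrier N" for a v
  proof -
    have "?c (a \<odot>\<^bsub>N\<^esub> u) = ?c (a \<odot>\<^bsub>N\<^esub> v)" if "u \<in> ?c v" for u
    proof -
      obtain w where w: "w \<in> W" "u = w \<oplus>\<^bsub>N\<^esub> v" using \<open>u \<in> ?c v\<close> unfolding a_r_coset_def' by blast
      have wc: "w \<in> carrier N" using w(1) by simp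
      have "a \<odot>\<^bsub>N\<^esub> u \<ominus>\<^bsub>N\<^esub> a \<odot>\<^bsub>N\<^esub> v = a \<odot>\<^bsub>N\<^esub> w"
        unfolding w(2) a_minus_def using a v wc by (simp add: N.act_add_right N.act_closed N.a_assoc N.r_neg)
      then have "a \<odot>\<^bsub>N\<^esub> u \<ominus>\<^bsub>N\<^esub> a \<odot>\<^bsub>N\<^esub> v \<in> W" using act[OF a w(1)] by simp
      then show ?thesis using eq[of "a \<odot>\<^bsub>N\<^esub> u" "a \<odot>\<^bsub>N\<^esub> v"] a v wc w(2) by (simp add: N.act_closed)
    qed
    moreover have "v \<in> ?c v" using v by (rule W.a_rcos_self)
    ultimately have "(\<Union>u\<in>?c v. ?c (a \<odot>\<^bsub>N\<^esub> u)) = ?c (a \<odot>\<^bsub>N\<^esub> v)" by blast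
    then show ?thesis by (simp add: quotient_smod_def)
  qed
  have part: "part ?Q p = ?c ` part N p" for p by (simp add: quotient_smod_def)
  show Q: "supermodule (hecke_clifford n) ?Q"
  proof (rule supermodule_image[OF N car add _ smult part])
    show "\<zero>\<^bsub>?Q\<^esub> = ?c \<zero>\<^bsub>N\<^esub>" unfolding zero c0 ..
    fix u v assume u: "u \<in> part N False" and v: "v \<in> part N True" and uv: "?c u = ?c v"
    have uc: "u \<in> carrier N" and vc: "v \<in> carrier N" using u v N.part_carrier by auto
    have "u \<ominus>\<^bsub>N\<^esub> v \<in> W" using uv eq[OF uc vc] by simp
    then obtain w0 w1 where w: "w0 \<in> W \<inter> part N False" "w1 \<in> W \<inter> part N True" "u \<ominus>\<^bsub>N\<^esub> v = w0 \<oplus>\<^bsub>N\<^esub> w1"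
      using R by blast
    have "u = w0"
      by (rule N.part_unique2(1)[of u w0 "\<ominus>\<^bsub>N\<^esub> v" w1]) (use u v w N.part_minus in \<open>auto simp: a_minus_def\<close>)
    then show "?c u = \<zero>\<^bsub>?Q\<^esub>" using mem[OF uc] w(1) zero by simp
  qed
  show "shom_part (hecke_clifford n) False N ?Q ?c"
    by (rule even_homI) (use car add smult part in auto)
  show "fin_dim ?Q" if "fin_dim N"
    using fin_dim_image[OF N Q that car add _ smult] zero c0 by simp
qed

lemma short_exact_quotient:
  assumes N: "supermodule (hecke_clifford n) N"
    and W: "subsupermodule (hecke_clifford n) N W" and U: "subsupermodule (hecke_clifford n) N U" "U \<subseteq> W"
  shows "short_exact (hecke_clifford n) (restrict_smod N U) (restrict_smod N W) (quotient_smod (restrict_smod N W) U)"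
proof -
  note q = quotient_facts[OF restrict_supermodule[OF N W] restrict_subsupermodule[OF N W U]]
  have i: "shom_part (hecke_clifford n) False (restrict_smod N U) (restrict_smod N W) (\<lambda>v. v)"
    by (rule even_homI) (use U(2) in auto)
  show ?thesis unfolding short_exact_def
  proof (intro exI conjI)
    show "(\<lambda>v. v) ` carrier (restrict_smod N U) =
      {v \<in> carrier (restrict_smod N W). U +>\<^bsub>restrict_smod N W\<^esub> v = \<zero>\<^bsub>quotient_smod (restrict_smod N W) U\<^esub>}"
      using q(6) U(2) unfolding q(5) by auto
  qed (rule i, rule q(2), simp, rule q(3)[symmetric])
qed

section \<open>Dimensions of submodules\<close>

text \<open>A finite spanning set \<open>S\<close> of \<open>N\<close> gives a linear surjection \<open>T\<close> from the free space on \<open>S\<close> to \<open>N\<close>.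
  Submodules of \<open>N\<close> are compared through their preimages, which live in a vector space type.\<close>

lemma finite_dimensional_presentation:
  fixes N :: "(hc, 'v) smod"
  assumes N: "supermodule (hecke_clifford n) N" and "fin_dim N"
  obtains S :: "'v set" and T where "finite S" "T ` free_space S = carrier N" "T 0 = \<zero>\<^bsub>N\<^esub>"
    "\<And>x y. x \<in> free_space S \<Longrightarrow> y \<in> free_space S \<Longrightarrow> T (x + y) = T x \<oplus>\<^bsub>N\<^esub> T y"
    "\<And>c x. x \<in> free_space S \<Longrightarrow> T (fscale c x) = hc_scalar c \<odot>\<^bsub>N\<^esub> T x"
proof -
  interpret N: supermodule "hecke_clifford n" N by fact
  obtain S where S: "finite S" "S \<subseteq> carrier N"
    and sp: "\<forall>v\<in>carrier N. \<exists>f. v = (\<Oplus>\<^bsub>N\<^esub>s\<in>S. hc_scalar (f s) \<odot>\<^bsub>N\<^esub> s)"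
    using \<open>fin_dim N\<close> unfolding fin_dim_def by auto
  let ?T = "\<lambda>x. \<Oplus>\<^bsub>N\<^esub>s\<in>S. hc_scalar (Poly_Mapping.lookup x s) \<odot>\<^bsub>N\<^esub> s"
  have cl: "hc_scalar c \<odot>\<^bsub>N\<^esub> s \<in> carrier N" if "s \<in> S" for c s
    using that S(2) by (auto intro: N.act_closed)
  have clT: "?T x \<in> carrier N" for x by (intro N.finsum_closed) (use cl in auto)
  have add: "?T (x + y) = ?T x \<oplus>\<^bsub>N\<^esub> ?T y" for x y
  proof -
    have "?T (x + y) = (\<Oplus>\<^bsub>N\<^esub>s\<in>S. hc_scalar (Poly_Mapping.lookup x s) \<odot>\<^bsub>N\<^esub> s \<oplus>\<^bsub>N\<^esub> hc_scalar (Poly_Mapping.lookup y s) \<odot>\<^bsub>N\<^esub> s)"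
      using S(2) by (intro N.finsum_cong') (auto simp: lookup_add hc_scalar_add subset_iff intro: N.act_add_left cl)
    then show ?thesis using cl by (subst N.finsum_addf[symmetric]) auto
  qed
  have scale: "?T (fscale c x) = hc_scalar c \<odot>\<^bsub>N\<^esub> ?T x" for c x
  proof -
    have "(\<Oplus>\<^bsub>N\<^esub>s\<in>S'. hc_scalar (Poly_Mapping.lookup (fscale c x) s) \<odot>\<^bsub>N\<^esub> s)
      = hc_scalar c \<odot>\<^bsub>N\<^esub> (\<Oplus>\<^bsub>N\<^esub>s\<in>S'. hc_scalar (Poly_Mapping.lookup x s) \<odot>\<^bsub>N\<^esub> s)" if "finite S'" "S' \<subseteq> S" for S'
      using that
    proof (induction S')
      case empty
      then show ?case by (simp add: N.act_zero_right)
    next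
      case (insert t S')
      have t: "t \<in> carrier N" using insert.prems S(2) by auto
      have m: "hc_scalar (c * d) \<odot>\<^bsub>N\<^esub> t = hc_scalar c \<odot>\<^bsub>N\<^esub> (hc_scalar d \<odot>\<^bsub>N\<^esub> t)" for d
      proof -
        have "hc_scalar c \<star> hc_scalar d = hc_scalar (c * d)"
          unfolding hc_scalar_mult by (simp add: hc_scalar_def)
        then show ?thesis using N.act_mult[of "hc_scalar c" "hc_scalar d" t] t by simp
      qed
      have c': "(\<lambda>s. hc_scalar (f s) \<odot>\<^bsub>N\<^esub> s) \<in> S' \<rightarrow> carrier N" for f
        using insert.prems cl by auto
      show ?case
        using insert t c' m by (simp add: N.finsum_insert N.act_add_right N.act_closed N.finsum_closed)
    qed
    then show ?thesis using S(1) by simp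
  qed
  have zero: "?T 0 = \<zero>\<^bsub>N\<^esub>"
    by (intro N.add.finprod_one_eqI) (use S(2) in \<open>auto simp: N.act_zero_left\<close>)
  have surj: "?T ` free_space S = carrier N"
  proof (intro equalityI subsetI)
    fix v assume "v \<in> carrier N"
    then obtain f where f: "v = (\<Oplus>\<^bsub>N\<^esub>s\<in>S. hc_scalar (f s) \<odot>\<^bsub>N\<^esub> s)" using sp by blast
    let ?x = "\<Sum>s\<in>S. Poly_Mapping.single s (f s)"
    have "Poly_Mapping.lookup ?x s = f s" if "s \<in> S" for s
      using that S(1) by (simp add: lookup_sum lookup_single when_def)
    then have "?T ?x = v" unfolding f by (intro N.finsum_cong') (use cl in auto)
    moreover have "?x \<in> free_space S" by (intro free_space_sum free_space_single)
    ultimately show "v \<in> ?T ` free_space S" by blast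
  qed (use clT in auto)
  show ?thesis using that[of S ?T] S(1) surj zero add scale by blast
qed

lemma subspace_preimage:
  assumes N: "supermodule (hecke_clifford n) N"
    and add: "\<And>x y. x \<in> free_space S \<Longrightarrow> y \<in> free_space S \<Longrightarrow> T (x + y) = T x \<oplus>\<^bsub>N\<^esub> T y"
    and scale: "\<And>c x. x \<in> free_space S \<Longrightarrow> T (fscale c x) = hc_scalar c \<odot>\<^bsub>N\<^esub> T x" and zero: "T 0 = \<zero>\<^bsub>N\<^esub>"
    and W: "subsupermodule (hecke_clifford n) N W"
  shows "fs.subspace {x \<in> free_space S. T x \<in> W}"
  using W[unfolded subsupermodule_iff[OF N]] zero
  by (auto simp: fs.subspace_def add scale free_space_zero free_space_add free_space_fscale)

lemma dim_less:
  assumes "fs.subspace V" "fs.subspace V'" "V \<subseteq> V'" "V \<noteq> V'" "V' \<subseteq> free_space S" "finite S"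
  shows "fs.dim V < fs.dim V'"
proof -
  have span: "free_space S \<subseteq> fspan (fbasis ` S)"
  proof
    fix x assume "x \<in> free_space S"
    then show "x \<in> fspan (fbasis ` S)"
      by (induction rule: free_space_induct) (auto intro: fs.span_zero fs.span_base fs.span_add fs.span_scale)
  qed
  have fin: "finite B" if "fs.independent B" "B \<subseteq> V'" for B
    using fs.independent_span_bound[of "fbasis ` S" B] that assms span by auto
  obtain B where B: "B \<subseteq> V" "fs.independent B" "V \<subseteq> fspan B" "card B = fs.dim V"
    using fs.basis_exists[of V] by blast
  obtain x where x: "x \<in> V'" "x \<notin> V" using assms by blast
  have "fspan B \<subseteq> V" using B(1) assms(1) by (rule fs.span_minimal)
  then have "x \<notin> fspan B" using x by blast
  then have "fs.independent (insert x B)" using B(2) by (simp add: fs.independent_insert)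
  then obtain C where C: "insert x B \<subseteq> C" "C \<subseteq> V'" "fs.independent C" "V' \<subseteq> fspan C"
    using fs.maximal_independent_subset_extend[of "insert x B" V'] x B assms by blast
  have "card (insert x B) = Suc (card B)" using fin[of B] B x assms by (intro card_insert_disjoint) auto
  moreover have "card (insert x B) \<le> card C" using fin[OF C(3,2)] C(1) by (intro card_mono)
  moreover have "card C = fs.dim V'" using C by (intro fs.basis_card_eq_dim)
  ultimately show ?thesis using B(4) by simp
qed

text \<open>A length function for submodules, together with the finite-dimensionality of submodules.\<close>

lemma submodule_dimension:
  fixes N :: "(hc, 'v) smod"
  assumes N: "supermodule (hecke_clifford n) N" and fd: "fin_dim N"
  obtains d :: "'v set \<Rightarrow> nat" where
    "\<And>U W. subsupermodule (hecke_clifford n) N U \<Longrightarrow> subsupermodule (hecke_clifford n) N W \<Longrightarrow> U \<subset> W \<Longrightarrow> d U < d W"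
    "\<And>W. subsupermodule (hecke_clifford n) N W \<Longrightarrow> hc_module n (restrict_smod N W)"
proof -
  interpret N: supermodule "hecke_clifford n" N by fact
  obtain S and T :: "('v \<Rightarrow>\<^sub>0 complex) \<Rightarrow> 'v" where S: "finite S" "T ` free_space S = carrier N"
    and T: "T 0 = \<zero>\<^bsub>N\<^esub>"
    "\<And>x y. x \<in> free_space S \<Longrightarrow> y \<in> free_space S \<Longrightarrow> T (x + y) = T x \<oplus>\<^bsub>N\<^esub> T y"
    "\<And>c x. x \<in> free_space S \<Longrightarrow> T (fscale c x) = hc_scalar c \<odot>\<^bsub>N\<^esub> T x"
    using finite_dimensional_presentation[OF N fd] by blast
  let ?P = "\<lambda>W. {x \<in> free_space S. T x \<in> W}"
  have sp: "fs.subspace (?P W)" if "subsupermodule (hecke_clifford n) N W" for W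
    by (rule subspace_preimage[OF N _ _ _ that]) (use T in auto)
  show ?thesis
  proof (rule that[of "\<lambda>W. fs.dim (?P W)"])
    fix U W assume U: "subsupermodule (hecke_clifford n) N U" and W: "subsupermodule (hecke_clifford n) N W"
      and "U \<subset> W"
    then obtain w where w: "w \<in> W" "w \<notin> U" by blast
    have "w \<in> carrier N" using w(1) W unfolding subsupermodule_iff[OF N] by blast
    then obtain x where "x \<in> free_space S" "w = T x" using S(2) by blast
    then have "?P U \<noteq> ?P W" using w by blast
    moreover have "?P U \<subseteq> ?P W" using \<open>U \<subset> W\<close> by blast
    ultimately show "fs.dim (?P U) < fs.dim (?P W)"
      by (intro dim_less[OF sp[OF U] sp[OF W] _ _ _ S(1)]) auto
  next
    fix W assume W: "subsupermodule (hecke_clifford n) N W"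
    note rW = restrict_supermodule[OF N W]
    obtain B where B: "B \<subseteq> ?P W" "fs.independent B" "?P W \<subseteq> fspan B" "card B = fs.dim (?P W)"
      using fs.basis_exists[of "?P W"] by blast
    have "free_space S \<subseteq> fspan (fbasis ` S)"
    proof
      fix x assume "x \<in> free_space S"
      then show "x \<in> fspan (fbasis ` S)"
        by (induction rule: free_space_induct) (auto intro: fs.span_zero fs.span_base fs.span_add fs.span_scale)
    qed
    then have fB: "finite B" using fs.independent_span_bound[of "fbasis ` S" B] B S(1) by auto
    have "T x \<in> lin_span (restrict_smod N W) (T ` B) \<and> x \<in> free_space S" if "x \<in> fspan B" for x
      using that
    proof (induction rule: fs.span_induct_alt)
      case base
      then show ?case using lin_span.zero[of "restrict_smod N W"] T(1) by (simp add: free_space_zero)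
    next
      case (step c b y)
      have b: "b \<in> free_space S" using step(1) B(1) by blast
      have "T b \<in> carrier N" "T y \<in> carrier N" using b step(2) S(2) by auto
      then have "T (fscale c b + y) = T y \<oplus>\<^bsub>N\<^esub> hc_scalar c \<odot>\<^bsub>N\<^esub> T b"
        using b step(2) by (simp add: T(2,3) free_space_fscale N.a_comm N.act_closed)
      then show ?case
        using step b lin_span.step[of "T y" "restrict_smod N W" "T ` B" "T b" c]
        by (auto intro: free_space_add free_space_fscale)
    qed
    moreover have "\<exists>x\<in>?P W. w = T x" if "w \<in> W" for w
    proof -
      have "w \<in> T ` free_space S" unfolding S(2) using that W unfolding subsupermodule_iff[OF N] by blast
      then show ?thesis using that by blast
    qed
    ultimately have "W \<subseteq> lin_span (restrict_smod N W) (T ` B)" using B(3) by blast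
    then have "fin_dim (restrict_smod N W)"
      using fB B(1) by (intro iffD2[OF fin_dim_iff[OF rW]] exI[of _ "T ` B"]) auto
    then show "hc_module n (restrict_smod N W)" using rW by (simp add: hc_module_def)
  qed
qed

section \<open>Irreducible modules\<close>

lemma even_hom_kernel:
  assumes f: "shom_part (hecke_clifford n) False M N f"
    and M: "supermodule (hecke_clifford n) M" and N: "supermodule (hecke_clifford n) N"
  shows "subsupermodule (hecke_clifford n) M {v \<in> carrier M. f v = \<zero>\<^bsub>N\<^esub>}"
proof -
  interpret M: supermodule "hecke_clifford n" M by fact
  interpret N: supermodule "hecke_clifford n" N by fact
  have "\<exists>v0\<in>{v \<in> carrier M. f v = \<zero>\<^bsub>N\<^esub>} \<inter> part M False. \<exists>v1\<in>{v \<in> carrier M. f v = \<zero>\<^bsub>N\<^esub>} \<inter> part M True. v = v0 \<oplus>\<^bsub>M\<^esub> v1"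
    if v: "v \<in> carrier M" "f v = \<zero>\<^bsub>N\<^esub>" for v
  proof -
    obtain v0 v1 where d: "v0 \<in> part M False" "v1 \<in> part M True" "v = v0 \<oplus>\<^bsub>M\<^esub> v1"
      using M.decompose[OF v(1)] by blast
    have c: "v0 \<in> carrier M" "v1 \<in> carrier M" using d M.part_carrier by auto
    have "f v0 \<oplus>\<^bsub>N\<^esub> f v1 = \<zero>\<^bsub>N\<^esub>" using v(2) d(3) even_homD(2)[OF f c] by simp
    then have "f v0 = \<zero>\<^bsub>N\<^esub>" "f v1 = \<zero>\<^bsub>N\<^esub>"
      using N.part_sum_zero even_homD(3)[OF f d(1)] even_homD(3)[OF f d(2)] by blast+
    then show ?thesis using d c by blast
  qed
  moreover have "f \<zero>\<^bsub>M\<^esub> = \<zero>\<^bsub>N\<^esub>" by (rule even_hom_zero[OF f M N])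
  ultimately show ?thesis unfolding subsupermodule_iff[OF M]
    by (simp add: even_homD(2)[OF f] even_hom_act[OF f M N] M.act_closed N.act_zero_right subset_iff)
qed

lemma even_hom_image:
  assumes f: "shom_part (hecke_clifford n) False M N f"
    and M: "supermodule (hecke_clifford n) M" and N: "supermodule (hecke_clifford n) N"
    and W: "subsupermodule (hecke_clifford n) M W"
  shows "subsupermodule (hecke_clifford n) N (f ` W)"
proof -
  note R = W[unfolded subsupermodule_iff[OF M]]
  have c: "w \<in> carrier M" if "w \<in> W" for w using R that by blast
  have add: "x \<oplus>\<^bsub>M\<^esub> y \<in> W" if "x \<in> W" "y \<in> W" for x y using R that by blast
  have act: "a \<odot>\<^bsub>M\<^esub> x \<in> W" if "a \<in> hecke_clifford n" "x \<in> W" for a x using R that by blast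
  show ?thesis unfolding subsupermodule_iff[OF N]
  proof (intro conjI ballI)
    show "f ` W \<subseteq> carrier N" using c even_homD(1)[OF f] by blast
    have "f \<zero>\<^bsub>M\<^esub> \<in> f ` W" using R by blast
    then show "\<zero>\<^bsub>N\<^esub> \<in> f ` W" unfolding even_hom_zero[OF f M N] .
  next
    fix x y assume "x \<in> f ` W" "y \<in> f ` W"
    then obtain u v where uv: "u \<in> W" "v \<in> W" "x = f u" "y = f v" by blast
    then show "x \<oplus>\<^bsub>N\<^esub> y \<in> f ` W"
      using even_homD(2)[OF f c[OF uv(1)] c[OF uv(2)]] add[OF uv(1,2)] by (metis imageI)
  next
    fix a x assume a: "a \<in> hecke_clifford n" and "x \<in> f ` W"
    then obtain u where u: "u \<in> W" "x = f u" by blast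
    then show "a \<odot>\<^bsub>N\<^esub> x \<in> f ` W"
      using even_hom_act[OF f M N a c[OF u(1)]] act[OF a u(1)] by (metis imageI)
  next
    fix x assume "x \<in> f ` W"
    then obtain u where u: "u \<in> W" "x = f u" by blast
    obtain u0 u1 where d: "u0 \<in> W \<inter> part M False" "u1 \<in> W \<inter> part M True" "u = u0 \<oplus>\<^bsub>M\<^esub> u1"
      using R u(1) by blast
    have "x = f u0 \<oplus>\<^bsub>N\<^esub> f u1" using u(2) d even_homD(2)[OF f, of u0 u1] c by simp
    then show "\<exists>v0\<in>f ` W \<inter> part N False. \<exists>v1\<in>f ` W \<inter> part N True. x = v0 \<oplus>\<^bsub>N\<^esub> v1"
      using d even_homD(3)[OF f] by (intro bexI[of _ "f u0"] bexI[of _ "f u1"]) auto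
  qed
qed

lemma subsupermodule_carrier:
  assumes "supermodule (hecke_clifford n) M" shows "subsupermodule (hecke_clifford n) M (carrier M)"
proof -
  interpret M: supermodule "hecke_clifford n" M by fact
  have "\<exists>v0\<in>carrier M \<inter> part M False. \<exists>v1\<in>carrier M \<inter> part M True. v = v0 \<oplus>\<^bsub>M\<^esub> v1" if v: "v \<in> carrier M" for v
  proof -
    obtain v0 v1 where "v0 \<in> part M False" "v1 \<in> part M True" "v = v0 \<oplus>\<^bsub>M\<^esub> v1"
      using M.decompose[OF v] by blast
    then show ?thesis using M.part_carrier by blast
  qed
  then show ?thesis unfolding subsupermodule_iff[OF assms] by (simp add: M.act_closed)
qed

text \<open>Schur's lemma: the kernel and the image are submodules.\<close>

lemma irreducible_even_hom:
  assumes M: "irreducible_smod (hecke_clifford n) M" and N: "irreducible_smod (hecke_clifford n) N"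
    and f: "shom_part (hecke_clifford n) False M N f" and v: "v \<in> carrier M" "f v \<noteq> \<zero>\<^bsub>N\<^esub>"
  shows "smod_even_iso (hecke_clifford n) M N"
proof -
  have sM: "supermodule (hecke_clifford n) M" and sN: "supermodule (hecke_clifford n) N"
    using M N by (auto simp: irreducible_smod_def)
  interpret M: supermodule "hecke_clifford n" M by fact
  interpret N: supermodule "hecke_clifford n" N by fact
  have "{v \<in> carrier M. f v = \<zero>\<^bsub>N\<^esub>} \<noteq> carrier M" using v by blast
  then have ker: "{v \<in> carrier M. f v = \<zero>\<^bsub>N\<^esub>} = {\<zero>\<^bsub>M\<^esub>}"
    using M even_hom_kernel[OF f sM sN] unfolding irreducible_smod_def by blast
  have "inj_on f (carrier M)"
  proof (rule inj_onI)
    fix x y assume xy: "x \<in> carrier M" "y \<in> carrier M" "f x = f y"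
    have "f (x \<oplus>\<^bsub>M\<^esub> \<ominus>\<^bsub>M\<^esub> y) = f x \<oplus>\<^bsub>N\<^esub> \<ominus>\<^bsub>N\<^esub> f y"
      using xy even_homD(2)[OF f] even_hom_minus[OF f sM sN] by simp
    also have "\<dots> = \<zero>\<^bsub>N\<^esub>" using xy even_homD(1)[OF f] by (simp add: N.r_neg)
    finally have "x \<oplus>\<^bsub>M\<^esub> \<ominus>\<^bsub>M\<^esub> y \<in> {v \<in> carrier M. f v = \<zero>\<^bsub>N\<^esub>}" using xy by simp
    then have "x \<oplus>\<^bsub>M\<^esub> \<ominus>\<^bsub>M\<^esub> y = \<zero>\<^bsub>M\<^esub>" unfolding ker by simp
    from M.minus_equality[OF this] show "x = y" using xy by simp
  qed
  moreover have "f ` carrier M \<noteq> {\<zero>\<^bsub>N\<^esub>}" using v by blast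
  then have "f ` carrier M = carrier N"
    using N even_hom_image[OF f sM sN subsupermodule_carrier[OF sM]] unfolding irreducible_smod_def by blast
  ultimately show ?thesis using f unfolding smod_even_iso_def bij_betw_def by blast
qed

lemma hc_grading_involution: "hc_grading (hc_grading a) = a"
proof (rule free_space_induct[of a UNIV])
  fix b :: "nat set \<times> (nat \<Rightarrow> nat)"
  obtain I w where b: "b = (I, w)" by fastforce
  have "(-1 :: complex) ^ card I * (-1) ^ card I = 1" by (simp add: power_mult_distrib[symmetric])
  then show "hc_grading (hc_grading (fbasis b)) = fbasis b" unfolding b by (simp add: hc_grading_single)
qed (simp_all add: hc_grading_add hc_grading_scale)

lemma parity_shift_irreducible:
  assumes "irreducible_smod (hecke_clifford n) M"
  shows "irreducible_smod (hecke_clifford n) (parity_shift M)"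
proof -
  have sM: "supermodule (hecke_clifford n) M" using assms by (simp add: irreducible_smod_def)
  interpret M: supermodule "hecke_clifford n" M by fact
  note sP = parity_shift_supermodule[OF sM]
  have "subsupermodule (hecke_clifford n) M W" if W: "subsupermodule (hecke_clifford n) (parity_shift M) W" for W
  proof -
    note R = W[unfolded subsupermodule_iff[OF sP] parity_shift_simps]
    have act: "a \<odot>\<^bsub>M\<^esub> v \<in> W" if "a \<in> hecke_clifford n" "v \<in> W" for a v
    proof -
      have "hc_grading (hc_grading a) \<odot>\<^bsub>M\<^esub> v \<in> W" using R hc_grading_closed[OF that(1)] that(2) by blast
      then show ?thesis by (simp add: hc_grading_involution)
    qed
    have dec: "\<exists>v0\<in>W \<inter> part M False. \<exists>v1\<in>W \<inter> part M True. v = v0 \<oplus>\<^bsub>M\<^esub> v1" if "v \<in> W" for v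
    proof -
      obtain v0 v1 where d: "v0 \<in> W \<inter> part M True" "v1 \<in> W \<inter> part M False" "v = v0 \<oplus>\<^bsub>M\<^esub> v1"
        using R \<open>v \<in> W\<close> by auto
      then have "v0 \<in> carrier M" "v1 \<in> carrier M" using M.part_carrier by blast+
      then have "v = v1 \<oplus>\<^bsub>M\<^esub> v0" unfolding d(3) by (rule M.a_comm)
      then show ?thesis using d by blast
    qed
    show ?thesis unfolding subsupermodule_iff[OF sM] using R act dec by simp
  qed
  then show ?thesis using assms sP unfolding irreducible_smod_def by simp
qed

text \<open>One of the two homogeneous components of an isomorphism is nonzero, and Schur's lemma makes
  that component an isomorphism.\<close>

lemma irreducible_iso_cases:
  assumes M: "irreducible_smod (hecke_clifford n) M" and N: "irreducible_smod (hecke_clifford n) N"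
    and iso: "smod_iso (hecke_clifford n) M N"
  shows "smod_even_iso (hecke_clifford n) M N \<or> smod_even_iso (hecke_clifford n) M (parity_shift N)"
proof -
  have sM: "supermodule (hecke_clifford n) M" and sN: "supermodule (hecke_clifford n) N"
    using M N by (auto simp: irreducible_smod_def)
  interpret M: supermodule "hecke_clifford n" M by fact
  interpret N: supermodule "hecke_clifford n" N by fact
  obtain f f0 f1 where f: "bij_betw f (carrier M) (carrier N)" "\<forall>v\<in>carrier M. f v = f0 v \<oplus>\<^bsub>N\<^esub> f1 v"
    and f0: "shom_part (hecke_clifford n) False M N f0" and f1: "shom_part (hecke_clifford n) True M N f1"
    using iso unfolding smod_iso_def shom_def by blast
  have "\<exists>v\<in>carrier M. f0 v \<noteq> \<zero>\<^bsub>N\<^esub> \<or> f1 v \<noteq> \<zero>\<^bsub>N\<^esub>"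
  proof (rule ccontr)
    assume "\<not> ?thesis"
    then have "f v = \<zero>\<^bsub>N\<^esub>" if "v \<in> carrier M" for v using f(2) that by simp
    then have "v = \<zero>\<^bsub>M\<^esub>" if "v \<in> carrier M" for v
      using f(1) that M.zero_closed unfolding bij_betw_def inj_on_def by metis
    then have "carrier M = {\<zero>\<^bsub>M\<^esub>}" using M.zero_closed by blast
    then show False using M by (simp add: irreducible_smod_def)
  qed
  then obtain v where v: "v \<in> carrier M" "f0 v \<noteq> \<zero>\<^bsub>N\<^esub> \<or> f1 v \<noteq> \<zero>\<^bsub>N\<^esub>" by blast
  show ?thesis
  proof (cases "f0 v = \<zero>\<^bsub>N\<^esub>")
    case False
    then show ?thesis using irreducible_even_hom[OF M N f0 v(1)] by blast
  next
    case True
    then have "f1 v \<noteq> \<zero>\<^bsub>parity_shift N\<^esub>" using v by simp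
    then show ?thesis
      using irreducible_even_hom[OF M parity_shift_irreducible[OF N] odd_hom_parity_shift[OF f1 sN] v(1)] by blast
  qed
qed

lemma irreducible_even_iso:
  assumes N: "irreducible_smod (hecke_clifford n) N" and M: "supermodule (hecke_clifford n) M"
    and iso: "smod_even_iso (hecke_clifford n) M N"
  shows "irreducible_smod (hecke_clifford n) M"
proof -
  have sN: "supermodule (hecke_clifford n) N" using N by (simp add: irreducible_smod_def)
  obtain f g where f: "shom_part (hecke_clifford n) False M N f" and g: "shom_part (hecke_clifford n) False N M g"
    and gf: "\<And>v. v \<in> carrier M \<Longrightarrow> g (f v) = v" and fg: "\<And>v. v \<in> carrier N \<Longrightarrow> f (g v) = v"
    using even_iso_inverse[OF iso M sN] by blast
  have "W = {\<zero>\<^bsub>M\<^esub>} \<or> W = carrier M" if W: "subsupermodule (hecke_clifford n) M W" for W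
  proof -
    have sub: "W \<subseteq> carrier M" "\<zero>\<^bsub>M\<^esub> \<in> W" using W unfolding subsupermodule_iff[OF M] by blast+
    have "(\<lambda>w. g (f w)) ` W = (\<lambda>w. w) ` W" by (rule image_cong) (use sub gf in auto)
    then have "g ` f ` W = W" by (simp add: image_image)
    moreover have "f ` W = {\<zero>\<^bsub>N\<^esub>} \<or> f ` W = carrier N"
      using N even_hom_image[OF f M sN W] unfolding irreducible_smod_def by blast
    moreover have "g ` carrier N = carrier M"
    proof (intro equalityI subsetI)
      fix v assume "v \<in> carrier M"
      then have "v = g (f v)" "f v \<in> carrier N" using gf even_homD(1)[OF f] by auto
      then show "v \<in> g ` carrier N" by (rule image_eqI)
    qed (use even_homD(1)[OF g] in blast)
    moreover have "g \<zero>\<^bsub>N\<^esub> = \<zero>\<^bsub>M\<^esub>" by (rule even_hom_zero[OF g sN M])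
    ultimately show ?thesis by (metis image_empty image_insert)
  qed
  moreover have "carrier M \<noteq> {\<zero>\<^bsub>M\<^esub>}"
  proof
    assume c: "carrier M = {\<zero>\<^bsub>M\<^esub>}"
    have "v = \<zero>\<^bsub>N\<^esub>" if "v \<in> carrier N" for v
    proof -
      have "g v = \<zero>\<^bsub>M\<^esub>" using even_homD(1)[OF g that] c by simp
      then show ?thesis using fg[OF that] even_hom_zero[OF f M sN] by simp
    qed
    then have "carrier N \<subseteq> {\<zero>\<^bsub>N\<^esub>}" by blast
    moreover have "\<zero>\<^bsub>N\<^esub> \<in> carrier N"
      using subsupermodule_carrier[OF sN] unfolding subsupermodule_iff[OF sN] by blast
    ultimately show False using N unfolding irreducible_smod_def by blast
  qed
  ultimately show ?thesis using M unfolding irreducible_smod_def by blast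
qed

section \<open>Composition series\<close>

lemma (in abelian_group) add_minus_cancel_left:
  assumes "x \<in> carrier G" "y \<in> carrier G" shows "y \<oplus> (x \<ominus> y) = x"
proof -
  have "x \<oplus> \<ominus> y = \<ominus> y \<oplus> x" using assms by (intro a_comm) auto
  then show ?thesis unfolding a_minus_def using assms by (simp only: r_neg2)
qed

lemma quotient_irreducible:
  assumes N: "supermodule (hecke_clifford n) N"
    and W: "subsupermodule (hecke_clifford n) N W" and U: "subsupermodule (hecke_clifford n) N U" "U \<subset> W"
    and max: "\<And>X. subsupermodule (hecke_clifford n) N X \<Longrightarrow> U \<subseteq> X \<Longrightarrow> X \<subseteq> W \<Longrightarrow> X = U \<or> X = W"
  shows "irreducible_smod (hecke_clifford n) (quotient_smod (restrict_smod N W) U)"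
proof -
  interpret N: supermodule "hecke_clifford n" N by fact
  let ?R = "restrict_smod N W" let ?Q = "quotient_smod ?R U" and ?c = "\<lambda>v. U +>\<^bsub>?R\<^esub> v"
  have "U \<subseteq> W" using U(2) by blast
  note sR = restrict_supermodule[OF N W]
  note q = quotient_facts[OF sR restrict_subsupermodule[OF N W U(1) \<open>U \<subseteq> W\<close>], unfolded restrict_smod_simps]
  have partQ: "part ?Q p = ?c ` (W \<inter> part N p)" for p by (simp add: quotient_smod_def)
  note RU = U(1)[unfolded subsupermodule_iff[OF N]] and RW = W[unfolded subsupermodule_iff[OF N]]
  have decU: "\<exists>u0\<in>U \<inter> part N False. \<exists>u1\<in>U \<inter> part N True. x = u0 \<oplus>\<^bsub>N\<^esub> u1" if "x \<in> U" for x
    using RU[THEN conjunct2, THEN conjunct2, THEN conjunct2, THEN conjunct2] that by (rule bspec)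
  have cW: "v \<in> carrier N" if "v \<in> W" for v using RW that by blast
  have addW: "x \<oplus>\<^bsub>N\<^esub> y \<in> W" if "x \<in> W" "y \<in> W" for x y using RW that by blast
  have actW: "a \<odot>\<^bsub>N\<^esub> x \<in> W" if "a \<in> hecke_clifford n" "x \<in> W" for a x using RW that by blast
  have cadd: "?c (x \<oplus>\<^bsub>N\<^esub> y) = ?c x \<oplus>\<^bsub>?Q\<^esub> ?c y" if "x \<in> W" "y \<in> W" for x y
    using even_homD(2)[OF q(2)] that by simp
  have cact: "?c (a \<odot>\<^bsub>N\<^esub> x) = a \<odot>\<^bsub>?Q\<^esub> ?c x" if "a \<in> hecke_clifford n" "x \<in> W" for a x
    using even_hom_act[OF q(2) sR q(1) that(1)] that(2) by simp
  interpret Q: supermodule "hecke_clifford n" ?Q by (rule q(1))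
  have "X = {\<zero>\<^bsub>?Q\<^esub>} \<or> X = carrier ?Q" if X: "subsupermodule (hecke_clifford n) ?Q X" for X
  proof -
    note RX = X[unfolded subsupermodule_iff[OF q(1)]]
    have addX: "x \<oplus>\<^bsub>?Q\<^esub> y \<in> X" if "x \<in> X" "y \<in> X" for x y using RX that by blast
    have actX: "a \<odot>\<^bsub>?Q\<^esub> x \<in> X" if "a \<in> hecke_clifford n" "x \<in> X" for a x using RX that by blast
    have decX: "\<exists>x0\<in>X \<inter> part ?Q False. \<exists>x1\<in>X \<inter> part ?Q True. x = x0 \<oplus>\<^bsub>?Q\<^esub> x1" if "x \<in> X" for x
      using RX[THEN conjunct2, THEN conjunct2, THEN conjunct2, THEN conjunct2] that by (rule bspec)
    let ?Y = "{v \<in> W. ?c v \<in> X}"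
    have "U \<in> X" using RX unfolding q(5) by blast
    have UY: "U \<subseteq> ?Y"
    proof
      fix x assume x: "x \<in> U"
      then have "x \<in> W" using \<open>U \<subseteq> W\<close> by blast
      then show "x \<in> ?Y" using q(6)[of x] x \<open>U \<in> X\<close> by simp
    qed
    have "subsupermodule (hecke_clifford n) N ?Y" unfolding subsupermodule_iff[OF N]
    proof (intro conjI ballI)
      show "?Y \<subseteq> carrier N" using cW by blast
      show "\<zero>\<^bsub>N\<^esub> \<in> ?Y" using UY RU by blast
    next
      fix x y assume "x \<in> ?Y" "y \<in> ?Y"
      then show "x \<oplus>\<^bsub>N\<^esub> y \<in> ?Y" using addW addX by (simp add: cadd)
    next
      fix a x assume "a \<in> hecke_clifford n" "x \<in> ?Y"
      then show "a \<odot>\<^bsub>N\<^esub> x \<in> ?Y" using actW actX by (simp add: cact)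
    next
      fix v assume "v \<in> ?Y"
      then have v: "v \<in> W" "?c v \<in> X" by auto
      then obtain x0 x1 where x: "x0 \<in> X \<inter> part ?Q False" "x1 \<in> X \<inter> part ?Q True" "?c v = x0 \<oplus>\<^bsub>?Q\<^esub> x1"
        using decX[OF v(2)] by blast
      then obtain a b where a: "a \<in> W \<inter> part N False" "x0 = ?c a" and b: "b \<in> W \<inter> part N True" "x1 = ?c b"
        unfolding partQ by blast
      have ab: "a \<in> W" "b \<in> W" using a b by auto
      have "?c v = ?c (a \<oplus>\<^bsub>N\<^esub> b)" using x(3) a(2) b(2) cadd[OF ab] by simp
      then have "v \<ominus>\<^bsub>?R\<^esub> (a \<oplus>\<^bsub>N\<^esub> b) \<in> U" using q(4)[OF v(1) addW[OF ab]] by simp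
      then obtain u0 u1 where u: "u0 \<in> U \<inter> part N False" "u1 \<in> U \<inter> part N True"
        "v \<ominus>\<^bsub>?R\<^esub> (a \<oplus>\<^bsub>N\<^esub> b) = u0 \<oplus>\<^bsub>N\<^esub> u1" using decU by blast
      have uW: "u0 \<in> W" "u1 \<in> W" using u \<open>U \<subseteq> W\<close> by auto
      have "v = (a \<oplus>\<^bsub>N\<^esub> b) \<oplus>\<^bsub>N\<^esub> (u0 \<oplus>\<^bsub>N\<^esub> u1)"
      proof -
        interpret R: supermodule "hecke_clifford n" ?R by (rule sR)
        have "(a \<oplus>\<^bsub>N\<^esub> b) \<oplus>\<^bsub>?R\<^esub> (v \<ominus>\<^bsub>?R\<^esub> (a \<oplus>\<^bsub>N\<^esub> b)) = v"
          by (rule R.add_minus_cancel_left) (use v(1) addW[OF ab] in simp_all)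
        then show ?thesis unfolding u(3) by simp
      qed
      also have "\<dots> = (a \<oplus>\<^bsub>N\<^esub> u0) \<oplus>\<^bsub>N\<^esub> (b \<oplus>\<^bsub>N\<^esub> u1)"
        using ab uW cW by (simp add: N.a_ac)
      finally have "v = (a \<oplus>\<^bsub>N\<^esub> u0) \<oplus>\<^bsub>N\<^esub> (b \<oplus>\<^bsub>N\<^esub> u1)" .
      moreover have "a \<oplus>\<^bsub>N\<^esub> u0 \<in> ?Y \<inter> part N False" "b \<oplus>\<^bsub>N\<^esub> u1 \<in> ?Y \<inter> part N True"
        using a b u uW ab addW addX UY x(1,2) N.part_add by (auto simp: cadd)
      ultimately show "\<exists>v0\<in>?Y \<inter> part N False. \<exists>v1\<in>?Y \<inter> part N True. v = v0 \<oplus>\<^bsub>N\<^esub> v1" by blast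
    qed
    from max[OF this UY] have "?Y = U \<or> ?Y = W" by blast
    then show ?thesis
    proof
      assume Y: "?Y = U"
      have "x = U" if x: "x \<in> X" for x
      proof -
        have "x \<in> carrier ?Q" using x RX by blast
        then obtain v where v: "v \<in> W" "x = ?c v" unfolding q(3) by blast
        then have "v \<in> U" using Y x by blast
        then show ?thesis using q(6)[OF v(1)] v(2) by simp
      qed
      moreover have "U \<in> X" using RX unfolding q(5) by blast
      ultimately show ?thesis unfolding q(5) by blast
    next
      assume Y: "?Y = W"
      have "carrier ?Q \<subseteq> X" unfolding q(3) using Y by blast
      then show ?thesis using RX by blast
    qed
  qed
  moreover have "carrier ?Q \<noteq> {\<zero>\<^bsub>?Q\<^esub>}"
  proof -
    obtain v where v: "v \<in> W" "v \<notin> U" using U(2) by blast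
    then have "?c v \<noteq> U" using q(6)[OF v(1)] by simp
    moreover have "?c v \<in> carrier ?Q" unfolding q(3) using v(1) by (rule imageI)
    ultimately show ?thesis unfolding q(5) by blast
  qed
  ultimately show ?thesis using q(1) unfolding irreducible_smod_def by blast
qed

text \<open>Induction on the dimension: below a nonzero submodule there is a proper submodule of largest
  dimension, and the quotient by it is irreducible.\<close>

lemma composition_series_exists:
  assumes N: "supermodule (hecke_clifford n) N" and fd: "fin_dim N"
  shows "\<exists>Ws. composition_series (hecke_clifford n) N Ws"
proof -
  let ?sub = "subsupermodule (hecke_clifford n) N"
  obtain d where d: "\<And>U W. ?sub U \<Longrightarrow> ?sub W \<Longrightarrow> U \<subset> W \<Longrightarrow> d U < (d W :: nat)"
    using submodule_dimension[OF N fd] by metis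
  have zero_in: "\<zero>\<^bsub>N\<^esub> \<in> W" if "?sub W" for W using that unfolding subsupermodule_iff[OF N] by blast
  have zero_sub: "?sub {\<zero>\<^bsub>N\<^esub>}"
  proof -
    interpret N: supermodule "hecke_clifford n" N by fact
    show ?thesis unfolding subsupermodule_iff[OF N] by (simp add: N.act_zero_right)
  qed
  have "\<exists>Ws. Ws \<noteq> [] \<and> hd Ws = {\<zero>\<^bsub>N\<^esub>} \<and> last Ws = W \<and> (\<forall>W\<in>set Ws. ?sub W) \<and>
     (\<forall>i. Suc i < length Ws \<longrightarrow> Ws ! i \<subseteq> Ws ! Suc i \<and> irreducible_smod (hecke_clifford n) (composition_factor N Ws i))"
    if "?sub W" for W
    using that
  proof (induction "d W" arbitrary: W rule: less_induct)
    case less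
    show ?case
    proof (cases "W = {\<zero>\<^bsub>N\<^esub>}")
      case True
      then show ?thesis using less.prems by (intro exI[of _ "[W]"]) auto
    next
      case False
      let ?P = "\<lambda>U. ?sub U \<and> U \<subset> W"
      have "?P {\<zero>\<^bsub>N\<^esub>}" using zero_sub zero_in[OF less.prems] False by blast
      moreover have "\<forall>U. ?P U \<longrightarrow> d U < d W" using d less.prems by blast
      ultimately have "\<exists>U. ?P U \<and> (\<forall>X. ?P X \<longrightarrow> d X \<le> d U)"
        by (rule Lattices_Big.ex_has_greatest_nat)
      then obtain U where U: "?P U" "\<forall>X. ?P X \<longrightarrow> d X \<le> d U" by (elim exE conjE) (rule that, rule conjI)
      obtain Ws where Ws: "Ws \<noteq> []" "hd Ws = {\<zero>\<^bsub>N\<^esub>}" "last Ws = U" "\<forall>W\<in>set Ws. ?sub W"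
        "\<And>i. Suc i < length Ws \<Longrightarrow> Ws ! i \<subseteq> Ws ! Suc i \<and> irreducible_smod (hecke_clifford n) (composition_factor N Ws i)"
        using less.hyps[of U] d[of U W] U(1) less.prems by blast
      have irr: "irreducible_smod (hecke_clifford n) (quotient_smod (restrict_smod N W) U)"
      proof (rule quotient_irreducible[OF N less.prems])
        fix X assume X: "?sub X" "U \<subseteq> X" "X \<subseteq> W"
        show "X = U \<or> X = W"
        proof (rule ccontr)
          assume "\<not> ?thesis"
          then have "U \<subset> X" "X \<subset> W" using X by auto
          then show False using U d[of U X] X(1) by (meson leD)
        qed
      qed (use U in auto)
      show ?thesis
      proof (intro exI[of _ "Ws @ [W]"] conjI allI impI)
        fix i assume i: "Suc i < length (Ws @ [W])"
        show "(Ws @ [W]) ! i \<subseteq> (Ws @ [W]) ! Suc i"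
          "irreducible_smod (hecke_clifford n) (composition_factor N (Ws @ [W]) i)"
        proof (atomize (full), cases "Suc i < length Ws")
          case True
          then show "(Ws @ [W]) ! i \<subseteq> (Ws @ [W]) ! Suc i \<and>
              irreducible_smod (hecke_clifford n) (composition_factor N (Ws @ [W]) i)"
            using Ws(5)[OF True] by (simp add: nth_append composition_factor_def)
        next
          case False
          then have "i = length Ws - 1" "Suc i = length Ws" using i Ws(1) by auto
          then have "(Ws @ [W]) ! i = U" "(Ws @ [W]) ! Suc i = W"
            using Ws(1,3) by (auto simp: nth_append last_conv_nth)
          then show "(Ws @ [W]) ! i \<subseteq> (Ws @ [W]) ! Suc i \<and>
              irreducible_smod (hecke_clifford n) (composition_factor N (Ws @ [W]) i)"
            using U irr by (auto simp: composition_factor_def)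
        qed
      qed (use Ws less.prems in auto)
    qed
  qed
  from this[OF subsupermodule_carrier[OF N]] show ?thesis unfolding composition_series_def by blast
qed

context char_map
begin

lemma chi_composition_series:
  assumes hN: "hc_module n N" and Ws: "composition_series (hecke_clifford n) N Ws"
  shows "chi n N m = (\<Sum>i<length Ws - 1. chi n (composition_factor N Ws i) m)"
    and "Suc i < length Ws \<Longrightarrow> hc_module n (composition_factor N Ws i)"
proof -
  have N: "supermodule (hecke_clifford n) N" and fd: "fin_dim N" using hN by (auto simp: hc_module_def)
  have ne: "Ws \<noteq> []" and hd: "hd Ws = {\<zero>\<^bsub>N\<^esub>}" and last: "last Ws = carrier N"
    and sub: "\<And>i. i < length Ws \<Longrightarrow> subsupermodule (hecke_clifford n) N (Ws ! i)"
    and chain: "\<And>i. Suc i < length Ws \<Longrightarrow> Ws ! i \<subseteq> Ws ! Suc i"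
    using Ws unfolding composition_series_def by auto
  have hr: "hc_module n (restrict_smod N W)" if "subsupermodule (hecke_clifford n) N W" for W
    using submodule_dimension[OF N fd] that by metis
  have hf: "hc_module n (composition_factor N Ws i)" if i: "Suc i < length Ws" for i
  proof -
    note W = sub[OF i] and U = sub[OF Suc_lessD[OF i]]
    have "fin_dim (restrict_smod N (Ws ! Suc i))" using hr[OF W] by (simp add: hc_module_def)
    then show ?thesis
      using quotient_facts(1,7)[OF restrict_supermodule[OF N W] restrict_subsupermodule[OF N W U chain[OF i]]]
      by (simp add: composition_factor_def hc_module_def)
  qed
  then show "Suc i < length Ws \<Longrightarrow> hc_module n (composition_factor N Ws i)" .
  have "chi n (restrict_smod N (Ws ! i)) m = (\<Sum>j<i. chi n (composition_factor N Ws j) m)" if "i < length Ws" for i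
    using that
  proof (induction i)
    case 0
    have "Ws ! 0 = {\<zero>\<^bsub>N\<^esub>}" using hd ne by (simp add: hd_conv_nth)
    then show ?case using chi_zero[OF hr[OF sub[OF 0]]] by simp
  next
    case (Suc i)
    have "chi n (restrict_smod N (Ws ! Suc i)) = (\<lambda>m. chi n (restrict_smod N (Ws ! i)) m + chi n (composition_factor N Ws i) m)"
      using short_exact_quotient[OF N sub[OF Suc.prems] sub[OF Suc_lessD[OF Suc.prems]] chain[OF Suc.prems]]
      by (intro chi_ses hr sub hf) (use Suc.prems in \<open>auto simp: composition_factor_def\<close>)
    then show ?case using Suc by simp
  qed
  from this[of "length Ws - 1"] have "chi n (restrict_smod N (carrier N)) m = (\<Sum>i<length Ws - 1. chi n (composition_factor N Ws i) m)"
    using ne last by (simp add: last_conv_nth)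
  moreover have "chi n (restrict_smod N (carrier N)) = chi n N"
  proof (rule chi_iso[OF hr[OF subsupermodule_carrier[OF N]] hN])
    show "smod_even_iso (hecke_clifford n) (restrict_smod N (carrier N)) N"
      unfolding smod_even_iso_def
      by (intro exI[of _ "\<lambda>x. x"] conjI even_homI) (auto simp: bij_betw_def)
  qed
  ultimately show "chi n N m = (\<Sum>i<length Ws - 1. chi n (composition_factor N Ws i) m)" by simp
qed

end

section \<open>Multiplicities\<close>

locale labelled_irreducibles = char_map ch for ch +
  fixes D :: "nat list \<Rightarrow> cmod"
  assumes labelling: "irreducible_labelling ch D"
begin

definition norm_factor :: "nat list \<Rightarrow> complex" where
  "norm_factor lam = 1 / 2 ^ ((length lam - pdelta lam) div 2)"

definition has_type :: "nat \<Rightarrow> nat list \<Rightarrow> (hc, 'v) smod \<Rightarrow> bool" where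
  "has_type n lam F \<longleftrightarrow> smod_even_iso (hecke_clifford n) F (D lam) \<or>
     smod_even_iso (hecke_clifford n) F (parity_shift (D lam))"

lemma D_facts:
  assumes "strict_partition lam n"
  shows "hc_module n (D lam)" "irreducible_smod (hecke_clifford n) (D lam)"
    "chi n (D lam) m = mconst (norm_factor lam) * Q_fun lam m"
proof -
  have *: "hc_module n (D lam) \<and> irreducible_smod (hecke_clifford n) (D lam) \<and>
        ch (K_class n (D lam)) = (\<lambda>m. mconst (1 / 2 ^ ((length lam - pdelta lam) div 2)) * Q_fun lam m)"
    using labelling assms unfolding irreducible_labelling_def by blast
  then show "hc_module n (D lam)" "irreducible_smod (hecke_clifford n) (D lam)"
    "chi n (D lam) m = mconst (norm_factor lam) * Q_fun lam m" by (simp_all add: chi_def norm_factor_def)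
qed

lemma chi_has_type:
  assumes "strict_partition lam n" "hc_module n F" "has_type n lam F"
  shows "chi n F m = mconst (norm_factor lam) * Q_fun lam m"
proof -
  note D = D_facts[OF assms(1)]
  have "chi n F = chi n (D lam)"
    using assms(3) unfolding has_type_def
  proof
    assume "smod_even_iso (hecke_clifford n) F (D lam)"
    then show ?thesis by (rule chi_iso[OF assms(2) D(1)])
  next
    assume "smod_even_iso (hecke_clifford n) F (parity_shift (D lam))"
    then have "chi n F = chi n (parity_shift (D lam))"
      by (rule chi_iso[OF assms(2) parity_shift_hc_module[OF D(1)]])
    then show ?thesis using chi_parity_shift[OF D(1)] by simp
  qed
  then show ?thesis using D(3) by simp
qed

lemma ex_type:
  assumes F: "hc_module n F" and irr: "irreducible_smod (hecke_clifford n) F"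
  shows "\<exists>lam. strict_partition lam n \<and> has_type n lam F"
proof -
  obtain M :: cmod where M: "hc_module n M" "smod_even_iso (hecke_clifford n) M F"
    using ex_model[OF F] by blast
  have sM: "supermodule (hecke_clifford n) M" and sF: "supermodule (hecke_clifford n) F"
    using M F by (auto simp: hc_module_def)
  have iM: "irreducible_smod (hecke_clifford n) M" by (rule irreducible_even_iso[OF irr sM M(2)])
  then obtain lam where lam: "strict_partition lam n" "smod_iso (hecke_clifford n) M (D lam)"
    using labelling M(1) unfolding irreducible_labelling_def by blast
  have "smod_even_iso (hecke_clifford n) M (D lam) \<or> smod_even_iso (hecke_clifford n) M (parity_shift (D lam))"
    by (rule irreducible_iso_cases[OF iM D_facts(2)[OF lam(1)] lam(2)])
  moreover have "smod_even_iso (hecke_clifford n) F M" by (rule even_iso_sym[OF M(2) sM sF])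
  ultimately have "has_type n lam F" unfolding has_type_def using even_iso_trans by blast
  then show ?thesis using lam(1) by blast
qed

lemma mconst_sum: "mconst (\<Sum>i\<in>S. f i) = (\<Sum>i\<in>S. mconst (f i))"
  unfolding mconst_def by (induction S rule: infinite_finite_induct) (auto simp: single_add)

lemma mconst_diff: "mconst (a - b) = mconst a - mconst b"
  by (simp add: mconst_def single_diff)

lemma norm_factor_nonzero: "norm_factor lam \<noteq> 0"
  by (simp add: norm_factor_def)

lemma sum_single_type:
  assumes "strict_partition mu n"
  shows "(\<Sum>lam | strict_partition lam n. mconst (if lam = mu then c else 0) * Q_fun lam m) = mconst c * Q_fun mu m"
proof -
  have "(\<Sum>lam | strict_partition lam n. mconst (if lam = mu then c else 0) * Q_fun lam m)
    = (\<Sum>lam\<in>{mu}. mconst (if lam = mu then c else 0) * Q_fun lam m)"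
    using assms finite_strict_partitions by (intro sum.mono_neutral_right) (auto simp: mconst_def)
  then show ?thesis by simp
qed

text \<open>Otherwise the characteristic would give a linear relation between
  \<open>Q\<^bsub>lam\<^esub>\<close> and \<open>Q\<^bsub>mu\<^esub>\<close>.\<close>

lemma type_unique:
  assumes "strict_partition lam n" "strict_partition mu n" "hc_module n F" "has_type n lam F" "has_type n mu F"
  shows "lam = mu"
proof (rule ccontr)
  assume ne: "lam \<noteq> mu"
  let ?c = "\<lambda>x. (if x = lam then norm_factor lam else 0) - (if x = mu then norm_factor mu else 0)"
  have "(\<Sum>x | strict_partition x n. mconst (?c x) * Q_fun x n)
      = mconst (norm_factor lam) * Q_fun lam n - mconst (norm_factor mu) * Q_fun mu n"
    unfolding mconst_diff left_diff_distrib sum_subtractf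
    by (simp only: sum_single_type[OF assms(1)] sum_single_type[OF assms(2)])
  also have "\<dots> = 0"
    using chi_has_type[OF assms(1,3,4), of n] chi_has_type[OF assms(2,3,5), of n] by simp
  finally have "?c lam = 0" using assms(1) by (rule Q_independent)
  then show False using ne norm_factor_nonzero by simp
qed

definition type_count :: "nat \<Rightarrow> (hc, 'v) smod \<Rightarrow> 'v set list \<Rightarrow> nat list \<Rightarrow> nat" where
  "type_count n N Ws lam = card {i. Suc i < length Ws \<and> has_type n lam (composition_factor N Ws i)}"

lemma chi_type_count:
  assumes hN: "hc_module n N" and Ws: "composition_series (hecke_clifford n) N Ws"
  shows "chi n N m = (\<Sum>lam | strict_partition lam n. mconst (of_nat (type_count n N Ws lam) * norm_factor lam) * Q_fun lam m)"
proof -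
  let ?F = "composition_factor N Ws" and ?L = "{..<length Ws - 1}"
  have hF: "hc_module n (?F i)" if "i \<in> ?L" for i
    using chi_composition_series(2)[OF hN Ws, of i] that by auto
  have "\<exists>lam. strict_partition lam n \<and> has_type n lam (?F i)" if "i \<in> ?L" for i
    using that Ws by (intro ex_type hF) (auto simp: composition_series_def)
  then obtain t where t: "\<And>i. i \<in> ?L \<Longrightarrow> strict_partition (t i) n \<and> has_type n (t i) (?F i)" by metis
  have "chi n N m = (\<Sum>i\<in>?L. chi n (?F i) m)" using chi_composition_series(1)[OF hN Ws] .
  also have "\<dots> = (\<Sum>i\<in>?L. \<Sum>lam | strict_partition lam n. mconst (if lam = t i then norm_factor lam else 0) * Q_fun lam m)"
  proof (rule sum.cong)
    fix i assume i: "i \<in> ?L"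
    have "(\<Sum>lam | strict_partition lam n. mconst (if lam = t i then norm_factor lam else 0) * Q_fun lam m)
      = (\<Sum>lam | strict_partition lam n. mconst (if lam = t i then norm_factor (t i) else 0) * Q_fun lam m)"
      by (rule sum.cong) auto
    then show "chi n (?F i) m = (\<Sum>lam | strict_partition lam n. mconst (if lam = t i then norm_factor lam else 0) * Q_fun lam m)"
      using chi_has_type[OF _ hF[OF i]] t[OF i] sum_single_type by simp
  qed simp
  also have "\<dots> = (\<Sum>lam | strict_partition lam n. \<Sum>i\<in>?L. mconst (if lam = t i then norm_factor lam else 0) * Q_fun lam m)"
    by (rule sum.swap)
  also have "\<dots> = (\<Sum>lam | strict_partition lam n. mconst (of_nat (type_count n N Ws lam) * norm_factor lam) * Q_fun lam m)"
  proof (rule sum.cong)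
    fix lam assume "lam \<in> {lam. strict_partition lam n}"
    then have lam: "strict_partition lam n" by simp
    have "{i. Suc i < length Ws \<and> has_type n lam (?F i)} = {i \<in> ?L. lam = t i}"
      using t type_unique[OF lam _ hF] by (auto simp: less_diff_conv)
    then have "type_count n N Ws lam = card {i \<in> ?L. lam = t i}" by (simp add: type_count_def)
    moreover have "(\<Sum>i\<in>?L. if lam = t i then norm_factor lam else 0) = (\<Sum>i\<in>{i \<in> ?L. lam = t i}. norm_factor lam)"
      by (rule sum.inter_filter[symmetric]) simp
    ultimately have "(\<Sum>i\<in>?L. if lam = t i then norm_factor lam else 0) = of_nat (type_count n N Ws lam) * norm_factor lam"
      by (simp only: sum_constant)
    then show "(\<Sum>i\<in>?L. mconst (if lam = t i then norm_factor lam else 0) * Q_fun lam m)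
        = mconst (of_nat (type_count n N Ws lam) * norm_factor lam) * Q_fun lam m"
      by (simp only: sum_distrib_right[symmetric] mconst_sum[symmetric])
  qed simp
  finally show ?thesis .
qed

text \<open>The numbers of composition factors of each type are determined by the characteristic, because the
  Schur \<open>Q\<close>-functions are linearly independent; this gives the uniqueness statement of the
  Jordan--Hoelder theorem.\<close>

theorem chi_multiplicity:
  assumes hN: "hc_module n N"
  shows "chi n N m = (\<Sum>lam | strict_partition lam n.
    mconst (of_nat (smod_multiplicity (hecke_clifford n) (D lam) N) * norm_factor lam) * Q_fun lam m)"
proof -
  have "supermodule (hecke_clifford n) N" "fin_dim N" using hN by (auto simp: hc_module_def)
  then obtain Ws where Ws: "composition_series (hecke_clifford n) N Ws"
    using composition_series_exists by blast
  have "type_count n N Vs lam = type_count n N Ws lam"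
    if Vs: "composition_series (hecke_clifford n) N Vs" and lam: "strict_partition lam n" for Vs lam
  proof -
    let ?c = "\<lambda>lam. of_nat (type_count n N Vs lam) * norm_factor lam - of_nat (type_count n N Ws lam) * norm_factor lam"
    have "(\<Sum>lam | strict_partition lam n. mconst (?c lam) * Q_fun lam n) = 0"
      unfolding mconst_diff left_diff_distrib sum_subtractf
      using chi_type_count[OF hN Vs, of n] chi_type_count[OF hN Ws, of n] by simp
    then have "?c lam = 0" using lam by (rule Q_independent)
    then show ?thesis using norm_factor_nonzero by simp
  qed
  then have "smod_multiplicity (hecke_clifford n) (D lam) N = type_count n N Ws lam"
    if "strict_partition lam n" for lam
    unfolding smod_multiplicity_def has_type_def[symmetric] type_count_def[symmetric]
    using Ws that by (intro the_equality) blast+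
  then show ?thesis using chi_type_count[OF hN Ws] by simp
qed

end

section \<open>Signs\<close>

lemma prod_signs: "finite S \<Longrightarrow> (\<Prod>x\<in>S. if P x then -1 else (1 :: complex)) = (-1) ^ card {x \<in> S. P x}"
  using prod.inter_filter[of S "\<lambda>_. - 1 :: complex" P] by simp

definition below_sign :: "nat \<Rightarrow> nat \<Rightarrow> complex" where
  "below_sign i j = (if j < i then -1 else 1)"

lemma clifford_sign_prod:
  assumes "finite I" "finite J"
  shows "clifford_sign I J = (\<Prod>i\<in>I. \<Prod>j\<in>J. below_sign i j)"
proof -
  have "{(i, j). i \<in> I \<and> j \<in> J \<and> j < i} = {p \<in> I \<times> J. snd p < fst p}" by auto
  then have "clifford_sign I J = (\<Prod>p\<in>I \<times> J. if snd p < fst p then -1 else 1)"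
    using assms by (simp add: clifford_sign_def prod_signs)
  then show ?thesis by (simp add: prod.cartesian_product below_sign_def case_prod_unfold)
qed

lemma prod_sym_diff:
  fixes g :: "'a \<Rightarrow> complex"
  assumes "finite X" "finite Y" "\<And>x. g x * g x = 1"
  shows "prod g (sym_diff X Y) = prod g X * prod g Y"
proof -
  have "prod g X = prod g (X - Y) * prod g (X \<inter> Y)" "prod g Y = prod g (Y - X) * prod g (X \<inter> Y)"
    using assms by (metis prod.Int_Diff mult.commute, metis prod.Int_Diff mult.commute Int_commute)
  moreover have "prod g (X \<inter> Y) * prod g (X \<inter> Y) = 1"
    using assms(3) by (simp add: prod.distrib[symmetric])
  moreover have "prod g (sym_diff X Y) = prod g (X - Y) * prod g (Y - X)"
    using assms by (intro prod.union_disjoint) auto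
  ultimately show ?thesis by (simp add: mult_ac)
qed

lemma below_sign_square: "below_sign i j * below_sign i j = 1"
  by (simp add: below_sign_def)

lemma clifford_sign_sym_diff_left:
  assumes "finite I" "finite I'" "finite J"
  shows "clifford_sign (sym_diff I I') J = clifford_sign I J * clifford_sign I' J"
proof -
  have "(\<Prod>j\<in>J. below_sign i j) * (\<Prod>j\<in>J. below_sign i j) = 1" for i
    by (simp add: prod.distrib[symmetric] below_sign_square)
  then show ?thesis using assms by (simp add: clifford_sign_prod prod_sym_diff)
qed

lemma clifford_sign_sym_diff_right:
  assumes "finite I" "finite J" "finite J'"
  shows "clifford_sign I (sym_diff J J') = clifford_sign I J * clifford_sign I J'"
  using assms by (simp add: clifford_sign_prod prod_sym_diff below_sign_square prod.distrib)

lemma sign_square: "(-1) ^ k * (-1) ^ k = (1 :: complex)"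
  by (simp add: power_mult_distrib[symmetric])

lemma clifford_sign_square: "clifford_sign I J * clifford_sign I J = 1"
  and perm_sign_square: "perm_sign w J * perm_sign w J = 1"
  by (simp_all add: clifford_sign_def perm_sign_def sign_square)

definition inversion_sign :: "(nat \<Rightarrow> nat) \<Rightarrow> nat \<Rightarrow> nat \<Rightarrow> complex" where
  "inversion_sign w i j = (if i < j \<and> w j < w i \<or> j < i \<and> w i < w j then -1 else 1)"

lemma perm_sign_insert:
  assumes "finite I" "j \<notin> I"
  shows "perm_sign w (insert j I) = perm_sign w I * (\<Prod>i\<in>I. inversion_sign w i j)"
proof -
  let ?inv = "\<lambda>J. {(a, b). a \<in> J \<and> b \<in> J \<and> a < b \<and> w b < w a}"
  let ?K = "{i \<in> I. i < j \<and> w j < w i \<or> j < i \<and> w i < w j}"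
  let ?f = "\<lambda>i. if i < j then (i, j) else (j, i)"
  have "?inv (insert j I) = ?inv I \<union> ?f ` ?K"
    using assms by (auto simp: image_iff)
  moreover have "finite (?inv I)" by (rule finite_subset[of _ "I \<times> I"]) (use assms in auto)
  moreover have "?inv I \<inter> ?f ` ?K = {}" using assms by auto
  moreover have "card (?f ` ?K) = card ?K" by (rule card_image) (auto simp: inj_on_def split: if_splits)
  ultimately have "card (?inv (insert j I)) = card (?inv I) + card ?K"
    using assms by (simp add: card_Un_disjoint)
  then show ?thesis using assms
    by (simp add: perm_sign_def inversion_sign_def prod_signs power_add)
qed

lemma perm_sign_empty [simp]: "perm_sign w {} = 1"
  by (simp add: perm_sign_def)

lemma perm_sign_compose:
  assumes "inj v" "inj w" "finite J"
  shows "perm_sign (w \<circ> v) J = perm_sign w (v ` J) * perm_sign v J"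
  using assms(3)
proof (induction J)
  case (insert j J)
  have "inversion_sign (w \<circ> v) i j = inversion_sign w (v i) (v j) * inversion_sign v i j" if "i \<in> J" for i
  proof -
    have "v i \<noteq> v j" using that insert assms(1) by (auto dest: injD)
    moreover from this have "w (v i) \<noteq> w (v j)" using assms(2) by (auto dest: injD)
    ultimately show ?thesis using that insert by (auto simp: inversion_sign_def)
  qed
  then have "(\<Prod>i\<in>J. inversion_sign (w \<circ> v) i j) = (\<Prod>i\<in>v ` J. inversion_sign w i (v j)) * (\<Prod>i\<in>J. inversion_sign v i j)"
    using inj_on_subset[OF assms(1)] by (simp add: prod.reindex prod.distrib)
  moreover have "v j \<notin> v ` J" using insert assms(1) by (auto dest: injD)
  ultimately show ?case using insert by (simp add: perm_sign_insert o_def)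
qed simp

text \<open>As a function of \<open>J\<close>, \<open>perm_sign w J\<close> is the exponential of a quadratic form over the field with
  two elements whose polarization compares \<open>clifford_sign\<close> before and after applying \<open>w\<close>.\<close>

definition polarization :: "(nat \<Rightarrow> nat) \<Rightarrow> nat set \<Rightarrow> nat set \<Rightarrow> complex" where
  "polarization w I J = (\<Prod>i\<in>I. \<Prod>j\<in>J. inversion_sign w i j)"

lemma inversion_sign_simps: "inversion_sign w i i = 1" "inversion_sign w i j * inversion_sign w i j = 1"
  by (simp_all add: inversion_sign_def)

lemma polarization_sym_diff:
  assumes "finite I" "finite I'" "finite J"
  shows "polarization w (sym_diff I I') J = polarization w I J * polarization w I' J"
proof -
  have "(\<Prod>j\<in>J. inversion_sign w i j) * (\<Prod>j\<in>J. inversion_sign w i j) = 1" for i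
    by (simp add: prod.distrib[symmetric] inversion_sign_simps)
  then show ?thesis using assms by (simp add: polarization_def prod_sym_diff)
qed

lemma perm_sign_toggle:
  assumes "finite I" shows "perm_sign w (sym_diff I {j}) = perm_sign w I * polarization w I {j}"
proof (cases "j \<in> I")
  case True
  have "perm_sign w I = perm_sign w (I - {j}) * (\<Prod>i\<in>I - {j}. inversion_sign w i j)"
    using perm_sign_insert[of "I - {j}" j w] True assms by (simp add: insert_absorb)
  moreover have "polarization w I {j} = (\<Prod>i\<in>I - {j}. inversion_sign w i j)"
    using True assms by (simp add: polarization_def prod.remove[of I j] inversion_sign_simps)
  moreover have "(\<Prod>i\<in>I - {j}. inversion_sign w i j) * (\<Prod>i\<in>I - {j}. inversion_sign w i j) = 1"
    by (simp add: prod.distrib[symmetric] inversion_sign_simps)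
  ultimately show ?thesis using True by (simp add: mult.assoc insert_Diff_if)
next
  case False
  then have "sym_diff I {j} = insert j I" by auto
  then show ?thesis using perm_sign_insert[OF assms False, of w] by (simp add: polarization_def)
qed

lemma perm_sign_sym_diff:
  assumes "finite I" "finite J"
  shows "perm_sign w (sym_diff I J) = perm_sign w I * perm_sign w J * polarization w I J"
  using assms(2)
proof (induction J)
  case empty
  then show ?case by (simp add: polarization_def)
next
  case (insert j J)
  have "sym_diff I (insert j J) = sym_diff (sym_diff I J) {j}" using insert by auto
  then have "perm_sign w (sym_diff I (insert j J)) = perm_sign w (sym_diff I J) * polarization w (sym_diff I J) {j}"
    using perm_sign_toggle[of "sym_diff I J" w j] insert assms by simp
  also have "\<dots> = perm_sign w I * perm_sign w J * polarization w I J * (polarization w I {j} * polarization w J {j})"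
    using insert assms by (simp add: polarization_sym_diff)
  also have "\<dots> = perm_sign w I * perm_sign w (insert j J) * polarization w I (insert j J)"
    using insert assms by (simp add: perm_sign_insert polarization_def prod.distrib mult_ac)
  finally show ?case .
qed

lemma clifford_sign_image:
  assumes "inj w" "finite I" "finite J"
  shows "clifford_sign (w ` I) (w ` J) = clifford_sign I J * polarization w I J"
proof -
  have "below_sign (w i) (w j) = below_sign i j * inversion_sign w i j" for i j
  proof -
    have "w i = w j \<longleftrightarrow> i = j" using assms(1) by (auto dest: injD)
    then show ?thesis by (cases i j rule: linorder_cases) (auto simp: below_sign_def inversion_sign_def)
  qed
  then show ?thesis using assms inj_on_subset[OF assms(1)]
    by (simp add: clifford_sign_prod polarization_def prod.reindex prod.distrib)
qed

text \<open>Conjugation by \<open>w\<close> is multiplicative on the Clifford algebra.\<close>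

lemma perm_sign_equivariant:
  assumes "inj w" "finite I" "finite J"
  shows "perm_sign w (sym_diff I J) * clifford_sign I J = perm_sign w I * perm_sign w J * clifford_sign (w ` I) (w ` J)"
  using assms by (simp add: perm_sign_sym_diff clifford_sign_image mult_ac)

section \<open>The model\<close>

text \<open>The vector \<open>(I, J)\<close> stands for \<open>c\<^sub>I \<otimes> e\<^sub>J\<close> with \<open>e\<^sub>J = e\<^bsub>j_1\<^esub> \<and> \<dots> \<and> e\<^bsub>j_q\<^esub>\<close> in the module induced from
  the \<open>q\<close>-th exterior power of the permutation module.\<close>

definition model_basis :: "nat \<Rightarrow> nat \<Rightarrow> (nat set \<times> nat set) set" where
  "model_basis n q = Pow {..<n} \<times> {J. J \<subseteq> {..<n} \<and> card J = q}"

fun model_act_basis :: "nat set \<times> (nat \<Rightarrow> nat) \<Rightarrow> nat set \<times> nat set \<Rightarrow> (nat set \<times> nat set) \<Rightarrow>\<^sub>0 complex" where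
  "model_act_basis (K, w) (I, J) = Poly_Mapping.single (sym_diff K (w ` I), w ` J)
     (perm_sign w I * clifford_sign K (w ` I) * perm_sign w J)"

definition model_act :: "hc \<Rightarrow> ((nat set \<times> nat set) \<Rightarrow>\<^sub>0 complex) \<Rightarrow> ((nat set \<times> nat set) \<Rightarrow>\<^sub>0 complex)" where
  "model_act a x = flinear (\<lambda>g. flinear (model_act_basis g) x) a"

definition model :: "nat \<Rightarrow> nat \<Rightarrow> (hc, (nat set \<times> nat set) \<Rightarrow>\<^sub>0 complex) smod" where
  "model n q = \<lparr>carrier = free_space (model_basis n q), mult = undefined, one = undefined, zero = 0,
     add = (+), smult = model_act, part = (\<lambda>p. free_space {(I, J) \<in> model_basis n q. odd (card I) = p})\<rparr>"

lemma model_simps [simp]: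
  "carrier (model n q) = free_space (model_basis n q)" "\<zero>\<^bsub>model n q\<^esub> = 0" "add (model n q) = (+)"
  "smult (model n q) = model_act" "part (model n q) p = free_space {(I, J) \<in> model_basis n q. odd (card I) = p}"
  by (simp_all add: model_def)

lemma model_act_linear:
  "model_act (a + b) x = model_act a x + model_act b x" "model_act (fscale c a) x = fscale c (model_act a x)"
  "model_act a (x + y) = model_act a x + model_act a y" "model_act a (fscale c x) = fscale c (model_act a x)"
  "model_act 0 x = 0" "model_act a 0 = 0"
  by (simp_all add: model_act_def flinear_add flinear_fscale flinear_sum_fun flinear_fscale_fun)
    (simp add: flinear_def)

lemma model_act_single [simp]: "model_act (Poly_Mapping.single g c) (Poly_Mapping.single x d) = fscale (c * d) (model_act_basis g x)"
  by (simp add: model_act_def)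

lemma model_basis_closed:
  assumes "(K, w) \<in> hc_basis n" "(I, J) \<in> model_basis n q"
  shows "(sym_diff K (w ` I), w ` J) \<in> model_basis n q"
proof -
  have w: "w permutes {..<n}" using assms by auto
  then have "w ` I \<subseteq> {..<n}" "w ` J \<subseteq> {..<n}" "card (w ` J) = card J"
    using assms permutes_image_subset[OF w] by (auto simp: model_basis_def intro!: card_image permutes_inj_on)
  then show ?thesis using assms by (auto simp: model_basis_def)
qed

lemma model_act_closed:
  assumes "a \<in> hecke_clifford n" "x \<in> free_space (model_basis n q)"
  shows "model_act a x \<in> free_space (model_basis n q)"
  unfolding model_act_def using assms model_basis_closed
  by (auto intro!: flinear_closed[where B = "hc_basis n"] flinear_closed[where B = "model_basis n q"] free_space_single
      simp: hecke_clifford_def)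

text \<open>The signs agree because \<open>perm_sign\<close> is a cocycle in the permutation and because
  of the compatibility \<open>perm_sign_equivariant\<close> with the Clifford multiplication.\<close>

lemma model_act_mult_basis:
  assumes "(K, w) \<in> hc_basis n" "(L, v) \<in> hc_basis n" "(I, J) \<in> model_basis n q"
  shows "model_act (hc_mult_basis (K, w) (L, v)) (fbasis (I, J)) = model_act (fbasis (K, w)) (model_act_basis (L, v) (I, J))"
proof -
  have w: "inj w" "inj v" using assms by (auto intro: permutes_inj)
  have fin: "finite K" "finite L" "finite I" "finite J"
    using assms by (auto simp: model_basis_def intro: finite_subset[of _ "{..<n}"])
  have img: "w ` (sym_diff L (v ` I)) = sym_diff (w ` L) (w ` v ` I)"
    using w(1) by (simp add: image_Un image_set_diff)
  have "perm_sign w L * clifford_sign K (w ` L) *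
      (perm_sign (w \<circ> v) I * clifford_sign (sym_diff K (w ` L)) (w ` v ` I) * perm_sign (w \<circ> v) J)
    = clifford_sign K (w ` L) * clifford_sign K (w ` v ` I) * perm_sign v I * perm_sign v J * perm_sign w (v ` J) *
      (perm_sign w L * perm_sign w (v ` I) * clifford_sign (w ` L) (w ` v ` I))"
    using w fin by (simp add: perm_sign_compose clifford_sign_sym_diff_left mult_ac)
  also have "\<dots> = perm_sign v I * clifford_sign L (v ` I) * perm_sign v J *
      (perm_sign w (sym_diff L (v ` I)) * clifford_sign K (w ` (sym_diff L (v ` I))) * perm_sign w (v ` J))"
    using w fin perm_sign_equivariant[of w L "v ` I"] by (simp add: img clifford_sign_sym_diff_right mult_ac)
  finally have coeff: "perm_sign w L * clifford_sign K (w ` L) *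
      (perm_sign (w \<circ> v) I * clifford_sign (sym_diff K (w ` L)) (w ` v ` I) * perm_sign (w \<circ> v) J)
    = perm_sign v I * clifford_sign L (v ` I) * perm_sign v J *
      (perm_sign w (sym_diff L (v ` I)) * clifford_sign K (w ` (sym_diff L (v ` I))) * perm_sign w (v ` J))" .
  have sets: "sym_diff (sym_diff K (w ` L)) (w ` v ` I) = sym_diff K (w ` (sym_diff L (v ` I)))"
    unfolding img by blast
  show ?thesis
    unfolding hc_mult_basis.simps model_act_basis.simps model_act_single fscale_single image_comp[symmetric]
      sets mult_1_left mult_1_right coeff ..
qed

lemma model_act_mult:
  assumes "a \<in> hecke_clifford n" "b \<in> hecke_clifford n" "x \<in> free_space (model_basis n q)"
  shows "model_act (a \<star> b) x = model_act a (model_act b x)"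
  using assms(1) unfolding hecke_clifford_def
proof (induction rule: free_space_induct)
  case (basis g)
  show ?case using assms(2) unfolding hecke_clifford_def
  proof (induction rule: free_space_induct)
    case (basis h)
    show ?case using assms(3)
    proof (induction rule: free_space_induct)
      case (basis t)
      obtain K w L v I J where e: "g = (K, w)" "h = (L, v)" "t = (I, J)" by (metis surj_pair)
      have "model_act (fbasis h) (fbasis t) = model_act_basis h t" by simp
      then show ?case
        using model_act_mult_basis[of K w n L v I J q] basis \<open>g \<in> hc_basis n\<close> \<open>h \<in> hc_basis n\<close>
        unfolding e hc_mult_fbasis by simp
    qed (simp_all add: model_act_linear)
  qed (simp_all add: model_act_linear hc_mult_add_right hc_mult_scale_right)
qed (simp_all add: model_act_linear hc_mult_add_left hc_mult_scale_left)

lemma model_act_scalar: "model_act (hc_scalar c) x = fscale c x"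
proof -
  have "model_act (hc_scalar 1) x = x"
    by (rule free_space_induct[of x UNIV])
      (auto simp: model_act_linear hc_scalar_def perm_sign_id[unfolded id_def] perm_sign_id clifford_sign_empty id_def)
  then show ?thesis by (subst hc_scalar_eq) (simp add: model_act_linear)
qed

lemma free_space_inter: "free_space B \<inter> free_space C = free_space (B \<inter> C)"
  by (auto simp: free_space_def)

lemma free_space_union:
  assumes "x \<in> free_space (B \<union> C)"
  obtains y z where "y \<in> free_space B" "z \<in> free_space C" "x = y + z"
proof -
  have "\<exists>y\<in>free_space B. \<exists>z\<in>free_space C. x = y + z"
    using assms
  proof (induction rule: free_space_induct)
    case zero
    then show ?case by (intro bexI[of _ 0]) (auto simp: free_space_zero)
  next
    case (basis b)
    then show ?case
    proof
      assume "b \<in> B"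
      then show ?thesis by (intro bexI[of _ "fbasis b"] bexI[of _ 0]) (auto simp: free_space_zero free_space_single)
    next
      assume "b \<in> C"
      then show ?thesis by (intro bexI[of _ 0] bexI[of _ "fbasis b"]) (auto simp: free_space_zero free_space_single)
    qed
  next
    case (add x y)
    then obtain a b c d where "a \<in> free_space B" "b \<in> free_space C" "x = a + b"
      "c \<in> free_space B" "d \<in> free_space C" "y = c + d" by blast
    then show ?case by (intro bexI[of _ "a + c"] bexI[of _ "b + d"]) (auto simp: free_space_add)
  next
    case (scale c x)
    then obtain a b where "a \<in> free_space B" "b \<in> free_space C" "x = a + b" by blast
    then show ?case
      by (intro bexI[of _ "fscale c a"] bexI[of _ "fscale c b"]) (auto simp: free_space_fscale fs.scale_right_distrib)
  qed
  then show ?thesis using that by blast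
qed

lemma hc_module_model: "hc_module n (model n q)"
proof -
  let ?B = "\<lambda>p. {(I, J) \<in> model_basis n q. odd (card I) = p}"
  have ag: "abelian_group (model n q)"
  proof (rule abelian_groupI; simp)
    show "x + y \<in> free_space (model_basis n q)" if "x \<in> free_space (model_basis n q)" "y \<in> free_space (model_basis n q)" for x y
      using that by (rule free_space_add)
    show "0 \<in> free_space (model_basis n q)" by (rule free_space_zero)
    show "\<exists>y\<in>free_space (model_basis n q). y + x = 0" if "x \<in> free_space (model_basis n q)" for x
      using free_space_uminus[OF that] by (intro bexI[of _ "- x"]) auto
  qed
  interpret X: abelian_group "model n q" by (rule ag)
  have minus: "\<ominus>\<^bsub>model n q\<^esub> x = - x" if "x \<in> free_space (model_basis n q)" for x
    using that by (intro X.minus_equality) (auto intro: free_space_uminus)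
  have sub: "free_space (?B p) \<subseteq> free_space (model_basis n q)" for p
    unfolding free_space_def by auto
  have X: "supermodule (hecke_clifford n) (model n q)"
  proof (intro supermodule.intro ag supermodule_axioms.intro; (simp only: model_simps)?)
    fix p show "additive_subgroup (free_space (?B p)) (model n q)"
    proof (rule X.additive_subgroup_of_closed; (simp only: model_simps)?)
      fix x assume x: "x \<in> free_space (?B p)"
      then have "x \<in> free_space (model_basis n q)" using sub by blast
      then show "\<ominus>\<^bsub>model n q\<^esub> x \<in> free_space (?B p)" using free_space_uminus[OF x] minus by simp
    qed (use sub in \<open>auto intro: free_space_zero free_space_add\<close>)
  next
    show "free_space (model_basis n q) = free_space (?B False) <+>\<^bsub>model n q\<^esub> free_space (?B True)"
    proof (intro equalityI subsetI)
      fix x assume "x \<in> free_space (model_basis n q)"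
      moreover have "model_basis n q = ?B False \<union> ?B True" by auto
      ultimately have "x \<in> free_space (?B False \<union> ?B True)" by metis
      from free_space_union[OF this] obtain y z where
        "y \<in> free_space (?B False)" "z \<in> free_space (?B True)" "x = y + z" by blast
      then show "x \<in> free_space (?B False) <+>\<^bsub>model n q\<^esub> free_space (?B True)"
        unfolding set_add_def' model_simps by blast
    next
      fix x assume "x \<in> free_space (?B False) <+>\<^bsub>model n q\<^esub> free_space (?B True)"
      then obtain y z where "y \<in> free_space (?B False)" "z \<in> free_space (?B True)" "x = y + z"
        unfolding set_add_def' model_simps by blast
      then show "x \<in> free_space (model_basis n q)" using sub free_space_add by blast
    qed
  next
    have "?B False \<inter> ?B True = {}" by auto
    then have "free_space (?B False) \<inter> free_space (?B True) = free_space {}" by (simp only: free_space_inter)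
    then show "free_space (?B False) \<inter> free_space (?B True) = {0}" by (simp add: free_space_def)
  next
    fix a p x r assume a: "a \<in> hecke_clifford n \<inter> hc_part p" and x: "x \<in> free_space (?B r)"
    have "a \<in> free_space (hc_basis n \<inter> {(I, w). odd (card I) = p})"
      using a unfolding hecke_clifford_def hc_part_def free_space_inter .
    then show "model_act a x \<in> free_space (?B (p \<noteq> r))"
      unfolding model_act_def
    proof (rule flinear_closed)
      fix g assume g: "g \<in> hc_basis n \<inter> {(I, w). odd (card I) = p}"
      show "flinear (model_act_basis g) x \<in> free_space (?B (p \<noteq> r))" using x
      proof (rule flinear_closed)
        fix t assume t: "t \<in> ?B r"
        obtain K w I J where e: "g = (K, w)" "t = (I, J)" by (metis surj_pair)
        have w: "w permutes {..<n}" and fin: "finite K" "finite I"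
          using g t e by (auto simp: model_basis_def intro: finite_subset[of _ "{..<n}"])
        have "card (w ` I) = card I" using permutes_inj_on[OF w] by (rule card_image)
        then have "(-1) ^ card (sym_diff K (w ` I)) = (-1) ^ card K * (-1 :: int) ^ card I"
          using card_symmetric_difference_parity[of K "w ` I"] fin by simp
        then have "odd (card (sym_diff K (w ` I))) \<longleftrightarrow> odd (card K) \<noteq> odd (card I)"
          by (auto simp: minus_one_power_iff split: if_splits)
        moreover have "(sym_diff K (w ` I), w ` J) \<in> model_basis n q"
          using g t e by (intro model_basis_closed) auto
        ultimately show "model_act_basis g t \<in> free_space (?B (p \<noteq> r))"
          unfolding e model_act_basis.simps using g t e by (intro free_space_single) auto
      qed
    qed
  qed (simp_all add: model_act_closed model_act_linear model_act_mult model_act_scalar)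
  have "finite (model_basis n q)"
    unfolding model_basis_def by (intro finite_cartesian_product) (auto intro: finite_subset[of _ "Pow {..<n}"])
  moreover have "x \<in> lin_span (model n q) (fbasis ` model_basis n q)" if "x \<in> free_space (model_basis n q)" for x
  proof -
    have step: "y + fscale c (fbasis b) \<in> lin_span (model n q) (fbasis ` model_basis n q)"
      if "y \<in> lin_span (model n q) (fbasis ` model_basis n q)" "b \<in> model_basis n q" for y c b
      using lin_span.step[OF that(1), of "fbasis b" c] that(2) by (simp add: model_act_scalar)
    have "(\<Sum>b\<in>T. fscale (Poly_Mapping.lookup x b) (fbasis b)) \<in> lin_span (model n q) (fbasis ` model_basis n q)"
      if "finite T" "T \<subseteq> model_basis n q" for T
      using that
    proof (induction T)
      case empty
      then show ?case using lin_span.zero[of "model n q"] by simp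
    next
      case (insert b T)
      then show ?case using step[of "\<Sum>b\<in>T. fscale (Poly_Mapping.lookup x b) (fbasis b)" b]
        by (simp add: add.commute)
    qed
    from this[of "Poly_Mapping.keys x"] have "flinear fbasis x \<in> lin_span (model n q) (fbasis ` model_basis n q)"
      using that unfolding flinear_def by (simp add: free_space_def)
    then show ?thesis by simp
  qed
  ultimately have "fin_dim (model n q)"
    by (intro iffD2[OF fin_dim_iff[OF X]] exI[of _ "fbasis ` model_basis n q"]) (auto intro: free_space_single)
  then show ?thesis using X by (simp add: hc_module_def)
qed

section \<open>Recognizing induced modules\<close>

lemma subspace_tensor_relations: "fs.subspace (tensor_relations A B M)"
  unfolding tensor_relations_def by (rule fs.subspace_span)

lemma tensor_rel_add_left: "a \<in> A \<Longrightarrow> a' \<in> A \<Longrightarrow> v \<in> carrier M \<Longrightarrow>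
    fbasis (a + a', v) - fbasis (a, v) - fbasis (a', v) \<in> tensor_relations A B M"
  and tensor_rel_add_right: "a \<in> A \<Longrightarrow> v \<in> carrier M \<Longrightarrow> v' \<in> carrier M \<Longrightarrow>
    fbasis (a, v \<oplus>\<^bsub>M\<^esub> v') - fbasis (a, v) - fbasis (a, v') \<in> tensor_relations A B M"
  and tensor_rel_scale: "a \<in> A \<Longrightarrow> v \<in> carrier M \<Longrightarrow>
    fbasis (fscale c a, v) - fscale c (fbasis (a, v)) \<in> tensor_relations A B M"
  and tensor_rel_balance: "a \<in> A \<Longrightarrow> b \<in> B \<Longrightarrow> v \<in> carrier M \<Longrightarrow>
    fbasis (a \<star> b, v) - fbasis (a, b \<odot>\<^bsub>M\<^esub> v) \<in> tensor_relations A B M"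
  unfolding tensor_relations_def by (rule fs.span_base; blast)+

lemma hc_mult_scalar_right:
  assumes "a \<in> hecke_clifford n" shows "a \<star> hc_scalar c = fscale c a"
  using assms unfolding hecke_clifford_def
proof (induction rule: free_space_induct)
  case (basis g)
  obtain I w where g: "g = (I, w)" by fastforce
  have "fbasis g \<star> hc_scalar c = fscale c (fbasis g \<star> fbasis ({}, id))"
    by (subst hc_scalar_eq) (simp only: hc_mult_scale_right hc_scalar_def)
  then show ?case unfolding g hc_mult_fbasis by (simp add: perm_sign_def clifford_sign_def)
qed (simp_all add: hc_mult_add_left hc_mult_scale_left fs.scale_right_distrib mult.commute)

text \<open>To identify the induced module with \<open>X\<close>, it suffices to give the equivariant map \<open>\<gamma>\<close> to \<open>X\<close> and,
  for each basis vector of \<open>X\<close>, a preimage under the induced map such that every symbol is equivalent,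
  modulo the defining relations, to a combination of these preimages. Then the relations are exactly
  the kernel of the induced map.\<close>

locale induction_model =
  fixes n :: nat and B0 :: "hc set" and M :: "(hc, 'v) smod"
    and X :: "(hc, 'b \<Rightarrow>\<^sub>0 complex) smod" and B :: "'b set" and Bp :: "bool \<Rightarrow> 'b set"
    and \<gamma> :: "'v \<Rightarrow> 'b \<Rightarrow>\<^sub>0 complex" and s :: "'b \<Rightarrow> (hc \<times> 'v) \<Rightarrow>\<^sub>0 complex"
  assumes hX: "hc_module n X"
    and X_carrier: "carrier X = free_space B" and X_add: "add X = (+)" and X_zero: "\<zero>\<^bsub>X\<^esub> = 0"
    and X_scalar: "\<And>c x. hc_scalar c \<odot>\<^bsub>X\<^esub> x = fscale c x"
    and X_part: "\<And>p. part X p = free_space (Bp p)" and Bp_sub: "\<And>p. Bp p \<subseteq> B"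
    and B0: "B0 \<subseteq> hecke_clifford n"
    and M_add: "\<And>u v. u \<in> carrier M \<Longrightarrow> v \<in> carrier M \<Longrightarrow> u \<oplus>\<^bsub>M\<^esub> v \<in> carrier M"
    and M_act: "\<And>b v. b \<in> B0 \<Longrightarrow> v \<in> carrier M \<Longrightarrow> b \<odot>\<^bsub>M\<^esub> v \<in> carrier M"
    and M_part: "\<And>p. part M p \<subseteq> carrier M"
    and \<gamma>_closed: "\<And>v. v \<in> carrier M \<Longrightarrow> \<gamma> v \<in> free_space B"
    and \<gamma>_add: "\<And>u v. u \<in> carrier M \<Longrightarrow> v \<in> carrier M \<Longrightarrow> \<gamma> (u \<oplus>\<^bsub>M\<^esub> v) = \<gamma> u + \<gamma> v"
    and \<gamma>_act: "\<And>b v. b \<in> B0 \<Longrightarrow> v \<in> carrier M \<Longrightarrow> \<gamma> (b \<odot>\<^bsub>M\<^esub> v) = b \<odot>\<^bsub>X\<^esub> \<gamma> v"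
    and \<gamma>_part: "\<And>v t. v \<in> part M t \<Longrightarrow> \<gamma> v \<in> part X t"
    and s_part: "\<And>b p. b \<in> Bp p \<Longrightarrow> s b \<in> free_space
        {(a, v). \<exists>r t. a \<in> hecke_clifford n \<inter> hc_part r \<and> v \<in> part M t \<and> p = (r \<noteq> t)}"
    and s_closed: "\<And>b. b \<in> B \<Longrightarrow> s b \<in> free_space (hecke_clifford n \<times> carrier M)"
    and s_section: "\<And>b. b \<in> B \<Longrightarrow> flinear (\<lambda>(a, v). a \<odot>\<^bsub>X\<^esub> \<gamma> v) (s b) = fbasis b"
    and normal_form: "\<And>g v. g \<in> hc_basis n \<Longrightarrow> v \<in> carrier M \<Longrightarrow>
        fbasis (fbasis g, v) - flinear s (fbasis g \<odot>\<^bsub>X\<^esub> \<gamma> v) \<in> tensor_relations (hecke_clifford n) B0 M"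
begin

abbreviation "A \<equiv> hecke_clifford n"
abbreviation "R \<equiv> tensor_relations A B0 M"
abbreviation "F \<equiv> flinear (\<lambda>(a, v). a \<odot>\<^bsub>X\<^esub> \<gamma> v)"
abbreviation "symbols \<equiv> free_space (A \<times> carrier M)"

lemmas subspace_R = subspace_tensor_relations[of A B0 M]
  and rel_add_left = tensor_rel_add_left[of _ A _ _ M B0]
  and rel_scale = tensor_rel_scale[of _ A _ M _ B0]

lemma X_super: "supermodule A X" and X_fin: "fin_dim X"
  using hX by (auto simp: hc_module_def)

lemma X_act_closed: "a \<in> A \<Longrightarrow> x \<in> free_space B \<Longrightarrow> a \<odot>\<^bsub>X\<^esub> x \<in> free_space B"
  using supermodule.act_closed[OF X_super] X_carrier by auto

lemma X_act_add_left: "a \<in> A \<Longrightarrow> b \<in> A \<Longrightarrow> x \<in> free_space B \<Longrightarrow> (a + b) \<odot>\<^bsub>X\<^esub> x = a \<odot>\<^bsub>X\<^esub> x + b \<odot>\<^bsub>X\<^esub> x"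
  using supermodule.act_add_left[OF X_super] X_carrier X_add by auto

lemma X_act_add_right: "a \<in> A \<Longrightarrow> x \<in> free_space B \<Longrightarrow> y \<in> free_space B \<Longrightarrow> a \<odot>\<^bsub>X\<^esub> (x + y) = a \<odot>\<^bsub>X\<^esub> x + a \<odot>\<^bsub>X\<^esub> y"
  using supermodule.act_add_right[OF X_super] X_carrier X_add by auto

lemma X_act_mult: "a \<in> A \<Longrightarrow> b \<in> A \<Longrightarrow> x \<in> free_space B \<Longrightarrow> (a \<star> b) \<odot>\<^bsub>X\<^esub> x = a \<odot>\<^bsub>X\<^esub> (b \<odot>\<^bsub>X\<^esub> x)"
  using supermodule.act_mult[OF X_super] X_carrier by auto

lemma X_act_fscale_left: "a \<in> A \<Longrightarrow> x \<in> free_space B \<Longrightarrow> fscale c a \<odot>\<^bsub>X\<^esub> x = fscale c (a \<odot>\<^bsub>X\<^esub> x)"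
  using X_act_mult[of "hc_scalar c" a x] by (simp add: X_scalar)

lemma X_act_zero: "x \<in> free_space B \<Longrightarrow> 0 \<odot>\<^bsub>X\<^esub> x = 0"
  using X_act_fscale_left[of 0 x 0] by simp

lemma X_act_fscale_right:
  assumes "a \<in> A" "x \<in> free_space B" shows "a \<odot>\<^bsub>X\<^esub> fscale c x = fscale c (a \<odot>\<^bsub>X\<^esub> x)"
  using X_act_mult[of a "hc_scalar c" x] X_act_fscale_left[of a x c] assms
  by (simp add: X_scalar hc_mult_scalar_right)

lemma F_closed: "y \<in> symbols \<Longrightarrow> F y \<in> free_space B"
  by (rule flinear_closed) (auto simp: \<gamma>_closed X_act_closed)

lemma R_kernel:
  assumes "y \<in> R" shows "F y = 0"
proof -
  have sub: "fs.subspace {0 :: 'b \<Rightarrow>\<^sub>0 complex}" by (simp add: fs.subspace_def)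
  have gens: "F g \<in> {0}" if "g \<in> {fbasis (a + a', v) - fbasis (a, v) - fbasis (a', v) | a a' v. a \<in> A \<and> a' \<in> A \<and> v \<in> carrier M} \<union>
     {fbasis (a, v \<oplus>\<^bsub>M\<^esub> v') - fbasis (a, v) - fbasis (a, v') | a v v'. a \<in> A \<and> v \<in> carrier M \<and> v' \<in> carrier M} \<union>
     {fbasis (fscale c a, v) - fscale c (fbasis (a, v)) | c a v. a \<in> A \<and> v \<in> carrier M} \<union>
     {fbasis (a \<star> b, v) - fbasis (a, b \<odot>\<^bsub>M\<^esub> v) | a b v. a \<in> A \<and> b \<in> B0 \<and> v \<in> carrier M}" for g
    using that B0
    by (auto simp: flinear_diff flinear_fscale \<gamma>_closed \<gamma>_add \<gamma>_act X_act_add_left X_act_add_right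
        X_act_fscale_left X_act_mult subset_iff simp del: fscale_single)
  have "F y \<in> {0}"
    using assms unfolding tensor_relations_def by (rule fs_span_induct_linear[OF _ gens sub])
  then show "F y = 0" by simp
qed

lemma normal_form_symbol:
  assumes "a \<in> A" and v: "v \<in> carrier M"
  shows "fbasis (a, v) - flinear s (a \<odot>\<^bsub>X\<^esub> \<gamma> v) \<in> R"
  using assms(1) unfolding hecke_clifford_def
proof (induction rule: free_space_induct)
  case zero
  have "fbasis (fscale 0 0, v) - fscale 0 (fbasis (0, v)) \<in> R" by (rule rel_scale) (use v in auto)
  then show ?case unfolding hecke_clifford_def using v by (simp add: X_act_zero \<gamma>_closed)
next
  case (basis g)
  then show ?case using normal_form[OF _ v] unfolding hecke_clifford_def by blast
next
  case (add a b)
  have ab: "a \<in> A" "b \<in> A" using add by (auto simp: hecke_clifford_def)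
  have "fbasis (a + b, v) - flinear s ((a + b) \<odot>\<^bsub>X\<^esub> \<gamma> v)
    = (fbasis (a + b, v) - fbasis (a, v) - fbasis (b, v)) + (fbasis (a, v) - flinear s (a \<odot>\<^bsub>X\<^esub> \<gamma> v)) + (fbasis (b, v) - flinear s (b \<odot>\<^bsub>X\<^esub> \<gamma> v))"
    using ab v by (simp add: X_act_add_left \<gamma>_closed flinear_add)
  also have "\<dots> \<in> R"
    using add rel_add_left[OF ab v] unfolding hecke_clifford_def[symmetric]
    by (intro fs.subspace_add[OF subspace_R])
  finally show ?case unfolding hecke_clifford_def[symmetric] .
next
  case (scale c a)
  have a: "a \<in> A" using scale by (simp add: hecke_clifford_def)
  have "fbasis (fscale c a, v) - flinear s (fscale c a \<odot>\<^bsub>X\<^esub> \<gamma> v)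
    = (fbasis (fscale c a, v) - fscale c (fbasis (a, v))) + fscale c (fbasis (a, v) - flinear s (a \<odot>\<^bsub>X\<^esub> \<gamma> v))"
    using a v by (simp add: X_act_fscale_left \<gamma>_closed flinear_fscale fs.scale_right_diff_distrib del: fscale_single)
  also have "\<dots> \<in> R"
    using scale rel_scale[OF a v] unfolding hecke_clifford_def[symmetric]
    by (intro fs.subspace_add[OF subspace_R] fs.subspace_scale[OF subspace_R])
  finally show ?case unfolding hecke_clifford_def[symmetric] .
qed

lemma normal_form_all:
  assumes "y \<in> symbols" shows "y - flinear s (F y) \<in> R"
  using assms
proof (induction rule: free_space_induct)
  case zero
  then show ?case using fs.subspace_0[OF subspace_R] by simp
next
  case (basis p)
  then show ?case using normal_form_symbol by (cases p) auto
next
  case (add x y)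
  have "x + y - flinear s (F (x + y)) = (x - flinear s (F x)) + (y - flinear s (F y))" by (simp add: flinear_add)
  then show ?case using fs.subspace_add[OF subspace_R add.IH] by (simp only:)
next
  case (scale c x)
  have "fscale c x - flinear s (F (fscale c x)) = fscale c (x - flinear s (F x))"
    by (simp add: flinear_fscale fs.scale_right_diff_distrib)
  then show ?case using fs.subspace_scale[OF subspace_R scale.IH] by (simp only:)
qed

lemma kernel_R: "y \<in> symbols \<Longrightarrow> F y = 0 \<Longrightarrow> y \<in> R"
  using normal_form_all[of y] by simp

lemma s_lin_closed: "x \<in> free_space B \<Longrightarrow> flinear s x \<in> symbols"
  by (rule flinear_closed) (auto intro: s_closed)

lemma F_s: "x \<in> free_space B \<Longrightarrow> F (flinear s x) = x"
  unfolding flinear_flinear by (subst flinear_cong[of x B _ fbasis]) (auto simp: s_section)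

lemma R_sub: "R \<subseteq> symbols"
proof -
  have "R \<subseteq> free_space (A \<times> carrier M)"
    unfolding tensor_relations_def
    by (rule fs.span_minimal[OF _ subspace_free_space])
      (use B0 in \<open>auto intro!: free_space_diff free_space_fscale free_space_single
        simp: hc_add_closed hc_scale_closed hc_mult_closed M_add M_act subset_iff simp del: fscale_single\<close>)
  then show ?thesis .
qed

abbreviation "left_mult a \<equiv> flinear (\<lambda>(b, v). fbasis (a \<star> b, v))"

lemma left_mult_closed: "a \<in> A \<Longrightarrow> y \<in> symbols \<Longrightarrow> left_mult a y \<in> symbols"
  by (rule flinear_closed) (auto intro!: free_space_single hc_mult_closed)

lemma F_left_mult:
  assumes a: "a \<in> A" and "y \<in> symbols" shows "F (left_mult a y) = a \<odot>\<^bsub>X\<^esub> F y"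
  using assms(2)
proof (induction rule: free_space_induct)
  case zero
  then show ?case using X_act_fscale_right[OF a free_space_zero, of 0] by simp
next
  case (basis p)
  then show ?case using a by (cases p) (auto simp: X_act_mult \<gamma>_closed)
next
  case (add x y)
  then show ?case using a by (simp add: flinear_add X_act_add_right F_closed)
next
  case (scale c x)
  then show ?case using a by (simp add: flinear_fscale X_act_fscale_right F_closed)
qed

text \<open>The map \<open>F\<close> from the symbols to \<open>X\<close> is surjective with kernel
  \<open>R\<close>, so \<open>X\<close> is the quotient of the symbols by \<open>R\<close>.\<close>

theorem induced_model:
  "hc_module n (induced_module A B0 M)" "smod_even_iso A X (induced_module A B0 M)"
proof -
  let ?N = "induced_module A B0 M" and ?f = "\<lambda>x. fcoset R (flinear s x)"
  let ?H = "\<lambda>p. {(a, v). \<exists>r t. a \<in> A \<inter> hc_part r \<and> v \<in> part M t \<and> p = (r \<noteq> t)}"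
  have N: "carrier ?N = fcoset R ` symbols" "\<zero>\<^bsub>?N\<^esub> = fcoset R 0" "add ?N = qadd"
    "smult ?N a = qmap R (left_mult a)" "part ?N p = fcoset R ` free_space (?H p)" for a p
    by (simp_all add: induced_module_def Let_def)
  have coset: "fcoset R y = ?f (F y)" if "y \<in> symbols" for y
    using normal_form_all[OF that] by (simp add: fcoset_eq_iff[OF subspace_R])
  have inj: "inj_on ?f (free_space B)"
  proof (rule inj_onI)
    fix x y assume xy: "x \<in> free_space B" "y \<in> free_space B" "?f x = ?f y"
    then have "flinear s (x - y) \<in> R" by (simp add: fcoset_eq_iff[OF subspace_R] flinear_diff)
    then have "F (flinear s (x - y)) = 0" by (rule R_kernel)
    then show "x = y" using F_s[OF free_space_diff[OF xy(1,2)]] by simp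
  qed
  have bij: "bij_betw ?f (carrier X) (carrier ?N)"
    unfolding bij_betw_def X_carrier N
  proof (intro conjI inj equalityI subsetI)
    fix C assume "C \<in> ?f ` free_space B"
    then show "C \<in> fcoset R ` symbols" using s_lin_closed by blast
  next
    fix C assume "C \<in> fcoset R ` symbols"
    then obtain y where "y \<in> symbols" "C = fcoset R y" by blast
    then show "C \<in> ?f ` free_space B" using coset F_closed by blast
  qed
  have add: "?f (x \<oplus>\<^bsub>X\<^esub> y) = ?f x \<oplus>\<^bsub>?N\<^esub> ?f y" for x y
    unfolding X_add N by (simp add: qadd_fcoset[OF subspace_R] flinear_add)
  have zero: "\<zero>\<^bsub>?N\<^esub> = ?f \<zero>\<^bsub>X\<^esub>" unfolding X_zero N by simp
  have act: "?f (a \<odot>\<^bsub>X\<^esub> x) = a \<odot>\<^bsub>?N\<^esub> ?f x" if a: "a \<in> A" and x: "x \<in> carrier X" for a x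
  proof -
    have x': "x \<in> free_space B" using x X_carrier by simp
    have "left_mult a y - left_mult a z \<in> R" if "y \<in> fcoset R z" for y z
    proof -
      have yz: "y - z \<in> R" using that by (simp add: fcoset_def)
      then have sym: "y - z \<in> symbols" using R_sub by blast
      have "F (left_mult a (y - z)) = a \<odot>\<^bsub>X\<^esub> 0" using F_left_mult[OF a sym] R_kernel[OF yz] by simp
      also have "\<dots> = 0" using X_act_fscale_right[OF a free_space_zero, of 0] by simp
      finally have "left_mult a (y - z) \<in> R" by (intro kernel_R left_mult_closed[OF a sym])
      then show ?thesis by (simp add: flinear_diff)
    qed
    then have "a \<odot>\<^bsub>?N\<^esub> ?f x = fcoset R (left_mult a (flinear s x))"
      unfolding N by (rule qmap_fcoset[OF subspace_R])
    also have "\<dots> = ?f (F (left_mult a (flinear s x)))"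
      by (rule coset[OF left_mult_closed[OF a s_lin_closed[OF x']]])
    also have "\<dots> = ?f (a \<odot>\<^bsub>X\<^esub> x)"
      using F_left_mult[OF a s_lin_closed[OF x']] F_s[OF x'] by simp
    finally show ?thesis by simp
  qed
  have part: "part ?N p = ?f ` part X p" for p
    unfolding N X_part
  proof (intro equalityI subsetI)
    fix C assume "C \<in> fcoset R ` free_space (?H p)"
    then obtain y where y: "y \<in> free_space (?H p)" "C = fcoset R y" by blast
    have "?H p \<subseteq> A \<times> carrier M" using M_part by blast
    then have sym: "y \<in> symbols" using y(1) by (auto simp: free_space_def)
    have "F y \<in> free_space (Bp p)"
      using y(1)
    proof (rule flinear_closed)
      fix h assume "h \<in> ?H p"
      then obtain a v r t where h: "h = (a, v)" "a \<in> A \<inter> hc_part r" "v \<in> part M t" "p = (r \<noteq> t)" by blast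
      have "a \<odot>\<^bsub>X\<^esub> \<gamma> v \<in> part X (r \<noteq> t)"
        by (rule supermodule.part_act[OF X_super h(2) \<gamma>_part[OF h(3)]])
      then show "(case h of (a, v) \<Rightarrow> a \<odot>\<^bsub>X\<^esub> \<gamma> v) \<in> free_space (Bp p)" using h X_part by simp
    qed
    then show "C \<in> ?f ` free_space (Bp p)" using y(2) coset[OF sym] by blast
  next
    fix C assume "C \<in> ?f ` free_space (Bp p)"
    then obtain x where x: "x \<in> free_space (Bp p)" "C = ?f x" by blast
    have "flinear s x \<in> free_space (?H p)" using x(1) by (rule flinear_closed) (rule s_part)
    then show "C \<in> fcoset R ` free_space (?H p)" using x(2) by blast
  qed
  show "hc_module n ?N" by (rule hc_module_transport(1)[OF hX bij add zero act part])
  show "smod_even_iso A X ?N" by (rule hc_module_transport(2)[OF hX bij add zero act part])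
qed

end

section \<open>Modules induced from the trivial module\<close>

lemma ex_permutation_onto:
  assumes "J \<subseteq> {..<n}" "card J = q"
  shows "\<exists>g. g permutes {..<n} \<and> g ` {..<q} = J"
proof -
  have fin: "finite J" using assms by (auto intro: finite_subset)
  have qn: "q \<le> n" using assms card_mono[of "{..<n}" J] by simp
  obtain f where f: "bij_betw f {..<q} J" using finite_same_card_bij[of "{..<q}" J] fin assms by auto
  have "card ({..<n} - J) = card {q..<n}" using assms fin by (simp add: card_Diff_subset)
  then obtain f' where f': "bij_betw f' {q..<n} ({..<n} - J)"
    using finite_same_card_bij[of "{q..<n}" "{..<n} - J"] by auto
  let ?g = "\<lambda>i. if i < q then f i else if i < n then f' i else i"
  have g1: "bij_betw ?g {..<q} J" using f by (rule bij_betw_cong[THEN iffD1, rotated]) auto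
  have g2: "bij_betw ?g {q..<n} ({..<n} - J)" using f' by (rule bij_betw_cong[THEN iffD1, rotated]) auto
  have "bij_betw ?g ({..<q} \<union> {q..<n}) (J \<union> ({..<n} - J))"
    using g1 g2 by (rule bij_betw_combine) auto
  moreover have "{..<q} \<union> {q..<n} = {..<n}" "J \<union> ({..<n} - J) = {..<n}" using qn assms by auto
  ultimately have "?g permutes {..<n}" using qn by (intro bij_imp_permutes) auto
  moreover have "?g ` {..<q} = J" using g1 by (simp add: bij_betw_def)
  ultimately show ?thesis by blast
qed

definition block_stabilizer :: "nat \<Rightarrow> nat \<Rightarrow> (nat \<Rightarrow> nat) set" where
  "block_stabilizer n q = {w. w permutes {..<n} \<and> w ` {..<q} = {..<q}}"

text \<open>The vector generating a copy of the trivial module has the parity of \<open>q\<close>,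
  whereas the trivial module is even; this accounts for the shift.\<close>

definition shifted_model :: "nat \<Rightarrow> nat \<Rightarrow> (hc, (nat set \<times> nat set) \<Rightarrow>\<^sub>0 complex) smod" where
  "shifted_model n q = (if odd q then parity_shift (model n q) else model n q)"

definition twist :: "nat \<Rightarrow> hc \<Rightarrow> hc" where
  "twist q a = (if odd q then hc_grading a else a)"

definition twist_sign :: "nat \<Rightarrow> nat set \<Rightarrow> complex" where
  "twist_sign q K = (if odd q then (-1) ^ card K else 1)"

lemma twist_single: "twist q (Poly_Mapping.single (K, w) c) = Poly_Mapping.single (K, w) (c * twist_sign q K)"
  by (simp add: twist_def twist_sign_def hc_grading_single)

lemma twist_linear: "twist q (a + b) = twist q a + twist q b" "twist q (fscale c a) = fscale c (twist q a)" "twist q 0 = 0"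
  by (simp_all add: twist_def hc_grading_add hc_grading_scale)

lemma twist_sign_square: "twist_sign q K * twist_sign q K = 1"
  by (simp add: twist_sign_def sign_square)

lemma shifted_model_simps [simp]:
  "carrier (shifted_model n q) = free_space (model_basis n q)" "\<zero>\<^bsub>shifted_model n q\<^esub> = 0"
  "add (shifted_model n q) = (+)" "a \<odot>\<^bsub>shifted_model n q\<^esub> x = model_act (twist q a) x"
  "part (shifted_model n q) p = free_space {(I, J) \<in> model_basis n q. odd (card I) = (p \<noteq> odd q)}"
  by (simp_all add: shifted_model_def twist_def)

lemma hc_module_shifted_model: "hc_module n (shifted_model n q)"
  by (simp add: shifted_model_def hc_module_model parity_shift_hc_module)

abbreviation trivial_vector :: "nat \<Rightarrow> (nat set \<times> nat set) \<Rightarrow>\<^sub>0 complex" where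
  "trivial_vector q \<equiv> fbasis ({..<q}, {..<q})"

text \<open>In \<open>(K, w) \<cdot> trivial_vector q\<close> the factor \<open>perm_sign w {..<q}\<close> occurs twice, once from the
  Clifford algebra and once from the exterior power; so \<open>block_stabilizer n q\<close> acts trivially.\<close>

lemma act_trivial_vector:
  "model_act (twist q (fbasis (K, w))) (trivial_vector q)
    = fscale (twist_sign q K * clifford_sign K (w ` {..<q})) (fbasis (sym_diff K (w ` {..<q}), w ` {..<q}))"
proof -
  have "perm_sign w {..<q} * clifford_sign K (w ` {..<q}) * perm_sign w {..<q} = clifford_sign K (w ` {..<q})"
    by (metis mult.assoc mult.commute mult_1_right perm_sign_square)
  then show ?thesis
    unfolding twist_single model_act_single model_act_basis.simps by (simp only: fscale_single mult_1_left mult_1_right)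
qed

lemma trivial_module_simps [simp]:
  "carrier trivial_module = UNIV" "add trivial_module = (+)" "\<zero>\<^bsub>trivial_module\<^esub> = 0"
  "part trivial_module p = (if p then {0} else UNIV)"
  "a \<odot>\<^bsub>trivial_module\<^esub> v = (\<Sum>g\<in>Poly_Mapping.keys a. Poly_Mapping.lookup a g) * v"
  by (simp_all add: trivial_module_def)

lemma coefficient_sum_eq:
  "(\<Sum>g\<in>Poly_Mapping.keys a. Poly_Mapping.lookup a g) = Poly_Mapping.lookup (flinear (\<lambda>_. fbasis ()) a) ()"
  by (simp add: flinear_def lookup_sum)

lemma block_stabilizer_invariant:
  assumes "b \<in> group_algebra (block_stabilizer n q)"
  shows "model_act (twist q b) (trivial_vector q)
    = fscale (Poly_Mapping.lookup (flinear (\<lambda>_. fbasis ()) b) ()) (trivial_vector q)"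
  using assms unfolding group_algebra_def
proof (induction rule: free_space_induct)
  case (basis g)
  then obtain w where g: "g = ({}, w)" "w ` {..<q} = {..<q}" by (auto simp: block_stabilizer_def)
  then show ?case unfolding g(1) act_trivial_vector by (simp add: g(2) twist_sign_def clifford_sign_empty)
next
  case (add x y)
  show ?case unfolding twist_linear model_act_linear add.IH flinear_add lookup_add fs.scale_left_distrib ..
next
  case (scale c x)
  show ?case unfolding twist_linear model_act_linear scale.IH flinear_fscale lookup_fscale fs.scale_scale ..
qed (simp add: twist_linear model_act_linear)

text \<open>Up to sign, the vector \<open>(I, J)\<close> is obtained from \<open>trivial_vector
  q\<close> by the action of \<open>(sym_diff I J, g J)\<close>, where \<open>g J\<close> is a fixed
  permutation that maps \<open>{..<q}\<close> onto \<open>J\<close>. Two permutations with the same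
  image of \<open>{..<q}\<close> differ by an element of the stabilizer on the right, so these elements
  represent every symbol.\<close>

lemma induced_trivial_model:
  assumes q: "q \<le> n"
  shows "hc_module n (induced_module (hecke_clifford n) (group_algebra (block_stabilizer n q)) trivial_module)"
    "smod_even_iso (hecke_clifford n) (shifted_model n q)
      (induced_module (hecke_clifford n) (group_algebra (block_stabilizer n q)) trivial_module)"
proof -
  let ?G = "group_algebra (block_stabilizer n q)" and ?X = "shifted_model n q"
  let ?R = "tensor_relations (hecke_clifford n) ?G trivial_module"
  have "\<forall>J\<in>{J. J \<subseteq> {..<n} \<and> card J = q}. \<exists>g. g permutes {..<n} \<and> g ` {..<q} = J"
  proof
    fix J assume "J \<in> {J. J \<subseteq> {..<n} \<and> card J = q}"
    then show "\<exists>g. g permutes {..<n} \<and> g ` {..<q} = J" by (intro ex_permutation_onto) auto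
  qed
  from bchoice[OF this] obtain g where
    g0: "\<forall>J\<in>{J. J \<subseteq> {..<n} \<and> card J = q}. g J permutes {..<n} \<and> g J ` {..<q} = J" ..
  have g: "g J permutes {..<n} \<and> g J ` {..<q} = J" if "J \<subseteq> {..<n}" "card J = q" for J
    using bspec[OF g0, of J] that by simp
  let ?\<gamma> = "\<lambda>c. fscale c (trivial_vector q)"
  let ?\<epsilon> = "\<lambda>K J. twist_sign q K * clifford_sign K J"
  let ?s = "\<lambda>(I, J). Poly_Mapping.single (fbasis (sym_diff I J, g J), 1 :: complex) (?\<epsilon> (sym_diff I J) J)"
  have eps: "?\<epsilon> K J * ?\<epsilon> K J = 1" for K J
  proof -
    have "?\<epsilon> K J * ?\<epsilon> K J = (twist_sign q K * twist_sign q K) * (clifford_sign K J * clifford_sign K J)" by (simp only: mult_ac)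
    then show ?thesis by (simp only: twist_sign_square clifford_sign_square mult_1_right)
  qed
  have sd: "sym_diff (sym_diff I J) J = I" for I J :: "nat set" by blast
  have sb: "(sym_diff I J, g J) \<in> hc_basis n" if "(I, J) \<in> model_basis n q" for I J
    using that g[of J] by (auto simp: model_basis_def)
  have v0: "trivial_vector q \<in> free_space (model_basis n q)"
    using q by (intro free_space_single) (auto simp: model_basis_def)
  have id: "id \<in> block_stabilizer n q" by (simp add: block_stabilizer_def permutes_id)
  interpret induction_model n ?G trivial_module ?X "model_basis n q"
    "\<lambda>p. {(I, J) \<in> model_basis n q. odd (card I) = (p \<noteq> odd q)}" ?\<gamma> ?s
  proof
    show "hc_module n ?X" by (rule hc_module_shifted_model)
    show "hc_scalar c \<odot>\<^bsub>?X\<^esub> x = fscale c x" for c x by (simp add: twist_def model_act_scalar)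
    show "?G \<subseteq> hecke_clifford n"
      by (auto simp: group_algebra_def hecke_clifford_def free_space_def block_stabilizer_def)
    show "?\<gamma> v \<in> free_space (model_basis n q)" for v using v0 by (rule free_space_fscale)
    show "?\<gamma> (u \<oplus>\<^bsub>trivial_module\<^esub> v) = ?\<gamma> u + ?\<gamma> v" for u v by (simp add: single_add)
  next
    fix b v assume b: "b \<in> ?G"
    show "?\<gamma> (b \<odot>\<^bsub>trivial_module\<^esub> v) = b \<odot>\<^bsub>?X\<^esub> ?\<gamma> v"
      unfolding shifted_model_simps model_act_linear(4) block_stabilizer_invariant[OF b]
      by (simp add: coefficient_sum_eq mult.commute)
  next
    fix v :: complex and t assume v: "v \<in> part trivial_module t"
    show "?\<gamma> v \<in> part ?X t"
    proof (cases t)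
      case True
      then show ?thesis using v by (simp add: free_space_zero)
    next
      case False
      then show ?thesis using q unfolding shifted_model_simps
        by (intro free_space_fscale free_space_single) (auto simp: model_basis_def)
    qed
  next
    fix b p assume "b \<in> {(I, J) \<in> model_basis n q. odd (card I) = (p \<noteq> odd q)}"
    then obtain I J where b: "b = (I, J)" "(I, J) \<in> model_basis n q" "odd (card I) = (p \<noteq> odd q)" by auto
    have fin: "finite I" "finite J" "card J = q" using b(2) by (auto simp: model_basis_def intro: finite_subset[of _ "{..<n}"])
    have "odd (card (sym_diff I J)) = (odd (card I) \<noteq> odd q)"
      using card_symmetric_difference_parity[where 'a = int, OF fin(1,2)] fin(3) by (auto simp: minus_one_power_iff split: if_splits)
    then have "odd (card (sym_diff I J)) = p" using b(3) by auto
    then have "fbasis (sym_diff I J, g J) \<in> hecke_clifford n \<inter> hc_part p"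
      using hc_basis_closed[OF sb[OF b(2)]] by (auto simp: hc_part_def intro: free_space_single)
    then show "?s b \<in> free_space {(a, v). \<exists>r t. a \<in> hecke_clifford n \<inter> hc_part r \<and> v \<in> part trivial_module t \<and> p = (r \<noteq> t)}"
      unfolding b(1) prod.case by (intro free_space_single) (simp only: mem_Collect_eq prod.case, rule exI[of _ p], rule exI[of _ False], simp)
  next
    fix b assume "b \<in> model_basis n q"
    then obtain I J where b: "b = (I, J)" "(I, J) \<in> model_basis n q" by (cases b) auto
    then have gJ: "g J ` {..<q} = J" using g[of J] by (auto simp: model_basis_def)
    show "?s b \<in> free_space (hecke_clifford n \<times> carrier trivial_module)"
      unfolding b(1) prod.case by (intro free_space_single) (use hc_basis_closed[OF sb[OF b(2)]] in auto)
    show "flinear (\<lambda>(a, v). a \<odot>\<^bsub>?X\<^esub> ?\<gamma> v) (?s b) = fbasis b"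
      unfolding b(1) prod.case flinear_single shifted_model_simps fs.scale_one act_trivial_vector gJ sd
        fs.scale_scale eps ..
  next
    fix h and v :: complex assume h: "h \<in> hc_basis n"
    then obtain K w where hw: "h = (K, w)" "K \<subseteq> {..<n}" and w: "w permutes {..<n}" by auto
    let ?J = "w ` {..<q}"
    have J: "?J \<subseteq> {..<n}" "card ?J = q"
      using permutes_image_subset[OF w, of "{..<q}"] q by (auto simp: card_image[OF permutes_inj_on[OF w]])
    have gp: "g ?J permutes {..<n}" and gJ: "g ?J ` {..<q} = ?J" using g[OF J] by blast+
    \<comment> \<open>\<open>w\<close> is the chosen representative \<open>g ?J\<close> times the element \<open>?u\<close> of the stabilizer\<close>
    let ?u = "inv_into UNIV (g ?J) \<circ> w" and ?a = "fbasis (K, g ?J)"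
    have a: "?a \<in> hecke_clifford n" using hw gp by (intro hc_basis_closed) auto
    have gu: "g ?J \<circ> ?u = w" using permutes_inverses[OF gp] by (simp add: fun_eq_iff)
    have "?u permutes {..<n}" using permutes_inv[OF gp] w by (intro permutes_compose)
    moreover have "?u ` {..<q} = {..<q}"
    proof -
      have "?u ` {..<q} = inv_into UNIV (g ?J) ` g ?J ` {..<q}" unfolding gJ by (simp add: image_comp)
      also have "\<dots> = {..<q}" using permutes_inverses[OF gp] by (simp add: image_image)
      finally show ?thesis .
    qed
    ultimately have uG: "fbasis ({}, ?u) \<in> ?G"
      by (auto simp: group_algebra_def block_stabilizer_def intro!: free_space_single)
    have au: "?a \<star> fbasis ({}, ?u) = fbasis (K, w)"
      unfolding hc_mult_fbasis hc_mult_basis.simps gu by (simp add: clifford_sign_empty)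
    have e1: "fbasis (fbasis (K, w), v) - fbasis (?a, v) \<in> ?R"
      using tensor_rel_balance[OF a uG, of v trivial_module] unfolding au by simp
    have sG: "hc_scalar v \<in> ?G"
      using id by (auto simp: group_algebra_def hc_scalar_def intro!: free_space_single)
    have sv: "hc_scalar v \<odot>\<^bsub>trivial_module\<^esub> 1 = v"
      by (simp add: coefficient_sum_eq hc_scalar_def)
    have e2: "fbasis (fscale v ?a, 1) - fbasis (?a, v) \<in> ?R"
      using tensor_rel_balance[OF a sG, of 1 trivial_module] unfolding sv hc_mult_scalar_right[OF a] by simp
    have e3: "fbasis (fscale v ?a, 1) - fscale v (fbasis (?a, 1)) \<in> ?R"
      using tensor_rel_scale[OF a, of 1 trivial_module] by simp
    have "flinear ?s (fbasis h \<odot>\<^bsub>?X\<^esub> ?\<gamma> v) = fscale v (fbasis (?a, 1))"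
    proof -
      have "?s (sym_diff K ?J, ?J) = fscale (?\<epsilon> K ?J) (fbasis (?a, 1))"
        by (simp only: prod.case sd fscale_single mult_1_right)
      then show ?thesis
        unfolding hw(1) shifted_model_simps model_act_linear(4) act_trivial_vector flinear_fscale flinear_single fs.scale_one
        by (simp only: fs.scale_scale eps mult_1_right mult_1_left)
    qed
    moreover have "fbasis (fbasis h, v) - fscale v (fbasis (?a, 1))
      = (fbasis (fbasis (K, w), v) - fbasis (?a, v)) - (fbasis (fscale v ?a, 1) - fbasis (?a, v))
        + (fbasis (fscale v ?a, 1) - fscale v (fbasis (?a, 1)))" unfolding hw(1) by simp
    moreover have "\<dots> \<in> ?R"
      by (intro fs.subspace_add[OF subspace_tensor_relations] fs.subspace_diff[OF subspace_tensor_relations] e1 e2 e3)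
    ultimately show "fbasis (fbasis h, v) - flinear ?s (fbasis h \<odot>\<^bsub>?X\<^esub> ?\<gamma> v) \<in> ?R" by simp
  qed auto
  show "hc_module n (induced_module (hecke_clifford n) ?G trivial_module)"
    "smod_even_iso (hecke_clifford n) ?X (induced_module (hecke_clifford n) ?G trivial_module)"
    by (rule induced_model)+
qed

section \<open>The exterior powers of the permutation module\<close>

lemma clifford_sign_singleton:
  "clifford_sign {i} {} = 1"
  "k \<notin> J \<Longrightarrow> clifford_sign {i} (insert k J) = below_sign i k * clifford_sign {i} J"
proof -
  show "clifford_sign {i} {} = 1" by (simp add: clifford_sign_def)
  have e: "{(i', j). i' \<in> {i} \<and> j \<in> X \<and> j < i'} = Pair i ` {j \<in> X. j < i}" for X by auto
  have c: "clifford_sign {i} X = (-1) ^ card {j \<in> X. j < i}" for X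
    unfolding clifford_sign_def e by (simp add: card_image inj_on_def)
  assume k: "k \<notin> J"
  have "{j \<in> insert k J. j < i} = (if k < i then insert k {j \<in> J. j < i} else {j \<in> J. j < i})" by auto
  moreover have "finite {j \<in> J. j < i}" by (rule finite_subset[of _ "{..<i}"]) auto
  ultimately show "clifford_sign {i} (insert k J) = below_sign i k * clifford_sign {i} J"
    unfolding c below_sign_def using k by simp
qed

text \<open>Exterior multiplication by \<open>e\<^sub>i\<close> on the left, in the basis of the
  \<open>e\<^sub>J\<close>.\<close>

definition wedge_unit :: "nat \<Rightarrow> (nat set \<Rightarrow>\<^sub>0 complex) \<Rightarrow> (nat set \<Rightarrow>\<^sub>0 complex)" where
  "wedge_unit i = flinear (\<lambda>J. if i \<in> J then 0 else Poly_Mapping.single (insert i J) (clifford_sign {i} J))"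

definition wedge :: "nat \<Rightarrow> (nat \<Rightarrow> complex) \<Rightarrow> (nat set \<Rightarrow>\<^sub>0 complex) \<Rightarrow> (nat set \<Rightarrow>\<^sub>0 complex)" where
  "wedge n v x = (\<Sum>i<n. fscale (v i) (wedge_unit i x))"

abbreviation wedge_list :: "nat \<Rightarrow> (nat \<Rightarrow> complex) list \<Rightarrow> (nat set \<Rightarrow>\<^sub>0 complex)" where
  "wedge_list n vs \<equiv> foldr (wedge n) vs (fbasis {})"

lemma wedge_unit_linear:
  "wedge_unit i (x + y) = wedge_unit i x + wedge_unit i y" "wedge_unit i (fscale c x) = fscale c (wedge_unit i x)"
  "wedge_unit i (sum g S) = (\<Sum>s\<in>S. wedge_unit i (g s))" "wedge_unit i 0 = 0"
  by (simp_all add: wedge_unit_def flinear_add flinear_fscale flinear_sum)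

lemma wedge_unit_anticommute: "wedge_unit i (wedge_unit k x) = - wedge_unit k (wedge_unit i x)"
proof (rule free_space_induct[of x UNIV])
  fix J
  consider "i = k" | "i \<noteq> k" "i \<in> J \<or> k \<in> J" | "i \<noteq> k" "i \<notin> J" "k \<notin> J" by blast
  then show "wedge_unit i (wedge_unit k (fbasis J)) = - wedge_unit k (wedge_unit i (fbasis J))"
  proof cases
    case 3
    have "below_sign i k = - below_sign k i" using 3 by (simp add: below_sign_def)
    then have "clifford_sign {k} J * clifford_sign {i} (insert k J) = - (clifford_sign {i} J * clifford_sign {k} (insert i J))"
      using 3 by (simp add: clifford_sign_singleton)
    then show ?thesis using 3 by (simp add: wedge_unit_def insert_commute single_uminus)
  qed (auto simp: wedge_unit_def)
qed (simp_all add: wedge_unit_linear fs.scale_minus_right)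

lemma wedge_linear:
  "wedge n v (x + y) = wedge n v x + wedge n v y" "wedge n v (fscale c x) = fscale c (wedge n v x)"
  "wedge n v 0 = 0" "wedge n (\<lambda>i. u i + v i) x = wedge n u x + wedge n v x"
  "wedge n (\<lambda>i. c * v i) x = fscale c (wedge n v x)"
  by (simp_all add: wedge_def wedge_unit_linear fs.scale_right_distrib fs.scale_left_distrib sum.distrib
      fs.scale_sum_right mult.commute)

lemma wedge_anticommute: "wedge n u (wedge n v x) = - wedge n v (wedge n u x)"
proof -
  have e: "wedge n u (wedge n v x) = (\<Sum>i<n. \<Sum>k<n. fscale (u i * v k) (wedge_unit i (wedge_unit k x)))" for u v
    by (simp add: wedge_def wedge_unit_linear fs.scale_sum_right)
  have "wedge n u (wedge n v x) = (\<Sum>i<n. \<Sum>k<n. - fscale (v k * u i) (wedge_unit k (wedge_unit i x)))"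
    unfolding e by (intro sum.cong refl) (subst wedge_unit_anticommute, simp add: fs.scale_minus_right mult.commute)
  also have "\<dots> = - wedge n v (wedge n u x)"
    unfolding e sum_negf by (subst sum.swap) simp
  finally show ?thesis .
qed

lemma wedge_square: "wedge n v (wedge n v x) = 0"
proof (rule poly_mapping_eqI)
  fix b
  have "Poly_Mapping.lookup (wedge n v (wedge n v x)) b = - Poly_Mapping.lookup (wedge n v (wedge n v x)) b"
    by (subst wedge_anticommute) simp
  then show "Poly_Mapping.lookup (wedge n v (wedge n v x)) b = Poly_Mapping.lookup 0 b" by simp
qed

lemma foldr_wedge_linear:
  "foldr (wedge n) us (x + y) = foldr (wedge n) us x + foldr (wedge n) us y"
  "foldr (wedge n) us (fscale c x) = fscale c (foldr (wedge n) us x)"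
  "foldr (wedge n) us 0 = 0"
  by (induction us) (simp_all add: wedge_linear)

lemma wedge_repeated: "v \<in> set us \<Longrightarrow> wedge n v (foldr (wedge n) us x) = 0"
proof (induction us)
  case (Cons a us)
  show ?case
  proof (cases "v = a")
    case False
    then have "wedge n v (foldr (wedge n) us x) = 0" using Cons by auto
    then show ?thesis using wedge_anticommute[of n v a "foldr (wedge n) us x"] by (simp add: wedge_linear)
  qed (simp add: wedge_square)
qed simp

lemma wedge_list_repeated: "\<not> distinct vs \<Longrightarrow> wedge_list n vs = 0"
  by (induction vs) (auto simp: wedge_repeated wedge_linear)

abbreviation subsets_of_card :: "nat \<Rightarrow> nat \<Rightarrow> nat set set" where
  "subsets_of_card n q \<equiv> {J. J \<subseteq> {..<n} \<and> card J = q}"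

lemma finite_subset_lessThan: "J \<subseteq> {..<n} \<Longrightarrow> finite (J :: nat set)"
  by (rule finite_subset) auto

lemma wedge_closed:
  assumes "x \<in> free_space (subsets_of_card n q)"
  shows "wedge n v x \<in> free_space (subsets_of_card n (Suc q))"
  unfolding wedge_def
proof (intro free_space_sum free_space_fscale)
  fix i assume i: "i \<in> {..<n}"
  show "wedge_unit i x \<in> free_space (subsets_of_card n (Suc q))"
    unfolding wedge_unit_def using assms
  proof (rule flinear_closed)
    fix J assume J: "J \<in> subsets_of_card n q"
    show "(if i \<in> J then 0 else Poly_Mapping.single (insert i J) (clifford_sign {i} J)) \<in> free_space (subsets_of_card n (Suc q))"
      using i J finite_subset_lessThan[of J n] by (auto intro: free_space_zero free_space_single)
  qed
qed

lemma wedge_list_closed: "wedge_list n vs \<in> free_space (subsets_of_card n (length vs))"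
  by (induction vs) (auto intro: wedge_closed free_space_single)

definition permute_subsets :: "(nat \<Rightarrow> nat) \<Rightarrow> (nat set \<Rightarrow>\<^sub>0 complex) \<Rightarrow> (nat set \<Rightarrow>\<^sub>0 complex)" where
  "permute_subsets w = flinear (\<lambda>J. Poly_Mapping.single (w ` J) (perm_sign w J))"

lemma permute_subsets_linear:
  "permute_subsets w (x + y) = permute_subsets w x + permute_subsets w y"
  "permute_subsets w (fscale c x) = fscale c (permute_subsets w x)"
  "permute_subsets w (sum g S) = (\<Sum>s\<in>S. permute_subsets w (g s))" "permute_subsets w 0 = 0"
  by (simp_all add: permute_subsets_def flinear_add flinear_fscale flinear_sum)

lemma permute_subsets_wedge_unit:
  assumes "inj w" "x \<in> free_space {J. finite J}"
  shows "permute_subsets w (wedge_unit i x) = wedge_unit (w i) (permute_subsets w x)"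
  using assms(2)
proof (induction rule: free_space_induct)
  case (basis J)
  have mem: "w i \<in> w ` J \<longleftrightarrow> i \<in> J" using assms(1) by (auto dest: injD)
  show ?case
  proof (cases "i \<in> J")
    case True
    then show ?thesis using mem by (simp add: wedge_unit_def permute_subsets_def)
  next
    case False
    have "sym_diff {i} J = insert i J" using False by auto
    moreover have "perm_sign w {i} = 1" using perm_sign_insert[of "{}" i w] by simp
    ultimately have "clifford_sign {i} J * perm_sign w (insert i J) = perm_sign w J * clifford_sign {w i} (w ` J)"
      using perm_sign_equivariant[OF assms(1), of "{i}" J] basis by (simp add: mult.commute)
    then show ?thesis using False mem by (simp add: wedge_unit_def permute_subsets_def)
  qed
qed (simp_all add: permute_subsets_linear wedge_unit_linear)

lemma permute_subsets_wedge:
  assumes w: "w permutes {..<n}" and x: "x \<in> free_space {J. finite J}"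
  shows "permute_subsets w (wedge n v x) = wedge n (\<lambda>i. v (inv_into UNIV w i)) (permute_subsets w x)"
proof -
  have "wedge n (\<lambda>i. v (inv_into UNIV w i)) (permute_subsets w x)
    = (\<Sum>i<n. fscale (v (inv_into UNIV w (w i))) (wedge_unit (w i) (permute_subsets w x)))"
    unfolding wedge_def by (rule sum.reindex_bij_betw[symmetric, OF permutes_imp_bij[OF w]])
  then show ?thesis
    by (simp add: wedge_def permute_subsets_linear permute_subsets_wedge_unit[OF permutes_inj[OF w] x] permutes_inverses[OF w])
qed

lemma permute_subsets_wedge_list:
  assumes w: "w permutes {..<n}"
  shows "permute_subsets w (wedge_list n vs) = wedge_list n (map (\<lambda>v i. v (inv_into UNIV w i)) vs)"
proof (induction vs)
  case Nil
  then show ?case by (simp add: permute_subsets_def)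
next
  case (Cons v vs)
  have "free_space (subsets_of_card n (length vs)) \<subseteq> free_space {J. finite J}"
    using finite_subset_lessThan by (auto simp: free_space_def)
  then have "wedge_list n vs \<in> free_space {J. finite J}" using wedge_list_closed by blast
  then show ?case using Cons permute_subsets_wedge[OF w] by simp
qed

lemma permutation_module_carrier: "v \<in> carrier (permutation_module n) \<longleftrightarrow> (\<forall>i\<ge>n. v i = 0)"
  by (simp add: permutation_module_def Let_def)

lemma permutation_module_simps [simp]:
  "u \<oplus>\<^bsub>permutation_module n\<^esub> v = (\<lambda>i. u i + v i)"
  "Poly_Mapping.single (I, w) c \<odot>\<^bsub>permutation_module n\<^esub> v = (\<lambda>i. c * v (inv_into UNIV w i))"
  by (simp_all add: permutation_module_def Let_def)

lemma permutation_module_closed [simp]: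
  "u \<in> carrier (permutation_module n) \<Longrightarrow> v \<in> carrier (permutation_module n) \<Longrightarrow> (\<lambda>i. u i + v i) \<in> carrier (permutation_module n)"
  "v \<in> carrier (permutation_module n) \<Longrightarrow> (\<lambda>i. c * v i) \<in> carrier (permutation_module n)"
  by (simp_all add: permutation_module_carrier)

abbreviation vector_lists :: "nat \<Rightarrow> nat \<Rightarrow> (nat \<Rightarrow> complex) list set" where
  "vector_lists n q \<equiv> {vs. length vs = q \<and> set vs \<subseteq> carrier (permutation_module n)}"

abbreviation ext_relations :: "nat \<Rightarrow> nat \<Rightarrow> ((nat \<Rightarrow> complex) list \<Rightarrow>\<^sub>0 complex) set" where
  "ext_relations n q \<equiv> exterior_relations q (permutation_module n)"

lemma subspace_ext_relations: "fs.subspace (ext_relations n q)"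
  unfolding exterior_relations_def by (rule fs.subspace_span)

lemma ext_relations_induct_linear:
  assumes "x \<in> ext_relations n q"
    and "\<And>us us' v v'. Suc (length us + length us') = q \<Longrightarrow> set us \<union> set us' \<union> {v, v'} \<subseteq> carrier (permutation_module n) \<Longrightarrow>
      f (us @ [\<lambda>i. v i + v' i] @ us') - f (us @ [v] @ us') - f (us @ [v'] @ us') \<in> R"
    and "\<And>c us us' v. Suc (length us + length us') = q \<Longrightarrow> set us \<union> set us' \<union> {v} \<subseteq> carrier (permutation_module n) \<Longrightarrow>
      f (us @ [\<lambda>i. c * v i] @ us') - fscale c (f (us @ [v] @ us')) \<in> R"
    and "\<And>vs. vs \<in> vector_lists n q \<Longrightarrow> \<not> distinct vs \<Longrightarrow> f vs \<in> R"
    and "fs.subspace R"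
  shows "flinear f x \<in> R"
  using assms(1) unfolding exterior_relations_def
proof (rule fs_span_induct_linear[OF _ _ assms(5)], elim UnE)
  fix g
  assume "g \<in> {fbasis (us @ [v \<oplus>\<^bsub>permutation_module n\<^esub> v'] @ us') - fbasis (us @ [v] @ us') - fbasis (us @ [v'] @ us') | us us' v v'.
        Suc (length us + length us') = q \<and> set us \<union> set us' \<union> {v, v'} \<subseteq> carrier (permutation_module n)}"
  then obtain us us' v v' where g: "g = fbasis (us @ [\<lambda>i. v i + v' i] @ us') - fbasis (us @ [v] @ us') - fbasis (us @ [v'] @ us')"
    and h: "Suc (length us + length us') = q" "set us \<union> set us' \<union> {v, v'} \<subseteq> carrier (permutation_module n)" by auto
  show "flinear f g \<in> R" using assms(2)[OF h] unfolding g flinear_diff flinear_single fs.scale_one .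
next
  fix g
  assume "g \<in> {fbasis (us @ [hc_scalar c \<odot>\<^bsub>permutation_module n\<^esub> v] @ us') - fscale c (fbasis (us @ [v] @ us')) | c us us' v.
        Suc (length us + length us') = q \<and> set us \<union> set us' \<union> {v} \<subseteq> carrier (permutation_module n)}"
  then obtain c us us' v where g: "g = fbasis (us @ [hc_scalar c \<odot>\<^bsub>permutation_module n\<^esub> v] @ us') - fscale c (fbasis (us @ [v] @ us'))"
    and h: "Suc (length us + length us') = q" "set us \<union> set us' \<union> {v} \<subseteq> carrier (permutation_module n)" by blast
  have "hc_scalar c \<odot>\<^bsub>permutation_module n\<^esub> v = (\<lambda>i. c * v i)" by (simp add: hc_scalar_def)
  then show "flinear f g \<in> R" using assms(3)[OF h, of c] unfolding g flinear_diff flinear_fscale flinear_single fs.scale_one by simp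
next
  fix g
  assume "g \<in> {fbasis vs | vs. length vs = q \<and> set vs \<subseteq> carrier (permutation_module n) \<and> \<not> distinct vs}"
  then obtain vs where "g = fbasis vs" "vs \<in> vector_lists n q" "\<not> distinct vs" by auto
  then show "flinear f g \<in> R" using assms(4) by simp
qed

lemma ext_rel_add:
  assumes "Suc (length us + length us') = q" "set us \<union> set us' \<union> {v, v'} \<subseteq> carrier (permutation_module n)"
  shows "fbasis (us @ [\<lambda>i. v i + v' i] @ us') - fbasis (us @ [v] @ us') - fbasis (us @ [v'] @ us') \<in> ext_relations n q"
proof -
  have "fbasis (us @ [v \<oplus>\<^bsub>permutation_module n\<^esub> v'] @ us') - fbasis (us @ [v] @ us') - fbasis (us @ [v'] @ us') \<in> ext_relations n q"
    unfolding exterior_relations_def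
    by (rule fs.span_base, rule UnI1, rule UnI1, rule CollectI, intro exI conjI, rule refl, rule assms(1), rule assms(2))
  then show ?thesis by simp
qed

lemma ext_rel_scale:
  assumes "Suc (length us + length us') = q" "set us \<union> set us' \<union> {v} \<subseteq> carrier (permutation_module n)"
  shows "fbasis (us @ [\<lambda>i. c * v i] @ us') - fscale c (fbasis (us @ [v] @ us')) \<in> ext_relations n q"
proof -
  have "fbasis (us @ [hc_scalar c \<odot>\<^bsub>permutation_module n\<^esub> v] @ us') - fscale c (fbasis (us @ [v] @ us')) \<in> ext_relations n q"
    unfolding exterior_relations_def
    by (rule fs.span_base, rule UnI1, rule UnI2, rule CollectI, intro exI conjI, rule refl, rule assms(1), rule assms(2))
  then show ?thesis by (simp add: hc_scalar_def del: fscale_single)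
qed

lemma ext_rel_repeated: "vs \<in> vector_lists n q \<Longrightarrow> \<not> distinct vs \<Longrightarrow> fbasis vs \<in> ext_relations n q"
  unfolding exterior_relations_def by (rule fs.span_base, rule UnI2) auto

lemma ext_relations_cons:
  assumes "x \<in> ext_relations n q" "v \<in> carrier (permutation_module n)"
  shows "flinear (\<lambda>us. fbasis (v # us)) x \<in> ext_relations n (Suc q)"
proof (rule ext_relations_induct_linear[OF assms(1)])
  show "fbasis (v # us @ [\<lambda>i. a i + b i] @ us') - fbasis (v # us @ [a] @ us') - fbasis (v # us @ [b] @ us')
      \<in> ext_relations n (Suc q)"
    if "Suc (length us + length us') = q" "set us \<union> set us' \<union> {a, b} \<subseteq> carrier (permutation_module n)" for us us' a b
    using ext_rel_add[of "v # us" us' "Suc q" a b n] that assms(2) by simp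
  show "fbasis (v # us @ [\<lambda>i. c * a i] @ us') - fscale c (fbasis (v # us @ [a] @ us')) \<in> ext_relations n (Suc q)"
    if "Suc (length us + length us') = q" "set us \<union> set us' \<union> {a} \<subseteq> carrier (permutation_module n)" for c us us' a
    using ext_rel_scale[of "v # us" us' "Suc q" a n c] that assms(2) by simp
  show "fbasis (v # vs) \<in> ext_relations n (Suc q)" if "vs \<in> vector_lists n q" "\<not> distinct vs" for vs
    by (rule ext_rel_repeated) (use that assms(2) in auto)
qed (rule subspace_ext_relations)

lemma ext_relations_closed:
  assumes "x \<in> ext_relations n q" shows "x \<in> free_space (vector_lists n q)"
proof -
  have "flinear fbasis x \<in> free_space (vector_lists n q)"
  proof (rule ext_relations_induct_linear[OF assms])
    show "fbasis (us @ [\<lambda>i. v i + v' i] @ us') - fbasis (us @ [v] @ us') - fbasis (us @ [v'] @ us')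
        \<in> free_space (vector_lists n q)"
      if "Suc (length us + length us') = q" "set us \<union> set us' \<union> {v, v'} \<subseteq> carrier (permutation_module n)" for us us' v v'
      by (intro free_space_diff free_space_single) (use that in simp_all)
    show "fbasis (us @ [\<lambda>i. c * v i] @ us') - fscale c (fbasis (us @ [v] @ us')) \<in> free_space (vector_lists n q)"
      if "Suc (length us + length us') = q" "set us \<union> set us' \<union> {v} \<subseteq> carrier (permutation_module n)" for c us us' v
      by (intro free_space_diff free_space_fscale free_space_single) (use that in simp_all)
  qed (simp_all add: free_space_single subspace_free_space)
  then show ?thesis by simp
qed

lemma wedge_list_ext_relations:
  assumes "x \<in> ext_relations n q" shows "flinear (wedge_list n) x = 0"
proof -
  have "flinear (wedge_list n) x \<in> {0}"
    by (rule ext_relations_induct_linear[OF assms])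
      (simp_all add: wedge_linear foldr_wedge_linear wedge_list_repeated fs.subspace_def)
  then show ?thesis by simp
qed

text \<open>The polarization of \<open>v \<and> v = 0\<close>.\<close>

lemma ext_rel_swap:
  assumes "Suc (Suc (length r)) = q" "set r \<union> {u, v} \<subseteq> carrier (permutation_module n)"
  shows "fbasis (u # v # r) + fbasis (v # u # r) \<in> ext_relations n q"
proof -
  let ?a = "\<lambda>i. u i + v i" and ?E = "ext_relations n q"
  have a: "?a \<in> carrier (permutation_module n)" using assms by simp
  have 1: "fbasis (?a # ?a # r) \<in> ?E" "fbasis (u # u # r) \<in> ?E" "fbasis (v # v # r) \<in> ?E"
    using assms a by (auto intro!: ext_rel_repeated)
  have 2: "fbasis (?a # ?a # r) - fbasis (u # ?a # r) - fbasis (v # ?a # r) \<in> ?E"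
    using ext_rel_add[of "[]" "?a # r" q u v n] assms a by simp
  have 3: "fbasis (t # ?a # r) - fbasis (t # u # r) - fbasis (t # v # r) \<in> ?E" if "t \<in> {u, v}" for t
    using ext_rel_add[of "[t]" r q u v n] assms a that by auto
  have "fbasis (u # v # r) + fbasis (v # u # r) = fbasis (?a # ?a # r) - fbasis (u # u # r) - fbasis (v # v # r)
      - (fbasis (?a # ?a # r) - fbasis (u # ?a # r) - fbasis (v # ?a # r))
      - (fbasis (u # ?a # r) - fbasis (u # u # r) - fbasis (u # v # r))
      - (fbasis (v # ?a # r) - fbasis (v # u # r) - fbasis (v # v # r))" by simp
  also have "\<dots> \<in> ?E"
    by (intro fs.subspace_diff[OF subspace_ext_relations] 1 2 3) auto
  finally show ?thesis .
qed

definition unit_vector :: "nat \<Rightarrow> nat \<Rightarrow> complex" where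
  "unit_vector i k = (if k = i then 1 else 0)"

lemma unit_vector_closed: "i < n \<Longrightarrow> unit_vector i \<in> carrier (permutation_module n)"
  by (auto simp: unit_vector_def permutation_module_carrier)

text \<open>Insertion of a factor into a sorted product: each exchange with a smaller neighbour changes
  the sign.\<close>

lemma ext_rel_insort:
  assumes "sorted xs" "distinct xs" "i \<notin> set xs" "set xs \<subseteq> {..<n}" "i < n"
  shows "fbasis (unit_vector i # map unit_vector xs)
    - fscale (clifford_sign {i} (set xs)) (fbasis (map unit_vector (insort i xs))) \<in> ext_relations n (Suc (length xs))"
  using assms
proof (induction xs)
  case Nil
  then show ?case by (simp add: clifford_sign_singleton fs.subspace_0[OF subspace_ext_relations])
next
  case (Cons k xs)
  let ?E = "ext_relations n (Suc (Suc (length xs)))" and ?u = unit_vector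
  have sign: "clifford_sign {i} (set (k # xs)) = below_sign i k * clifford_sign {i} (set xs)"
    using Cons.prems by (simp add: clifford_sign_singleton)
  show ?case
  proof (cases "i \<le> k")
    case True
    then have "{(i', j). i' \<in> {i} \<and> j \<in> set (k # xs) \<and> j < i'} = {}" using Cons.prems by auto
    then have "clifford_sign {i} (set (k # xs)) = 1" unfolding clifford_sign_def by (simp only: card.empty power_0)
    then show ?thesis using True by (simp add: fs.subspace_0[OF subspace_ext_relations] del: set_simps)
  next
    case False
    have IH: "fbasis (?u i # map ?u xs) - fscale (clifford_sign {i} (set xs)) (fbasis (map ?u (insort i xs))) \<in> ext_relations n (Suc (length xs))"
      by (rule Cons.IH) (use Cons.prems in auto)
    have e1: "fbasis (?u k # ?u i # map ?u xs) - fscale (clifford_sign {i} (set xs)) (fbasis (?u k # map ?u (insort i xs))) \<in> ?E"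
      using ext_relations_cons[OF IH, of "?u k"] Cons.prems unit_vector_closed[of k n]
      unfolding flinear_diff flinear_fscale flinear_single fs.scale_one by simp
    have e2: "fbasis (?u i # ?u k # map ?u xs) + fbasis (?u k # ?u i # map ?u xs) \<in> ?E"
      by (rule ext_rel_swap) (use Cons.prems unit_vector_closed in auto)
    have "fbasis (?u i # ?u k # map ?u xs) + fbasis (?u k # ?u i # map ?u xs) -
      (fbasis (?u k # ?u i # map ?u xs) - fscale (clifford_sign {i} (set xs)) (fbasis (?u k # map ?u (insort i xs)))) \<in> ?E"
      by (rule fs.subspace_diff[OF subspace_ext_relations e2 e1])
    moreover have "clifford_sign {i} (set (k # xs)) = - clifford_sign {i} (set xs)"
      unfolding sign below_sign_def using False by simp
    moreover have "map ?u (insort i (k # xs)) = ?u k # map ?u (insort i xs)" using False by simp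
    moreover have "fbasis (?u i # ?u k # map ?u xs) + fbasis (?u k # ?u i # map ?u xs) -
      (fbasis (?u k # ?u i # map ?u xs) - fscale (clifford_sign {i} (set xs)) (fbasis (?u k # map ?u (insort i xs))))
      = fbasis (?u i # ?u k # map ?u xs) - fscale (- clifford_sign {i} (set xs)) (fbasis (?u k # map ?u (insort i xs)))"
      unfolding fs.scale_minus_left by simp
    ultimately show ?thesis by (simp only: list.map list.size add_0_right add_Suc_right)
  qed
qed

lemma ext_rel_expand:
  assumes v: "v \<in> carrier (permutation_module n)" and r: "r \<in> vector_lists n q"
  shows "fbasis (v # r) - (\<Sum>i<n. fscale (v i) (fbasis (unit_vector i # r))) \<in> ext_relations n (Suc q)"
proof -
  let ?E = "ext_relations n (Suc q)"
  have step: "fbasis ((\<lambda>i. if i < m then v i else 0) # r) - (\<Sum>i<m. fscale (v i) (fbasis (unit_vector i # r))) \<in> ?E"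
    if "m \<le> n" for m
    using that
  proof (induction m)
    case 0
    have "fbasis ((\<lambda>i. 0 * (0 :: complex)) # r) - fscale 0 (fbasis ((\<lambda>i. 0) # r)) \<in> ?E"
      using ext_rel_scale[of "[]" r "Suc q" "\<lambda>i. 0" n 0] r by (simp add: permutation_module_carrier)
    then show ?case by simp
  next
    case (Suc m)
    let ?t = "\<lambda>i. if i < m then v i else 0" and ?s = "\<lambda>i. v m * unit_vector m i"
    have st: "(\<lambda>i. if i < Suc m then v i else 0) = (\<lambda>i. ?t i + ?s i)"
      by (auto simp: unit_vector_def fun_eq_iff less_Suc_eq)
    have 1: "fbasis ((\<lambda>i. ?t i + ?s i) # r) - fbasis (?t # r) - fbasis (?s # r) \<in> ?E"
      using ext_rel_add[of "[]" r "Suc q" ?t ?s n] r Suc.prems by (simp add: unit_vector_def permutation_module_carrier)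
    have 2: "fbasis (?s # r) - fscale (v m) (fbasis (unit_vector m # r)) \<in> ?E"
      using ext_rel_scale[of "[]" r "Suc q" "unit_vector m" n "v m"] r Suc.prems unit_vector_closed[of m n] by simp
    have 3: "fbasis (?t # r) - (\<Sum>i<m. fscale (v i) (fbasis (unit_vector i # r))) \<in> ?E"
      by (rule Suc.IH) (use Suc.prems in auto)
    have "fbasis ((\<lambda>i. ?t i + ?s i) # r) - (\<Sum>i<Suc m. fscale (v i) (fbasis (unit_vector i # r)))
      = (fbasis ((\<lambda>i. ?t i + ?s i) # r) - fbasis (?t # r) - fbasis (?s # r))
        + (fbasis (?s # r) - fscale (v m) (fbasis (unit_vector m # r)))
        + (fbasis (?t # r) - (\<Sum>i<m. fscale (v i) (fbasis (unit_vector i # r))))" by simp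
    also have "\<dots> \<in> ?E" by (intro fs.subspace_add[OF subspace_ext_relations] 1 2 3)
    finally show ?case unfolding st .
  qed
  have "(\<lambda>i. if i < n then v i else 0) = v" using v by (auto simp: permutation_module_carrier)
  then show ?thesis using step[of n] by simp
qed

definition standard_list :: "nat set \<Rightarrow> (nat \<Rightarrow> complex) list \<Rightarrow>\<^sub>0 complex" where
  "standard_list J = fbasis (map unit_vector (sorted_list_of_set J))"

lemma standard_list_closed: "J \<in> subsets_of_card n q \<Longrightarrow> standard_list J \<in> free_space (vector_lists n q)"
  unfolding standard_list_def using unit_vector_closed finite_subset_lessThan[of J n]
  by (intro free_space_single) (auto simp: image_subset_iff subset_iff)

lemma standard_list_wedge:
  assumes v: "v \<in> carrier (permutation_module n)" and y: "y \<in> free_space (subsets_of_card n q)"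
  shows "flinear (\<lambda>us. fbasis (v # us)) (flinear standard_list y) - flinear standard_list (wedge n v y) \<in> ext_relations n (Suc q)"
  using y
proof (induction rule: free_space_induct)
  case zero
  then show ?case by (simp add: wedge_linear fs.subspace_0[OF subspace_ext_relations])
next
  case (basis J)
  let ?E = "ext_relations n (Suc q)" and ?r = "map unit_vector (sorted_list_of_set J)"
  have fin: "finite J" using basis finite_subset_lessThan by auto
  have r: "?r \<in> vector_lists n q" using standard_list_closed[OF basis] by (simp add: standard_list_def free_space_def)
  have summand: "fbasis (unit_vector i # ?r) - flinear standard_list (wedge_unit i (fbasis J)) \<in> ?E" if i: "i < n" for i
  proof (cases "i \<in> J")
    case True
    then have "unit_vector i \<in> set ?r" using fin by simp
    then have "fbasis (unit_vector i # ?r) \<in> ?E"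
      using r unit_vector_closed[OF i] by (intro ext_rel_repeated) auto
    then show ?thesis using True by (simp add: wedge_unit_def)
  next
    case False
    have "fbasis (unit_vector i # ?r) - fscale (clifford_sign {i} (set (sorted_list_of_set J)))
        (fbasis (map unit_vector (insort i (sorted_list_of_set J)))) \<in> ext_relations n (Suc (length (sorted_list_of_set J)))"
      by (rule ext_rel_insort) (use False fin i basis in auto)
    then show ?thesis using False fin basis
      by (simp add: wedge_unit_def standard_list_def sorted_list_of_set_insert)
  qed
  have "(fbasis (v # ?r) - (\<Sum>i<n. fscale (v i) (fbasis (unit_vector i # ?r))))
      + (\<Sum>i<n. fscale (v i) (fbasis (unit_vector i # ?r) - flinear standard_list (wedge_unit i (fbasis J)))) \<in> ?E"
    by (intro fs.subspace_add[OF subspace_ext_relations] fs.subspace_sum[OF subspace_ext_relations]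
        fs.subspace_scale[OF subspace_ext_relations] ext_rel_expand[OF v r] summand) auto
  moreover have "(fbasis (v # ?r) - (\<Sum>i<n. fscale (v i) (fbasis (unit_vector i # ?r))))
      + (\<Sum>i<n. fscale (v i) (fbasis (unit_vector i # ?r) - flinear standard_list (wedge_unit i (fbasis J))))
    = fbasis (v # ?r) - flinear standard_list (wedge n v (fbasis J))"
    unfolding wedge_def flinear_sum flinear_fscale fs.scale_right_diff_distrib sum_subtractf by simp
  moreover have "flinear (\<lambda>us. fbasis (v # us)) (flinear standard_list (fbasis J)) = fbasis (v # ?r)"
    by (simp add: standard_list_def)
  ultimately show ?case by (simp only:)
next
  case (add x y)
  then show ?case using fs.subspace_add[OF subspace_ext_relations add.IH]
    by (simp add: flinear_add wedge_linear algebra_simps)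
next
  case (scale c x)
  show ?case using fs.subspace_scale[OF subspace_ext_relations scale.IH, of c]
    by (simp only: flinear_fscale wedge_linear fs.scale_right_diff_distrib)
qed

text \<open>Straightening: modulo the relations, a symbol equals the combination of sorted symbols without
  repetitions that the exterior product prescribes. So the relations are exactly the kernel of the
  exterior product.\<close>

lemma straightening:
  assumes "vs \<in> vector_lists n q"
  shows "fbasis vs - flinear standard_list (wedge_list n vs) \<in> ext_relations n q"
  using assms
proof (induction vs arbitrary: q)
  case Nil
  then show ?case by (simp add: standard_list_def fs.subspace_0[OF subspace_ext_relations])
next
  case (Cons v vs)
  have v: "v \<in> carrier (permutation_module n)" using Cons.prems by simp
  have IH: "fbasis vs - flinear standard_list (wedge_list n vs) \<in> ext_relations n (length vs)"
    by (rule Cons.IH) (use Cons.prems in auto)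
  have "fbasis (v # vs) - flinear (\<lambda>us. fbasis (v # us)) (flinear standard_list (wedge_list n vs)) \<in> ext_relations n (Suc (length vs))"
    using ext_relations_cons[OF IH v] by (simp add: flinear_diff)
  from fs.subspace_add[OF subspace_ext_relations this standard_list_wedge[OF v wedge_list_closed]]
  show ?case using Cons.prems by simp
qed

lemma straightening_linear:
  assumes "x \<in> free_space (vector_lists n q)"
  shows "x - flinear standard_list (flinear (wedge_list n) x) \<in> ext_relations n q"
  using assms
proof (induction rule: free_space_induct)
  case zero
  then show ?case by (simp add: fs.subspace_0[OF subspace_ext_relations])
next
  case (basis vs)
  then show ?case using straightening[OF basis] by simp
next
  case (add x y)
  show ?case using fs.subspace_add[OF subspace_ext_relations add.IH] by (simp add: flinear_add algebra_simps)
next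
  case (scale c x)
  show ?case using fs.subspace_scale[OF subspace_ext_relations scale.IH, of c]
    by (simp only: flinear_fscale fs.scale_right_diff_distrib)
qed

lemma ext_relations_iff:
  assumes "x \<in> free_space (vector_lists n q)"
  shows "x \<in> ext_relations n q \<longleftrightarrow> flinear (wedge_list n) x = 0"
  using straightening_linear[OF assms] wedge_list_ext_relations by auto

lemma wedge_list_standard:
  assumes "J \<subseteq> {..<n}" shows "flinear (wedge_list n) (standard_list J) = fbasis J"
proof -
  have "wedge_list n (map unit_vector xs) = fbasis (set xs)"
    if "sorted xs" "distinct xs" "set xs \<subseteq> {..<n}" for xs
    using that
  proof (induction xs)
    case (Cons k xs)
    have "wedge n (unit_vector k) x = (\<Sum>i<n. if i = k then wedge_unit i x else 0)" for x
      unfolding wedge_def unit_vector_def by (intro sum.cong) auto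
    then have w: "wedge n (unit_vector k) x = wedge_unit k x" for x using Cons.prems by simp
    have "{(i', j). i' \<in> {k} \<and> j \<in> set xs \<and> j < i'} = {}" using Cons.prems by auto
    then have "clifford_sign {k} (set xs) = 1" unfolding clifford_sign_def by (simp only: card.empty power_0)
    then show ?case using Cons by (simp add: w wedge_unit_def)
  qed simp
  then show ?thesis using assms finite_subset_lessThan[OF assms] by (simp add: standard_list_def)
qed

section \<open>Modules induced from the exterior powers\<close>

text \<open>The action of the group algebra on the exterior power, in coordinates.\<close>

definition permute_by :: "hc \<Rightarrow> (nat set \<Rightarrow>\<^sub>0 complex) \<Rightarrow> (nat set \<Rightarrow>\<^sub>0 complex)" where
  "permute_by b z = flinear (\<lambda>g. permute_subsets (snd g) z) b"

lemma permute_by_linear: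
  "permute_by b (x + y) = permute_by b x + permute_by b y" "permute_by b (fscale c x) = fscale c (permute_by b x)"
  "permute_by b 0 = 0"
  by (simp_all add: permute_by_def permute_subsets_linear flinear_sum_fun flinear_fscale_fun) (simp add: flinear_def)

definition ext_act :: "nat \<Rightarrow> hc \<Rightarrow> ((nat \<Rightarrow> complex) list \<Rightarrow>\<^sub>0 complex) \<Rightarrow> ((nat \<Rightarrow> complex) list \<Rightarrow>\<^sub>0 complex)" where
  "ext_act n b = flinear (\<lambda>vs. flinear (\<lambda>g. fbasis (map (\<lambda>v. fbasis g \<odot>\<^bsub>permutation_module n\<^esub> v) vs)) b)"

abbreviation ext_power :: "nat \<Rightarrow> nat \<Rightarrow> (hc, ((nat \<Rightarrow> complex) list \<Rightarrow>\<^sub>0 complex) set) smod" where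
  "ext_power n q \<equiv> exterior_power q (permutation_module n)"

abbreviation ext_class :: "nat \<Rightarrow> nat \<Rightarrow> ((nat \<Rightarrow> complex) list \<Rightarrow>\<^sub>0 complex) \<Rightarrow> ((nat \<Rightarrow> complex) list \<Rightarrow>\<^sub>0 complex) set" where
  "ext_class n q \<equiv> fcoset (ext_relations n q)"

lemma exterior_power_simps [simp]:
  "carrier (ext_power n q) = ext_class n q ` free_space (vector_lists n q)"
  "add (ext_power n q) = qadd" "\<zero>\<^bsub>ext_power n q\<^esub> = ext_class n q 0"
  "b \<odot>\<^bsub>ext_power n q\<^esub> C = qmap (ext_relations n q) (ext_act n b) C"
  "part (ext_power n q) p = (if p then {ext_class n q 0} else carrier (ext_power n q))"
  by (simp_all add: exterior_power_def Let_def ext_act_def)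

lemma group_algebra_closed: "b \<in> group_algebra (sym_group n) \<Longrightarrow> b \<in> hecke_clifford n"
  by (auto simp: group_algebra_def hecke_clifford_def free_space_def)

lemma permutation_module_act_closed:
  assumes "w permutes {..<n}" "v \<in> carrier (permutation_module n)"
  shows "(\<lambda>i. v (inv_into UNIV w i)) \<in> carrier (permutation_module n)"
proof -
  have "inv_into UNIV w i = i" if "i \<ge> n" for i
    using permutes_not_in[OF permutes_inv[OF assms(1)], of i] that by simp
  then show ?thesis using assms(2) by (simp add: permutation_module_carrier)
qed

lemma ext_act_closed:
  assumes "b \<in> group_algebra (sym_group n)" "x \<in> free_space (vector_lists n q)"
  shows "ext_act n b x \<in> free_space (vector_lists n q)"
  unfolding ext_act_def using assms(2)
proof (rule flinear_closed)
  fix vs assume vs: "vs \<in> vector_lists n q"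
  show "flinear (\<lambda>g. fbasis (map (\<lambda>v. fbasis g \<odot>\<^bsub>permutation_module n\<^esub> v) vs)) b \<in> free_space (vector_lists n q)"
    using assms(1) unfolding group_algebra_def
  proof (rule flinear_closed)
    fix g :: "nat set \<times> (nat \<Rightarrow> nat)" assume "g \<in> {{}} \<times> sym_group n"
    then obtain w where g: "g = ({}, w)" "w permutes {..<n}" by auto
    show "fbasis (map (\<lambda>v. fbasis g \<odot>\<^bsub>permutation_module n\<^esub> v) vs) \<in> free_space (vector_lists n q)"
      using vs permutation_module_act_closed[OF g(2)] unfolding g(1) permutation_module_simps
      by (intro free_space_single) auto
  qed
qed

lemma wedge_list_ext_act:
  assumes b: "b \<in> group_algebra (sym_group n)"
  shows "flinear (wedge_list n) (ext_act n b x) = permute_by b (flinear (wedge_list n) x)"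
proof (rule free_space_induct[of x UNIV])
  fix vs
  have "flinear (wedge_list n) (ext_act n b (fbasis vs))
    = flinear (\<lambda>g. wedge_list n (map (\<lambda>v. fbasis g \<odot>\<^bsub>permutation_module n\<^esub> v) vs)) b"
    by (simp add: ext_act_def flinear_flinear)
  also have "\<dots> = flinear (\<lambda>g. permute_subsets (snd g) (wedge_list n vs)) b"
    using b unfolding group_algebra_def
  proof (rule flinear_cong)
    fix g :: "nat set \<times> (nat \<Rightarrow> nat)" assume "g \<in> {{}} \<times> sym_group n"
    then obtain w where g: "g = ({}, w)" "w permutes {..<n}" by auto
    have "(\<lambda>v. fbasis g \<odot>\<^bsub>permutation_module n\<^esub> v) = (\<lambda>v i. v (inv_into UNIV w i))"
      by (rule ext) (simp add: g(1))
    then show "wedge_list n (map (\<lambda>v. fbasis g \<odot>\<^bsub>permutation_module n\<^esub> v) vs) = permute_subsets (snd g) (wedge_list n vs)"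
      by (simp add: g(1) permute_subsets_wedge_list[OF g(2)])
  qed
  finally show "flinear (wedge_list n) (ext_act n b (fbasis vs)) = permute_by b (flinear (wedge_list n) (fbasis vs))"
    by (simp add: permute_by_def)
qed (simp_all add: ext_act_def flinear_add flinear_fscale permute_by_linear)

lemma ext_act_linear:
  "ext_act n b (x + y) = ext_act n b x + ext_act n b y" "ext_act n b (x - y) = ext_act n b x - ext_act n b y"
  by (simp_all add: ext_act_def flinear_add flinear_diff)

lemma ext_power_act:
  assumes b: "b \<in> group_algebra (sym_group n)" and x: "x \<in> free_space (vector_lists n q)"
  shows "b \<odot>\<^bsub>ext_power n q\<^esub> ext_class n q x = ext_class n q (ext_act n b x)"
  unfolding exterior_power_simps
proof (rule qmap_fcoset[OF subspace_ext_relations])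
  fix y assume "y \<in> ext_class n q x"
  then have yx: "y - x \<in> ext_relations n q" by (simp add: fcoset_def)
  have "ext_act n b (y - x) \<in> ext_relations n q"
    by (rule iffD2[OF ext_relations_iff[OF ext_act_closed[OF b ext_relations_closed[OF yx]]]])
      (simp add: wedge_list_ext_act[OF b] wedge_list_ext_relations[OF yx] permute_by_linear)
  then show "ext_act n b y - ext_act n b x \<in> ext_relations n q" by (simp add: ext_act_linear)
qed

lemma ext_class_eqI:
  assumes "x \<in> free_space (vector_lists n q)" "y \<in> free_space (vector_lists n q)"
    and "flinear (wedge_list n) x = flinear (wedge_list n) y"
  shows "ext_class n q x = ext_class n q y"
  unfolding fcoset_eq_iff[OF subspace_ext_relations] ext_relations_iff[OF free_space_diff[OF assms(1,2)]]
  using assms(3) by (simp add: flinear_diff)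

definition embed_subsets :: "(nat set \<Rightarrow>\<^sub>0 complex) \<Rightarrow> ((nat set \<times> nat set) \<Rightarrow>\<^sub>0 complex)" where
  "embed_subsets = flinear (\<lambda>J. fbasis ({}, J))"

lemma model_act_embed:
  "model_act (fbasis (K, w)) (embed_subsets z) = flinear (\<lambda>J. fbasis (K, J)) (permute_subsets w z)"
proof (rule free_space_induct[of z UNIV])
  show "model_act (fbasis (K, w)) (embed_subsets (fbasis J)) = flinear (\<lambda>J. fbasis (K, J)) (permute_subsets w (fbasis J))" for J
    by (simp add: embed_subsets_def permute_subsets_def clifford_sign_def)
qed (simp_all add: embed_subsets_def flinear_add flinear_fscale model_act_linear permute_subsets_linear)

lemma model_act_embed_group:
  assumes "b \<in> group_algebra (sym_group n)"
  shows "model_act b (embed_subsets z) = embed_subsets (permute_by b z)"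
  using assms unfolding group_algebra_def
proof (induction rule: free_space_induct)
  case (basis g)
  then obtain w where g: "g = ({}, w)" by auto
  show ?case unfolding g model_act_embed by (simp add: embed_subsets_def permute_by_def)
qed (simp_all add: model_act_linear embed_subsets_def permute_by_def flinear_add flinear_fscale)

text \<open>The map \<open>e\<^sub>J \<mapsto> 1 \<otimes> e\<^sub>J\<close>. It is defined through an
  arbitrary representative of the coset, since the relations lie in the kernel of the exterior
  product.\<close>

definition ext_embed :: "nat \<Rightarrow> ((nat \<Rightarrow> complex) list \<Rightarrow>\<^sub>0 complex) set \<Rightarrow> ((nat set \<times> nat set) \<Rightarrow>\<^sub>0 complex)" where
  "ext_embed n C = embed_subsets (flinear (wedge_list n) (SOME y. y \<in> C))"

lemma ext_embed_class: "ext_embed n (ext_class n q x) = embed_subsets (flinear (wedge_list n) x)"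
proof -
  have "(SOME y. y \<in> ext_class n q x) \<in> ext_class n q x"
    by (rule someI[of _ x]) (rule fcoset_self[OF subspace_ext_relations])
  then have "(SOME y. y \<in> ext_class n q x) - x \<in> ext_relations n q" by (simp add: fcoset_def)
  from wedge_list_ext_relations[OF this] show ?thesis by (simp add: ext_embed_def flinear_diff)
qed

lemma wedge_list_image_closed:
  assumes "x \<in> free_space (vector_lists n q)" shows "flinear (wedge_list n) x \<in> free_space (subsets_of_card n q)"
  using assms by (rule flinear_closed) (use wedge_list_closed in auto)

lemma flinear_standard_closed:
  "z \<in> free_space (subsets_of_card n q) \<Longrightarrow> flinear standard_list z \<in> free_space (vector_lists n q)"
  by (erule flinear_closed) (rule standard_list_closed)

lemma wedge_list_flinear_standard:
  assumes "z \<in> free_space (subsets_of_card n q)" shows "flinear (wedge_list n) (flinear standard_list z) = z"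
proof -
  have "flinear (\<lambda>J. flinear (wedge_list n) (standard_list J)) z = flinear fbasis z"
    using assms by (rule flinear_cong) (auto simp: wedge_list_standard)
  then show ?thesis by (simp add: flinear_flinear)
qed

lemma permute_subsets_closed:
  assumes w: "w permutes {..<n}" and z: "z \<in> free_space (subsets_of_card n q)"
  shows "permute_subsets w z \<in> free_space (subsets_of_card n q)"
  unfolding permute_subsets_def using z
proof (rule flinear_closed)
  fix J assume "J \<in> subsets_of_card n q"
  then show "Poly_Mapping.single (w ` J) (perm_sign w J) \<in> free_space (subsets_of_card n q)"
    using permutes_image_subset[OF w] card_image[OF permutes_inj_on[OF w, of J]] by (intro free_space_single) auto
qed

text \<open>A symbol \<open>(c\<^sub>K w, C)\<close> is equivalent to \<open>(c\<^sub>K, w C)\<close>,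
  and \<open>w C\<close> is a combination of the \<open>e\<^sub>J\<close>; so the symbols
  \<open>(c\<^sub>I, e\<^sub>J)\<close> suffice.\<close>

theorem induced_exterior_power_model:
  shows "hc_module n (induced_module (hecke_clifford n) (group_algebra (sym_group n)) (ext_power n q))"
    "smod_even_iso (hecke_clifford n) (model n q)
      (induced_module (hecke_clifford n) (group_algebra (sym_group n)) (ext_power n q))"
proof -
  let ?G = "group_algebra (sym_group n)" and ?E = "ext_power n q" and ?X = "model n q"
  let ?R = "tensor_relations (hecke_clifford n) ?G ?E"
  let ?c = "ext_class n q" and ?L = "free_space (vector_lists n q)" and ?S = "free_space (subsets_of_card n q)"
  let ?s = "\<lambda>(I, J). fbasis (fbasis (I, id :: nat \<Rightarrow> nat), ?c (standard_list J))"
  have sb: "(I, id) \<in> hc_basis n" if "(I, J) \<in> model_basis n q" for I J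
    using that by (auto simp: model_basis_def permutes_id)
  have embed: "embed_subsets z \<in> free_space (model_basis n q)" "embed_subsets z \<in> part ?X False" if "z \<in> ?S" for z
    unfolding embed_subsets_def model_simps using that
    by (auto intro!: flinear_closed[OF that] free_space_single simp: model_basis_def)
  have act_closed: "b \<odot>\<^bsub>?E\<^esub> C \<in> carrier ?E" if "b \<in> ?G" "C \<in> carrier ?E" for b C
  proof -
    from that(2) obtain x where "C = ?c x" "x \<in> ?L" by auto
    then show ?thesis using ext_power_act[OF that(1)] ext_act_closed[OF that(1)] by simp
  qed
  have zeroS: "0 \<in> ?S" and zeroL: "0 \<in> ?L" by (rule free_space_zero)+
  interpret induction_model n ?G ?E ?X "model_basis n q"
    "\<lambda>p. {(I, J) \<in> model_basis n q. odd (card I) = p}" "ext_embed n" ?s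
  proof
    show "hc_module n ?X" by (rule hc_module_model)
    show "hc_scalar c \<odot>\<^bsub>?X\<^esub> x = fscale c x" for c x by (simp add: model_act_scalar)
    show "?G \<subseteq> hecke_clifford n" using group_algebra_closed by blast
  next
    fix C C' assume "C \<in> carrier ?E" "C' \<in> carrier ?E"
    then obtain x x' where x: "C = ?c x" "x \<in> ?L" "C' = ?c x'" "x' \<in> ?L" by auto
    then have e: "C \<oplus>\<^bsub>?E\<^esub> C' = ?c (x + x')" by (simp add: qadd_fcoset[OF subspace_ext_relations])
    show "C \<oplus>\<^bsub>?E\<^esub> C' \<in> carrier ?E" unfolding e using free_space_add[OF x(2,4)] by simp
    show "ext_embed n (C \<oplus>\<^bsub>?E\<^esub> C') = ext_embed n C + ext_embed n C'"
      unfolding e unfolding x ext_embed_class flinear_add by (simp add: embed_subsets_def flinear_add)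
  next
    fix b C assume b: "b \<in> ?G" and C: "C \<in> carrier ?E"
    show "b \<odot>\<^bsub>?E\<^esub> C \<in> carrier ?E" using act_closed[OF b C] .
    from C obtain x where x: "C = ?c x" "x \<in> ?L" by auto
    show "ext_embed n (b \<odot>\<^bsub>?E\<^esub> C) = b \<odot>\<^bsub>?X\<^esub> ext_embed n C"
      unfolding x(1) ext_power_act[OF b x(2)] ext_embed_class wedge_list_ext_act[OF b] model_simps model_act_embed_group[OF b] ..
  next
    fix p
    show "part ?E p \<subseteq> carrier ?E" using zeroL by auto
  next
    fix C assume "C \<in> carrier ?E"
    then obtain x where x: "C = ?c x" "x \<in> ?L" by auto
    show "ext_embed n C \<in> free_space (model_basis n q)"
      unfolding x(1) ext_embed_class by (rule embed(1)[OF wedge_list_image_closed[OF x(2)]])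
  next
    fix C t assume C: "C \<in> part ?E t"
    show "ext_embed n C \<in> part ?X t"
    proof (cases t)
      case True
      then have "C = ?c 0" using C by simp
      then show ?thesis by (simp add: ext_embed_class embed_subsets_def free_space_zero)
    next
      case False
      then obtain x where x: "C = ?c x" "x \<in> ?L" using C by auto
      have "t = False" using False by simp
      then show ?thesis
        unfolding x(1) ext_embed_class using embed(2)[OF wedge_list_image_closed[OF x(2)]] by (simp only:)
    qed
  next
    fix b p assume "b \<in> {(I, J) \<in> model_basis n q. odd (card I) = p}"
    then obtain I J where b: "b = (I, J)" "(I, J) \<in> model_basis n q" "odd (card I) = p" by auto
    have "fbasis (I, id) \<in> hecke_clifford n \<inter> hc_part p"
      using hc_basis_closed[OF sb[OF b(2)]] b(3) by (auto simp: hc_part_def intro: free_space_single)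
    moreover have "?c (standard_list J) \<in> part ?E False"
      using standard_list_closed[of J n q] b(2) by (simp add: model_basis_def)
    ultimately have "(fbasis (I, id), ?c (standard_list J))
        \<in> {(a, v). \<exists>r t. a \<in> hecke_clifford n \<inter> hc_part r \<and> v \<in> part ?E t \<and> p = (r \<noteq> t)}"
      by (simp only: mem_Collect_eq prod.case) (rule exI[of _ p], rule exI[of _ False], simp)
    then show "?s b \<in> free_space {(a, v). \<exists>r t. a \<in> hecke_clifford n \<inter> hc_part r \<and> v \<in> part ?E t \<and> p = (r \<noteq> t)}"
      unfolding b(1) prod.case by (rule free_space_single)
  next
    fix b assume "b \<in> model_basis n q"
    then obtain I J where b: "b = (I, J)" "(I, J) \<in> model_basis n q" by (cases b) auto
    have J: "J \<in> subsets_of_card n q" using b(2) by (simp add: model_basis_def)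
    show "?s b \<in> free_space (hecke_clifford n \<times> carrier ?E)"
      unfolding b(1) prod.case using hc_basis_closed[OF sb[OF b(2)]] standard_list_closed[OF J]
      by (intro free_space_single) simp
    have "model_act (fbasis (I, id)) (ext_embed n (?c (standard_list J))) = fbasis b"
      unfolding ext_embed_class model_act_embed b(1) using J
      by (simp add: wedge_list_standard permute_subsets_def perm_sign_id)
    then show "flinear (\<lambda>(a, v). a \<odot>\<^bsub>?X\<^esub> ext_embed n v) (?s b) = fbasis b"
      unfolding b(1) by simp
  next
    fix h C assume h: "h \<in> hc_basis n" and C: "C \<in> carrier ?E"
    obtain K w where hw: "h = (K, w)" "K \<subseteq> {..<n}" and w: "w permutes {..<n}" using h by auto
    obtain x where x: "C = ?c x" "x \<in> ?L" using C by auto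
    define u :: hc where "u = fbasis (K, id)"
    let ?w = "fbasis ({} :: nat set, w)"
    define z where "z = permute_subsets w (flinear (wedge_list n) x)"
    have z: "z \<in> ?S" unfolding z_def by (rule permute_subsets_closed[OF w wedge_list_image_closed[OF x(2)]])
    have a: "u \<in> hecke_clifford n" unfolding u_def using hw by (intro hc_basis_closed) (auto simp: permutes_id)
    have wG: "?w \<in> ?G" using w by (auto simp: group_algebra_def intro: free_space_single)
    have aw: "u \<star> ?w = fbasis (K, w)"
      unfolding u_def hc_mult_fbasis hc_mult_basis.simps by (simp add: clifford_sign_def)
    have wC: "?w \<odot>\<^bsub>?E\<^esub> C = ?c (flinear standard_list z)"
      unfolding x(1) ext_power_act[OF wG x(2)]
    proof (rule ext_class_eqI[OF ext_act_closed[OF wG x(2)] flinear_standard_closed[OF z]])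
      show "flinear (wedge_list n) (ext_act n ?w x) = flinear (wedge_list n) (flinear standard_list z)"
        unfolding wedge_list_ext_act[OF wG] wedge_list_flinear_standard[OF z] by (simp add: permute_by_def z_def)
    qed
    \<comment> \<open>\<open>w\<close> moves across the tensor product\<close>
    have e1: "fbasis (fbasis (K, w), C) - fbasis (u, ?c (flinear standard_list z)) \<in> ?R"
      using tensor_rel_balance[OF a wG C] unfolding aw wC .
    \<comment> \<open>the symbols with first entry \<open>u\<close> are linear in the second entry\<close>
    have e2: "fbasis (u, ?c (flinear standard_list y)) - flinear (\<lambda>J. fbasis (u, ?c (standard_list J))) y \<in> ?R"
      if "y \<in> ?S" for y
      using that
    proof (induction rule: free_space_induct)
      case zero
      have "fbasis (u, ?c 0 \<oplus>\<^bsub>?E\<^esub> ?c 0) - fbasis (u, ?c 0) - fbasis (u, ?c 0) \<in> ?R"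
        by (rule tensor_rel_add_right[OF a]) (use zeroL in simp_all)
      then have "- fbasis (u, ?c 0) \<in> ?R" by (simp add: qadd_fcoset[OF subspace_ext_relations])
      from fs.subspace_neg[OF subspace_tensor_relations this] show ?case by (simp only: minus_minus flinear_zero diff_0_right)
    next
      case (basis J)
      then show ?case by (simp add: fs.subspace_0[OF subspace_tensor_relations])
    next
      case (add x y)
      have "fbasis (u, ?c (flinear standard_list x) \<oplus>\<^bsub>?E\<^esub> ?c (flinear standard_list y))
          - fbasis (u, ?c (flinear standard_list x)) - fbasis (u, ?c (flinear standard_list y)) \<in> ?R"
        by (rule tensor_rel_add_right[OF a]) (use flinear_standard_closed add.hyps in simp_all)
      from fs.subspace_add[OF subspace_tensor_relations this fs.subspace_add[OF subspace_tensor_relations add.IH]]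
      show ?case by (simp add: qadd_fcoset[OF subspace_ext_relations] flinear_add algebra_simps)
    next
      case (scale c y)
      have sG: "hc_scalar c \<in> ?G"
        by (auto simp: group_algebra_def hc_scalar_def permutes_id intro!: free_space_single)
      have yL: "flinear standard_list y \<in> ?L" by (rule flinear_standard_closed[OF scale.hyps])
      have "permute_by (hc_scalar c) y = fscale c y"
        by (rule free_space_induct[of y UNIV])
          (simp_all add: permute_by_linear fs.scale_right_distrib mult.commute,
           simp add: permute_by_def hc_scalar_def permute_subsets_def perm_sign_id)
      then have "hc_scalar c \<odot>\<^bsub>?E\<^esub> ?c (flinear standard_list y) = ?c (flinear standard_list (fscale c y))"
        unfolding ext_power_act[OF sG yL]
        by (intro ext_class_eqI ext_act_closed[OF sG yL] flinear_standard_closed free_space_fscale scale.hyps)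
          (simp only: wedge_list_ext_act[OF sG] wedge_list_flinear_standard[OF scale.hyps]
            wedge_list_flinear_standard[OF free_space_fscale[OF scale.hyps]])
      then have 1: "fbasis (fscale c u, ?c (flinear standard_list y)) - fbasis (u, ?c (flinear standard_list (fscale c y))) \<in> ?R"
        using tensor_rel_balance[OF a sG, of "?c (flinear standard_list y)" ?E] yL
        unfolding hc_mult_scalar_right[OF a] by (simp del: exterior_power_simps(4) fscale_single add: exterior_power_simps(1))
      have 2: "fbasis (fscale c u, ?c (flinear standard_list y)) - fscale c (fbasis (u, ?c (flinear standard_list y))) \<in> ?R"
        by (rule tensor_rel_scale[OF a]) (use yL in simp)
      from fs.subspace_add[OF subspace_tensor_relations fs.subspace_diff[OF subspace_tensor_relations 2 1]
          fs.subspace_scale[OF subspace_tensor_relations scale.IH, of c]]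
      show ?case by (simp only: fs.scale_right_diff_distrib flinear_fscale algebra_simps) simp
    qed
    have "flinear ?s (fbasis h \<odot>\<^bsub>?X\<^esub> ext_embed n C) = flinear (\<lambda>J. fbasis (u, ?c (standard_list J))) z"
      unfolding hw(1) x(1) u_def ext_embed_class model_simps model_act_embed z_def[symmetric] flinear_flinear
      by simp
    moreover have "fbasis (fbasis h, C) - flinear (\<lambda>J. fbasis (u, ?c (standard_list J))) z
      = (fbasis (fbasis (K, w), C) - fbasis (u, ?c (flinear standard_list z)))
        + (fbasis (u, ?c (flinear standard_list z)) - flinear (\<lambda>J. fbasis (u, ?c (standard_list J))) z)"
      unfolding hw(1) by simp
    moreover have "\<dots> \<in> ?R" by (intro fs.subspace_add[OF subspace_tensor_relations] e1 e2 z)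
    ultimately show "fbasis (fbasis h, C) - flinear ?s (fbasis h \<odot>\<^bsub>?X\<^esub> ext_embed n C) \<in> ?R" by (simp only:)
  qed auto
  show "hc_module n (induced_module (hecke_clifford n) ?G ?E)"
    "smod_even_iso (hecke_clifford n) ?X (induced_module (hecke_clifford n) ?G ?E)"
    by (rule induced_model)+
qed

section \<open>The multiplicities\<close>

text \<open>The composition \<open>(q, n - q)\<close> without its zero parts.\<close>

definition two_blocks :: "nat \<Rightarrow> nat \<Rightarrow> nat list" where
  "two_blocks n q = (if q = 0 \<or> q = n then [n] else [q, n - q])"

lemma young_subgroup_two_blocks:
  assumes "q \<le> n" shows "young_subgroup (two_blocks n q) = block_stabilizer n q"
proof (cases "q = 0 \<or> q = n")
  case True
  have "w \<in> young_subgroup [n] \<longleftrightarrow> w \<in> block_stabilizer n q" for w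
    using True permutes_image[of w "{..<n}"] by (auto simp: young_subgroup_def block_stabilizer_def lessThan_atLeast0)
  then show ?thesis using True by (simp add: two_blocks_def set_eq_iff)
next
  case False
  have sets: "{q..<n} = {..<n} - {..<q}" by auto
  have "w ` {q..<n} = {q..<n}" if w: "w permutes {..<n}" and q: "w ` {..<q} = {..<q}" for w
    unfolding sets using image_set_diff[OF permutes_inj[OF w]] permutes_image[OF w] q by metis
  moreover have "(\<forall>k<2. P k) \<longleftrightarrow> P 0 \<and> P 1" for P :: "nat \<Rightarrow> bool" by (auto simp: less_2_cases_iff)
  ultimately show ?thesis using False assms
    by (auto simp: young_subgroup_def block_stabilizer_def two_blocks_def numeral_2_eq_2 lessThan_atLeast0)
qed

lemma q_fun_0: "q_fun 0 m = 1"
proof -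
  have "fps_nth (\<Prod>i<m. (1 + fps_const (zvar i) * fps_X) * Abs_fps (\<lambda>k. zvar i ^ k)) 0 = (1 :: mpoly)"
    by (induction m) auto
  then show ?thesis by (simp add: q_fun_def)
qed

lemma q_comp_two_blocks: "q_comp (two_blocks n q) m = q_fun q m * q_fun (n - q) m"
  by (cases "q = 0"; cases "q = n") (simp_all add: q_comp_def two_blocks_def q_fun_0)

text \<open>As a module over the Hecke--Clifford algebra, the module induced from the \<open>q\<close>-th exterior power
  is isomorphic up to parity to the module induced from the trivial module of the Young subgroup of
  type \<open>(q, n - q)\<close>; so its characteristic is \<open>q\<^sub>q q\<^bsub>n - q\<^esub>\<close>.\<close>

lemma (in char_map) chi_induced_exterior_power:
  assumes n: "1 \<le> n" and q: "q \<le> n"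
  shows "chi n (induced_module (hecke_clifford n) (group_algebra (sym_group n)) (ext_power n q)) m
    = q_fun q m * q_fun (n - q) m"
proof -
  note ext = induced_exterior_power_model[of n q] and triv = induced_trivial_model[OF q]
  have "chi n (induced_module (hecke_clifford n) (group_algebra (sym_group n)) (ext_power n q)) = chi n (model n q)"
    by (rule chi_iso[OF hc_module_model ext, symmetric])
  also have "\<dots> = chi n (shifted_model n q)"
    using chi_parity_shift[OF hc_module_model] by (simp add: shifted_model_def)
  also have "\<dots> = chi n (induced_module (hecke_clifford n) (group_algebra (block_stabilizer n q)) trivial_module)"
    by (rule chi_iso[OF hc_module_shifted_model triv])
  also have "\<dots> = ch (K_class n (induced_module (hecke_clifford n) (group_algebra (young_subgroup (two_blocks n q))) trivial_module))"
    by (simp add: chi_def young_subgroup_two_blocks[OF q])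
  also have "\<dots> = q_comp (two_blocks n q)"
  proof -
    have "sum_list (two_blocks n q) = n \<and> (\<forall>r\<in>set (two_blocks n q). 0 < r)"
      using n q by (auto simp: two_blocks_def)
    from mp[OF spec[OF spec[OF conjunct2[OF conjunct2[OF conjunct2[OF ch[unfolded characteristic_map_def]]]]]] this]
    show ?thesis .
  qed
  finally show ?thesis by (simp add: q_comp_two_blocks)
qed

lemma (in labelled_irreducibles) multiplicity_exterior_power:
  assumes n: "1 \<le> n" and q: "q \<le> n" and lam: "strict_partition lam n"
  shows "of_nat (smod_multiplicity (hecke_clifford n) (D lam)
      (induced_module (hecke_clifford n) (group_algebra (sym_group n)) (ext_power n q))) * norm_factor lam
    = of_nat (Q_coeff lam q)"
proof (rule Q_product_coefficients[OF n q _ lam])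
  show "(\<Sum>lam | strict_partition lam n. mconst (of_nat (smod_multiplicity (hecke_clifford n) (D lam)
      (induced_module (hecke_clifford n) (group_algebra (sym_group n)) (ext_power n q))) * norm_factor lam) * Q_fun lam n)
    = q_fun q n * q_fun (n - q) n"
    using chi_multiplicity[OF induced_exterior_power_model(1), of n q n] chi_induced_exterior_power[OF n q, of n] by (simp only:)
qed

lemma half_sum: "(l - d) div 2 + (l + d) div 2 = l" if "d = (if even l then 0 else 1)" for l d :: nat
  using that by (cases "even l") (auto elim!: evenE oddE)

lemma fract_of_product:
  assumes "a * d = b" "d \<noteq> 0" shows "Fract a 1 = Fract b (d :: complex poly)"
  using assms by (simp add: eq_fract)

lemma smult_sum_distrib: "Polynomial.smult c (\<Sum>i\<in>S. f i) = (\<Sum>i\<in>S. Polynomial.smult c (f i))"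
  by (induction S rule: infinite_finite_induct) (auto simp: smult_add_right)

theorem corollary4p5:
  fixes n :: nat and lam :: "nat list"
    and ch :: "(nat \<times> cmod \<Rightarrow>\<^sub>0 complex) set \<Rightarrow> symfun"
    and D :: "nat list \<Rightarrow> cmod"
  assumes "n \<ge> 1"
    and "characteristic_map ch"
    and "irreducible_labelling ch D"
    and "strict_partition lam n"
  shows "(\<Sum>q=0..n. monom (of_nat (smod_multiplicity (hecke_clifford n) (D lam)
             (induced_module (hecke_clifford n) (group_algebra (sym_group n))
               (exterior_power q (permutation_module n))))) q)
           = [:1 / 2 ^ ((length lam + pdelta lam) div 2):] * Q_one_s lam
         \<and> (\<forall>k l. k > l \<and> lam = (if l = 0 then [k] else [k, l]) \<longrightarrow>
              Fract (Q_one_s lam) 1 =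
                Fract (2 ^ length lam * (1 + [:0, 1:]) * ([:0, 1:] ^ l - [:0, 1:] ^ k)) (1 - [:0, 1:]))
         \<and> ((\<nexists>k l. k > l \<and> lam = (if l = 0 then [k] else [k, l])) \<longrightarrow> Q_one_s lam = 0)"
proof (intro conjI allI impI)
  interpret labelled_irreducibles ch D by unfold_locales (use assms in auto)
  let ?mult = "\<lambda>q. smod_multiplicity (hecke_clifford n) (D lam)
      (induced_module (hecke_clifford n) (group_algebra (sym_group n)) (ext_power n q))"
  let ?a = "(length lam - pdelta lam) div 2" and ?b = "(length lam + pdelta lam) div 2"
  have "monom (of_nat (?mult q)) q = Polynomial.smult (2 ^ ?a) (monom (of_nat (Q_coeff lam q)) q :: complex poly)" if "q \<in> {0..n}" for q
  proof -
    have "of_nat (?mult q) = 2 ^ ?a * (of_nat (Q_coeff lam q) :: complex)"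
      using multiplicity_exterior_power[OF assms(1) _ assms(4), of q] that by (simp add: norm_factor_def field_simps)
    then show ?thesis by (simp only: smult_monom)
  qed
  then have "(\<Sum>q=0..n. monom (of_nat (?mult q)) q) = Polynomial.smult (2 ^ ?a) (\<Sum>q=0..n. monom (of_nat (Q_coeff lam q)) q :: complex poly)"
    by (simp add: smult_sum_distrib)
  also have "\<dots> = Polynomial.smult (1 / 2 ^ ?b * 2 ^ length lam) (\<Sum>q=0..n. monom (of_nat (Q_coeff lam q)) q)"
  proof -
    have "?a + ?b = length lam" by (rule half_sum) (simp add: pdelta_def)
    then have "(2 :: complex) ^ length lam = 2 ^ ?a * 2 ^ ?b" by (metis power_add)
    then show ?thesis by simp
  qed
  also have "\<dots> = [:1 / 2 ^ ?b:] * Q_one_s lam"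
  proof -
    have "(2 :: complex poly) ^ k = [:2 ^ k:]" for k by (induction k) (simp_all add: numeral_poly one_pCons)
    then show ?thesis by (simp add: Q_one_s_eq[OF assms(4,1)])
  qed
  finally show "(\<Sum>q=0..n. monom (of_nat (?mult q)) q) = [:1 / 2 ^ ?b:] * Q_one_s lam" .
next
  fix k l assume kl: "k > l \<and> lam = (if l = 0 then [k] else [k, l])"
  show "Fract (Q_one_s lam) 1 =
      Fract (2 ^ length lam * (1 + [:0, 1:]) * ([:0, 1:] ^ l - [:0, 1:] ^ k)) (1 - [:0, 1:])"
  proof (rule fract_of_product)
    show "Q_one_s lam * (1 - [:0, 1:]) = 2 ^ length lam * (1 + [:0, 1:]) * ([:0, 1:] ^ l - [:0, 1:] ^ k)"
      using kl Q_one_s_one_part[of k] Q_one_s_two_parts[of k l] by (cases "l = 0") (simp_all add: power2_eq_square)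
    have "poly (1 - [:0, 1:]) 0 \<noteq> (0 :: complex)" by simp
    then show "1 - [:0, 1:] \<noteq> (0 :: complex poly)" by (metis poly_0)
  qed
next
  assume none: "\<nexists>k l. k > l \<and> lam = (if l = 0 then [k] else [k, l])"
  have "\<not> length lam \<le> 2"
  proof
    assume "length lam \<le> 2"
    from strict_partition_two_rows[OF assms(4) this assms(1)] show False
    proof cases
      case 1
      then have "n > 0 \<and> lam = (if 0 = (0 :: nat) then [n] else [n, 0])" using assms(1) by simp
      then show False using none by blast
    next
      case (2 i)
      then have "n - i > i \<and> lam = (if i = 0 then [n - i] else [n - i, i])" by simp
      then show False using none by blast
    qed
  qed
  then show "Q_one_s lam = 0"
    using assms(4) by (intro Q_one_s_many_parts) (auto simp: strict_partition_def)
qed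

end
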